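(* Let $\mathcal{T}$ be a geodesic triangle in the Poincaré disc, and let $\mathcal{S}^*$, $M^*=T^1\mathcal{S}^*$ and the closed three-manifold $M\supset M^*$ be obtained from $\mathcal{T}$ by the construction described in the context. Let $X$ be the velocity field on $M^*$ of the geodesic flow of $\mathcal{S}^*$, let $\varepsilon>0$, and let $\rho:M^*\to\mathbb{R}$ be a positive smooth function such that $\rho(v)=\sinh(\operatorname{dist}(\Pi(v),\sigma))$ whenever $v\in M^*$, $\sigma\in\mathcal{V}$ and $\operatorname{dist}(\Pi(v),\sigma)<\varepsilon$. Then the vector field $Y=\rho X$ on $M^*$ has a smooth extension to $M$.
   Context: **The surface $\mathcal{S}$.** Let $\mathbb{D}$ be the Poincaré disc with constant curvature $-1$ and $\mathcal{T}\subset\mathbb{D}$ a (compact, nondegenerate) triangle with geodesic sides. Let $\mathcal{S}$ be the double of $\mathcal{T}$: two disjoint isometric copies of $\mathcal{T}$ glued along their boundaries by $x\simeq\varphi(x)$ for $x\in\partial\mathcal{T}$, where $\varphi$ is an isometry from the first copy to the second. $\mathcal{S}$ is homeomorphic to the two-sphere. Let $\mathcal{V}\subset\mathcal{S}$ be the set of the three classes of vertices of $\mathcal{T}$ (the conical singularities) and $\mathcal{S}^*=\mathcal{S}\setminus\mathcal{V}$. Since the sides are geodesic, $\mathcal{S}^*$ has a natural smooth structure and Riemannian metric of curvature $-1$ inducing the given metric on each copy of $\mathcal{T}$; $\operatorname{dist}$ is the induced distance, extended to $\mathcal{S}$. Fix an orientation of $\mathcal{S}$. **Polar coordinates and charts of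 $\mathcal{S}$.** For $\tau>0$ put $B_\tau(\sigma)=\{p\in\mathcal{S}:\operatorname{dist}(p,\sigma)<\tau\}$ and $B^*_\tau(\sigma)=B_\tau(\sigma)\setminus\{\sigma\}$. Fix $\tau>0$ such that for every $\sigma\in\mathcal{V}$ the closure of $B_\tau(\sigma)$ is homeomorphic to a compact disc and $B_\tau(\sigma)\cap\mathcal{V}=\{\sigma\}$. For $\sigma\in\mathcal{V}$ let $\theta$ be the angle of $\mathcal{T}$ at $\sigma$ (the cone angle at $\sigma$ is $2\theta$), $\mathbb{S}^1_\theta=\mathbb{R}/2\theta\mathbb{Z}$, $\mathbb{S}^1=\mathbb{R}/2\pi\mathbb{Z}$, and $\zeta_\theta:\mathbb{S}^1_\theta\to\mathbb{S}^1$ the isomorphism induced by $x\mapsto x\pi/\theta$. Let $r(p)=\operatorname{dist}(p,\sigma)$, fix a geodesic $l$ starting at $\sigma$, and let $\alpha(p)\in\mathbb{S}^1_\theta$ be the angle, measured positively with respect to the orientation, from $l$ to the geodesic segment from $\sigma$ to $p$. Let $D_\tau=\{(x,y)\in\mathbb{R}^2:\sqrt{x^2+y^2}<\sinh\tau\}$ and $\phi_\sigma:B_\tau(\sigma)\to D_\tau$, $\phi_\sigma(p)=\sinh(r(p))\,(\cos\zeta_\theta(\alpha(p)),\sin\zeta_\theta(\alpha(p)))$ for $p\ne\sigma$, $\phi_\sigma(\sigma)=(0,0)$. The maps $\phi_\sigma$, together with the charts of $\mathcal{S}^*$, define the smooth structure of $\mathcal{S}$. **The manifold $M$.** Let $M^*=T^1\mathcal{S}^*$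 be the unit tangent bundle with projection $\Pi:M^*\to\mathcal{S}^*$. For $\sigma\in\mathcal{V}$ let $U^*_\tau(\sigma)=\Pi^{-1}(B^*_\tau(\sigma))$, and for $v\in U_\tau^*(\sigma)$ with base point $x$ let $\beta(v)\in\mathbb{S}^1$ be the oriented angle from the outward velocity at $x$ of the geodesic from $\sigma$ to $x$, to $v$. Let $\gamma_\sigma=\{\sigma\}\times\mathbb{S}^1$ (singular fiber), $U_\tau(\sigma)=U^*_\tau(\sigma)\cup\gamma_\sigma$, and $\Phi_\sigma:U_\tau(\sigma)\to D_\tau\times\mathbb{S}^1$, $\Phi_\sigma(v)=(\phi_\sigma(\Pi(v)),\beta(v))$ on $U^*_\tau(\sigma)$, $\Phi_\sigma(\sigma,\beta)=(0,0,\beta)$ on $\gamma_\sigma$. Put $M=M^*\cup\bigcup_{\sigma\in\mathcal{V}}\gamma_\sigma$, with the smooth structure for which $M^*$ is an open submanifold and each $\Phi_\sigma$ is a diffeomorphism. $M$ is a closed three-manifold. *)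

theory Defs
  imports "HOL-Complex_Analysis.Riemann_Mapping"
begin

section \<open>Smooth manifolds given by an atlas\<close>

primrec Ck_on :: "nat \<Rightarrow> ('a::real_normed_vector \<Rightarrow> 'b::real_normed_vector) \<Rightarrow> 'a set \<Rightarrow> bool" where
  "Ck_on 0 f S \<longleftrightarrow> continuous_on S f"
| "Ck_on (Suc n) f S \<longleftrightarrow>
     (\<forall>x\<in>S. f differentiable (at x)) \<and> (\<forall>v. Ck_on n (\<lambda>x. frechet_derivative f (at x) v) S)"

definition smooth_on :: "('a::real_normed_vector \<Rightarrow> 'b::real_normed_vector) \<Rightarrow> 'a set \<Rightarrow> bool" where
  "smooth_on f S \<longleftrightarrow> (\<forall>n. Ck_on n f S)"

text \<open>A chart is a domain together with a coordinate map; the map is only meaningful on the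
  domain. The smooth structures below are given by an atlas, not necessarily a maximal one.\<close>

type_synonym ('p, 'e) chart = "'p set \<times> ('p \<Rightarrow> 'e)"

definition carrier :: "('p, 'e) chart set \<Rightarrow> 'p set" where
  "carrier \<A> = (\<Union>ch\<in>\<A>. fst ch)"

definition manifold_topology :: "('p, 'e::euclidean_space) chart set \<Rightarrow> 'p topology" where
  "manifold_topology \<A> =
     topology (\<lambda>U. U \<subseteq> carrier \<A> \<and> (\<forall>ch\<in>\<A>. open (snd ch ` (U \<inter> fst ch))))"

text \<open>A tangent vector at \<open>p\<close> is the family of its coordinate vectors in all charts around
  \<open>p\<close>, related by the derivatives of the transition maps. The value at every other chart is
  fixed to be 0, so that equality of tangent vectors is equality of families.\<close>

type_synonym ('p, 'e) tangent = "('p, 'e) chart \<Rightarrow> 'e"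

definition tangent_space ::
    "('p, 'e::euclidean_space) chart set \<Rightarrow> 'p \<Rightarrow> ('p, 'e) tangent set" where
  "tangent_space \<A> p =
     {v. (\<forall>ch. ch \<notin> \<A> \<or> p \<notin> fst ch \<longrightarrow> v ch = 0) \<and>
         (\<forall>ch\<in>\<A>. \<forall>ch'\<in>\<A>. p \<in> fst ch \<and> p \<in> fst ch' \<longrightarrow>
            v ch' = frechet_derivative (snd ch' \<circ> inv_into (fst ch) (snd ch)) (at (snd ch p)) (v ch))}"

definition velocity ::
    "('p, 'e::euclidean_space) chart set \<Rightarrow> (real \<Rightarrow> 'p) \<Rightarrow> real \<Rightarrow> ('p, 'e) tangent" where
  "velocity \<A> c t =
     (\<lambda>ch. if ch \<in> \<A> \<and> c t \<in> fst ch then vector_derivative (snd ch \<circ> c) (at t) else 0)"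

definition smooth_function ::
    "('p, 'e::euclidean_space) chart set \<Rightarrow> ('p \<Rightarrow> real) \<Rightarrow> bool" where
  "smooth_function \<A> f \<longleftrightarrow>
     (\<forall>ch\<in>\<A>. smooth_on (f \<circ> inv_into (fst ch) (snd ch)) (snd ch ` fst ch))"

definition smooth_vector_field ::
    "('p, 'e::euclidean_space) chart set \<Rightarrow> ('p \<Rightarrow> ('p, 'e) tangent) \<Rightarrow> bool" where
  "smooth_vector_field \<A> Z \<longleftrightarrow>
     (\<forall>p\<in>carrier \<A>. Z p \<in> tangent_space \<A> p) \<and>
     (\<forall>ch\<in>\<A>. smooth_on (\<lambda>x. Z (inv_into (fst ch) (snd ch) x) ch) (snd ch ` fst ch))"

definition C1_curve_on ::
    "('p, 'e::euclidean_space) chart set \<Rightarrow> (real \<Rightarrow> 'p) \<Rightarrow> real set \<Rightarrow> bool" where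
  "C1_curve_on \<A> c I \<longleftrightarrow>
     continuous_map (top_of_set I) (manifold_topology \<A>) c \<and>
     (\<forall>ch\<in>\<A>. (snd ch \<circ> c) C1_differentiable_on {t \<in> I. c t \<in> fst ch})"


section \<open>Hyperbolic surfaces\<close>

text \<open>Below, \<open>\<A>\<close> is an atlas with charts in the Poincare disc whose transition maps are
  hyperbolic isometries, so that the Riemannian metric has the same expression in all charts.\<close>

definition poincare_metric :: "complex \<Rightarrow> complex \<Rightarrow> complex \<Rightarrow> real" where
  "poincare_metric z u v = 4 * (u \<bullet> v) / (1 - (cmod z)\<^sup>2)\<^sup>2"

text \<open>Christoffel symbols of the first kind, \<open>\<langle>\<Gamma>(u, v), w\<rangle>\<close>.\<close>

definition christoffel ::
    "('e::euclidean_space \<Rightarrow> 'e \<Rightarrow> 'e \<Rightarrow> real) \<Rightarrow> 'e \<Rightarrow> 'e \<Rightarrow> 'e \<Rightarrow> 'e \<Rightarrow> real" where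
  "christoffel g z u v w =
     (frechet_derivative (\<lambda>x. g x v w) (at z) u
      + frechet_derivative (\<lambda>x. g x u w) (at z) v
      - frechet_derivative (\<lambda>x. g x u v) (at z) w) / 2"

definition tangent_norm :: "('p, complex) chart set \<Rightarrow> 'p \<Rightarrow> ('p, complex) tangent \<Rightarrow> real" where
  "tangent_norm \<A> p v =
     (let ch = (SOME ch. ch \<in> \<A> \<and> p \<in> fst ch)
      in sqrt (poincare_metric (snd ch p) (v ch) (v ch)))"

text \<open>The geodesic equation, paired with an arbitrary vector \<open>w\<close>; \<open>I\<close> is an open interval.\<close>

definition geodesic_on :: "('p, complex) chart set \<Rightarrow> (real \<Rightarrow> 'p) \<Rightarrow> real set \<Rightarrow> bool" where
  "geodesic_on \<A> c I \<longleftrightarrow>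
     continuous_map (top_of_set I) (manifold_topology \<A>) c \<and>
     (\<forall>ch\<in>\<A>. \<exists>c' c''. \<forall>t\<in>I. c t \<in> fst ch \<longrightarrow>
        ((snd ch \<circ> c) has_vector_derivative c' t) (at t) \<and>
        (c' has_vector_derivative c'' t) (at t) \<and>
        (\<forall>w. poincare_metric (snd ch (c t)) (c'' t) w
             + christoffel poincare_metric (snd ch (c t)) (c' t) (c' t) w = 0))"

definition unit_geodesic_on :: "('p, complex) chart set \<Rightarrow> (real \<Rightarrow> 'p) \<Rightarrow> real set \<Rightarrow> bool" where
  "unit_geodesic_on \<A> c I \<longleftrightarrow>
     geodesic_on \<A> c I \<and> (\<forall>t\<in>I. tangent_norm \<A> (c t) (velocity \<A> c t) = 1)"

definition unit_tangent_bundle ::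
    "('p, complex) chart set \<Rightarrow> ('p \<times> ('p, complex) tangent) set" where
  "unit_tangent_bundle \<A> =
     {(p, v). p \<in> carrier \<A> \<and> v \<in> tangent_space \<A> p \<and> tangent_norm \<A> p v = 1}"

text \<open>Circles \<open>\<real>/2\<pi>\<int>\<close> are represented by the unit circle in the complex plane, via
  \<^const>\<open>cis\<close>. A map \<open>F\<close> on \<open>U\<close> with values in (plane) \<open>\<times>\<close> (circle) is turned into honest
  charts by cutting the circle at \<open>cis s\<close>, the angle then taking values in \<open>(s, s + 2\<pi>)\<close>.\<close>

definition angular_chart ::
    "'q set \<Rightarrow> ('q \<Rightarrow> complex \<times> complex) \<Rightarrow> real \<Rightarrow> ('q, complex \<times> real) chart" where
  "angular_chart U F s =
     ({q \<in> U. snd (F q) \<noteq> cis s}, \<lambda>q. (fst (F q), s + Arg2pi (snd (F q) / cis s)))"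

definition utb_atlas ::
    "('p, complex) chart set \<Rightarrow> ('p \<times> ('p, complex) tangent, complex \<times> real) chart set" where
  "utb_atlas \<A> =
     {angular_chart {(p, v) \<in> unit_tangent_bundle \<A>. p \<in> fst ch}
        (\<lambda>(p, v). (snd ch p, sgn (v ch))) s | ch s. ch \<in> \<A>}"

text \<open>The velocity field of the geodesic flow: its value at \<open>w\<close> is the velocity at time 0 of
  the curve of the velocity vectors of the geodesic with initial velocity \<open>w\<close>.\<close>

definition geodesic_field ::
    "('p, complex) chart set \<Rightarrow> 'p \<times> ('p, complex) tangent
       \<Rightarrow> ('p \<times> ('p, complex) tangent, complex \<times> real) tangent" where
  "geodesic_field \<A> w =
     (THE X. \<exists>c \<delta>. \<delta> > 0 \<and> geodesic_on \<A> c {-\<delta><..<\<delta>} \<and> (c 0, velocity \<A> c 0) = w \<and>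
        X = velocity (utb_atlas \<A>) (\<lambda>t. (c t, velocity \<A> c t)) 0)"


section \<open>Geodesic triangles in the Poincare disc\<close>

text \<open>\<open>Moebius_function 0 p\<close> is the orientation preserving isometry of the disc that sends
  \<open>p\<close> to 0 and has positive derivative at \<open>p\<close>, with inverse \<open>Moebius_function 0 (-p)\<close>. It sends
  the geodesics through \<open>p\<close> to diameters and preserves their directions at \<open>p\<close>.\<close>

definition hyp_segment :: "complex \<Rightarrow> complex \<Rightarrow> complex set" where
  "hyp_segment p q = Moebius_function 0 (- p) ` closed_segment 0 (Moebius_function 0 p q)"

definition hyp_line :: "complex \<Rightarrow> complex \<Rightarrow> complex set" where
  "hyp_line p q =
     {z \<in> ball 0 1. \<exists>t::real. Moebius_function 0 p z = t *\<^sub>R Moebius_function 0 p q}"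

text \<open>Reflection in \<open>hyp_line p q\<close>.\<close>

definition hyp_reflection :: "complex \<Rightarrow> complex \<Rightarrow> complex \<Rightarrow> complex" where
  "hyp_reflection p q z =
     Moebius_function 0 (- p) ((sgn (Moebius_function 0 p q))\<^sup>2 * cnj (Moebius_function 0 p z))"

text \<open>The vertices are \<open>A 0, A 1, A 2\<close>, with cyclic index arithmetic in the type \<open>3\<close>, and side
  \<open>i\<close> is opposite to the vertex \<open>A i\<close>.\<close>

definition nondegenerate_triangle :: "(3 \<Rightarrow> complex) \<Rightarrow> bool" where
  "nondegenerate_triangle A \<longleftrightarrow> range A \<subseteq> ball 0 1 \<and> inj A \<and> A 0 \<notin> hyp_line (A 1) (A 2)"

definition side :: "(3 \<Rightarrow> complex) \<Rightarrow> 3 \<Rightarrow> complex set" where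
  "side A i = hyp_segment (A (i + 1)) (A (i + 2))"

definition triangle :: "(3 \<Rightarrow> complex) \<Rightarrow> complex set" where
  "triangle A = (\<Union>w\<in>side A 0. hyp_segment (A 0) w)"

definition interior_angle :: "(3 \<Rightarrow> complex) \<Rightarrow> 3 \<Rightarrow> real" where
  "interior_angle A k =
     \<bar>Arg (Moebius_function 0 (A k) (A (k + 2)) / Moebius_function 0 (A k) (A (k + 1)))\<bar>"


section \<open>The double of a triangle\<close>

text \<open>\<open>(z, b)\<close> is the point \<open>z\<close> of the copy number \<open>b\<close> of the triangle; the points of the
  double are the classes of the gluing relation.\<close>

type_synonym dpoint = "(complex \<times> bool) set"

definition glue :: "(3 \<Rightarrow> complex) \<Rightarrow> complex \<times> bool \<Rightarrow> dpoint" where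
  "glue A = (\<lambda>(z, b). if z \<in> (\<Union>i. side A i) then {(z, False), (z, True)} else {(z, b)})"

definition double :: "(3 \<Rightarrow> complex) \<Rightarrow> dpoint set" where
  "double A = glue A ` (triangle A \<times> UNIV)"

definition double_topology :: "(3 \<Rightarrow> complex) \<Rightarrow> dpoint topology" where
  "double_topology A =
     topology (\<lambda>U. U \<subseteq> double A \<and>
       openin (prod_topology (top_of_set (triangle A)) (discrete_topology UNIV))
         {x \<in> triangle A \<times> UNIV. glue A x \<in> U})"

definition cone_point :: "(3 \<Rightarrow> complex) \<Rightarrow> 3 \<Rightarrow> dpoint" where
  "cone_point A k = glue A (A k, False)"

definition fold_point :: "dpoint \<Rightarrow> complex" where
  "fold_point P = the_elem (fst ` P)"

definition in_first_copy :: "dpoint \<Rightarrow> bool" where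
  "in_first_copy P \<longleftrightarrow> False \<in> snd ` P"

text \<open>The charts of the complement of the cone points: chart \<open>i\<close> unfolds the double along the
  open side \<open>i\<close>, mapping the second copy to the mirror image of the triangle in this side. Its
  domain omits the two other closed sides. The metric of the disc pulls back to the natural
  metric of the double, since the transition maps are the identity on one copy and the product
  of two reflections on the other one.\<close>

definition double_chart :: "(3 \<Rightarrow> complex) \<Rightarrow> 3 \<Rightarrow> (dpoint, complex) chart" where
  "double_chart A i =
     ({P \<in> double A. fold_point P \<notin> (\<Union>j\<in>UNIV - {i}. side A j)},
      \<lambda>P. if in_first_copy P then fold_point P
          else hyp_reflection (A (i + 1)) (A (i + 2)) (fold_point P))"

definition double_atlas :: "(3 \<Rightarrow> complex) \<Rightarrow> (dpoint, complex) chart set" where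
  "double_atlas A = range (double_chart A)"

text \<open>The distance on the whole double: the infimum of the lengths of the continuous curves in
  the double which, off a finite set of times, avoid the cone points and are continuously
  differentiable there. It is the continuous extension of the Riemannian distance of the
  complement of the cone points. Integrability is required because \<^const>\<open>integral\<close> is 0 on
  non-integrable functions.\<close>

definition double_dist :: "(3 \<Rightarrow> complex) \<Rightarrow> dpoint \<Rightarrow> dpoint \<Rightarrow> real" where
  "double_dist A P Q =
     Inf {L. \<exists>c K. finite K \<and> c 0 = P \<and> c 1 = Q \<and>
        continuous_map (top_of_set {0..1}) (double_topology A) c \<and>
        C1_curve_on (double_atlas A) c ({0<..<1} - K) \<and>
        ((\<lambda>t. tangent_norm (double_atlas A) (c t) (velocity (double_atlas A) c t))
           has_integral L) {0..1}}"

definition cone_ball :: "(3 \<Rightarrow> complex) \<Rightarrow> real \<Rightarrow> 3 \<Rightarrow> dpoint set" where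
  "cone_ball A \<tau> k = {P \<in> double A. double_dist A P (cone_point A k) < \<tau>}"


section \<open>Polar coordinates at the cone points\<close>

definition cone_geodesic :: "(3 \<Rightarrow> complex) \<Rightarrow> 3 \<Rightarrow> (real \<Rightarrow> dpoint) \<Rightarrow> real \<Rightarrow> bool" where
  "cone_geodesic A k c a \<longleftrightarrow>
     a > 0 \<and> c 0 = cone_point A k \<and>
     continuous_map (top_of_set {0..<a}) (double_topology A) c \<and>
     unit_geodesic_on (double_atlas A) c {0<..<a}"

text \<open>\<open>c\<close> restricted to \<open>{0..r}\<close>, where \<open>r\<close> is the distance from \<open>P\<close> to the cone point, is a
  geodesic segment from the cone point to \<open>P\<close>. It is required to extend beyond \<open>P\<close> (this is
  automatic, \<open>P\<close> not being a cone point), so that its velocity at \<open>P\<close> is a two-sided derivative.\<close>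

definition cone_segment :: "(3 \<Rightarrow> complex) \<Rightarrow> 3 \<Rightarrow> dpoint \<Rightarrow> (real \<Rightarrow> dpoint) \<Rightarrow> bool" where
  "cone_segment A k P c \<longleftrightarrow>
     (\<exists>a > double_dist A P (cone_point A k).
        cone_geodesic A k c a \<and> c (double_dist A P (cone_point A k)) = P)"

text \<open>The choice of the radius \<open>\<tau>\<close>. The last condition says that \<open>the\<close> geodesic segment from
  the cone point to a point of the ball, which is used in the definition of the polar
  coordinates, is unique. It does not follow from the other ones: it can fail if \<open>\<tau>\<close> is the
  distance to another vertex and larger than the distance to the opposite side.\<close>

definition admissible_radius :: "(3 \<Rightarrow> complex) \<Rightarrow> real \<Rightarrow> bool" where
  "admissible_radius A \<tau> \<longleftrightarrow> \<tau> > 0 \<and>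
     (\<forall>k. subtopology (double_topology A) (double_topology A closure_of cone_ball A \<tau> k)
            homeomorphic_space top_of_set (cball (0::complex) 1) \<and>
          cone_ball A \<tau> k \<inter> range (cone_point A) = {cone_point A k} \<and>
          (\<forall>P \<in> cone_ball A \<tau> k - {cone_point A k}.
             (\<exists>c. cone_segment A k P c) \<and>
             (\<forall>c c'. cone_segment A k P c \<and> cone_segment A k P c' \<longrightarrow>
                (\<forall>t\<in>{0..double_dist A P (cone_point A k)}. c t = c' t))))"

text \<open>The orientation is given by \<open>\<omega> \<in> {1, -1}\<close>; the charts of \<^const>\<open>double_atlas\<close> are positively
  oriented if and only if \<open>\<omega> = 1\<close>. Elements of \<open>\<real>/2\<theta>\<int>\<close> and \<open>\<real>/2\<pi>\<int>\<close> are represented by real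
  numbers.

  \<open>cone_angle\<close> is the oriented angle at the cone point, modulo twice the interior angle, from
  the side towards \<open>A (k + 1)\<close> to the geodesic towards \<open>P\<close> in the copy of the triangle
  containing \<open>P\<close>. The second copy has the opposite orientation.\<close>

definition cone_angle :: "(3 \<Rightarrow> complex) \<Rightarrow> real \<Rightarrow> 3 \<Rightarrow> dpoint \<Rightarrow> real" where
  "cone_angle A \<omega> k P =
     \<omega> * (if in_first_copy P then 1 else - 1) *
     Arg (Moebius_function 0 (A k) (fold_point P) / Moebius_function 0 (A k) (A (k + 1)))"

definition initial_direction :: "(3 \<Rightarrow> complex) \<Rightarrow> real \<Rightarrow> 3 \<Rightarrow> (real \<Rightarrow> dpoint) \<Rightarrow> real" where
  "initial_direction A \<omega> k c = Lim (at_right 0) (\<lambda>t. cone_angle A \<omega> k (c t))"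

text \<open>The angle \<open>\<alpha>(P)\<close> from the geodesic \<open>l\<close> to the geodesic segment towards \<open>P\<close>.\<close>

definition polar_angle ::
    "(3 \<Rightarrow> complex) \<Rightarrow> real \<Rightarrow> (real \<Rightarrow> dpoint) \<Rightarrow> 3 \<Rightarrow> dpoint \<Rightarrow> real" where
  "polar_angle A \<omega> l k P =
     initial_direction A \<omega> k (SOME c. cone_segment A k P c) - initial_direction A \<omega> k l"

text \<open>The map \<open>\<phi>\<^sub>\<sigma>\<close>.\<close>

definition cone_chart ::
    "(3 \<Rightarrow> complex) \<Rightarrow> real \<Rightarrow> (real \<Rightarrow> dpoint) \<Rightarrow> 3 \<Rightarrow> dpoint \<Rightarrow> complex" where
  "cone_chart A \<omega> l k P =
     (if P = cone_point A k then 0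
      else sinh (double_dist A P (cone_point A k)) *\<^sub>R
           cis (polar_angle A \<omega> l k P * pi / interior_angle A k))"


section \<open>The closed three-manifold\<close>

definition outward_velocity :: "(3 \<Rightarrow> complex) \<Rightarrow> 3 \<Rightarrow> dpoint \<Rightarrow> (dpoint, complex) tangent" where
  "outward_velocity A k P =
     velocity (double_atlas A) (SOME c. cone_segment A k P c) (double_dist A P (cone_point A k))"

text \<open>The angle \<open>\<beta>(v)\<close> of the tangent vector \<open>v\<close> at \<open>P\<close>; the charts are conformal.\<close>

definition fiber_angle ::
    "(3 \<Rightarrow> complex) \<Rightarrow> real \<Rightarrow> 3 \<Rightarrow> dpoint \<times> (dpoint, complex) tangent \<Rightarrow> real" where
  "fiber_angle A \<omega> k = (\<lambda>(P, v).
     let ch = (SOME ch. ch \<in> double_atlas A \<and> P \<in> fst ch)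
     in \<omega> * Arg (v ch / outward_velocity A k P ch))"

text \<open>Points of \<open>M\<close> are \<open>Inl v\<close> for unit tangent vectors \<open>v\<close> off the cone points and
  \<open>Inr (\<sigma>, u)\<close> for points of the singular fibers, \<open>u\<close> being in the unit circle.\<close>

type_synonym mpoint = "(dpoint \<times> (dpoint, complex) tangent) + (dpoint \<times> complex)"

definition M_star :: "(3 \<Rightarrow> complex) \<Rightarrow> (dpoint \<times> (dpoint, complex) tangent) set" where
  "M_star A = unit_tangent_bundle (double_atlas A)"

definition M_star_atlas ::
    "(3 \<Rightarrow> complex) \<Rightarrow> (dpoint \<times> (dpoint, complex) tangent, complex \<times> real) chart set" where
  "M_star_atlas A = utb_atlas (double_atlas A)"

text \<open>The neighbourhood \<open>U\<^sub>\<tau>(\<sigma>)\<close> of a singular fiber and the map \<open>\<Phi>\<^sub>\<sigma>\<close>.\<close>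

definition fiber_nbhd :: "(3 \<Rightarrow> complex) \<Rightarrow> real \<Rightarrow> 3 \<Rightarrow> mpoint set" where
  "fiber_nbhd A \<tau> k =
     Inl ` {(P, v) \<in> M_star A. P \<in> cone_ball A \<tau> k - {cone_point A k}} \<union>
     Inr ` ({cone_point A k} \<times> sphere 0 1)"

definition fiber_map ::
    "(3 \<Rightarrow> complex) \<Rightarrow> real \<Rightarrow> (real \<Rightarrow> dpoint) \<Rightarrow> 3 \<Rightarrow> mpoint \<Rightarrow> complex \<times> complex" where
  "fiber_map A \<omega> l k q =
     (case q of Inl (P, v) \<Rightarrow> (cone_chart A \<omega> l k P, cis (fiber_angle A \<omega> k (P, v)))
              | Inr (_, u) \<Rightarrow> (0, u))"

text \<open>The inclusion of the open submanifold \<open>M\<^sup>*\<close> into \<open>M\<close> is \<^const>\<open>Inl\<close>, and a chart of the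
  former is transported to a chart of the latter.\<close>

definition lift_chart :: "('p, 'e) chart \<Rightarrow> ('p + 'q, 'e) chart" where
  "lift_chart ch = (Inl ` fst ch, snd ch \<circ> projl)"

definition M_atlas ::
    "(3 \<Rightarrow> complex) \<Rightarrow> real \<Rightarrow> real \<Rightarrow> (3 \<Rightarrow> real \<Rightarrow> dpoint) \<Rightarrow> (mpoint, complex \<times> real) chart set" where
  "M_atlas A \<omega> \<tau> l =
     lift_chart ` M_star_atlas A \<union>
     {angular_chart (fiber_nbhd A \<tau> k) (fiber_map A \<omega> (l k) k) s | k s. True}"

text \<open>\<open>Z\<close> extends the vector field \<open>Y\<close> on the open submanifold with atlas \<open>\<A>\<close>, that is, \<open>Z\<close> at
  \<open>Inl v\<close> is the image of \<open>Y v\<close> under the derivative of \<^const>\<open>Inl\<close>.\<close>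

definition extends_field ::
    "('p, 'e) chart set \<Rightarrow> ('p \<Rightarrow> ('p, 'e) tangent) \<Rightarrow> ('p + 'q \<Rightarrow> ('p + 'q, 'e) tangent) \<Rightarrow> bool" where
  "extends_field \<A> Y Z \<longleftrightarrow>
     (\<forall>v\<in>carrier \<A>. \<forall>ch\<in>\<A>. v \<in> fst ch \<longrightarrow> Z (Inl v) (lift_chart ch) = Y v ch)"

end

theory Submission
  imports Defs
begin

text \<open>Let \<open>m\<close> be a unit speed geodesic in the disc model centred at a vertex of angle \<open>\<theta>\<close>, and put
  \<open>y = m' / m\<close> and \<open>K = (1 + \<bar>m\<bar>\<^sup>2) / (1 - \<bar>m\<bar>\<^sup>2)\<close>. The geodesic equation becomes
  \<open>y' = - K y\<^sup>2\<close>. The angle \<open>\<beta>\<close> of the velocity with the radial direction is the argument of \<open>y\<close>,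
  and the polar coordinate is \<open>w = \<bar>w\<bar> cis ((\<pi> / \<theta>) Arg m)\<close> with \<open>\<bar>w\<bar> = 2 \<bar>m\<bar> / (1 - \<bar>m\<bar>\<^sup>2)\<close>, the
  hyperbolic sine of the distance to the vertex. Unit speed means \<open>\<bar>y\<bar> = 1 / \<bar>w\<bar>\<close>, and
  \<open>K = sqrt (1 + \<bar>w\<bar>\<^sup>2)\<close>. Hence the derivative of \<open>(w, \<beta>)\<close> along the flow is \<open>1 / \<bar>w\<bar>\<close> times
  \<open>(w (K cos \<beta> + \<i> (\<pi> / \<theta>) sin \<beta>), - K sin \<beta>)\<close>, and the factor \<open>\<rho> = \<bar>w\<bar>\<close> leaves a smooth
  field up to \<open>w = 0\<close>.

  The polar coordinates are given by the distance and by the geodesics of the double. The distance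
  to a cone point is the hyperbolic distance to the vertex, because folding a curve into the triangle
  preserves its length, and admissibility of the radius keeps the ball off the opposite side, so that
  the punctured ball is covered by two charts of the double in which the geodesics from the cone
  point are radial.\<close>

section \<open>The calculus of smooth functions\<close>

text \<open>A tangent vector of \<open>M\<close> is a family of values in all charts, tied together
  by the transition maps. The extension is therefore given as \<open>speed\<close> times the
  velocity of curves: lifted geodesics off the singular fibers, and on a fiber a curve that turns
  the angle with the rate \<open>- sin \<beta>\<close> prescribed by the limit field. The chain rule
  turns smoothness of all transitions into tangency, and what remains is one velocity computation
  per kind of chart.

  The obstacle is that the polar coordinates are defined by arbitrary curves. The distance is an
  infimum over curves that may cross the sides in complicated ways, and folding is not
  differentiable at a side; the length estimate therefore works with one-sided difference quotients.
  The segments are picked by \<open>SOME\<close>, and become radial only through uniqueness in the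
  ball, once a symmetry argument has excluded the opposite side. Both arguments describe the
  triangle by signs of barycentric coordinates in the hyperboloid model, in which segments,
  reflections and sectors at a vertex are matters of linear algebra.\<close>

lemma Ck_on_SucI:
  assumes "open S" "\<And>x. x \<in> S \<Longrightarrow> (f has_derivative f' x) (at x)"
    and "\<And>v. Ck_on n (\<lambda>x. f' x v) S"
    and cong: "\<And>(g :: _ \<Rightarrow> 'b) h. Ck_on n g S \<Longrightarrow> (\<And>x. x \<in> S \<Longrightarrow> h x = g x) \<Longrightarrow> Ck_on n h S"
  shows "Ck_on (Suc n) (f :: 'a::real_normed_vector \<Rightarrow> 'b::real_normed_vector) S"
proof -
  have "frechet_derivative f (at x) v = f' x v" if "x \<in> S" for x v
    using assms(2)[OF that] frechet_derivative_at by metis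
  then have "Ck_on n (\<lambda>x. frechet_derivative f (at x) v) S" for v
    by (intro cong[OF assms(3)[of v]]) auto
  moreover have "f differentiable (at x)" if "x \<in> S" for x
    using assms(2)[OF that] by (auto simp: differentiable_def)
  ultimately show ?thesis by simp
qed

text \<open>Passing from a derivative to \<open>Ck_on (Suc n)\<close> needs congruence at level
  \<open>n\<close>. That is the hypothesis \<open>cong\<close> of \<open>Ck_on_SucI\<close>, and
  here it is the induction hypothesis, which breaks the circle.\<close>

lemma Ck_on_cong:
  assumes "open S" "\<And>x. x \<in> S \<Longrightarrow> f x = g x" "Ck_on n g S"
  shows "Ck_on n (f :: 'a::real_normed_vector \<Rightarrow> 'b::real_normed_vector) S"
  using assms(2,3)
proof (induction n arbitrary: f g)
  case 0
  then show ?case by (simp cong: continuous_on_cong)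
next
  case (Suc n)
  have d: "(f has_derivative frechet_derivative g (at x)) (at x)" if "x \<in> S" for x
  proof (rule has_derivative_transform_within_open[OF _ \<open>open S\<close> that])
    show "(g has_derivative frechet_derivative g (at x)) (at x)"
      using Suc.prems(2) that by (simp flip: frechet_derivative_works)
  qed (use Suc.prems in auto)
  show ?case
    by (rule Ck_on_SucI[OF \<open>open S\<close> d]) (use Suc in auto)
qed

lemma Ck_on_has_derivativeI:
  assumes "open S" "\<And>x. x \<in> S \<Longrightarrow> (f has_derivative f' x) (at x)"
    and "\<And>v. Ck_on n (\<lambda>x. f' x v) S"
  shows "Ck_on (Suc n) (f :: 'a::real_normed_vector \<Rightarrow> 'b::real_normed_vector) S"
  by (rule Ck_on_SucI[OF assms]) (auto intro: Ck_on_cong[OF \<open>open S\<close>])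

lemma Ck_on_SucD:
  assumes "Ck_on (Suc n) f S" "x \<in> S"
  shows "(f has_derivative frechet_derivative f (at x)) (at x)"
  using assms by (simp flip: frechet_derivative_works)

lemma Ck_on_mono: "Ck_on (Suc n) f S \<Longrightarrow> Ck_on n f S"
proof (induction n arbitrary: f)
  case 0
  then show ?case
    by (auto intro!: continuous_at_imp_continuous_on differentiable_imp_continuous_within)
next
  case (Suc n)
  then show ?case by (metis Ck_on.simps(2))
qed

lemma Ck_on_subset: "Ck_on n f S \<Longrightarrow> T \<subseteq> S \<Longrightarrow> Ck_on n f T"
  by (induction n arbitrary: f) (auto intro: continuous_on_subset)

text \<open>\<open>Ck_on\<close> takes its derivatives at \<open>at x\<close>, so it is a local
  notion even if \<open>S\<close> is not known to be open. The later use is for images of charts of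
  \<open>M\<close>.\<close>

lemma Ck_on_local:
  assumes "\<And>x. x \<in> S \<Longrightarrow> \<exists>U. open U \<and> x \<in> U \<and> Ck_on n f U"
  shows "Ck_on n f S"
  using assms
proof (induction n arbitrary: f)
  case 0
  then show ?case
    by simp (metis continuous_at_imp_continuous_on continuous_on_eq_continuous_at)
next
  case (Suc n)
  then show ?case by simp metis
qed

lemma Ck_on_const: "open S \<Longrightarrow> Ck_on n (\<lambda>x. c) S"
proof (induction n arbitrary: c)
  case (Suc n)
  then show ?case by (intro Ck_on_has_derivativeI[where f' = "\<lambda>_ _. 0"]) auto
qed auto

lemma Ck_on_linear_compose:
  assumes "open S" "bounded_linear L" "Ck_on n f S"
  shows "Ck_on n (\<lambda>x. L (f x)) S"
  using assms(3)
proof (induction n arbitrary: f)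
  case 0
  then show ?case by (auto intro: bounded_linear.continuous_on[OF assms(2)])
next
  case (Suc n)
  show ?case
    by (rule Ck_on_has_derivativeI[OF \<open>open S\<close>
          bounded_linear.has_derivative[OF assms(2) Ck_on_SucD[OF Suc.prems]]])
       (use Suc in auto)
qed

lemma Ck_on_add:
  assumes "open S" "Ck_on n f S" "Ck_on n g S"
  shows "Ck_on n (\<lambda>x. f x + g x) S"
  using assms(2,3)
proof (induction n arbitrary: f g)
  case 0
  then show ?case by (auto intro: continuous_intros)
next
  case (Suc n)
  show ?case
    by (rule Ck_on_has_derivativeI[OF \<open>open S\<close>
          has_derivative_add[OF Ck_on_SucD[OF Suc.prems(1)] Ck_on_SucD[OF Suc.prems(2)]]])
       (use Suc in auto)
qed

lemma Ck_on_sum: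
  assumes "open S" "\<And>i. i \<in> I \<Longrightarrow> Ck_on n (f i) S"
  shows "Ck_on n (\<lambda>x. \<Sum>i\<in>I. f i x) S"
  using assms(2)
  by (induction I rule: infinite_finite_induct)
     (auto intro: Ck_on_const Ck_on_add assms(1))

lemma Ck_on_bilinear:
  assumes "open S" "bounded_bilinear B" "Ck_on n f S" "Ck_on n g S"
  shows "Ck_on n (\<lambda>x. B (f x) (g x)) S"
  using assms(3,4)
proof (induction n arbitrary: f g)
  case 0
  then show ?case by (auto intro: bounded_bilinear.continuous_on[OF assms(2)])
next
  case (Suc n)
  show ?case
  proof (rule Ck_on_has_derivativeI[OF \<open>open S\<close> bounded_bilinear.FDERIV[OF assms(2)
          Ck_on_SucD[OF Suc.prems(1)] Ck_on_SucD[OF Suc.prems(2)]]])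
    fix v
    have "Ck_on n f S" "Ck_on n g S"
      using Suc.prems Ck_on_mono by blast+
    then show "Ck_on n (\<lambda>x. B (f x) (frechet_derivative g (at x) v)
                          + B (frechet_derivative f (at x) v) (g x)) S"
      using Suc by (intro Ck_on_add \<open>open S\<close>) auto
  qed
qed

text \<open>In the derivative \<open>g' (f x) (f' x v)\<close> both the point and the direction
  depend on \<open>x\<close>, while \<open>Ck_on\<close> speaks of fixed directions. Expanding the
  direction in \<open>Basis\<close> leaves functions
  \<open>frechet_derivative g (at (f x)) b\<close> with fixed \<open>b\<close>, which are
  compositions covered by the induction hypothesis. This is why \<open>'b\<close> is
  Euclidean.\<close>

lemma Ck_on_compose:
  fixes f :: "'a::real_normed_vector \<Rightarrow> 'b::euclidean_space"
    and g :: "'b \<Rightarrow> 'c::real_normed_vector"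
  assumes "open S" "Ck_on n f S" "Ck_on n g T" "f ` S \<subseteq> T"
  shows "Ck_on n (\<lambda>x. g (f x)) S"
  using assms(2,3)
proof (induction n arbitrary: g)
  case 0
  then show ?case
    using continuous_on_compose2[of T g S f] assms(4) by simp
next
  case (Suc n)
  have d: "((\<lambda>x. g (f x)) has_derivative
        (\<lambda>v. frechet_derivative g (at (f x)) (frechet_derivative f (at x) v))) (at x)"
    if "x \<in> S" for x
  proof -
    have "f x \<in> T" using that assms(4) by auto
    from has_derivative_compose[OF Ck_on_SucD[OF Suc.prems(1) that] Ck_on_SucD[OF Suc.prems(2) this]]
    show ?thesis .
  qed
  show ?case
  proof (rule Ck_on_has_derivativeI[OF \<open>open S\<close> d])
    fix v
    have f: "Ck_on n f S" using Suc.prems(1) by (rule Ck_on_mono)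
    have g: "Ck_on n (\<lambda>x. frechet_derivative g (at (f x)) b) S" for b
    proof -
      have "Ck_on n (\<lambda>y. frechet_derivative g (at y) b) T"
        using Suc.prems(2) by simp
      from Suc.IH[OF f this] show ?thesis .
    qed
    have fv: "Ck_on n (\<lambda>x. frechet_derivative f (at x) v) S"
      using Suc.prems(1) by simp
    have "Ck_on n (\<lambda>x. (frechet_derivative f (at x) v \<bullet> b) *\<^sub>R
                       frechet_derivative g (at (f x)) b) S" for b
      by (rule Ck_on_bilinear[OF \<open>open S\<close> bounded_bilinear_scaleR
            Ck_on_linear_compose[OF \<open>open S\<close> bounded_linear_inner_left fv] g])
    then have "Ck_on n (\<lambda>x. \<Sum>b\<in>Basis. (frechet_derivative f (at x) v \<bullet> b) *\<^sub>R
                                   frechet_derivative g (at (f x)) b) S"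
      by (rule Ck_on_sum[OF \<open>open S\<close>])
    moreover have "frechet_derivative g (at (f x)) (frechet_derivative f (at x) v) =
        (\<Sum>b\<in>Basis. (frechet_derivative f (at x) v \<bullet> b) *\<^sub>R frechet_derivative g (at (f x)) b)"
      if "x \<in> S" for x
    proof -
      have "f x \<in> T" using that assms(4) by auto
      then have lin: "linear (frechet_derivative g (at (f x)))"
        by (rule has_derivative_linear[OF Ck_on_SucD[OF Suc.prems(2)]])
      have "frechet_derivative g (at (f x)) (\<Sum>b\<in>Basis. (w \<bullet> b) *\<^sub>R b) =
        (\<Sum>b\<in>Basis. (w \<bullet> b) *\<^sub>R frechet_derivative g (at (f x)) b)" for w
        by (simp only: linear_sum[OF lin] linear_scale[OF lin])
      from this[of "frechet_derivative f (at x) v"] show ?thesis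
        by (simp only: euclidean_representation)
    qed
    ultimately show "Ck_on n (\<lambda>x. frechet_derivative g (at (f x)) (frechet_derivative f (at x) v)) S"
      by (rule Ck_on_cong[OF \<open>open S\<close>, rotated])
  qed
qed

lemma smooth_on_cong:
  "smooth_on g S \<Longrightarrow> open S \<Longrightarrow> (\<And>x. x \<in> S \<Longrightarrow> f x = g x) \<Longrightarrow> smooth_on f S"
  unfolding smooth_on_def by (blast intro: Ck_on_cong)

lemma smooth_on_subset: "smooth_on f S \<Longrightarrow> T \<subseteq> S \<Longrightarrow> smooth_on f T"
  unfolding smooth_on_def by (blast intro: Ck_on_subset)

lemma smooth_on_local:
  "(\<And>x. x \<in> S \<Longrightarrow> \<exists>U. open U \<and> x \<in> U \<and> smooth_on f U) \<Longrightarrow> smooth_on f S"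
  unfolding smooth_on_def by (metis Ck_on_local)

lemma smooth_on_differentiable: "smooth_on f S \<Longrightarrow> x \<in> S \<Longrightarrow> f differentiable (at x)"
  unfolding smooth_on_def by (metis Ck_on.simps(2))

lemma smooth_on_continuous: "smooth_on f S \<Longrightarrow> continuous_on S f"
  unfolding smooth_on_def by (metis Ck_on.simps(1))

lemma smooth_on_const [simp, intro]: "open S \<Longrightarrow> smooth_on (\<lambda>x. c) S"
  by (simp add: smooth_on_def Ck_on_const)

lemma smooth_on_linear_compose:
  "bounded_linear L \<Longrightarrow> open S \<Longrightarrow> smooth_on f S \<Longrightarrow> smooth_on (\<lambda>x. L (f x)) S"
  by (simp add: smooth_on_def Ck_on_linear_compose)

lemma smooth_on_ident: "open S \<Longrightarrow> smooth_on (\<lambda>x. x) S"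
  unfolding smooth_on_def
proof
  fix n assume "open S"
  show "Ck_on n (\<lambda>x. x) S"
    by (cases n) (auto intro!: Ck_on_has_derivativeI Ck_on_const \<open>open S\<close> derivative_intros
        simp del: Ck_on.simps(2))
qed

lemma smooth_on_bounded_linear: "bounded_linear L \<Longrightarrow> open S \<Longrightarrow> smooth_on L S"
  by (rule smooth_on_linear_compose[OF _ _ smooth_on_ident])

lemma smooth_on_compose:
  fixes f :: "'a::real_normed_vector \<Rightarrow> 'b::euclidean_space"
  shows "smooth_on g T \<Longrightarrow> open S \<Longrightarrow> smooth_on f S \<Longrightarrow> f ` S \<subseteq> T \<Longrightarrow> smooth_on (\<lambda>x. g (f x)) S"
  unfolding smooth_on_def by (blast intro: Ck_on_compose)

lemma smooth_on_bilinear: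
  "bounded_bilinear B \<Longrightarrow> open S \<Longrightarrow> smooth_on f S \<Longrightarrow> smooth_on g S \<Longrightarrow> smooth_on (\<lambda>x. B (f x) (g x)) S"
  by (simp add: smooth_on_def Ck_on_bilinear)

lemma smooth_on_add:
  "open S \<Longrightarrow> smooth_on f S \<Longrightarrow> smooth_on g S \<Longrightarrow> smooth_on (\<lambda>x. f x + g x) S"
  by (simp add: smooth_on_def Ck_on_add)

lemmas smooth_on_mult = smooth_on_bilinear[OF bounded_bilinear_mult]
lemmas smooth_on_scaleR = smooth_on_bilinear[OF bounded_bilinear_scaleR]
lemmas smooth_on_Re = smooth_on_linear_compose[OF bounded_linear_Re]
lemmas smooth_on_Im = smooth_on_linear_compose[OF bounded_linear_Im]
lemmas smooth_on_cnj = smooth_on_linear_compose[OF bounded_linear_cnj]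
lemmas smooth_on_of_real = smooth_on_linear_compose[OF bounded_linear_of_real]
lemmas smooth_on_minus = smooth_on_linear_compose[OF bounded_linear_minus[OF bounded_linear_ident]]

lemma smooth_on_diff:
  "open S \<Longrightarrow> smooth_on f S \<Longrightarrow> smooth_on g S \<Longrightarrow> smooth_on (\<lambda>x. f x - g x) S"
  using smooth_on_add[of S f "\<lambda>x. - g x"] smooth_on_minus[of S g] by simp

lemma smooth_on_Pair:
  assumes "open S" "smooth_on f S" "smooth_on g S"
  shows "smooth_on (\<lambda>x. (f x, g x)) S"
proof -
  have "smooth_on (\<lambda>x. (f x, 0) + (0, g x)) S"
    by (intro smooth_on_add smooth_on_linear_compose[where L = "\<lambda>x. (x, 0)"]
          smooth_on_linear_compose[where L = "\<lambda>x. (0, x)"] assms bounded_linear_intros)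
  then show ?thesis by simp
qed

text \<open>The real derivative in the direction \<open>v\<close> is \<open>deriv f x * v\<close>,
  and \<open>deriv f\<close> is holomorphic again. Smoothness of all elementary functions below is
  drawn from this.\<close>

lemma holomorphic_imp_smooth_on:
  assumes "open S" "f holomorphic_on S"
  shows "smooth_on f S"
  unfolding smooth_on_def
proof
  fix n show "Ck_on n f S" using assms(2)
  proof (induction n arbitrary: f)
    case 0
    then show ?case by (simp add: holomorphic_on_imp_continuous_on)
  next
    case (Suc n)
    show ?case
    proof (rule Ck_on_has_derivativeI[OF \<open>open S\<close>])
      show "(f has_derivative (*) (deriv f x)) (at x)" if "x \<in> S" for x
        using holomorphic_derivI[OF Suc.prems \<open>open S\<close> that] by (simp add: has_field_derivative_def)
      have "Ck_on n (deriv f) S"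
        using Suc holomorphic_deriv[OF Suc.prems \<open>open S\<close>] by blast
      then show "Ck_on n (\<lambda>x. deriv f x * v) S" for v
        by (intro Ck_on_bilinear[OF \<open>open S\<close> bounded_bilinear_mult] Ck_on_const \<open>open S\<close>)
    qed
  qed
qed

lemma smooth_on_holomorphic_compose:
  assumes "g holomorphic_on T" "open T" "open S" "smooth_on f S" "f ` S \<subseteq> T"
  shows "smooth_on (\<lambda>x. g (f x)) S"
  using smooth_on_compose[OF holomorphic_imp_smooth_on[OF assms(2,1)] assms(3-5)] .

lemma smooth_on_divide:
  fixes f g :: "'a::real_normed_vector \<Rightarrow> complex"
  assumes "open S" "smooth_on f S" "smooth_on g S" "\<And>x. x \<in> S \<Longrightarrow> g x \<noteq> 0"
  shows "smooth_on (\<lambda>x. f x / g x) S"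
proof -
  have "smooth_on (\<lambda>x. inverse (g x)) S"
    by (rule smooth_on_holomorphic_compose[where T = "- {0}"])
       (use assms in \<open>auto intro!: holomorphic_intros\<close>)
  then show ?thesis
    using smooth_on_mult[OF assms(1,2)] by (simp add: divide_inverse)
qed

lemma smooth_on_divide_real:
  fixes f g :: "'a::real_normed_vector \<Rightarrow> real"
  assumes "open S" "smooth_on f S" "smooth_on g S" "\<And>x. x \<in> S \<Longrightarrow> g x \<noteq> 0"
  shows "smooth_on (\<lambda>x. f x / g x) S"
proof -
  have "smooth_on (\<lambda>x. Re (of_real (f x) / of_real (g x))) S"
    by (intro smooth_on_Re smooth_on_divide smooth_on_of_real) (use assms in auto)
  then show ?thesis by simp
qed

lemma smooth_on_exp:
  fixes f :: "'a::real_normed_vector \<Rightarrow> complex"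
  shows "open S \<Longrightarrow> smooth_on f S \<Longrightarrow> smooth_on (\<lambda>x. exp (f x)) S"
  by (rule smooth_on_holomorphic_compose[where T = UNIV]) (auto intro: holomorphic_intros)

lemma smooth_on_cis: "open S \<Longrightarrow> smooth_on f S \<Longrightarrow> smooth_on (\<lambda>x. cis (f x)) S"
  unfolding cis_conv_exp by (intro smooth_on_exp smooth_on_mult smooth_on_const smooth_on_of_real)

lemma smooth_on_cos:
  fixes f :: "'a::real_normed_vector \<Rightarrow> real"
  shows "open S \<Longrightarrow> smooth_on f S \<Longrightarrow> smooth_on (\<lambda>x. cos (f x)) S"
  using smooth_on_Re[of S "\<lambda>x. cis (f x)"] by (simp add: smooth_on_cis)

lemma smooth_on_sin:
  fixes f :: "'a::real_normed_vector \<Rightarrow> real"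
  shows "open S \<Longrightarrow> smooth_on f S \<Longrightarrow> smooth_on (\<lambda>x. sin (f x)) S"
  using smooth_on_Im[of S "\<lambda>x. cis (f x)"] by (simp add: smooth_on_cis)

lemma smooth_on_Ln:
  assumes "open S" "smooth_on f S" "\<And>x. x \<in> S \<Longrightarrow> f x \<notin> \<real>\<^sub>\<le>\<^sub>0"
  shows "smooth_on (\<lambda>x. Ln (f x)) S"
  by (rule smooth_on_holomorphic_compose[where T = "- \<real>\<^sub>\<le>\<^sub>0"])
     (use assms in \<open>auto intro!: holomorphic_intros simp: open_Compl\<close>)

text \<open>The root is written as \<open>exp (Ln y / 2)\<close>, which is holomorphic off the
  slit.\<close>

lemma smooth_on_sqrt:
  assumes "open S" "smooth_on f S" "\<And>x. x \<in> S \<Longrightarrow> f x > 0"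
  shows "smooth_on (\<lambda>x. sqrt (f x)) S"
proof -
  have "smooth_on (\<lambda>x. Re (exp (Ln (of_real (f x)) / 2))) S"
    by (intro smooth_on_Re smooth_on_divide smooth_on_of_real smooth_on_exp smooth_on_Ln smooth_on_const)
       (use assms(1,2) in \<open>auto simp: complex_nonpos_Reals_iff not_le dest: assms(3)\<close>)
  then show ?thesis
  proof (rule smooth_on_cong[OF _ assms(1)])
    fix x assume "x \<in> S"
    then have "f x > 0" using assms by auto
    then have "exp (Ln (of_real (f x)) / 2) = complex_of_real (exp (ln (f x) / 2))"
      using exp_of_real[of "ln (f x) / 2", where 'a = complex] by (simp add: Ln_of_real)
    moreover have "exp (ln (f x) / 2) = sqrt (f x)"
      using \<open>f x > 0\<close> exp_ln[of "sqrt (f x)"] by (simp add: ln_sqrt)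
    ultimately show "sqrt (f x) = Re (exp (Ln (of_real (f x)) / 2))" by simp
  qed
qed

lemma smooth_on_cmod:
  assumes "open S" "smooth_on f S" "\<And>x. x \<in> S \<Longrightarrow> f x \<noteq> 0"
  shows "smooth_on (\<lambda>x. cmod (f x)) S"
proof -
  have "smooth_on (\<lambda>x. sqrt (Re (f x * cnj (f x)))) S"
    by (intro smooth_on_sqrt smooth_on_Re smooth_on_mult smooth_on_cnj assms)
       (use assms in \<open>simp_all flip: complex_norm_square of_real_power\<close>)
  then show ?thesis
    by (simp flip: complex_norm_square of_real_power)
qed

lemma smooth_on_cmod_power2:
  assumes "open S" "smooth_on f S"
  shows "smooth_on (\<lambda>x. (cmod (f x))\<^sup>2) S"
proof -
  have "smooth_on (\<lambda>x. Re (f x * cnj (f x))) S"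
    by (intro smooth_on_Re smooth_on_mult smooth_on_cnj assms)
  then show ?thesis
    by (simp flip: complex_norm_square of_real_power)
qed

section \<open>Index arithmetic modulo 3\<close>

lemma three_cases: "(j :: 3) = i \<or> j = i + 1 \<or> j = i + 2"
  using exhaust_3[of i] exhaust_3[of j] by auto

lemma three_add [simp]:
  "(i :: 3) + 1 + 1 = i + 2" "i + 1 + 2 = i" "i + 2 + 1 = i" "i + 2 + 2 = i + 1"
  using exhaust_3[of i] by auto

lemma three_neq [simp]:
  "(i :: 3) + 1 \<noteq> i" "i + 2 \<noteq> i" "i \<noteq> i + 1" "i \<noteq> i + 2" "i + 1 \<noteq> i + 2" "i + 2 \<noteq> i + 1"
  using exhaust_3[of i] by auto

lemma all_three: "(\<forall>j :: 3. P j) \<longleftrightarrow> P i \<and> P (i + 1) \<and> P (i + 2)"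
proof (intro iffI allI)
  fix j assume "P i \<and> P (i + 1) \<and> P (i + 2)"
  then show "P j" using three_cases[of j i] by auto
qed auto

lemma UNIV_three_minus: "UNIV - {i :: 3} = {i + 1, i + 2}"
proof (intro equalityI subsetI)
  fix j assume "j \<in> UNIV - {i}"
  then show "j \<in> {i + 1, i + 2}" using three_cases[of j i] by auto
qed auto

lemma UN_three_minus: "(\<Union>j\<in>UNIV - {i :: 3}. f j) = f (i + 1) \<union> f (i + 2)"
  by (simp add: UNIV_three_minus)

section \<open>Isometries of the disc\<close>

text \<open>The action on the disc of the matrix with rows \<open>(a, b)\<close> and
  \<open>(cnj b, cnj a)\<close>, with \<open>cmod b < cmod a\<close> in place of determinant 1. All
  orientation preserving isometries have this form, and composition is matrix multiplication without
  any normalization.\<close>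

definition su :: "complex \<Rightarrow> complex \<Rightarrow> complex \<Rightarrow> complex" where
  "su a b z = (a * z + b) / (cnj b * z + cnj a)"

lemma Moebius_eq_su: "Moebius_function 0 p = su 1 (- p)"
  by (rule ext) (simp add: Moebius_function_def su_def)

lemma su_denom:
  assumes "cmod b < cmod a" "cmod z \<le> 1"
  shows "cnj b * z + cnj a \<noteq> 0"
proof
  assume "cnj b * z + cnj a = 0"
  then have "cmod (cnj b * z) = cmod (cnj a)" by (metis add_eq_0_iff norm_minus_cancel)
  moreover have "cmod b * cmod z \<le> cmod b * 1" by (rule mult_left_mono[OF assms(2)]) simp
  ultimately show False using assms(1) by (simp add: norm_mult)
qed

lemma su_gap:
  assumes "cmod b < cmod a"
  shows "(cmod a)\<^sup>2 - (cmod b)\<^sup>2 > 0"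
  using assms power_strict_mono[of "cmod b" "cmod a" 2] by simp

lemma su_norm:
  assumes "cmod b < cmod a" "cmod z < 1"
  shows "1 - (cmod (su a b z))\<^sup>2 =
         ((cmod a)\<^sup>2 - (cmod b)\<^sup>2) * (1 - (cmod z)\<^sup>2) / (cmod (cnj b * z + cnj a))\<^sup>2"
proof -
  have "cnj b * z + cnj a \<noteq> 0" using su_denom assms by simp
  then have "(cmod (cnj b * z + cnj a))\<^sup>2 \<noteq> 0" by simp
  moreover have "(cmod (cnj b * z + cnj a))\<^sup>2 - (cmod (a * z + b))\<^sup>2 =
      ((cmod a)\<^sup>2 - (cmod b)\<^sup>2) * (1 - (cmod z)\<^sup>2)"
    unfolding cmod_power2 by (simp add: power2_eq_square algebra_simps)
  ultimately show ?thesis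
    by (simp add: su_def norm_divide power_divide field_simps)
qed

lemma su_in_ball:
  assumes "cmod b < cmod a" "cmod z < 1"
  shows "cmod (su a b z) < 1"
proof -
  have "1 - (cmod z)\<^sup>2 > 0" using assms(2) by (simp add: abs_square_less_1)
  then have "1 - (cmod (su a b z))\<^sup>2 > 0"
    unfolding su_norm[OF assms] using su_gap[OF assms(1)] su_denom[OF assms(1), of z] assms(2) by simp
  then show ?thesis by (simp add: abs_square_less_1)
qed

lemma su_has_field_derivative:
  assumes "cmod b < cmod a" "cmod z < 1"
  shows "(su a b has_field_derivative
          of_real ((cmod a)\<^sup>2 - (cmod b)\<^sup>2) / (cnj b * z + cnj a)\<^sup>2) (at z)"
proof -
  have "cnj b * z + cnj a \<noteq> 0" using su_denom assms by simp
  then have "((\<lambda>z. (a * z + b) / (cnj b * z + cnj a)) has_field_derivative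
      (a * (cnj b * z + cnj a) - (a * z + b) * cnj b) / (cnj b * z + cnj a)\<^sup>2) (at z)"
    by (auto intro!: derivative_eq_intros simp: power2_eq_square)
  moreover have "a * (cnj b * z + cnj a) - (a * z + b) * cnj b =
      of_real ((cmod a)\<^sup>2 - (cmod b)\<^sup>2)"
    by (simp add: complex_norm_square algebra_simps del: of_real_power)
  ultimately show ?thesis unfolding su_def[abs_def] by simp
qed

definition su' :: "complex \<Rightarrow> complex \<Rightarrow> complex \<Rightarrow> complex" where
  "su' a b z = of_real ((cmod a)\<^sup>2 - (cmod b)\<^sup>2) / (cnj b * z + cnj a)\<^sup>2"

lemma su_DERIV:
  assumes "cmod b < cmod a" "cmod z < 1"
  shows "(su a b has_field_derivative su' a b z) (at z)"
  unfolding su'_def by (rule su_has_field_derivative[OF assms])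

lemma su'_nonzero: "cmod b < cmod a \<Longrightarrow> cmod z < 1 \<Longrightarrow> su' a b z \<noteq> 0"
  using su_denom[of b a z] su_gap[of b a] unfolding su'_def
  by (simp flip: of_real_power of_real_diff)

text \<open>This is the isometry property: \<open>su a b\<close> preserves the line element
  \<open>2 |dz| / (1 - |z|^2)\<close>.\<close>

lemma su'_norm:
  assumes "cmod b < cmod a" "cmod z < 1"
  shows "1 - (cmod (su a b z))\<^sup>2 = cmod (su' a b z) * (1 - (cmod z)\<^sup>2)"
proof -
  have "cmod (su' a b z) = ((cmod a)\<^sup>2 - (cmod b)\<^sup>2) / (cmod (cnj b * z + cnj a))\<^sup>2"
    using su_gap[OF assms(1)] unfolding su'_def norm_divide norm_power norm_of_real
    by (simp only: abs_of_pos)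
  then show ?thesis unfolding su_norm[OF assms] by simp
qed

text \<open>The determinant \<open>|a|^2 - |b|^2\<close> is multiplicative.\<close>

lemma su_compose_gap:
  assumes "cmod b < cmod a" "cmod d < cmod c"
  shows "cmod (c * b + d * cnj a) < cmod (c * a + d * cnj b)"
proof -
  have "(cmod (c * a + d * cnj b))\<^sup>2 - (cmod (c * b + d * cnj a))\<^sup>2 =
     ((cmod a)\<^sup>2 - (cmod b)\<^sup>2) * ((cmod c)\<^sup>2 - (cmod d)\<^sup>2)"
    unfolding cmod_power2 by (simp add: power2_eq_square algebra_simps)
  also have "\<dots> > 0" using su_gap assms by simp
  finally show ?thesis using power2_less_imp_less norm_ge_zero by fastforce
qed

lemma su_compose:
  assumes "cmod b < cmod a" "cmod z < 1"
  shows "su c d (su a b z) = su (c * a + d * cnj b) (c * b + d * cnj a) z"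
proof -
  have n: "cnj b * z + cnj a \<noteq> 0" using su_denom assms by simp
  have "c * su a b z + d = ((c * a + d * cnj b) * z + (c * b + d * cnj a)) / (cnj b * z + cnj a)"
    "cnj d * su a b z + cnj c =
      (cnj (c * b + d * cnj a) * z + cnj (c * a + d * cnj b)) / (cnj b * z + cnj a)"
    using n by (simp_all add: su_def field_simps)
  then show ?thesis using n by (simp add: su_def[of c d] su_def[of "c * a + _"])
qed

lemma su_inverse:
  assumes "cmod b < cmod a" "cmod z < 1"
  shows "su (cnj a) (- b) (su a b z) = z"
proof -
  have "of_real ((cmod a)\<^sup>2 - (cmod b)\<^sup>2) \<noteq> (0::complex)"
    using su_gap[OF assms(1)] of_real_eq_0_iff by (metis less_irrefl)
  moreover have "cnj a * a + - b * cnj b = of_real ((cmod a)\<^sup>2 - (cmod b)\<^sup>2)"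
    by (simp add: complex_norm_square algebra_simps del: of_real_power)
  ultimately have "su (cnj a * a + - b * cnj b) 0 z = z"
    by (simp add: su_def)
  then show ?thesis by (simp add: su_compose[OF assms] algebra_simps)
qed

lemma cnj_su: "cnj (su a b z) = su (cnj a) (cnj b) (cnj z)"
  by (simp add: su_def)

lemma mob_inverse:
  assumes "cmod p < 1" "cmod z < 1"
  shows "su 1 p (su 1 (- p) z) = z" "su 1 (- p) (su 1 p z) = z"
  using su_inverse[of "- p" 1 z] su_inverse[of p 1 z] assms by auto

lemma of_real_1_plus_cmod: "complex_of_real (1 + (cmod w)\<^sup>2) = 1 + w * cnj w"
  by (simp flip: complex_norm_square)

text \<open>Writing a reflection as a matrix acting on \<open>cnj z\<close> makes a product of two
  reflections a map \<open>su\<close> again, so that transition maps and symmetries share one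
  calculus.\<close>

lemma reflection_su:
  assumes s: "cmod s = 1" and p: "cmod p < 1"
  obtains a b where "cmod b < cmod a"
    "\<And>z. cmod z < 1 \<Longrightarrow> su 1 p (s\<^sup>2 * cnj (su 1 (- p) z)) = su a b (cnj z)"
proof -
  have ss: "s * cnj s = 1" using complex_norm_square[of s] s by simp
  \<comment> \<open>\<open>su s 0\<close> is multiplication by \<open>s / cnj s\<close>, which
    equals \<open>s^2\<close> on the unit circle.\<close>
  have rot: "s\<^sup>2 * w = su s 0 w" for w
  proof -
    have "s\<^sup>2 * w * cnj s = s * w * (s * cnj s)" by (simp add: power2_eq_square)
    moreover have "cnj s \<noteq> 0" using s by auto
    ultimately show ?thesis unfolding ss by (simp add: su_def eq_divide_eq)
  qed
  have "su 1 p (s\<^sup>2 * cnj (su 1 (- p) z)) = su (1 * (s * 1 + 0 * cnj (- cnj p)) + p * cnj (s * (- cnj p) + 0 * cnj 1))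
     (1 * (s * (- cnj p) + 0 * cnj 1) + p * cnj (s * 1 + 0 * cnj (- cnj p))) (cnj z)"
    if "cmod z < 1" for z
  proof -
    have g: "cmod (s * (- cnj p) + 0 * cnj 1) < cmod (s * 1 + 0 * cnj (- cnj p))"
      using s p by (simp add: norm_mult)
    have "su 1 p (s\<^sup>2 * cnj (su 1 (- p) z)) = su 1 p (su s 0 (su 1 (- cnj p) (cnj z)))"
      unfolding rot cnj_su by simp
    also have "\<dots> = su 1 p (su (s * 1 + 0 * cnj (- cnj p)) (s * (- cnj p) + 0 * cnj 1) (cnj z))"
      using su_compose[of "- cnj p" 1 "cnj z" s 0] p that by simp
    also have "\<dots> = su (1 * (s * 1 + 0 * cnj (- cnj p)) + p * cnj (s * (- cnj p) + 0 * cnj 1))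
     (1 * (s * (- cnj p) + 0 * cnj 1) + p * cnj (s * 1 + 0 * cnj (- cnj p))) (cnj z)"
      by (rule su_compose[OF g]) (use that in simp)
    finally show ?thesis .
  qed
  moreover have "cmod (1 * (s * (- cnj p) + 0 * cnj 1) + p * cnj (s * 1 + 0 * cnj (- cnj p)))
     < cmod (1 * (s * 1 + 0 * cnj (- cnj p)) + p * cnj (s * (- cnj p) + 0 * cnj 1))"
    by (rule su_compose_gap) (use s p in \<open>simp_all add: norm_mult\<close>)
  ultimately show ?thesis using that by blast
qed

text \<open>A fixed point is a root of a quadratic polynomial with product of the roots \<open>- b / cnj b\<close>,
  which has modulus 1.\<close>

lemma su_two_fixed_points:
  assumes ab: "cmod b < cmod a" and "cmod p < 1" "cmod q < 1" "p \<noteq> q"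
    and fp: "su a b p = p" and fq: "su a b q = q"
  shows "su a b z = z"
proof -
  have quad: "cnj b * w * w + (cnj a - a) * w - b = 0" if "cmod w < 1" "su a b w = w" for w
  proof -
    have "cnj b * w + cnj a \<noteq> 0" using su_denom[OF ab, of w] that by simp
    then have "a * w + b = w * (cnj b * w + cnj a)" using that(2) by (simp add: su_def divide_eq_eq)
    then show ?thesis by (simp add: algebra_simps)
  qed
  note P = quad[OF assms(2) fp] and Q = quad[OF assms(3) fq]
  have "(p - q) * (cnj b * (p + q) + (cnj a - a)) = 0"
    using P Q by (simp add: algebra_simps)
  then have lin: "cnj a - a = - (cnj b * (p + q))" using assms(4) by (simp add: add_eq_0_iff)
  have "b = - (cnj b * (p * q))"
    using P unfolding lin by (simp add: algebra_simps)
  then have "cmod b = cmod b * (cmod p * cmod q)"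
    by (metis complex_mod_cnj norm_minus_cancel norm_mult)
  moreover have "cmod p * cmod q < 1"
    using mult_left_le_one_le[of "cmod q" "cmod p"] assms(2,3) by simp
  ultimately have b: "b = 0" by (cases "b = 0") auto
  with lin have "cnj a = a" by simp
  moreover have "a \<noteq> 0" using ab by auto
  ultimately show ?thesis using b by (simp add: su_def)
qed

section \<open>Lines and segments\<close>

text \<open>The points \<open>(2z, 1 + |z|\<^sup>2)\<close>, up to scaling, are the points of the hyperboloid model, in
  which the geodesics are the sections by planes; \<open>geo_det p q z\<close> is the determinant of three such
  points.\<close>

definition cross2 :: "complex \<Rightarrow> complex \<Rightarrow> real" where
  "cross2 p q = Im (cnj p * q)"

definition geo_det :: "complex \<Rightarrow> complex \<Rightarrow> complex \<Rightarrow> real" where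
  "geo_det p q z = (1 + (cmod p)\<^sup>2) * cross2 q z + (1 + (cmod q)\<^sup>2) * cross2 z p
                   + (1 + (cmod z)\<^sup>2) * cross2 p q"

lemma geo_det_rotate: "geo_det q z p = geo_det p q z"
  by (simp add: geo_det_def)

lemma geo_det_same [simp]: "geo_det p q p = 0" "geo_det p q q = 0"
  by (simp_all add: geo_det_def cross2_def algebra_simps)

text \<open>The hypotheses say that the lift of \<open>z\<close> is \<open>a\<close> times the lift
  of \<open>u\<close> plus \<open>b\<close> times the lift of \<open>v\<close>, and a determinant is
  linear in its last column.\<close>

lemma geo_det_linear:
  assumes "z = a *\<^sub>R u + b *\<^sub>R v" "1 + (cmod z)\<^sup>2 = a * (1 + (cmod u)\<^sup>2) + b * (1 + (cmod v)\<^sup>2)"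
  shows "geo_det p q z = a * geo_det p q u + b * geo_det p q v"
  unfolding geo_det_def assms(2) unfolding cross2_def assms(1) by (simp add: algebra_simps)

lemma geo_det_Cramer:
  "geo_det p q r *\<^sub>R z = geo_det q r z *\<^sub>R p + geo_det r p z *\<^sub>R q + geo_det p q z *\<^sub>R r"
  "geo_det p q r * (1 + (cmod z)\<^sup>2) = geo_det q r z * (1 + (cmod p)\<^sup>2)
      + geo_det r p z * (1 + (cmod q)\<^sup>2) + geo_det p q z * (1 + (cmod r)\<^sup>2)"
proof -
  show "geo_det p q r * (1 + (cmod z)\<^sup>2) = geo_det q r z * (1 + (cmod p)\<^sup>2)
      + geo_det r p z * (1 + (cmod q)\<^sup>2) + geo_det p q z * (1 + (cmod r)\<^sup>2)"
    unfolding geo_det_def cross2_def by (simp add: algebra_simps)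
  show "geo_det p q r *\<^sub>R z = geo_det q r z *\<^sub>R p + geo_det r p z *\<^sub>R q + geo_det p q z *\<^sub>R r"
    unfolding geo_det_def cross2_def by (rule complex_eqI) (simp_all add: algebra_simps)
qed

text \<open>The isometry that moves \<open>p\<close> to 0 turns the geodesic through
  \<open>p\<close> and \<open>q\<close> into a diameter, where the determinant reduces to a planar
  cross product up to a positive factor. This links signs of \<open>geo_det\<close> with Euclidean
  angles at \<open>p\<close>.\<close>

lemma mob_cross:
  assumes "cmod p < 1" "cmod q < 1" "cmod z < 1"
  shows "cross2 (su 1 (- p) q) (su 1 (- p) z) =
     geo_det p q z * ((1 - (cmod p)\<^sup>2) / ((cmod (1 - cnj p * q))\<^sup>2 * (cmod (1 - cnj p * z))\<^sup>2))"
proof -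
  have n: "1 - cnj p * q \<noteq> 0" "1 - cnj p * z \<noteq> 0"
    using su_denom[of "- p" 1] assms by auto
  have d: "w / d = w * cnj d / of_real ((cmod d)\<^sup>2)" if "d \<noteq> 0" for w d
    using that unfolding complex_norm_square by (simp add: divide_simps)
  have q: "cnj (su 1 (- p) q) = cnj (q - p) * (1 - cnj p * q) / of_real ((cmod (1 - cnj p * q))\<^sup>2)"
    using arg_cong[OF d[OF n(1), of "q - p"], of cnj] by (simp add: su_def)
  have z: "su 1 (- p) z = (z - p) * (1 - p * cnj z) / of_real ((cmod (1 - cnj p * z))\<^sup>2)"
    using d[OF n(2), of "z - p"] by (simp add: su_def)
  have "cross2 (su 1 (- p) q) (su 1 (- p) z) =
     Im (cnj (q - p) * (1 - cnj p * q) * ((z - p) * (1 - p * cnj z))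
       / of_real ((cmod (1 - cnj p * q))\<^sup>2 * (cmod (1 - cnj p * z))\<^sup>2))"
    unfolding cross2_def q z of_real_mult times_divide_times_eq ..
  also have "\<dots> = Im (cnj (q - p) * (1 - cnj p * q) * ((z - p) * (1 - p * cnj z)))
       / ((cmod (1 - cnj p * q))\<^sup>2 * (cmod (1 - cnj p * z))\<^sup>2)"
    by (rule Im_divide_of_real)
  also have "Im (cnj (q - p) * (1 - cnj p * q) * ((z - p) * (1 - p * cnj z))) =
     geo_det p q z * (1 - (cmod p)\<^sup>2)"
    unfolding geo_det_def cross2_def cmod_power2 by (simp add: power2_eq_square) algebra
  finally show ?thesis by simp
qed

lemma mob_cross_factor:
  assumes "cmod p < 1" "cmod q < 1" "cmod z < 1"
  shows "(1 - (cmod p)\<^sup>2) / ((cmod (1 - cnj p * q))\<^sup>2 * (cmod (1 - cnj p * z))\<^sup>2) > 0"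
  using su_denom[of "- p" 1 q] su_denom[of "- p" 1 z] assms
  by (auto intro!: divide_pos_pos mult_pos_pos simp: abs_square_less_1)

text \<open>In the hyperboloid model a geodesic segment spans a planar cone. With \<open>p\<close>
  moved to 0 and \<open>q\<close> to \<open>m\<close>, the point \<open>t m\<close> has a multiple
  of \<open>t\<close> as coefficient of \<open>q\<close> and a positive multiple of
  \<open>(1 - t) (1 - t |m|^2)\<close> as coefficient of \<open>p\<close>. As long as
  \<open>t m\<close> is in the disc, the latter is nonnegative exactly for
  \<open>t <= 1\<close>.\<close>

lemma hyp_segment_iff:
  assumes "cmod p < 1" "cmod q < 1"
  shows "z \<in> hyp_segment p q \<longleftrightarrow> cmod z < 1 \<and>
     (\<exists>a b. a \<ge> 0 \<and> b \<ge> 0 \<and> z = a *\<^sub>R p + b *\<^sub>R q \<and>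
            1 + (cmod z)\<^sup>2 = a * (1 + (cmod p)\<^sup>2) + b * (1 + (cmod q)\<^sup>2))"
    (is "?L \<longleftrightarrow> ?R")
proof
  define m where "m = su 1 (- p) q"
  have m: "cmod m < 1" "q = su 1 p m"
    using assms su_in_ball[of "- p" 1 q] mob_inverse by (auto simp: m_def)
  { assume ?L
    then obtain t :: real where t: "0 \<le> t" "t \<le> 1" "z = su 1 p (t *\<^sub>R m)"
      by (auto simp: hyp_segment_def Moebius_eq_su in_segment m_def)
    have "cmod m * t \<le> cmod m * 1" using t by (intro mult_left_mono) auto
    then have tm: "cmod (t *\<^sub>R m) < 1" using m t by (simp add: mult.commute)
    define d where "d = (\<lambda>w. 1 + cnj p * w)"
    have d: "d m \<noteq> 0" "d (t *\<^sub>R m) \<noteq> 0"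
      using su_denom[of p 1 m] su_denom[of p 1 "t *\<^sub>R m"] assms m tm by (auto simp: d_def add.commute)
    \<comment> \<open>After multiplication by the squared modulus of the denominator, both
      components of the lift of \<open>su 1 p w\<close> are polynomial in \<open>w\<close> and
      \<open>cnj w\<close>.\<close>
    have su: "(cmod (d w))\<^sup>2 *\<^sub>R su 1 p w = w + p\<^sup>2 * cnj w + of_real (1 + (cmod w)\<^sup>2) * p"
      "(cmod (d w))\<^sup>2 * (1 + (cmod (su 1 p w))\<^sup>2) = (1 + (cmod p)\<^sup>2) * (1 + (cmod w)\<^sup>2) + 4 * Re (cnj p * w)"
      if "d w \<noteq> 0" for w
    proof -
      have s: "su 1 p w = (w + p) / d w" by (simp add: su_def d_def add.commute)
      have "(cmod (d w))\<^sup>2 *\<^sub>R su 1 p w = (w + p) * cnj (d w)"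
        using that unfolding s scaleR_conv_of_real complex_norm_square by simp
      also have "\<dots> = w + p\<^sup>2 * cnj w + of_real (1 + (cmod w)\<^sup>2) * p"
        unfolding of_real_1_plus_cmod by (simp add: d_def power2_eq_square algebra_simps)
      finally show "(cmod (d w))\<^sup>2 *\<^sub>R su 1 p w = w + p\<^sup>2 * cnj w + of_real (1 + (cmod w)\<^sup>2) * p" .
      have "(cmod (d w))\<^sup>2 * (1 + (cmod (su 1 p w))\<^sup>2) = (cmod (d w))\<^sup>2 + (cmod (w + p))\<^sup>2"
        using that unfolding s by (simp add: norm_divide power_divide field_simps)
      also have "\<dots> = (1 + (cmod p)\<^sup>2) * (1 + (cmod w)\<^sup>2) + 4 * Re (cnj p * w)"
        unfolding cmod_power2 d_def by (simp add: power2_eq_square algebra_simps)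
      finally show "(cmod (d w))\<^sup>2 * (1 + (cmod (su 1 p w))\<^sup>2) =
        (1 + (cmod p)\<^sup>2) * (1 + (cmod w)\<^sup>2) + 4 * Re (cnj p * w)" .
    qed
    define e where "e = (cmod (d (t *\<^sub>R m)))\<^sup>2"
    define f where "f = (cmod (d m))\<^sup>2"
    define g where "g = (1 - t) * (1 - t * (cmod m)\<^sup>2)"
    have ef: "e > 0" "f > 0" using d by (simp_all add: e_def f_def)
    have "t * (cmod m)\<^sup>2 \<le> 1"
      using mult_le_one[of t "(cmod m)\<^sup>2"] t m by (simp add: abs_square_le_1)
    then have g: "g \<ge> 0" using t by (simp add: g_def)
    have tm2: "(cmod (t *\<^sub>R m))\<^sup>2 = t\<^sup>2 * (cmod m)\<^sup>2"
      by (simp add: power_mult_distrib)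
    have "e *\<^sub>R z = g *\<^sub>R p + (t * f) *\<^sub>R q"
      unfolding m(2) scaleR_scaleR[symmetric] su(1)[OF d(1), folded f_def] t(3) su(1)[OF d(2), folded e_def]
      unfolding g_def tm2 unfolding scaleR_conv_of_real
      by (simp add: algebra_simps power2_eq_square)
    then have "(1/e) *\<^sub>R (e *\<^sub>R z) = (1/e) *\<^sub>R (g *\<^sub>R p + (t * f) *\<^sub>R q)"
      by simp
    then have "z = (1/e) *\<^sub>R (g *\<^sub>R p + (t * f) *\<^sub>R q)"
      using ef by simp
    then have 1: "z = (g / e) *\<^sub>R p + (t * f / e) *\<^sub>R q" by (simp add: scaleR_add_right)
    have "e * (1 + (cmod z)\<^sup>2) = g * (1 + (cmod p)\<^sup>2) + t * (f * (1 + (cmod q)\<^sup>2))"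
      unfolding m(2) su(2)[OF d(1), folded f_def] t(3) su(2)[OF d(2), folded e_def]
      unfolding g_def tm2 by (simp add: algebra_simps power2_eq_square)
    then have 2: "1 + (cmod z)\<^sup>2 = (g / e) * (1 + (cmod p)\<^sup>2) + (t * f / e) * (1 + (cmod q)\<^sup>2)"
      using ef by (simp add: field_simps)
    have "cmod z < 1" using t tm su_in_ball[of p 1] assms by simp
    then show ?R using 1 2 ef g t by (intro conjI exI[of _ "g / e"] exI[of _ "t * f / e"]) auto }
  { assume ?R
    then obtain a b where ab: "cmod z < 1" "a \<ge> 0" "b \<ge> 0" "z = a *\<^sub>R p + b *\<^sub>R q"
      "1 + (cmod z)\<^sup>2 = a * (1 + (cmod p)\<^sup>2) + b * (1 + (cmod q)\<^sup>2)" by auto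
    define d where "d = (\<lambda>w. 1 - cnj p * w)"
    have d: "d q \<noteq> 0" "d z \<noteq> 0"
      using su_denom[of "- p" 1 q] su_denom[of "- p" 1 z] assms ab by (auto simp: d_def)
    have su: "(cmod (d w))\<^sup>2 *\<^sub>R su 1 (- p) w = w + p\<^sup>2 * cnj w - of_real (1 + (cmod w)\<^sup>2) * p"
      "(cmod (d w))\<^sup>2 * (1 + (cmod (su 1 (- p) w))\<^sup>2) = (1 + (cmod p)\<^sup>2) * (1 + (cmod w)\<^sup>2) - 4 * Re (cnj p * w)"
      if "d w \<noteq> 0" for w
    proof -
      have s: "su 1 (- p) w = (w - p) / d w" by (simp add: su_def d_def)
      have "(cmod (d w))\<^sup>2 *\<^sub>R su 1 (- p) w = (w - p) * cnj (d w)"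
        using that unfolding s scaleR_conv_of_real complex_norm_square by simp
      also have "\<dots> = w + p\<^sup>2 * cnj w - of_real (1 + (cmod w)\<^sup>2) * p"
        unfolding of_real_1_plus_cmod by (simp add: d_def power2_eq_square algebra_simps)
      finally show "(cmod (d w))\<^sup>2 *\<^sub>R su 1 (- p) w = w + p\<^sup>2 * cnj w - of_real (1 + (cmod w)\<^sup>2) * p" .
      have "(cmod (d w))\<^sup>2 * (1 + (cmod (su 1 (- p) w))\<^sup>2) = (cmod (d w))\<^sup>2 + (cmod (w - p))\<^sup>2"
        using that unfolding s by (simp add: norm_divide power_divide field_simps)
      also have "\<dots> = (1 + (cmod p)\<^sup>2) * (1 + (cmod w)\<^sup>2) - 4 * Re (cnj p * w)"
        unfolding cmod_power2 d_def by (simp add: power2_eq_square algebra_simps)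
      finally show "(cmod (d w))\<^sup>2 * (1 + (cmod (su 1 (- p) w))\<^sup>2) =
        (1 + (cmod p)\<^sup>2) * (1 + (cmod w)\<^sup>2) - 4 * Re (cnj p * w)" .
    qed
    define \<zeta> where "\<zeta> = su 1 (- p) z"
    define e where "e = (cmod (d z))\<^sup>2"
    define f where "f = (cmod (d q))\<^sup>2"
    have ef: "e > 0" "f > 0" using d by (simp_all add: e_def f_def)
    have pp: "p + p\<^sup>2 * cnj p - of_real (1 + (cmod p)\<^sup>2) * p = 0"
      unfolding of_real_1_plus_cmod by (simp add: power2_eq_square algebra_simps)
    have "e *\<^sub>R \<zeta> = z + p\<^sup>2 * cnj z - of_real (1 + (cmod z)\<^sup>2) * p"
      unfolding \<zeta>_def e_def by (rule su(1)[OF d(2)])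
    also have "\<dots> = a *\<^sub>R (p + p\<^sup>2 * cnj p - of_real (1 + (cmod p)\<^sup>2) * p)
        + b *\<^sub>R (q + p\<^sup>2 * cnj q - of_real (1 + (cmod q)\<^sup>2) * p)"
      unfolding ab(5) unfolding ab(4) by (simp add: scaleR_conv_of_real algebra_simps)
    also have "\<dots> = (b * f) *\<^sub>R m"
      unfolding pp su(1)[OF d(1), symmetric] m_def f_def by simp
    finally have \<zeta>: "e *\<^sub>R \<zeta> = (b * f) *\<^sub>R m" .
    define t where "t = b * f / e"
    have "\<zeta> = (1/e) *\<^sub>R ((b * f) *\<^sub>R m)"
      unfolding \<zeta>[symmetric] using ef by simp
    then have \<zeta>t: "\<zeta> = t *\<^sub>R m" by (simp add: t_def)
    have t0: "t \<ge> 0" using ef ab by (simp add: t_def)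
    have "e * (1 + (cmod \<zeta>)\<^sup>2) = (1 + (cmod p)\<^sup>2) * (1 + (cmod z)\<^sup>2) - 4 * Re (cnj p * z)"
      unfolding \<zeta>_def e_def by (rule su(2)[OF d(2)])
    also have "\<dots> = a * ((1 + (cmod p)\<^sup>2)\<^sup>2 - 4 * (cmod p)\<^sup>2)
        + b * ((1 + (cmod p)\<^sup>2) * (1 + (cmod q)\<^sup>2) - 4 * Re (cnj p * q))"
      unfolding ab(5) unfolding ab(4) cmod_power2
      by (simp add: power2_eq_square algebra_simps)
    also have "\<dots> = a * (1 - (cmod p)\<^sup>2)\<^sup>2 + b * (f * (1 + (cmod m)\<^sup>2))"
      unfolding su(2)[OF d(1), symmetric] m_def f_def by (simp add: power2_eq_square algebra_simps)
    finally have "e * (1 + (cmod \<zeta>)\<^sup>2) \<ge> (b * f) * (1 + (cmod m)\<^sup>2)"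
      using ab by simp
    then have "1 + (cmod \<zeta>)\<^sup>2 \<ge> t * (1 + (cmod m)\<^sup>2)"
      using ef by (simp add: t_def field_simps)
    then have *: "(1 - t) * (1 - t * (cmod m)\<^sup>2) \<ge> 0"
      unfolding \<zeta>t by (simp add: power_mult_distrib algebra_simps power2_eq_square)
    have "t \<le> 1"
    proof (rule ccontr)
      assume "\<not> t \<le> 1"
      have "cmod \<zeta> < 1" unfolding \<zeta>_def using su_in_ball[of "- p" 1 z] assms ab by simp
      then have "t * cmod m < 1" unfolding \<zeta>t using t0 by simp
      moreover have "t * cmod m * cmod m \<le> t * cmod m * 1"
        using t0 m by (intro mult_left_mono) auto
      ultimately have "t * (cmod m)\<^sup>2 < 1" by (simp add: power2_eq_square)
      then have "(1 - t) * (1 - t * (cmod m)\<^sup>2) < 0"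
        using \<open>\<not> t \<le> 1\<close> by (intro mult_neg_pos) auto
      then show False using * by simp
    qed
    moreover have "z = su 1 p (t *\<^sub>R m)"
      using mob_inverse(1)[of p z] assms ab \<zeta>t by (simp add: \<zeta>_def)
    moreover have "t *\<^sub>R m \<in> closed_segment 0 m"
      using t0 \<open>t \<le> 1\<close> by (auto simp: in_segment)
    ultimately show ?L
      unfolding hyp_segment_def Moebius_eq_su minus_minus m_def[symmetric] by blast }
qed

text \<open>The lifts of disc points lie in the open forward cone \<open>2 |v| < h\<close>, which is
  convex, and every vector of this cone is a positive multiple of a lift.\<close>

lemma hyperboloid_point:
  assumes "cmod p < 1" "cmod q < 1" "a \<ge> 0" "b \<ge> 0" "a + b > 0"
  obtains w c where "cmod w < 1" "c > 0" "c *\<^sub>R w = a *\<^sub>R p + b *\<^sub>R q"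
    "c * (1 + (cmod w)\<^sup>2) = a * (1 + (cmod p)\<^sup>2) + b * (1 + (cmod q)\<^sup>2)"
proof -
  define v h where "v = a *\<^sub>R p + b *\<^sub>R q" and "h = a * (1 + (cmod p)\<^sup>2) + b * (1 + (cmod q)\<^sup>2)"
  have pos: "1 + (cmod z)\<^sup>2 - 2 * cmod z > 0" if "cmod z < 1" for z
  proof -
    have "(1 - cmod z)\<^sup>2 > 0" using that by simp
    then show ?thesis by (simp add: power2_eq_square algebra_simps)
  qed
  have "a * (1 + (cmod p)\<^sup>2 - 2 * cmod p) + b * (1 + (cmod q)\<^sup>2 - 2 * cmod q) > 0"
  proof (cases "a > 0")
    case True
    then show ?thesis using pos[OF assms(1)] pos[OF assms(2)] assms
      by (intro add_pos_nonneg mult_pos_pos mult_nonneg_nonneg) auto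
  next
    case False
    then show ?thesis using pos[OF assms(1)] pos[OF assms(2)] assms
      by (intro add_nonneg_pos mult_pos_pos mult_nonneg_nonneg) auto
  qed
  moreover have "cmod v \<le> a * cmod p + b * cmod q"
    unfolding v_def using norm_triangle_ineq[of "a *\<^sub>R p" "b *\<^sub>R q"] assms by simp
  ultimately have vh: "2 * cmod v < h" by (simp add: h_def algebra_simps)
  have "(2 * cmod v)\<^sup>2 \<le> h\<^sup>2" using vh by (intro power_mono) auto
  then have s: "(sqrt (h\<^sup>2 - 4 * (cmod v)\<^sup>2))\<^sup>2 = h\<^sup>2 - 4 * (cmod v)\<^sup>2"
    by (simp add: power_mult_distrib)
  \<comment> \<open>For \<open>w = v / c\<close> the equation \<open>c (1 + |w|^2) = h\<close> reads
    \<open>c^2 - h c + |v|^2 = 0\<close>. The larger root is the one that exceeds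
    \<open>|v|\<close>, so that \<open>w\<close> is in the disc.\<close>
  define c where "c = (h + sqrt (h\<^sup>2 - 4 * (cmod v)\<^sup>2)) / 2"
  have ch: "c \<ge> h / 2" unfolding c_def using \<open>(2 * cmod v)\<^sup>2 \<le> h\<^sup>2\<close> by (simp add: power_mult_distrib)
  then have c: "c > 0" "cmod v < c" using vh norm_ge_zero[of v] by linarith+
  have "c\<^sup>2 + (cmod v)\<^sup>2 = h * c"
    using s by (simp add: c_def power2_eq_square field_simps)
  then have "c * (1 + (cmod v / c)\<^sup>2) = h"
    using c by (simp add: power2_eq_square field_simps)
  moreover have w: "cmod (v /\<^sub>R c) = cmod v / c"
    using c by (simp add: divide_inverse_commute)
  moreover have "cmod v / c < 1" using c by simp
  moreover have "c *\<^sub>R (v /\<^sub>R c) = v" using c by simp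
  ultimately show ?thesis
    using c by (intro that[of "v /\<^sub>R c" c]) (simp_all only: v_def h_def)
qed

text \<open>A ray determines its point of the disc: besides \<open>b = 1\<close> the quadratic
  equation has only the root \<open>b = 1 / |u|^2\<close>, which belongs to the inverse of
  \<open>u\<close> in the unit circle, outside the disc.\<close>

lemma hyperboloid_unique:
  assumes "cmod z < 1" "cmod u < 1" "z = b *\<^sub>R u" "1 + (cmod z)\<^sup>2 = b * (1 + (cmod u)\<^sup>2)"
  shows "z = u"
proof -
  define a where "a = (cmod u)\<^sup>2"
  have a: "0 \<le> a" "a < 1" using assms(2) by (simp_all add: a_def abs_square_less_1)
  have z2: "(cmod z)\<^sup>2 = b\<^sup>2 * a" using assms(3) by (simp add: a_def power_mult_distrib)
  have "(1 - b) * (1 - b * a) = 0"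
    using assms(4) unfolding z2 a_def[symmetric] by (simp add: algebra_simps power2_eq_square)
  moreover have "b * a \<noteq> 1"
  proof
    assume 1: "b * a = 1"
    then have "b\<^sup>2 * a = b" by (simp add: power2_eq_square)
    moreover have "(cmod z)\<^sup>2 < 1" using assms(1) by (simp add: abs_square_less_1)
    ultimately have "b < 1" using z2 by linarith
    moreover have "b * a \<le> 0" if "b < 0" using mult_nonpos_nonneg[of b a] that a by simp
    moreover have "b * a \<le> b" if "b \<ge> 0" using mult_left_mono[of a 1 b] that a by simp
    ultimately show False using 1 by linarith
  qed
  ultimately show ?thesis using assms(3) by simp
qed

section \<open>The triangle in barycentric coordinates\<close>

locale hyp_triangle =
  fixes A :: "3 \<Rightarrow> complex"
  assumes nondeg: "nondegenerate_triangle A"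
begin

text \<open>Coordinates of the lift \<open>(z, 1 + |z|^2)\<close> in the basis formed by the lifts
  of the vertices, by Cramer's rule. They are not normalized to sum 1. The denominator makes their
  signs independent of the orientation of the triangle.\<close>

definition bary :: "3 \<Rightarrow> complex \<Rightarrow> real" where
  "bary i z = geo_det (A (i + 1)) (A (i + 2)) z / geo_det (A 0) (A 1) (A 2)"

lemma A_ball: "cmod (A i) < 1"
proof -
  have "A i \<in> ball 0 1" using nondeg unfolding nondegenerate_triangle_def by blast
  then show ?thesis by simp
qed

lemma A_inj: "A i = A j \<longleftrightarrow> i = j"
  using nondeg by (auto simp: nondegenerate_triangle_def inj_def)

lemma mob_A_nonzero: "i \<noteq> j \<Longrightarrow> su 1 (- A i) (A j) \<noteq> 0"
  using A_inj[of i j] su_denom[of "- A i" 1 "A j"] A_ball[of i] A_ball[of j] by (simp add: su_def)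

lemma cross2_eq_0D:
  assumes "cross2 m w = 0" "m \<noteq> 0"
  shows "\<exists>t::real. w = t *\<^sub>R m"
proof -
  have "w / m = cnj m * w / (m * cnj m)" using assms(2) by simp
  also have "\<dots> = cnj m * w / of_real ((cmod m)\<^sup>2)" by (simp only: complex_norm_square)
  finally have "Im (w / m) = 0"
    using assms by (simp only: Im_divide_of_real) (simp add: cross2_def)
  then have "w / m = of_real (Re (w / m))" by (simp add: complex_eq_iff)
  then have "w = Re (w / m) *\<^sub>R m"
    using assms(2) by (metis nonzero_eq_divide_eq scaleR_conv_of_real)
  then show ?thesis ..
qed

lemma det_nonzero: "geo_det (A 0) (A 1) (A 2) \<noteq> 0"
proof
  assume "geo_det (A 0) (A 1) (A 2) = 0"
  then have "geo_det (A 1) (A 2) (A 0) = 0" using geo_det_rotate by metis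
  then have "cross2 (su 1 (- A 1) (A 2)) (su 1 (- A 1) (A 0)) = 0"
    by (simp add: mob_cross A_ball)
  then obtain t :: real where "su 1 (- A 1) (A 0) = t *\<^sub>R su 1 (- A 1) (A 2)"
    using cross2_eq_0D mob_A_nonzero[of 1 2] by auto
  then have "A 0 \<in> hyp_line (A 1) (A 2)"
    using A_ball by (auto simp: hyp_line_def Moebius_eq_su)
  then show False using nondeg by (simp add: nondegenerate_triangle_def)
qed

lemma det_rotate: "geo_det (A i) (A (i + 1)) (A (i + 2)) = geo_det (A 0) (A 1) (A 2)"
proof -
  define P where "P i = geo_det (A i) (A (i + 1)) (A (i + 2))" for i
  have step: "P j = P (j + 1)" for j
    unfolding P_def three_add by (rule geo_det_rotate[symmetric])
  have "P i = P (i + 1)" "P i = P (i + 2)"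
    using step[of i] step[of "i + 1"] by simp_all
  moreover have "0 = i \<or> 0 = i + 1 \<or> 0 = i + 2" by (rule three_cases)
  ultimately have "P 0 = P i" by (elim disjE) simp_all
  then show ?thesis by (simp add: P_def)
qed

lemma bary_vertex [simp]: "bary i (A i) = 1" "bary i (A (i + 1)) = 0" "bary i (A (i + 2)) = 0"
  using det_nonzero det_rotate[of i] geo_det_rotate by (auto simp: bary_def)

lemma bary_other_vertex [simp]: "bary (i + 1) (A i) = 0" "bary (i + 2) (A i) = 0"
  using bary_vertex(3)[of "i + 1"] bary_vertex(2)[of "i + 2"] by simp_all

lemma bary_Cramer:
  "z = bary i z *\<^sub>R A i + bary (i + 1) z *\<^sub>R A (i + 1) + bary (i + 2) z *\<^sub>R A (i + 2)"
  "1 + (cmod z)\<^sup>2 = bary i z * (1 + (cmod (A i))\<^sup>2) + bary (i + 1) z * (1 + (cmod (A (i + 1)))\<^sup>2)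
     + bary (i + 2) z * (1 + (cmod (A (i + 2)))\<^sup>2)"
proof -
  define D where "D = geo_det (A 0) (A 1) (A 2)"
  have D: "D \<noteq> 0" using det_nonzero by (simp add: D_def)
  have n: "geo_det (A (i + 1)) (A (i + 2)) z = D * bary i z"
    "geo_det (A (i + 2)) (A i) z = D * bary (i + 1) z"
    "geo_det (A i) (A (i + 1)) z = D * bary (i + 2) z"
    using D by (simp_all add: bary_def D_def)
  note C = geo_det_Cramer[of "A i" "A (i + 1)" "A (i + 2)" z, unfolded det_rotate n, folded D_def]
  have "D *\<^sub>R z = D *\<^sub>R (bary i z *\<^sub>R A i + bary (i + 1) z *\<^sub>R A (i + 1) + bary (i + 2) z *\<^sub>R A (i + 2))"
    using C(1) by (simp add: scaleR_add_right)
  then show "z = bary i z *\<^sub>R A i + bary (i + 1) z *\<^sub>R A (i + 1) + bary (i + 2) z *\<^sub>R A (i + 2)"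
    using D by simp
  have "D * (1 + (cmod z)\<^sup>2) = D * (bary i z * (1 + (cmod (A i))\<^sup>2) + bary (i + 1) z * (1 + (cmod (A (i + 1)))\<^sup>2)
     + bary (i + 2) z * (1 + (cmod (A (i + 2)))\<^sup>2))"
    using C(2) by (simp add: algebra_simps)
  then show "1 + (cmod z)\<^sup>2 = bary i z * (1 + (cmod (A i))\<^sup>2) + bary (i + 1) z * (1 + (cmod (A (i + 1)))\<^sup>2)
     + bary (i + 2) z * (1 + (cmod (A (i + 2)))\<^sup>2)"
    using D mult_left_cancel by blast
qed

lemma bary_linear:
  assumes "z = a *\<^sub>R u + b *\<^sub>R v" "1 + (cmod z)\<^sup>2 = a * (1 + (cmod u)\<^sup>2) + b * (1 + (cmod v)\<^sup>2)"
  shows "bary i z = a * bary i u + b * bary i v"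
  unfolding bary_def geo_det_linear[OF assms] by (simp add: add_divide_distrib)

lemma side_iff:
  "z \<in> side A i \<longleftrightarrow> cmod z < 1 \<and> bary i z = 0 \<and> bary (i + 1) z \<ge> 0 \<and> bary (i + 2) z \<ge> 0"
proof
  assume "z \<in> side A i"
  then obtain a b where ab: "cmod z < 1" "a \<ge> 0" "b \<ge> 0" "z = a *\<^sub>R A (i + 1) + b *\<^sub>R A (i + 2)"
      "1 + (cmod z)\<^sup>2 = a * (1 + (cmod (A (i + 1)))\<^sup>2) + b * (1 + (cmod (A (i + 2)))\<^sup>2)"
    by (auto simp: side_def hyp_segment_iff A_ball)
  have "bary j z = a * bary j (A (i + 1)) + b * bary j (A (i + 2))" for j
    by (rule bary_linear[OF ab(4,5)])
  then show "cmod z < 1 \<and> bary i z = 0 \<and> bary (i + 1) z \<ge> 0 \<and> bary (i + 2) z \<ge> 0"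
    using ab bary_other_vertex[of "i + 1"] bary_other_vertex[of "i + 2"] by simp
next
  assume *: "cmod z < 1 \<and> bary i z = 0 \<and> bary (i + 1) z \<ge> 0 \<and> bary (i + 2) z \<ge> 0"
  show "z \<in> side A i"
    unfolding side_def hyp_segment_iff[OF A_ball A_ball]
  proof (intro conjI)
    show "\<exists>a b. 0 \<le> a \<and> 0 \<le> b \<and> z = a *\<^sub>R A (i + 1) + b *\<^sub>R A (i + 2) \<and>
        1 + (cmod z)\<^sup>2 = a * (1 + (cmod (A (i + 1)))\<^sup>2) + b * (1 + (cmod (A (i + 2)))\<^sup>2)"
      by (rule exI[of _ "bary (i + 1) z"], rule exI[of _ "bary (i + 2) z"])
         (use bary_Cramer[of z i] * in simp)
  qed (use * in simp)
qed

lemma triangle_iff: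
  "z \<in> triangle A \<longleftrightarrow> cmod z < 1 \<and> (\<forall>i. bary i z \<ge> 0)"
proof
  assume "z \<in> triangle A"
  then obtain w where w: "w \<in> side A 0" "z \<in> hyp_segment (A 0) w" by (auto simp: triangle_def)
  then have w1: "cmod w < 1" "\<forall>i. bary i w \<ge> 0"
    using side_iff[of w 0] by (auto simp: all_three[of _ 0])
  with w(2) obtain a b where ab: "cmod z < 1" "a \<ge> 0" "b \<ge> 0" "z = a *\<^sub>R A 0 + b *\<^sub>R w"
      "1 + (cmod z)\<^sup>2 = a * (1 + (cmod (A 0))\<^sup>2) + b * (1 + (cmod w)\<^sup>2)"
    by (auto simp: hyp_segment_iff A_ball)
  have "bary j z = a * bary j (A 0) + b * bary j w" for j
    by (rule bary_linear[OF ab(4,5)])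
  moreover have "bary j (A 0) \<ge> 0" for j
    using three_cases[of j 0] bary_vertex(1)[of 0] bary_other_vertex[of 0] by auto
  ultimately show "cmod z < 1 \<and> (\<forall>i. bary i z \<ge> 0)"
    using ab w1 by simp
next
  assume z: "cmod z < 1 \<and> (\<forall>i. bary i z \<ge> 0)"
  note C = bary_Cramer[of z 0, simplified]
  show "z \<in> triangle A"
  proof (cases "bary 1 z + bary 2 z > 0")
    case True
    \<comment> \<open>The end point on the opposite side of the geodesic from \<open>A 0\<close>
      through \<open>z\<close>: drop the coordinate at \<open>A 0\<close> and rescale the rest to a
      lift.\<close>
    obtain w c where w: "cmod w < 1" "c > 0" "c *\<^sub>R w = bary 1 z *\<^sub>R A 1 + bary 2 z *\<^sub>R A 2"
      "c * (1 + (cmod w)\<^sup>2) = bary 1 z * (1 + (cmod (A 1))\<^sup>2) + bary 2 z * (1 + (cmod (A 2))\<^sup>2)"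
      using hyperboloid_point[OF A_ball A_ball, of "bary 1 z" "bary 2 z" 1 2] z True by auto
    have "inverse c *\<^sub>R (c *\<^sub>R w) = inverse c *\<^sub>R (bary 1 z *\<^sub>R A 1 + bary 2 z *\<^sub>R A 2)"
      unfolding w(3) ..
    then have "w = (bary 1 z / c) *\<^sub>R A 1 + (bary 2 z / c) *\<^sub>R A 2"
      using w(2) by (simp add: scaleR_add_right divide_inverse_commute)
    moreover have "1 + (cmod w)\<^sup>2 = (bary 1 z / c) * (1 + (cmod (A 1))\<^sup>2) + (bary 2 z / c) * (1 + (cmod (A 2))\<^sup>2)"
      using w(2,4) by (simp add: field_simps)
    ultimately have "\<exists>a b. a \<ge> 0 \<and> b \<ge> 0 \<and> w = a *\<^sub>R A 1 + b *\<^sub>R A 2 \<and>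
        1 + (cmod w)\<^sup>2 = a * (1 + (cmod (A 1))\<^sup>2) + b * (1 + (cmod (A 2))\<^sup>2)"
      using w(2) z by (intro exI[of _ "bary 1 z / c"] exI[of _ "bary 2 z / c"] conjI) simp_all
    then have "w \<in> side A 0"
      using w(1) by (simp add: side_def hyp_segment_iff A_ball)
    moreover have "z \<in> hyp_segment (A 0) w"
      unfolding hyp_segment_iff[OF A_ball w(1)]
    proof (intro conjI)
      show "\<exists>a b. 0 \<le> a \<and> 0 \<le> b \<and> z = a *\<^sub>R A 0 + b *\<^sub>R w \<and>
        1 + (cmod z)\<^sup>2 = a * (1 + (cmod (A 0))\<^sup>2) + b * (1 + (cmod w)\<^sup>2)"
        by (rule exI[of _ "bary 0 z"], rule exI[of _ c])
           (use z w C in \<open>simp add: add.assoc\<close>)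
    qed (use z in simp)
    ultimately show ?thesis by (auto simp: triangle_def)
  next
    \<comment> \<open>Only the coordinate at \<open>A 0\<close> survives, so \<open>z\<close> is at
      \<open>A 0\<close> and any end point on the opposite side will do; \<open>A 1\<close> is
      taken.\<close>
    case False
    moreover have "bary 1 z \<ge> 0" "bary 2 z \<ge> 0" using z by auto
    ultimately have "bary 1 z = 0" "bary 2 z = 0" by linarith+
    then have "z \<in> hyp_segment (A 0) (A 1)"
      unfolding hyp_segment_iff[OF A_ball A_ball]
    proof (intro conjI)
      show "\<exists>a b. 0 \<le> a \<and> 0 \<le> b \<and> z = a *\<^sub>R A 0 + b *\<^sub>R A 1 \<and>
        1 + (cmod z)\<^sup>2 = a * (1 + (cmod (A 0))\<^sup>2) + b * (1 + (cmod (A 1))\<^sup>2)"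
        by (rule exI[of _ "bary 0 z"], rule exI[of _ 0])
           (use z C \<open>bary 1 z = 0\<close> \<open>bary 2 z = 0\<close> in simp)
    qed (use z in simp)
    moreover have "A 1 \<in> side A 0"
      using side_iff[of "A 1" 0] A_ball bary_other_vertex[of 1] bary_vertex(1)[of 1] bary_vertex(2)[of 0] by simp
    ultimately show ?thesis by (auto simp: triangle_def)
  qed
qed

lemma side_subset: "side A i \<subseteq> triangle A"
  by (auto simp: triangle_iff side_iff all_three[where i = i])

lemma on_sides_iff: "z \<in> (\<Union>i. side A i) \<longleftrightarrow> z \<in> triangle A \<and> (\<exists>i. bary i z = 0)"
proof
  assume "z \<in> (\<Union>i. side A i)"
  then show "z \<in> triangle A \<and> (\<exists>i. bary i z = 0)"
    using side_subset side_iff by blast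
next
  assume "z \<in> triangle A \<and> (\<exists>i. bary i z = 0)"
  then obtain i where "z \<in> triangle A" "bary i z = 0" by blast
  then have "z \<in> side A i" by (simp add: triangle_iff side_iff)
  then show "z \<in> (\<Union>i. side A i)" by blast
qed

lemma vertex_in_triangle: "A i \<in> triangle A"
  using all_three[of "\<lambda>j. bary j (A i) \<ge> 0" i] by (simp add: triangle_iff A_ball)

lemma vertex_unique:
  assumes "cmod z < 1" "bary (i + 1) z = 0" "bary (i + 2) z = 0"
  shows "z = A i"
  using hyperboloid_unique[OF assms(1) A_ball, of "bary i z" i] bary_Cramer[of z i] assms(2,3) by simp

lemma continuous_on_bary: "continuous_on S (bary i)"
proof -
  have "continuous_on S (geo_det p q)" for p q
    unfolding geo_det_def[abs_def] cross2_def by (intro continuous_intros)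
  then show ?thesis
    unfolding bary_def by (intro continuous_on_divide continuous_on_const) (auto simp: det_nonzero)
qed

lemma open_bary_pos: "open {z. bary i z > 0}" "open {z. bary i z < 0}"
  by (intro open_Collect_less continuous_on_bary continuous_intros)+

section \<open>Reflections in the sides\<close>

definition refl :: "3 \<Rightarrow> complex \<Rightarrow> complex" where
  "refl i = hyp_reflection (A (i + 1)) (A (i + 2))"

lemma refl_eq: "refl i z = su 1 (A (i + 1))
   ((sgn (su 1 (- A (i + 1)) (A (i + 2))))\<^sup>2 * cnj (su 1 (- A (i + 1)) z))"
  by (simp add: refl_def hyp_reflection_def Moebius_eq_su)

lemma sgn_power2_mult_cnj: "m \<noteq> 0 \<Longrightarrow> (sgn m)\<^sup>2 * cnj m = (m :: complex)"
proof -
  assume "m \<noteq> 0"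
  then have c: "cmod m \<noteq> 0" by simp
  have "(sgn m)\<^sup>2 * cnj m = m * (m * cnj m) / (of_real (cmod m))\<^sup>2"
    by (simp add: sgn_eq power2_eq_square)
  also have "m * cnj m = (of_real (cmod m))\<^sup>2"
    by (simp add: complex_norm_square[symmetric] flip: of_real_power)
  finally show ?thesis using c by simp
qed

lemma mob_refl_aux:
  assumes "cmod z < 1"
  shows "cmod ((sgn (su 1 (- A (i + 1)) (A (i + 2))))\<^sup>2 * cnj (su 1 (- A (i + 1)) z)) < 1"
  using su_in_ball[of "- A (i + 1)" 1 z] assms A_ball mob_A_nonzero[of "i + 1" "i + 2"]
  by (simp add: norm_mult norm_power norm_sgn)

lemma mob_refl:
  assumes "cmod z < 1"
  shows "su 1 (- A (i + 1)) (refl i z) =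
    (sgn (su 1 (- A (i + 1)) (A (i + 2))))\<^sup>2 * cnj (su 1 (- A (i + 1)) z)"
  unfolding refl_eq by (rule mob_inverse(2)[OF A_ball mob_refl_aux[OF assms]])

lemma refl_ball: "cmod z < 1 \<Longrightarrow> cmod (refl i z) < 1"
  unfolding refl_eq by (rule su_in_ball[OF _ mob_refl_aux]) (simp_all add: A_ball)

lemma refl_refl:
  assumes "cmod z < 1"
  shows "refl i (refl i z) = z"
proof -
  define s where "s = sgn (su 1 (- A (i + 1)) (A (i + 2)))"
  have "cmod s = 1" using mob_A_nonzero[of "i + 1" "i + 2"] by (simp add: s_def norm_sgn)
  then have "s * cnj s = 1" using complex_norm_square[of s] by simp
  then have "s\<^sup>2 * (cnj s)\<^sup>2 = 1" by (metis power_mult_distrib power_one)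
  then show ?thesis
    unfolding refl_eq[of i "refl i z"] mob_refl[OF assms] s_def[symmetric]
    by (simp add: mob_inverse A_ball assms flip: mult.assoc)
qed

lemma refl_su: obtains a b where "cmod b < cmod a" "\<And>z. cmod z < 1 \<Longrightarrow> refl i z = su a b (cnj z)"
proof -
  have "cmod (sgn (su 1 (- A (i + 1)) (A (i + 2)))) = 1"
    using mob_A_nonzero[of "i + 1" "i + 2"] by (simp add: norm_sgn)
  from reflection_su[OF this A_ball[of "i + 1"]] show ?thesis
    using that unfolding refl_eq by blast
qed

lemma continuous_on_refl: "continuous_on (ball 0 1) (refl i)"
proof -
  obtain a b where ab: "cmod b < cmod a" "\<And>z. cmod z < 1 \<Longrightarrow> refl i z = su a b (cnj z)"
    using refl_su by blast
  have "continuous_on (ball 0 1) (\<lambda>z. su a b (cnj z))"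
    unfolding su_def using su_denom[OF ab(1), of "cnj z" for z]
    by (intro continuous_intros) (auto simp: less_imp_le)
  then show ?thesis by (rule continuous_on_eq) (simp add: ab)
qed

lemma bary_eq_cross:
  assumes "cmod z < 1"
  obtains k where "k > 0" "cross2 (su 1 (- A (i + 1)) (A (i + 2))) (su 1 (- A (i + 1)) z) =
     k * (bary i z * geo_det (A 0) (A 1) (A 2))"
proof -
  have "geo_det (A (i + 1)) (A (i + 2)) z = bary i z * geo_det (A 0) (A 1) (A 2)"
    using det_nonzero by (simp add: bary_def)
  then show ?thesis
    using that[OF mob_cross_factor[OF A_ball[of "i + 1"] A_ball[of "i + 2"] assms]]
      mob_cross[OF A_ball[of "i + 1"] A_ball[of "i + 2"] assms] by (simp add: mult.commute)
qed

text \<open>With \<open>A (i + 1)\<close> moved to 0 the reflection is one in the diameter through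
  \<open>m\<close>, and it reverses the cross product with \<open>m\<close>. The positive factors of
  \<open>bary_eq_cross\<close> at \<open>z\<close> and at its mirror image differ, hence the
  unspecified \<open>k\<close>.\<close>

lemma bary_refl:
  assumes "cmod z < 1"
  obtains k where "k > 0" "bary i (refl i z) = - k * bary i z"
proof -
  define m where "m = su 1 (- A (i + 1)) (A (i + 2))"
  have m: "m \<noteq> 0" using mob_A_nonzero by (simp add: m_def)
  have "cross2 m ((sgn m)\<^sup>2 * cnj w) = - cross2 m w" for w
  proof -
    have "cnj m * ((sgn m)\<^sup>2 * cnj w) = cnj (cnj m * w)"
      using sgn_power2_mult_cnj[OF m] by (simp add: mult.commute mult.left_commute)
    then show ?thesis unfolding cross2_def by (metis cnj.simps(2))
  qed
  then have c: "cross2 m (su 1 (- A (i + 1)) (refl i z)) = - cross2 m (su 1 (- A (i + 1)) z)"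
    unfolding mob_refl[OF assms] m_def[symmetric] .
  obtain k l where kl: "k > 0" "l > 0"
    "cross2 m (su 1 (- A (i + 1)) z) = k * (bary i z * geo_det (A 0) (A 1) (A 2))"
    "cross2 m (su 1 (- A (i + 1)) (refl i z)) = l * (bary i (refl i z) * geo_det (A 0) (A 1) (A 2))"
    using bary_eq_cross[OF assms, of i] bary_eq_cross[OF refl_ball[OF assms], of i i]
    unfolding m_def by metis
  have "geo_det (A 0) (A 1) (A 2) * (l * bary i (refl i z) + k * bary i z) = 0"
    using c kl(3,4) by (simp add: algebra_simps)
  then have "l * bary i (refl i z) = - (k * bary i z)"
    using det_nonzero by (simp add: add_eq_0_iff2)
  then have "bary i (refl i z) = - (k / l) * bary i z"
    using kl(1,2) by (simp add: field_simps)
  then show ?thesis using kl by (intro that[of "k / l"]) auto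
qed

lemma bary_refl_iff:
  assumes "cmod z < 1"
  shows "bary i (refl i z) > 0 \<longleftrightarrow> bary i z < 0" "bary i (refl i z) < 0 \<longleftrightarrow> bary i z > 0"
    "bary i (refl i z) = 0 \<longleftrightarrow> bary i z = 0"
proof -
  obtain k where "k > 0" "bary i (refl i z) = - k * bary i z" using bary_refl[OF assms] by blast
  then show "bary i (refl i z) > 0 \<longleftrightarrow> bary i z < 0" "bary i (refl i z) < 0 \<longleftrightarrow> bary i z > 0"
    "bary i (refl i z) = 0 \<longleftrightarrow> bary i z = 0"
    by (auto simp: mult_less_0_iff zero_less_mult_iff)
qed

lemma refl_fixed:
  assumes "cmod z < 1" "bary i z = 0"
  shows "refl i z = z"
proof -
  define m where "m = su 1 (- A (i + 1)) (A (i + 2))"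
  have m: "m \<noteq> 0" using mob_A_nonzero by (simp add: m_def)
  have "cross2 m (su 1 (- A (i + 1)) z) = 0"
    using bary_eq_cross[OF assms(1), of i] assms(2) unfolding m_def by (metis mult_zero_left mult_zero_right)
  then obtain t :: real where "su 1 (- A (i + 1)) z = t *\<^sub>R m"
    using cross2_eq_0D m by blast
  then have "su 1 (- A (i + 1)) (refl i z) = su 1 (- A (i + 1)) z"
    unfolding mob_refl[OF assms(1)] m_def[symmetric] using sgn_power2_mult_cnj[OF m] by simp
  then show ?thesis
    using mob_inverse(1)[OF A_ball[of "i + 1"]] refl_ball assms(1) by metis
qed

end

section \<open>The topology of an atlas\<close>

text \<open>Injectivity of the charts enters because images have to commute with
  intersections.\<close>

lemma istopology_manifold:
  fixes \<A> :: "('p, 'e::euclidean_space) chart set"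
  assumes "\<And>ch. ch \<in> \<A> \<Longrightarrow> inj_on (snd ch) (fst ch)"
  shows "istopology (\<lambda>U. U \<subseteq> carrier \<A> \<and> (\<forall>ch\<in>\<A>. open (snd ch ` (U \<inter> fst ch))))"
  unfolding istopology_def
proof (intro conjI allI impI)
  fix S T
  assume "S \<subseteq> carrier \<A> \<and> (\<forall>ch\<in>\<A>. open (snd ch ` (S \<inter> fst ch)))"
     and "T \<subseteq> carrier \<A> \<and> (\<forall>ch\<in>\<A>. open (snd ch ` (T \<inter> fst ch)))"
  moreover have "snd ch ` (S \<inter> T \<inter> fst ch) = snd ch ` (S \<inter> fst ch) \<inter> snd ch ` (T \<inter> fst ch)"
    if "ch \<in> \<A>" for ch
    using inj_on_image_Int[OF assms[OF that], of "S \<inter> fst ch" "T \<inter> fst ch"]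
    by (simp add: Int_ac)
  ultimately show "S \<inter> T \<subseteq> carrier \<A>" "\<forall>ch\<in>\<A>. open (snd ch ` (S \<inter> T \<inter> fst ch))"
    by auto
next
  fix K
  assume K: "\<forall>S\<in>K. S \<subseteq> carrier \<A> \<and> (\<forall>ch\<in>\<A>. open (snd ch ` (S \<inter> fst ch)))"
  then show "\<Union>K \<subseteq> carrier \<A>" by blast
  have "snd ch ` (\<Union>K \<inter> fst ch) = (\<Union>S\<in>K. snd ch ` (S \<inter> fst ch))" for ch :: "('p, 'e) chart"
    by blast
  then show "\<forall>ch\<in>\<A>. open (snd ch ` (\<Union>K \<inter> fst ch))"
    using K by (auto simp del: image_Union UN_simps intro!: open_UN)
qed

lemma openin_manifold_topology:
  fixes \<A> :: "('p, 'e::euclidean_space) chart set"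
  assumes "\<And>ch. ch \<in> \<A> \<Longrightarrow> inj_on (snd ch) (fst ch)"
  shows "openin (manifold_topology \<A>) U \<longleftrightarrow>
     U \<subseteq> carrier \<A> \<and> (\<forall>ch\<in>\<A>. open (snd ch ` (U \<inter> fst ch)))"
  unfolding manifold_topology_def by (simp add: topology_inverse'[OF istopology_manifold[OF assms]])

context hyp_triangle
begin

section \<open>The charts of the double\<close>

abbreviation dom :: "3 \<Rightarrow> dpoint set" where "dom i \<equiv> fst (double_chart A i)"
abbreviation crd :: "3 \<Rightarrow> dpoint \<Rightarrow> complex" where "crd i \<equiv> snd (double_chart A i)"

text \<open>In the chart \<open>i\<close> this is the unfolding of the copy \<open>b\<close>
  (\<open>crd_glue\<close>) and, being an involution on the disc, also the folding back
  (\<open>rho_rho\<close>).\<close>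

definition rho :: "3 \<Rightarrow> bool \<Rightarrow> complex \<Rightarrow> complex" where
  "rho i b z = (if b then refl i z else z)"

definition region :: "3 \<Rightarrow> complex set" where
  "region i = {z. cmod z < 1 \<and> bary i z \<ge> 0 \<and> bary (i + 1) z > 0 \<and> bary (i + 2) z > 0}"

lemma glue_eq: "glue A (z, b) = (if z \<in> (\<Union>i. side A i) then {(z, False), (z, True)} else {(z, b)})"
  unfolding glue_def prod.case ..

lemma fold_point_glue [simp]: "fold_point (glue A (z, b)) = z"
  by (auto simp: glue_eq fold_point_def)

lemma in_first_copy_glue [simp]:
  "in_first_copy (glue A (z, b)) \<longleftrightarrow> \<not> b \<or> z \<in> (\<Union>i. side A i)"
  unfolding glue_eq in_first_copy_def by (cases b) auto

lemma glue_eq_iff: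
  "glue A (z, b) = glue A (z', b') \<longleftrightarrow> z = z' \<and> (b = b' \<or> z \<in> (\<Union>i. side A i))"
proof
  assume *: "glue A (z, b) = glue A (z', b')"
  then have "z = z'" using fold_point_glue by metis
  then show "z = z' \<and> (b = b' \<or> z \<in> (\<Union>i. side A i))"
    using * unfolding glue_eq by (auto split: if_splits)
qed (auto simp: glue_eq)

lemma double_glueE:
  assumes "P \<in> double A"
  obtains z b where "z \<in> triangle A" "P = glue A (z, b)"
  using assms by (auto simp: double_def)

lemma glue_in_double [simp]: "z \<in> triangle A \<Longrightarrow> glue A (z, b) \<in> double A"
  by (auto simp: double_def)

lemma region_iff:
  "z \<in> region i \<longleftrightarrow> z \<in> triangle A \<and> z \<notin> side A (i + 1) \<and> z \<notin> side A (i + 2)"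
  by (auto simp: region_def triangle_iff side_iff all_three[where i = i])

lemma region_subset: "region i \<subseteq> triangle A"
  by (auto simp: region_iff)

lemma regionD: "z \<in> region i \<Longrightarrow> cmod z < 1"
  by (simp add: region_def)

lemma dom_iff: "P \<in> dom i \<longleftrightarrow> (\<exists>z b. z \<in> region i \<and> P = glue A (z, b))"
proof
  assume "P \<in> dom i"
  then have P: "P \<in> double A" "fold_point P \<notin> (\<Union>j\<in>UNIV - {i}. side A j)"
    by (simp_all add: double_chart_def)
  obtain z b where "z \<in> triangle A" "P = glue A (z, b)" using double_glueE[OF P(1)] .
  then show "\<exists>z b. z \<in> region i \<and> P = glue A (z, b)"
    using P(2) unfolding UN_three_minus by (auto simp: region_iff)
next
  assume "\<exists>z b. z \<in> region i \<and> P = glue A (z, b)"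
  then show "P \<in> dom i"
    unfolding double_chart_def fst_conv UN_three_minus by (auto simp: region_iff)
qed

lemma glue_in_dom [simp]: "glue A (z, b) \<in> dom i \<longleftrightarrow> z \<in> region i"
  by (auto simp: dom_iff glue_eq_iff)

lemma domE:
  assumes "P \<in> dom i"
  obtains z b where "z \<in> region i" "P = glue A (z, b)"
  using assms dom_iff by blast

lemma region_side: "z \<in> region i \<Longrightarrow> z \<in> (\<Union>j. side A j) \<longleftrightarrow> bary i z = 0"
  unfolding on_sides_iff region_def using region_subset three_cases[of _ i]
  by (auto simp: triangle_iff all_three[where i = i]) (metis less_irrefl)+

lemma rho_ball: "cmod z < 1 \<Longrightarrow> cmod (rho i b z) < 1"
  by (simp add: rho_def refl_ball)

lemma rho_rho: "cmod z < 1 \<Longrightarrow> rho i b (rho i b z) = z"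
  by (simp add: rho_def refl_refl)

lemma crd_glue: "z \<in> region i \<Longrightarrow> crd i (glue A (z, b)) = rho i b z"
  using region_side[of z i] refl_fixed[of z i]
  by (auto simp: double_chart_def rho_def refl_def region_def)

lemma crd_ball: "P \<in> dom i \<Longrightarrow> cmod (crd i P) < 1"
  by (erule domE) (simp add: crd_glue rho_ball regionD)

lemma inj_crd: "inj_on (crd i) (dom i)"
proof (rule inj_onI)
  fix P Q assume PQ: "P \<in> dom i" "Q \<in> dom i" "crd i P = crd i Q"
  obtain z b where z: "z \<in> region i" "P = glue A (z, b)" using PQ domE by metis
  obtain w c where w: "w \<in> region i" "Q = glue A (w, c)" using PQ domE by metis
  have eq: "rho i b z = rho i c w" using PQ z w crd_glue by metis
  note ball = regionD[OF z(1)] regionD[OF w(1)]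
  show "P = Q"
  proof (cases "b = c")
    case True
    have "rho i b (rho i b z) = rho i b (rho i b w)" using eq True by simp
    then have "z = w" by (simp only: rho_rho[OF ball(1)] rho_rho[OF ball(2)])
    then show ?thesis using True z w by simp
  next
    case False
    \<comment> \<open>Equal coordinates in different copies are mirror images with
      \<open>bary i >= 0\<close> for both preimages. Since the reflection reverses the sign of
      \<open>bary i\<close>, both lie on the side \<open>i\<close>, where the copies are
      glued.\<close>
    then have "refl i z = w \<or> refl i w = z" using eq by (auto simp: rho_def split: if_splits)
    then have "refl i z = w" using refl_refl[OF ball(2), of i] by auto
    moreover have "bary i z \<ge> 0" "bary i w \<ge> 0" using z w by (auto simp: region_def)
    ultimately have "bary i z = 0"
      using bary_refl_iff(2)[OF ball(1), of i] by auto
    then have "z = w" "z \<in> (\<Union>j. side A j)"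
      using \<open>refl i z = w\<close> refl_fixed ball region_side[OF z(1)] by auto
    then show ?thesis using z(2) w(2) by (auto simp: glue_eq_iff)
  qed
qed

lemma crd_image: "x \<in> crd i ` dom i \<longleftrightarrow> cmod x < 1 \<and> (x \<in> region i \<or> refl i x \<in> region i)"
proof
  assume "x \<in> crd i ` dom i"
  then obtain P where P: "P \<in> dom i" "x = crd i P" by blast
  from P(1) obtain z b where "z \<in> region i" "P = glue A (z, b)" by (rule domE)
  with P(2) have "z \<in> region i" "x = crd i (glue A (z, b))" by simp_all
  then have "x = rho i b z" "z \<in> region i" "cmod z < 1" by (simp_all add: crd_glue regionD)
  then show "cmod x < 1 \<and> (x \<in> region i \<or> refl i x \<in> region i)"
    using rho_ball[of z i b] refl_refl[of z i] by (auto simp: rho_def split: if_splits)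
next
  assume x: "cmod x < 1 \<and> (x \<in> region i \<or> refl i x \<in> region i)"
  then show "x \<in> crd i ` dom i"
  proof (elim conjE disjE)
    assume "x \<in> region i"
    then show ?thesis using crd_glue[of x i False] by (auto simp: rho_def intro!: rev_image_eqI[of "glue A (x, False)"])
  next
    assume "refl i x \<in> region i"
    then show ?thesis using crd_glue[of "refl i x" i True] x
      by (auto simp: rho_def refl_refl intro!: rev_image_eqI[of "glue A (refl i x, True)"])
  qed
qed

lemma open_preimage_refl: "open V \<Longrightarrow> open {x \<in> ball 0 1. refl i x \<in> V}"
  using continuous_open_preimage[OF continuous_on_refl open_ball, of V i]
  by (simp add: vimage_def Int_def)

text \<open>\<open>region i\<close> contains the open side \<open>i\<close>, so neither half of the
  image is open by itself. The piece \<open>E \<inter> E'\<close> covers the side: a point of it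
  lies in \<open>region i\<close> or has its mirror image there, according to the sign of
  \<open>bary i\<close>.\<close>

lemma open_crd_image: "open (crd i ` dom i)"
proof -
  define E where "E = {z \<in> ball 0 1. bary (i + 1) z > 0 \<and> bary (i + 2) z > 0}"
  define E' where "E' = {x \<in> ball 0 1. refl i x \<in> E}"
  have E: "open E"
  proof -
    have "E = ball 0 1 \<inter> {z. bary (i + 1) z > 0} \<inter> {z. bary (i + 2) z > 0}"
      by (auto simp: E_def)
    then show ?thesis using open_bary_pos by (auto intro!: open_Int)
  qed
  have E': "open E'" unfolding E'_def by (rule open_preimage_refl[OF E])
  have r: "x \<in> region i \<longleftrightarrow> x \<in> E \<and> bary i x \<ge> 0" for x
    by (auto simp: region_def E_def)
  have "crd i ` dom i = (E \<inter> {z. bary i z > 0}) \<union> (E' \<inter> {z. bary i z < 0}) \<union> (E \<inter> E')"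
  proof (rule set_eqI)
    fix x
    show "x \<in> crd i ` dom i \<longleftrightarrow> x \<in> (E \<inter> {z. bary i z > 0}) \<union> (E' \<inter> {z. bary i z < 0}) \<union> (E \<inter> E')"
    proof (cases "cmod x < 1")
      case True
      then show ?thesis
        using bary_refl_iff[OF True, of i] refl_fixed[OF True, of i] unfolding crd_image r
        by (cases "bary i x" "0::real" rule: linorder_cases) (auto simp: E'_def less_imp_le not_le)
    next
      case False
      then show ?thesis unfolding crd_image by (auto simp: E_def E'_def)
    qed
  qed
  then show ?thesis using E E' open_bary_pos by (simp add: open_Un open_Int)
qed

lemma overlapE:
  assumes "P \<in> dom i" "P \<in> dom j" "i \<noteq> j"
  obtains z b where "cmod z < 1" "\<And>k. bary k z > 0" "P = glue A (z, b)"
proof -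
  obtain z b where z: "z \<in> region i" "P = glue A (z, b)" using assms domE by metis
  have "z \<in> region j" using assms z by simp
  then have "bary i z > 0"
    using assms(3) three_cases[of i j] by (auto simp: region_def)
  then have "bary k z > 0" for k using z(1) three_cases[of k i] by (auto simp: region_def)
  then show ?thesis using z regionD that by blast
qed

lemma interior_region: "cmod z < 1 \<Longrightarrow> (\<And>k. bary k z > 0) \<Longrightarrow> z \<in> region i"
  by (simp add: region_def less_imp_le)

lemma rho_rho_su:
  obtains a b where "cmod b < cmod a" "\<And>x. cmod x < 1 \<Longrightarrow> rho j c (rho i c x) = su a b x"
proof (cases c)
  case True
  obtain a b where ab: "cmod b < cmod a" "\<And>z. cmod z < 1 \<Longrightarrow> refl i z = su a b (cnj z)"
    using refl_su by blast
  obtain a' b' where ab': "cmod b' < cmod a'" "\<And>z. cmod z < 1 \<Longrightarrow> refl j z = su a' b' (cnj z)"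
    using refl_su by blast
  have "rho j c (rho i c x) = su (a' * cnj a + b' * cnj (cnj b)) (a' * cnj b + b' * cnj (cnj a)) x"
    if "cmod x < 1" for x
  proof -
    have "rho j c (rho i c x) = su a' b' (cnj (su a b (cnj x)))"
      using True that refl_ball[OF that, of i] by (simp add: rho_def ab(2) ab'(2))
    also have "\<dots> = su a' b' (su (cnj a) (cnj b) x)" by (simp add: cnj_su)
    also have "\<dots> = su (a' * cnj a + b' * cnj (cnj b)) (a' * cnj b + b' * cnj (cnj a)) x"
      by (rule su_compose) (use ab that in simp_all)
    finally show ?thesis .
  qed
  moreover have "cmod (a' * cnj b + b' * cnj (cnj a)) < cmod (a' * cnj a + b' * cnj (cnj b))"
    by (rule su_compose_gap) (use ab ab' in simp_all)
  ultimately show ?thesis using that by blast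
next
  case False
  then show ?thesis by (intro that[of 0 1]) (auto simp: rho_def su_def)
qed

text \<open>The overlap of two different charts has a component in each copy of the triangle, with
  different isometries. One pair \<open>a\<close>, \<open>b\<close> therefore serves only near the
  given point.\<close>

lemma transition:
  assumes "P \<in> dom i" "P \<in> dom j"
  obtains a b where "cmod b < cmod a"
    "\<forall>\<^sub>F x in nhds (crd i P). \<exists>Q\<in>dom i \<inter> dom j. crd i Q = x \<and> crd j Q = su a b x"
proof (cases "i = j")
  case True
  have "\<forall>\<^sub>F x in nhds (crd i P). x \<in> crd i ` dom i"
    using open_crd_image assms by (intro eventually_nhds_in_open) auto
  then have "\<forall>\<^sub>F x in nhds (crd i P). \<exists>Q\<in>dom i \<inter> dom j. crd i Q = x \<and> crd j Q = su 1 0 x"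
    by eventually_elim (use True in \<open>auto simp: su_def\<close>)
  then show ?thesis using that[of 0 1] by simp
next
  case False
  obtain z c where z: "cmod z < 1" "\<And>k. bary k z > 0" "P = glue A (z, c)"
    using overlapE[OF assms False] by blast
  obtain a b where ab: "cmod b < cmod a" "\<And>x. cmod x < 1 \<Longrightarrow> rho j c (rho i c x) = su a b x"
    using rho_rho_su by blast
  define V where "V = {x. \<forall>k. bary k x > 0}"
  have "V = (\<Inter>k. {x. bary k x > 0})" by (auto simp: V_def)
  then have "open V" using open_bary_pos by auto
  define U where "U = {x \<in> ball 0 1. rho i c x \<in> V}"
  have "open U"
    using open_preimage_refl[OF \<open>open V\<close>, of i] \<open>open V\<close>
      open_Int[OF open_ball \<open>open V\<close>, of 0 1]
    by (cases c) (auto simp: U_def rho_def Int_def)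
  moreover have "crd i P \<in> U"
    using z interior_region[OF z(1,2)] by (simp add: crd_glue U_def V_def rho_rho rho_ball)
  ultimately have "\<forall>\<^sub>F x in nhds (crd i P). x \<in> U"
    by (intro eventually_nhds_in_open)
  then have "\<forall>\<^sub>F x in nhds (crd i P). \<exists>Q\<in>dom i \<inter> dom j. crd i Q = x \<and> crd j Q = su a b x"
  proof eventually_elim
    case (elim x)
    then have x: "cmod x < 1" "\<And>k. bary k (rho i c x) > 0" by (auto simp: U_def V_def)
    have "rho i c x \<in> region k" for k
      by (rule interior_region[OF rho_ball x(2)]) (rule x(1))
    then show ?case
      using x ab(2)
      by (intro bexI[of _ "glue A (rho i c x, c)"]) (auto simp: crd_glue rho_rho)
  qed
  then show ?thesis using ab(1) that by blast
qed

lemma inj_double_atlas: "ch \<in> double_atlas A \<Longrightarrow> inj_on (snd ch) (fst ch)"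
  using inj_crd by (auto simp: double_atlas_def)

lemma openin_double_manifold:
  "openin (manifold_topology (double_atlas A)) U \<longleftrightarrow>
     U \<subseteq> carrier (double_atlas A) \<and> (\<forall>i. open (crd i ` (U \<inter> dom i)))"
proof -
  have "(\<forall>ch\<in>double_atlas A. open (snd ch ` (U \<inter> fst ch))) \<longleftrightarrow> (\<forall>i. open (crd i ` (U \<inter> dom i)))"
    unfolding double_atlas_def by blast
  then show ?thesis
    using openin_manifold_topology[of "double_atlas A" U] inj_double_atlas by simp
qed

lemma carrier_double: "carrier (double_atlas A) = (\<Union>i. dom i)"
  by (auto simp: carrier_def double_atlas_def)

lemma dom_subset_double: "dom i \<subseteq> double A"
proof
  fix P assume "P \<in> dom i"
  then obtain z b where "z \<in> region i" "P = glue A (z, b)" by (rule domE)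
  then show "P \<in> double A" using glue_in_double region_iff by simp
qed

lemma cone_point_fold [simp]: "fold_point (cone_point A k) = A k"
  by (simp add: cone_point_def)

lemma dom_not_cone: "cone_point A k \<notin> dom i"
  using three_cases[of i k] bary_other_vertex[of k]
  by (auto simp: cone_point_def region_def)

lemma dom_cover:
  assumes "P \<in> double A" "P \<noteq> cone_point A k" "bary k (fold_point P) > 0"
  shows "P \<in> dom (k + 1) \<or> P \<in> dom (k + 2)"
proof -
  obtain z b where z: "z \<in> triangle A" "P = glue A (z, b)" using double_glueE[OF assms(1)] .
  have "z \<noteq> A k"
  proof
    assume "z = A k"
    moreover have "A k \<in> (\<Union>i. side A i)"
      unfolding on_sides_iff using vertex_in_triangle bary_other_vertex by blast
    ultimately show False using assms(2) z(2) by (auto simp: cone_point_def glue_eq_iff)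
  qed
  then have "\<not> (bary (k + 1) z = 0 \<and> bary (k + 2) z = 0)"
    using vertex_unique z(1) by (auto simp: triangle_iff)
  moreover have "cmod z < 1" "bary (k + 1) z \<ge> 0" "bary (k + 2) z \<ge> 0" "bary k z > 0"
    using z assms(3) by (auto simp: triangle_iff)
  ultimately show ?thesis
    using z(2) by (auto simp: region_def)
qed

section \<open>Continuity of curves in the double\<close>

text \<open>A set is open if its images in all charts are, so continuity of a single chart already
  uses the transition maps to the others.\<close>

lemma openin_chart_preimage:
  assumes "open V"
  shows "openin (manifold_topology (double_atlas A)) {P \<in> dom i. crd i P \<in> V}"
  unfolding openin_double_manifold
proof (intro conjI allI)
  show "{P \<in> dom i. crd i P \<in> V} \<subseteq> carrier (double_atlas A)"
    by (auto simp: carrier_double)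
  fix j
  have "\<exists>T. open T \<and> x \<in> T \<and> T \<subseteq> crd j ` ({P \<in> dom i. crd i P \<in> V} \<inter> dom j)"
    if x: "x \<in> crd j ` ({P \<in> dom i. crd i P \<in> V} \<inter> dom j)" for x
  proof -
    obtain P where P: "P \<in> dom i" "crd i P \<in> V" "P \<in> dom j" "x = crd j P" using x by auto
    obtain a b where ab: "cmod b < cmod a"
      "\<forall>\<^sub>F y in nhds (crd j P). \<exists>Q\<in>dom j \<inter> dom i. crd j Q = y \<and> crd i Q = su a b y"
      using transition[OF P(3,1)] by blast
    obtain Q where "Q \<in> dom j" "Q \<in> dom i" "crd j Q = crd j P" "crd i Q = su a b (crd j P)"
      using eventually_nhds_x_imp_x[OF ab(2)] by blast
    moreover from this have "Q = P" using inj_onD[OF inj_crd[of j], of Q P] P(3) by simp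
    ultimately have "su a b (crd j P) = crd i P" by simp
    moreover have "isCont (su a b) (crd j P)"
      using su_DERIV[OF ab(1) crd_ball[OF P(3)]] DERIV_isCont by blast
    ultimately have "\<forall>\<^sub>F y in nhds (crd j P). su a b y \<in> V"
      using P(2) assms by (metis isCont_def tendsto_at_iff_tendsto_nhds topological_tendstoD)
    with ab(2) have "\<forall>\<^sub>F y in nhds x. y \<in> crd j ` ({P \<in> dom i. crd i P \<in> V} \<inter> dom j)"
      unfolding P(4) by eventually_elim auto
    then show ?thesis unfolding eventually_nhds by blast
  qed
  then show "open (crd j ` ({P \<in> dom i. crd i P \<in> V} \<inter> dom j))"
    by (subst open_subopen) blast
qed

lemma topspace_manifold [simp]: "topspace (manifold_topology (double_atlas A)) = (\<Union>i. dom i)"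
proof
  show "topspace (manifold_topology (double_atlas A)) \<subseteq> (\<Union>i. dom i)"
    using openin_topspace[of "manifold_topology (double_atlas A)"]
    unfolding openin_double_manifold by (simp add: carrier_double)
  show "(\<Union>i. dom i) \<subseteq> topspace (manifold_topology (double_atlas A))"
    using openin_subset[OF openin_chart_preimage[OF open_UNIV]] by auto
qed

lemma curve_continuousI:
  assumes "\<And>t. t \<in> I \<Longrightarrow> \<exists>i. c t \<in> dom i \<and> (\<forall>\<^sub>F s in at t within I. c s \<in> dom i)
             \<and> ((\<lambda>s. crd i (c s)) \<longlongrightarrow> crd i (c t)) (at t within I)"
  shows "continuous_map (top_of_set I) (manifold_topology (double_atlas A)) c"
  unfolding continuous_map_def
proof (intro conjI allI impI)
  show "c \<in> topspace (top_of_set I) \<rightarrow> topspace (manifold_topology (double_atlas A))"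
    using assms by fastforce
  fix U assume U: "openin (manifold_topology (double_atlas A)) U"
  show "openin (top_of_set I) {t \<in> topspace (top_of_set I). c t \<in> U}"
  proof (subst openin_subopen, intro ballI)
    fix t assume "t \<in> {t \<in> topspace (top_of_set I). c t \<in> U}"
    then have t: "t \<in> I" "c t \<in> U" by auto
    obtain i where i: "c t \<in> dom i" "\<forall>\<^sub>F s in at t within I. c s \<in> dom i"
        "((\<lambda>s. crd i (c s)) \<longlongrightarrow> crd i (c t)) (at t within I)"
      using assms[OF t(1)] by blast
    have "open (crd i ` (U \<inter> dom i))"
      using U unfolding openin_double_manifold by blast
    then have "\<forall>\<^sub>F s in at t within I. crd i (c s) \<in> crd i ` (U \<inter> dom i)"
      using topological_tendstoD[OF i(3)] t i by blast
    with i(2) have "\<forall>\<^sub>F s in at t within I. c s \<in> U"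
      by eventually_elim (use inj_onD[OF inj_crd] in auto)
    then obtain T where T: "open T" "t \<in> T" "\<And>s. s \<in> T \<Longrightarrow> s \<noteq> t \<Longrightarrow> s \<in> I \<Longrightarrow> c s \<in> U"
      unfolding eventually_at_topological by blast
    then have "openin (top_of_set I) (I \<inter> T)" "t \<in> I \<inter> T"
      "I \<inter> T \<subseteq> {t \<in> topspace (top_of_set I). c t \<in> U}"
      using t by (auto simp: openin_open)
    then show "\<exists>T. openin (top_of_set I) T \<and> t \<in> T \<and> T \<subseteq> {t \<in> topspace (top_of_set I). c t \<in> U}"
      by blast
  qed
qed

lemma curve_continuousD:
  assumes "continuous_map (top_of_set I) (manifold_topology (double_atlas A)) c"
    and "open I" "t \<in> I" "c t \<in> dom i"
  shows "\<forall>\<^sub>F s in nhds t. s \<in> I \<and> c s \<in> dom i" "isCont (\<lambda>s. crd i (c s)) t"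
proof -
  have *: "\<forall>\<^sub>F s in nhds t. s \<in> I \<and> c s \<in> dom i \<and> crd i (c s) \<in> V"
    if "open V" "crd i (c t) \<in> V" for V
  proof -
    have "openin (top_of_set I) {s \<in> topspace (top_of_set I). c s \<in> {P \<in> dom i. crd i P \<in> V}}"
      using assms(1) openin_chart_preimage[OF that(1)] unfolding continuous_map_def by blast
    then have "open {s \<in> I. c s \<in> dom i \<and> crd i (c s) \<in> V}"
      using openin_open_trans[OF _ assms(2)] by simp
    then have "\<forall>\<^sub>F s in nhds t. s \<in> {s \<in> I. c s \<in> dom i \<and> crd i (c s) \<in> V}"
      using assms that by (intro eventually_nhds_in_open) auto
    then show ?thesis by simp
  qed
  show "\<forall>\<^sub>F s in nhds t. s \<in> I \<and> c s \<in> dom i"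
    using *[OF open_UNIV] by simp
  have "((\<lambda>s. crd i (c s)) \<longlongrightarrow> crd i (c t)) (nhds t)"
  proof (rule topological_tendstoI)
    fix V assume "open V" "crd i (c t) \<in> V"
    from *[OF this] show "\<forall>\<^sub>F s in nhds t. crd i (c s) \<in> V" by eventually_elim simp
  qed
  then show "isCont (\<lambda>s. crd i (c s)) t"
    unfolding isCont_def
    by (rule tendsto_at_iff_tendsto_nhds[where g = "\<lambda>s. crd i (c s)", THEN iffD2])
qed

lemma curve_in_carrier:
  assumes "continuous_map (top_of_set I) (manifold_topology (double_atlas A)) c" "t \<in> I"
  shows "\<exists>i. c t \<in> dom i"
  using assms continuous_map_image_subset_topspace[OF assms(1)] by auto

lemma openin_double_topology:
  "openin (double_topology A) U \<longleftrightarrow> U \<subseteq> double A \<and>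
       openin (prod_topology (top_of_set (triangle A)) (discrete_topology UNIV))
         {x \<in> triangle A \<times> UNIV. glue A x \<in> U}"
  unfolding double_topology_def
proof (rule fun_cong[OF topology_inverse'], unfold istopology_def, intro conjI allI impI, goal_cases)
  case (2 S T)
  then have "openin (prod_topology (top_of_set (triangle A)) (discrete_topology UNIV))
     ({x \<in> triangle A \<times> UNIV. glue A x \<in> S} \<inter> {x \<in> triangle A \<times> UNIV. glue A x \<in> T})" by auto
  moreover have "{x \<in> triangle A \<times> UNIV. glue A x \<in> S} \<inter> {x \<in> triangle A \<times> UNIV. glue A x \<in> T} =
    {x \<in> triangle A \<times> UNIV. glue A x \<in> S \<inter> T}" by auto
  ultimately show ?case by simp
next
  case (4 K)
  then have "openin (prod_topology (top_of_set (triangle A)) (discrete_topology UNIV))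
     (\<Union>S\<in>K. {x \<in> triangle A \<times> UNIV. glue A x \<in> S})" by auto
  moreover have "(\<Union>S\<in>K. {x \<in> triangle A \<times> UNIV. glue A x \<in> S}) =
    {x \<in> triangle A \<times> UNIV. glue A x \<in> \<Union>K}" by auto
  ultimately show ?case by simp
qed auto

lemma topspace_double_topology [simp]: "topspace (double_topology A) = double A"
proof
  show "topspace (double_topology A) \<subseteq> double A"
    using openin_topspace[of "double_topology A"] unfolding openin_double_topology by blast
  have eq: "{x \<in> triangle A \<times> UNIV. glue A x \<in> double A} =
      topspace (prod_topology (top_of_set (triangle A)) (discrete_topology (UNIV :: bool set)))"
    by (auto simp: double_def)
  have "openin (double_topology A) (double A)"
    unfolding openin_double_topology eq by (simp only: openin_topspace order_refl simp_thms)
  then show "double A \<subseteq> topspace (double_topology A)" by (rule openin_subset)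
qed

lemma continuous_fold:
  assumes "continuous_map (top_of_set I) (double_topology A) c"
  shows "continuous_on I (\<lambda>t. fold_point (c t))"
proof -
  have "continuous_map (double_topology A) euclidean fold_point"
    unfolding continuous_map_def
  proof (intro conjI allI impI)
    fix V :: "complex set" assume "openin euclidean V"
    then have "openin (top_of_set (triangle A)) (triangle A \<inter> V)" by (simp add: openin_open_Int)
    then have "openin (prod_topology (top_of_set (triangle A)) (discrete_topology (UNIV::bool set)))
        ((triangle A \<inter> V) \<times> UNIV)" by (simp add: openin_prod_Times_iff)
    moreover have "(triangle A \<inter> V) \<times> UNIV =
       {x \<in> triangle A \<times> UNIV. glue A x \<in> {P \<in> topspace (double_topology A). fold_point P \<in> V}}"
      by auto
    ultimately show "openin (double_topology A) {P \<in> topspace (double_topology A). fold_point P \<in> V}"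
      unfolding openin_double_topology by auto
  qed auto
  from continuous_map_compose[OF assms this] show ?thesis by (simp add: comp_def)
qed

lemma continuous_glue:
  assumes "continuous_on I \<gamma>" "\<And>t. t \<in> I \<Longrightarrow> \<gamma> t \<in> triangle A"
  shows "continuous_map (top_of_set I) (double_topology A) (\<lambda>t. glue A (\<gamma> t, b))"
proof -
  have g: "continuous_map (prod_topology (top_of_set (triangle A)) (discrete_topology UNIV))
     (double_topology A) (glue A)"
    unfolding continuous_map_def
    by (auto simp: openin_double_topology)
  have "continuous_map (top_of_set I)
     (prod_topology (top_of_set (triangle A)) (discrete_topology UNIV)) (\<lambda>t. (\<gamma> t, b))"
    using assms by (simp add: continuous_map_pairedI continuous_map_in_subtopology image_subset_iff)
  from continuous_map_compose[OF this g] show ?thesis by (simp add: comp_def)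
qed

end

section \<open>The geodesic equation in the disc\<close>

lemma has_vector_derivative_cong_nhds:
  assumes "\<forall>\<^sub>F s in nhds t. f s = g s"
  shows "(f has_vector_derivative D) (at t) \<longleftrightarrow> (g has_vector_derivative D) (at t)"
  using assms eventually_nhds_x_imp_x[OF assms]
  by (intro has_vector_derivative_cong_ev) (auto elim: eventually_mono)

lemma vector_derivative_cong_nhds:
  assumes "\<forall>\<^sub>F s in nhds t. f s = g s"
  shows "vector_derivative f (at t) = vector_derivative g (at t)"
  unfolding vector_derivative_def using has_vector_derivative_cong_nhds[OF assms] by simp

lemma differentiable_cong_nhds:
  fixes f :: "real \<Rightarrow> 'a::real_normed_vector"
  assumes "\<forall>\<^sub>F s in nhds t. f s = g s"
  shows "f differentiable (at t) \<longleftrightarrow> g differentiable (at t)"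
proof -
  have "h differentiable (at t) \<longleftrightarrow> (\<exists>D. (h has_vector_derivative D) (at t))" for h :: "real \<Rightarrow> 'a"
    using vector_derivative_works differentiableI_vector by blast
  then show ?thesis using has_vector_derivative_cong_nhds[OF assms] by simp
qed

text \<open>The geodesic equation of the Poincare metric in complex notation
  (\<open>geodesic_equation_iff\<close>). Differentiability is asked near \<open>t\<close>, so that
  the first derivative of a transformed curve can be computed on a neighbourhood and then
  differentiated at \<open>t\<close>.\<close>

definition disc_geodesic_at :: "(real \<Rightarrow> complex) \<Rightarrow> real \<Rightarrow> bool" where
  "disc_geodesic_at \<gamma> t \<longleftrightarrow> cmod (\<gamma> t) < 1 \<and>
     (\<forall>\<^sub>F s in nhds t. \<gamma> differentiable (at s)) \<and>
     ((\<lambda>s. vector_derivative \<gamma> (at s)) has_vector_derivative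
        - 2 * cnj (\<gamma> t) * (vector_derivative \<gamma> (at t))\<^sup>2 / of_real (1 - (cmod (\<gamma> t))\<^sup>2)) (at t)"

lemma disc_geodesic_at_cong:
  assumes "\<forall>\<^sub>F s in nhds t. \<gamma> s = \<eta> s" "disc_geodesic_at \<eta> t"
  shows "disc_geodesic_at \<gamma> t"
proof -
  have ev: "\<forall>\<^sub>F s in nhds t. \<forall>\<^sub>F r in nhds s. \<gamma> r = \<eta> r"
    using assms(1) by (simp add: eventually_eventually)
  have d: "\<forall>\<^sub>F s in nhds t. vector_derivative \<gamma> (at s) = vector_derivative \<eta> (at s)"
    using ev by eventually_elim (rule vector_derivative_cong_nhds)
  have "\<forall>\<^sub>F s in nhds t. \<eta> differentiable (at s)"
    using assms(2) by (simp add: disc_geodesic_at_def)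
  with ev have "\<forall>\<^sub>F s in nhds t. \<gamma> differentiable (at s)"
    by eventually_elim (simp add: differentiable_cong_nhds)
  moreover have "\<gamma> t = \<eta> t" "vector_derivative \<gamma> (at t) = vector_derivative \<eta> (at t)"
    using eventually_nhds_x_imp_x[OF assms(1)] eventually_nhds_x_imp_x[OF d] by simp_all
  ultimately show ?thesis
    using assms(2) has_vector_derivative_cong_nhds[OF d]
    by (simp add: disc_geodesic_at_def)
qed

lemma disc_geodesic_atD:
  assumes "disc_geodesic_at \<gamma> t"
  shows "cmod (\<gamma> t) < 1" "\<gamma> differentiable (at t)" "isCont \<gamma> t"
    "(\<gamma> has_vector_derivative vector_derivative \<gamma> (at t)) (at t)"
    "((\<lambda>s. vector_derivative \<gamma> (at s)) has_vector_derivative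
        - 2 * cnj (\<gamma> t) * (vector_derivative \<gamma> (at t))\<^sup>2 / of_real (1 - (cmod (\<gamma> t))\<^sup>2)) (at t)"
proof -
  show "cmod (\<gamma> t) < 1" "\<gamma> differentiable (at t)"
    using assms eventually_nhds_x_imp_x[of "\<lambda>s. \<gamma> differentiable (at s)" t]
    by (auto simp: disc_geodesic_at_def)
  then show "isCont \<gamma> t" "(\<gamma> has_vector_derivative vector_derivative \<gamma> (at t)) (at t)"
    by (simp_all add: differentiable_imp_continuous_within vector_derivative_works)
qed (use assms in \<open>auto simp: disc_geodesic_at_def\<close>)

lemma disc_geodesic_at_cnj:
  assumes "disc_geodesic_at \<gamma> t"
  shows "disc_geodesic_at (\<lambda>s. cnj (\<gamma> s)) t"
proof -
  have ev: "\<forall>\<^sub>F s in nhds t. \<gamma> differentiable (at s)"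
    using assms by (simp add: disc_geodesic_at_def)
  have vd: "((\<lambda>s. cnj (\<gamma> s)) has_vector_derivative cnj (vector_derivative \<gamma> (at s))) (at s)"
    if "\<gamma> differentiable (at s)" for s
    using that by (intro has_vector_derivative_cnj) (simp add: vector_derivative_works)
  have d: "\<forall>\<^sub>F s in nhds t. vector_derivative (\<lambda>s. cnj (\<gamma> s)) (at s) = cnj (vector_derivative \<gamma> (at s))"
    using ev by eventually_elim (rule vector_derivative_at[OF vd])
  have ev': "\<forall>\<^sub>F s in nhds t. (\<lambda>s. cnj (\<gamma> s)) differentiable (at s)"
    using ev by eventually_elim (rule differentiableI_vector[OF vd])
  have "((\<lambda>s. cnj (vector_derivative \<gamma> (at s))) has_vector_derivative
     cnj (- 2 * cnj (\<gamma> t) * (vector_derivative \<gamma> (at t))\<^sup>2 / of_real (1 - (cmod (\<gamma> t))\<^sup>2))) (at t)"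
    by (rule has_vector_derivative_cnj[OF disc_geodesic_atD(5)[OF assms]])
  then have "((\<lambda>s. vector_derivative (\<lambda>s. cnj (\<gamma> s)) (at s)) has_vector_derivative
     cnj (- 2 * cnj (\<gamma> t) * (vector_derivative \<gamma> (at t))\<^sup>2 / of_real (1 - (cmod (\<gamma> t))\<^sup>2))) (at t)"
    using has_vector_derivative_cong_nhds[OF d] by simp
  then show ?thesis
    using disc_geodesic_atD(1)[OF assms] ev' eventually_nhds_x_imp_x[OF d]
    by (simp add: disc_geodesic_at_def)
qed

lemma has_vector_derivative_su:
  assumes "cmod b < cmod a" "cmod (\<gamma> s) < 1" "(\<gamma> has_vector_derivative v) (at s)"
  shows "((\<lambda>s. su a b (\<gamma> s)) has_vector_derivative su' a b (\<gamma> s) * v) (at s)"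
  using field_vector_diff_chain_at[OF assms(3) su_DERIV[OF assms(1,2)]]
  by (simp add: comp_def mult.commute)

lemma su'_DERIV:
  assumes "cmod b < cmod a" "cmod z < 1"
  shows "(su' a b has_field_derivative su' a b z * (- 2 * cnj b / (cnj b * z + cnj a))) (at z)"
proof -
  define D where "D z = cnj b * z + cnj a" for z
  have D: "D z \<noteq> 0" using su_denom assms by (simp add: D_def)
  have "((\<lambda>z. (D z)\<^sup>2) has_field_derivative 2 * D z * cnj b) (at z)"
    unfolding D_def by (auto intro!: derivative_eq_intros)
  from DERIV_divide[OF DERIV_const this]
  have "((\<lambda>z. k / (D z)\<^sup>2) has_field_derivative
     (0 * (D z)\<^sup>2 - k * (2 * D z * cnj b)) / ((D z)\<^sup>2 * (D z)\<^sup>2)) (at z)" for k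
    using D by simp
  moreover have "(0 * d\<^sup>2 - k * (2 * d * e)) / (d\<^sup>2 * d\<^sup>2) = k / d\<^sup>2 * (- 2 * e / d)"
    if "d \<noteq> 0" for d e k :: complex
    using that by (simp add: field_simps power2_eq_square)
  ultimately show ?thesis
    using D unfolding su'_def[abs_def] D_def[symmetric] by simp
qed

text \<open>The second derivative of the image curve is the old quadratic term carried along plus a
  term from the logarithmic derivative \<open>- 2 cnj b / D\<close> of \<open>su'\<close>. Up to the
  common factor \<open>- 2 su' u^2\<close>, the facts \<open>1\<close> and \<open>2\<close> reduce
  this sum and the quadratic term of the new curve to the same fraction
  \<open>cnj (a z + b) / (D N)\<close>.\<close>

lemma disc_geodesic_at_su:
  assumes "disc_geodesic_at \<gamma> t" and ab: "cmod b < cmod a"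
  shows "disc_geodesic_at (\<lambda>s. su a b (\<gamma> s)) t"
proof -
  note g = disc_geodesic_atD[OF assms(1)]
  have ev: "\<forall>\<^sub>F s in nhds t. \<gamma> differentiable (at s)"
    using assms by (simp add: disc_geodesic_at_def)
  have "(\<gamma> \<longlongrightarrow> \<gamma> t) (nhds t)"
    using g(3) unfolding isCont_def by (rule tendsto_at_iff_tendsto_nhds[THEN iffD1])
  then have ball: "\<forall>\<^sub>F s in nhds t. \<gamma> s \<in> ball 0 1"
    using g(1) by (intro topological_tendstoD) auto
  have d: "\<forall>\<^sub>F s in nhds t. vector_derivative (\<lambda>s. su a b (\<gamma> s)) (at s) =
        su' a b (\<gamma> s) * vector_derivative \<gamma> (at s)"
    using ev ball
    by eventually_elim (intro vector_derivative_at has_vector_derivative_su ab,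
        simp_all add: vector_derivative_works)
  have ev': "\<forall>\<^sub>F s in nhds t. (\<lambda>s. su a b (\<gamma> s)) differentiable (at s)"
    using ev ball
    by eventually_elim (rule differentiableI_vector[OF has_vector_derivative_su[OF ab]],
        simp_all add: vector_derivative_works)
  define z u where "z = \<gamma> t" and "u = vector_derivative \<gamma> (at t)"
  define N where "N = 1 - (cmod z)\<^sup>2"
  have z: "cmod z < 1" using g by (simp add: z_def)
  then have N: "N > 0" by (simp add: N_def abs_square_less_1)
  define D where "D = cnj b * z + cnj a"
  have D: "D \<noteq> 0" using su_denom[OF ab, of z] z by (simp add: D_def)
  define K where "K = (cmod a)\<^sup>2 - (cmod b)\<^sup>2"
  have K: "K > 0" using su_gap[OF ab] by (simp add: K_def)
  have su'z: "su' a b z = of_real K / D\<^sup>2" by (simp add: su'_def K_def D_def)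
  have mu: "1 - (cmod (su a b z))\<^sup>2 = K * N / (cmod D)\<^sup>2"
    unfolding su_norm[OF ab z] by (simp add: K_def N_def D_def)
  have "((\<lambda>s. su' a b (\<gamma> s)) has_vector_derivative su' a b z * (- 2 * cnj b / D) * u) (at t)"
    using field_vector_diff_chain_at[OF g(4) su'_DERIV[OF ab g(1)]]
    by (simp add: comp_def mult.commute z_def u_def D_def)
  then have "((\<lambda>s. su' a b (\<gamma> s) * vector_derivative \<gamma> (at s)) has_vector_derivative
      su' a b z * (- 2 * cnj z * u\<^sup>2 / of_real N) + su' a b z * (- 2 * cnj b / D) * u * u) (at t)"
    unfolding z_def u_def N_def by (rule has_vector_derivative_mult[OF _ g(5)])
  moreover have "su' a b z * (- 2 * cnj z * u\<^sup>2 / of_real N) + su' a b z * (- 2 * cnj b / D) * u * u =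
     - 2 * cnj (su a b z) * (su' a b z * u)\<^sup>2 / of_real (1 - (cmod (su a b z))\<^sup>2)"
  proof -
    have 1: "cnj z / of_real N + cnj b / D = cnj (a * z + b) / (D * of_real N)"
    proof -
      have NN: "complex_of_real N = 1 - z * cnj z"
        by (simp add: N_def flip: complex_norm_square)
      have "cnj z * D + cnj b * of_real N = cnj (a * z + b)"
        unfolding NN D_def by (simp add: algebra_simps)
      then show ?thesis using D N by (simp add: divide_simps mult.commute)
    qed
    have 2: "cnj (su a b z) * su' a b z / of_real (1 - (cmod (su a b z))\<^sup>2) = cnj (a * z + b) / (D * of_real N)"
    proof -
      have c: "cnj (su a b z) = cnj (a * z + b) / cnj D" by (simp add: su_def D_def)
      have m: "complex_of_real (K * N / (cmod D)\<^sup>2) = of_real K * of_real N / (D * cnj D)"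
        unfolding of_real_divide of_real_mult complex_norm_square ..
      show ?thesis unfolding mu su'z c m using D N K by (simp add: divide_simps power2_eq_square)
    qed
    have "su' a b z * (- 2 * cnj z * u\<^sup>2 / of_real N) + su' a b z * (- 2 * cnj b / D) * u * u =
       - 2 * su' a b z * u\<^sup>2 * (cnj z / of_real N + cnj b / D)"
      by (simp add: algebra_simps power2_eq_square)
    also have "\<dots> = - 2 * su' a b z * u\<^sup>2 * (cnj (su a b z) * su' a b z / of_real (1 - (cmod (su a b z))\<^sup>2))"
      unfolding 1 2 ..
    also have "\<dots> = - 2 * cnj (su a b z) * (su' a b z * u)\<^sup>2 / of_real (1 - (cmod (su a b z))\<^sup>2)"
      by (simp add: power_mult_distrib power2_eq_square)
    finally show ?thesis .
  qed
  ultimately have "((\<lambda>s. vector_derivative (\<lambda>s. su a b (\<gamma> s)) (at s)) has_vector_derivative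
      - 2 * cnj (su a b z) * (su' a b z * u)\<^sup>2 / of_real (1 - (cmod (su a b z))\<^sup>2)) (at t)"
    using has_vector_derivative_cong_nhds[OF d] by simp
  then show ?thesis
    using su_in_ball[OF ab z] ev' eventually_nhds_x_imp_x[OF d]
    by (simp add: disc_geodesic_at_def z_def u_def)
qed

lemma has_vector_derivative_of_real_mult:
  fixes u :: complex
  assumes "(f has_real_derivative D) (at t)"
  shows "((\<lambda>t. of_real (f t) * u) has_vector_derivative of_real D * u) (at t)"
  using has_vector_derivative_scaleR[OF assms has_vector_derivative_const[of u]]
  by (simp add: scaleR_conv_of_real)

text \<open>\<open>tanh (t / 2)\<close> is the Euclidean radius of the points at hyperbolic distance
  \<open>t\<close> from 0, so for a unit vector \<open>u\<close> the ray is run through with unit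
  speed.\<close>

lemma has_vector_derivative_ray:
  "((\<lambda>t. complex_of_real (tanh (t / 2)) * u) has_vector_derivative
     of_real ((1 - (tanh (t / 2))\<^sup>2) / 2) * u) (at t)"
proof -
  have "((\<lambda>t. tanh (t / 2)) has_real_derivative (1 - (tanh (t / 2))\<^sup>2) / 2) (at t)"
    by (auto intro!: derivative_eq_intros)
  then show ?thesis by (rule has_vector_derivative_of_real_mult)
qed

lemma disc_geodesic_at_ray:
  assumes "cmod u = 1"
  shows "disc_geodesic_at (\<lambda>t. of_real (tanh (t / 2)) * u) t"
proof -
  define T where "T = tanh (t / 2)"
  have T: "\<bar>T\<bar> < 1" using tanh_real_bounds[of "t / 2"] by (auto simp: T_def)
  have vd: "vector_derivative (\<lambda>t. of_real (tanh (t / 2)) * u) (at s) =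
      of_real ((1 - (tanh (s / 2))\<^sup>2) / 2) * u" for s
    by (rule vector_derivative_at[OF has_vector_derivative_ray])
  have "((\<lambda>t. (1 - (tanh (t / 2))\<^sup>2) / 2) has_real_derivative - T * (1 - T\<^sup>2) / 2) (at t)"
    unfolding T_def by (auto intro!: derivative_eq_intros simp: field_simps)
  then have der: "((\<lambda>s. of_real ((1 - (tanh (s / 2))\<^sup>2) / 2) * u) has_vector_derivative
      of_real (- T * (1 - T\<^sup>2) / 2) * u) (at t)"
    by (rule has_vector_derivative_of_real_mult)
  have eq: "- 2 * cnj (of_real T * u) * (of_real ((1 - T\<^sup>2) / 2) * u)\<^sup>2 /
      of_real (1 - (cmod (of_real T * u))\<^sup>2) = of_real (- T * (1 - T\<^sup>2) / 2) * u"
  proof -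
    define N where "N = 1 - T\<^sup>2"
    have N: "N \<noteq> 0" using T by (simp add: N_def abs_square_eq_1)
    have uu: "cnj u * u = 1" using complex_norm_square[of u] assms by (simp add: mult.commute)
    have m: "1 - (cmod (of_real T * u))\<^sup>2 = N"
      using assms by (simp add: N_def norm_mult power_mult_distrib)
    have "- 2 * cnj (of_real T * u) * (of_real (N / 2) * u)\<^sup>2 =
       (cnj u * u) * (- of_real T * of_real N * of_real N * u / 2)"
      by (simp add: power2_eq_square)
    also have "\<dots> = - of_real T * of_real N * of_real N * u / 2"
      unfolding uu by simp
    finally have e: "- 2 * cnj (of_real T * u) * (of_real (N / 2) * u)\<^sup>2 =
      - of_real T * of_real N * of_real N * u / 2" .
    show ?thesis unfolding m N_def[symmetric] e using N by simp
  qed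
  show ?thesis
    unfolding disc_geodesic_at_def vd T_def[symmetric]
  proof (intro conjI)
    show "cmod (of_real T * u) < 1" using T assms by (simp add: norm_mult)
    show "\<forall>\<^sub>F s in nhds t. (\<lambda>t. of_real (tanh (t / 2)) * u) differentiable at s"
      by (intro always_eventually allI differentiableI_vector[OF has_vector_derivative_ray])
  qed (rule has_vector_derivative_eq_rhs[OF der eq[symmetric]])
qed

section \<open>The geodesic equation of the Poincare metric\<close>

lemma poincare_metric_has_derivative:
  assumes "cmod z < 1"
  shows "((\<lambda>x. poincare_metric x v w) has_derivative
     (\<lambda>u. 16 * (v \<bullet> w) * (z \<bullet> u) / (1 - (cmod z)\<^sup>2) ^ 3)) (at z)"
proof -
  have n: "1 - z \<bullet> z \<noteq> 0"
    using assms by (simp add: abs_square_eq_1 flip: power2_norm_eq_inner)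
  have d1: "((\<lambda>x. 1 - x \<bullet> x) has_derivative (\<lambda>u. - 2 * (z \<bullet> u))) (at z)"
    by (auto intro!: derivative_eq_intros simp: inner_commute)
  have d2: "((\<lambda>y. 4 * (v \<bullet> w) / y\<^sup>2) has_real_derivative - 8 * (v \<bullet> w) / y ^ 3) (at y)"
    if "y \<noteq> 0" for y :: real
    using that by (auto intro!: derivative_eq_intros simp: field_simps power2_eq_square power3_eq_cube)
  from DERIV_compose_FDERIV[OF d2[OF n] d1] show ?thesis unfolding poincare_metric_def power2_norm_eq_inner by (simp add: mult_ac)
qed

lemma geodesic_equation_iff:
  assumes "cmod z < 1"
  shows "(\<forall>w. poincare_metric z c w + christoffel poincare_metric z u u w = 0) \<longleftrightarrow>
    c = - 2 * cnj z * u\<^sup>2 / of_real (1 - (cmod z)\<^sup>2)"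
proof -
  define N where "N = 1 - (cmod z)\<^sup>2"
  have N: "N > 0" using assms by (simp add: N_def abs_square_less_1)
  have fd: "frechet_derivative (\<lambda>x. poincare_metric x v w) (at z) =
      (\<lambda>u. 16 * (v \<bullet> w) * (z \<bullet> u) / N ^ 3)" for v w
    unfolding N_def by (rule frechet_derivative_at[symmetric, OF poincare_metric_has_derivative[OF assms]])
  \<comment> \<open>The vector \<open>2 (z . u) u - (u . u) z\<close>, which the Christoffel symbols
    of a conformal metric produce, is \<open>cnj z u^2\<close> as a complex number.\<close>
  have inn: "(cnj z * u\<^sup>2) \<bullet> w = 2 * (u \<bullet> w) * (z \<bullet> u) - (u \<bullet> u) * (z \<bullet> w)" for w
    by (simp add: inner_complex_def power2_eq_square algebra_simps)
  have "poincare_metric z c w + christoffel poincare_metric z u u w =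
      4 / N\<^sup>2 * ((c + (2 / N) *\<^sub>R (cnj z * u\<^sup>2)) \<bullet> w)" for w
  proof -
    have "poincare_metric z c w + christoffel poincare_metric z u u w =
        4 * (c \<bullet> w) / N\<^sup>2 + 8 / N ^ 3 * (2 * (u \<bullet> w) * (z \<bullet> u) - (u \<bullet> u) * (z \<bullet> w))"
      unfolding christoffel_def fd unfolding poincare_metric_def N_def[symmetric]
      by (simp add: diff_divide_distrib algebra_simps)
    also have "\<dots> = 4 / N\<^sup>2 * ((c + (2 / N) *\<^sub>R (cnj z * u\<^sup>2)) \<bullet> w)"
      unfolding inn[symmetric] inner_add_left inner_scaleR_left
      by (simp add: distrib_left power2_eq_square power3_eq_cube)
    finally show ?thesis .
  qed
  then have "(\<forall>w. poincare_metric z c w + christoffel poincare_metric z u u w = 0) \<longleftrightarrow>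
      (\<forall>w. (c + (2 / N) *\<^sub>R (cnj z * u\<^sup>2)) \<bullet> w = 0)"
    using N by simp
  also have "\<dots> \<longleftrightarrow> c + (2 / N) *\<^sub>R (cnj z * u\<^sup>2) = 0"
    by (metis inner_eq_zero_iff inner_zero_left)
  also have "\<dots> \<longleftrightarrow> c = - ((2 / N) *\<^sub>R (cnj z * u\<^sup>2))"
    by (rule add_eq_0_iff2)
  also have "- ((2 / N) *\<^sub>R (cnj z * u\<^sup>2)) = - 2 * cnj z * u\<^sup>2 / of_real N"
    by (simp add: scaleR_conv_of_real)
  finally show ?thesis by (simp add: N_def)
qed

context hyp_triangle
begin

section \<open>Tangent vectors of the double\<close>

lemma double_atlas_iff: "ch \<in> double_atlas A \<longleftrightarrow> (\<exists>i. ch = double_chart A i)"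
  by (auto simp: double_atlas_def)

lemma double_chart_atlas [simp]: "double_chart A i \<in> double_atlas A"
  by (simp add: double_atlas_def)

definition trans_map :: "3 \<Rightarrow> 3 \<Rightarrow> dpoint \<Rightarrow> complex \<Rightarrow> complex \<Rightarrow> bool" where
  "trans_map i j P a b \<longleftrightarrow> cmod b < cmod a \<and>
     (\<forall>\<^sub>F x in nhds (crd i P). \<exists>Q\<in>dom i \<inter> dom j. crd i Q = x \<and> crd j Q = su a b x)"

lemma trans_mapD:
  assumes "trans_map i j P a b" "P \<in> dom i"
  shows "cmod b < cmod a" "P \<in> dom j" "crd j P = su a b (crd i P)"
    "\<forall>\<^sub>F x in nhds (crd i P). \<exists>Q\<in>dom i \<inter> dom j. crd i Q = x \<and> crd j Q = su a b x"
    "((crd j \<circ> inv_into (dom i) (crd i)) has_derivative (\<lambda>v. su' a b (crd i P) * v)) (at (crd i P))"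
    "frechet_derivative (crd j \<circ> inv_into (dom i) (crd i)) (at (crd i P)) = (\<lambda>v. su' a b (crd i P) * v)"
proof -
  show ab: "cmod b < cmod a" and ev: "\<forall>\<^sub>F x in nhds (crd i P). \<exists>Q\<in>dom i \<inter> dom j. crd i Q = x \<and> crd j Q = su a b x"
    using assms by (auto simp: trans_map_def)
  obtain Q where Q: "Q \<in> dom i" "Q \<in> dom j" "crd i Q = crd i P" "crd j Q = su a b (crd i P)"
    using eventually_nhds_x_imp_x[OF ev] by blast
  then have "Q = P" using inj_onD[OF inj_crd[of i], of Q P] assms(2) by simp
  then show "P \<in> dom j" "crd j P = su a b (crd i P)" using Q by simp_all
  have eq: "\<forall>\<^sub>F x in nhds (crd i P). (crd j \<circ> inv_into (dom i) (crd i)) x = su a b x"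
    using ev by eventually_elim (auto simp: inv_into_f_f[OF inj_crd])
  have "(su a b has_derivative (\<lambda>v. su' a b (crd i P) * v)) (at (crd i P))"
    using su_DERIV[OF ab crd_ball[OF assms(2)]] by (simp add: has_field_derivative_def)
  then show "((crd j \<circ> inv_into (dom i) (crd i)) has_derivative (\<lambda>v. su' a b (crd i P) * v)) (at (crd i P))"
    by (rule has_derivative_transform_eventually)
       (use eq eventually_nhds_x_imp_x[OF eq] in \<open>auto simp: eventually_at_filter elim: eventually_mono\<close>)
  then show "frechet_derivative (crd j \<circ> inv_into (dom i) (crd i)) (at (crd i P)) = (\<lambda>v. su' a b (crd i P) * v)"
    by (rule frechet_derivative_at[symmetric])
qed

lemma trans_mapE:
  assumes "P \<in> dom i" "P \<in> dom j"
  obtains a b where "trans_map i j P a b"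
  using transition[OF assms] unfolding trans_map_def by blast

lemma tangent_space_iff:
  "v \<in> tangent_space (double_atlas A) P \<longleftrightarrow>
    (\<forall>ch. ch \<notin> double_atlas A \<or> P \<notin> fst ch \<longrightarrow> v ch = 0) \<and>
    (\<forall>i j. P \<in> dom i \<and> P \<in> dom j \<longrightarrow> v (double_chart A j) =
       frechet_derivative (crd j \<circ> inv_into (dom i) (crd i)) (at (crd i P)) (v (double_chart A i)))"
  unfolding tangent_space_def mem_Collect_eq double_atlas_def by blast

lemma tangent_trans:
  assumes "v \<in> tangent_space (double_atlas A) P" "trans_map i j P a b" "P \<in> dom i"
  shows "v (double_chart A j) = su' a b (crd i P) * v (double_chart A i)"
proof -
  have "v (double_chart A j) = frechet_derivative (crd j \<circ> inv_into (dom i) (crd i)) (at (crd i P)) (v (double_chart A i))"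
    using assms(1,3) trans_mapD(2)[OF assms(2,3)] unfolding tangent_space_iff by blast
  then show ?thesis unfolding trans_mapD(6)[OF assms(2,3)] .
qed

lemma tangent_eqI:
  assumes "v \<in> tangent_space (double_atlas A) P" "w \<in> tangent_space (double_atlas A) P"
    "P \<in> dom i" "v (double_chart A i) = w (double_chart A i)"
  shows "v = w"
proof
  fix ch
  show "v ch = w ch"
  proof (cases "ch \<in> double_atlas A \<and> P \<in> fst ch")
    case True
    then obtain j where j: "ch = double_chart A j" by (auto simp: double_atlas_iff)
    with True obtain a b where ab: "trans_map i j P a b" using trans_mapE[OF assms(3), of j] by auto
    show ?thesis
      using tangent_trans[OF assms(1) ab assms(3)] tangent_trans[OF assms(2) ab assms(3)] assms(4) j
      by simp
  next
    case False
    then have "v ch = 0" "w ch = 0" using assms(1,2) unfolding tangent_space_iff by blast+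
    then show ?thesis by simp
  qed
qed

text \<open>The coefficients of an isometry are determined only up to a real factor, so the cocycle
  identity is obtained by comparing the maps near the point and differentiating.\<close>

lemma trans_map_compose:
  assumes "trans_map i j P a b" "trans_map j k P c d" "trans_map i k P e f" "P \<in> dom i"
  shows "su' e f (crd i P) = su' c d (crd j P) * su' a b (crd i P)"
proof -
  note 1 = trans_mapD[OF assms(1,4)] and 3 = trans_mapD[OF assms(3,4)]
  note 2 = trans_mapD[OF assms(2) 1(2)]
  have ball: "cmod (crd i P) < 1" "cmod (crd j P) < 1" using crd_ball assms(4) 1(2) by auto
  have d: "((\<lambda>x. su c d (su a b x)) has_field_derivative su' c d (crd j P) * su' a b (crd i P)) (at (crd i P))"
    using DERIV_chain2[OF su_DERIV[OF 2(1)] su_DERIV[OF 1(1) ball(1)]] ball 1(3) by simp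
  have "isCont (su a b) (crd i P)" using su_DERIV[OF 1(1) ball(1)] by (rule DERIV_isCont)
  then have "\<forall>\<^sub>F x in nhds (crd i P). \<exists>Q\<in>dom j \<inter> dom k. crd j Q = su a b x \<and> crd k Q = su c d (su a b x)"
    unfolding isCont_def tendsto_at_iff_tendsto_nhds
    using eventually_compose_filterlim[OF 2(4)[unfolded 1(3)]] by blast
  with 1(4) 3(4) have "\<forall>\<^sub>F x in nhds (crd i P). su e f x = su c d (su a b x)"
  proof eventually_elim
    case (elim x)
    then obtain Q Q' Q'' where Q: "Q \<in> dom i \<inter> dom j" "crd i Q = x" "crd j Q = su a b x"
      "Q' \<in> dom j \<inter> dom k" "crd j Q' = su a b x" "crd k Q' = su c d (su a b x)"
      "Q'' \<in> dom i \<inter> dom k" "crd i Q'' = x" "crd k Q'' = su e f x" by blast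
    then have "Q = Q''" "Q = Q'" using inj_onD[OF inj_crd[of i], of Q Q''] inj_onD[OF inj_crd[of j], of Q Q'] by auto
    then show ?case using Q by simp
  qed
  then have "(su e f has_field_derivative su' c d (crd j P) * su' a b (crd i P)) (at (crd i P))"
    using DERIV_cong_ev[of "crd i P" "crd i P" "su e f" "\<lambda>x. su c d (su a b x)"] d by simp
  then show ?thesis using DERIV_unique su_DERIV[OF 3(1) ball(1)] by blast
qed

lemma tangent_exists:
  assumes "P \<in> dom i"
  obtains v where "v \<in> tangent_space (double_atlas A) P" "v (double_chart A i) = u"
proof -
  define v where "v = (\<lambda>ch. if ch \<in> double_atlas A \<and> P \<in> fst ch then
      frechet_derivative (snd ch \<circ> inv_into (dom i) (crd i)) (at (crd i P)) u else 0)"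
  have v: "v (double_chart A j) = su' a b (crd i P) * u" if "trans_map i j P a b" for j a b
    using trans_mapD[OF that assms] by (simp add: v_def)
  have "v \<in> tangent_space (double_atlas A) P"
    unfolding tangent_space_iff
  proof (intro conjI allI impI)
    fix j k assume jk: "P \<in> dom j \<and> P \<in> dom k"
    obtain a b where 1: "trans_map i j P a b" using trans_mapE[of P i j] jk assms by auto
    obtain c d where 2: "trans_map j k P c d" using trans_mapE[of P j k] jk by auto
    obtain e f where 3: "trans_map i k P e f" using trans_mapE[of P i k] jk assms by auto
    have "v (double_chart A k) = su' c d (crd j P) * v (double_chart A j)"
      unfolding v[OF 1] v[OF 3] trans_map_compose[OF 1 2 3 assms] by simp
    then show "v (double_chart A k) =
       frechet_derivative (crd k \<circ> inv_into (dom j) (crd j)) (at (crd j P)) (v (double_chart A j))"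
      using trans_mapD(6)[OF 2] jk by simp
  qed (auto simp: v_def)
  moreover have "v (double_chart A i) = u"
  proof -
    have "trans_map i i P 1 0"
      using eventually_nhds_in_open[OF open_crd_image[of i], of "crd i P"] assms
      by (auto simp: trans_map_def su_def elim!: eventually_mono)
    from v[OF this] show ?thesis by (simp add: su'_def)
  qed
  ultimately show ?thesis using that by blast
qed

lemma chosen_chart:
  assumes "P \<in> dom i"
  obtains j where "(SOME ch. ch \<in> double_atlas A \<and> P \<in> fst ch) = double_chart A j" "P \<in> dom j"
proof -
  have "\<exists>ch. ch \<in> double_atlas A \<and> P \<in> fst ch" using assms double_chart_atlas by blast
  from someI_ex[OF this] show ?thesis using that unfolding double_atlas_iff by auto
qed

text \<open>\<open>tangent_norm\<close> is evaluated in a chart picked by \<open>SOME\<close>; by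
  \<open>su'_norm\<close> the result agrees with that in the chart \<open>i\<close>.\<close>

lemma tangent_norm_eq:
  assumes "v \<in> tangent_space (double_atlas A) P" "P \<in> dom i"
  shows "tangent_norm (double_atlas A) P v =
     2 * cmod (v (double_chart A i)) / (1 - (cmod (crd i P))\<^sup>2)"
proof -
  obtain j where j: "(SOME ch. ch \<in> double_atlas A \<and> P \<in> fst ch) = double_chart A j" "P \<in> dom j"
    using chosen_chart[OF assms(2)] .
  have pos: "1 - (cmod (crd k P))\<^sup>2 > 0" if "P \<in> dom k" for k
    using crd_ball[OF that] by (simp add: abs_square_less_1)
  obtain a b where ab: "trans_map i j P a b" using trans_mapE assms(2) j(2) .
  note t = trans_mapD[OF ab assms(2)]
  have "poincare_metric z u u = (2 * cmod u / (1 - (cmod z)\<^sup>2))\<^sup>2" for z u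
    by (simp add: poincare_metric_def power_divide power_mult_distrib flip: power2_norm_eq_inner)
  then have "tangent_norm (double_atlas A) P v = 2 * cmod (v (double_chart A j)) / (1 - (cmod (crd j P))\<^sup>2)"
    using pos[OF j(2)] by (simp add: tangent_norm_def Let_def j(1))
  also have "1 - (cmod (crd j P))\<^sup>2 = cmod (su' a b (crd i P)) * (1 - (cmod (crd i P))\<^sup>2)"
    unfolding t(3) by (rule su'_norm[OF t(1) crd_ball[OF assms(2)]])
  also have "v (double_chart A j) = su' a b (crd i P) * v (double_chart A i)"
    by (rule tangent_trans[OF assms(1) ab assms(2)])
  finally show ?thesis
    using su'_nonzero[OF t(1) crd_ball[OF assms(2)]] by (simp add: norm_mult)
qed

end

section \<open>Angles on a cut circle\<close>

text \<open>The branch of the argument with its cut along the direction \<open>cis s\<close>. It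
  ignores positive factors (\<open>ang_of_real_mult\<close>), so it can be applied to vectors of any
  length.\<close>

definition ang :: "real \<Rightarrow> complex \<Rightarrow> real" where
  "ang s y = s + Arg2pi (y / cis s)"

lemma snd_angular_chart: "snd (angular_chart U F s) q = (fst (F q), ang s (snd (F q)))"
  by (simp add: angular_chart_def ang_def)

lemma fst_angular_chart: "q \<in> fst (angular_chart U F s) \<longleftrightarrow> q \<in> U \<and> snd (F q) \<noteq> cis s"
  by (simp add: angular_chart_def)

lemma ang_of_real_mult: "r > 0 \<Longrightarrow> ang s (of_real r * y) = ang s y"
  using Arg2pi_times_of_real[of r "y / cis s"] by (simp add: ang_def)

lemma ang_sgn: "ang s (sgn y) = ang s y"
proof (cases "y = 0")
  case False
  then show ?thesis
    using ang_of_real_mult[of "inverse (cmod y)" s y] by (simp add: sgn_div_norm scaleR_conv_of_real)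
qed simp

lemma cis_ang: "y \<noteq> 0 \<Longrightarrow> cis (ang s y) = sgn y"
proof -
  assume "y \<noteq> 0"
  have "y / cis s = of_real (cmod (y / cis s)) * cis (Arg2pi (y / cis s))"
    using Arg2pi_eq[of "y / cis s"] by (simp add: cis_conv_exp)
  then have "y = of_real (cmod y) * (cis s * cis (Arg2pi (y / cis s)))"
    by (simp add: norm_divide field_simps)
  then have "y = of_real (cmod y) * cis (ang s y)"
    by (simp only: ang_def cis_mult)
  then show ?thesis
    using \<open>y \<noteq> 0\<close> by (metis nonzero_mult_div_cancel_left norm_eq_zero of_real_eq_0_iff sgn_eq)
qed

lemma ang_cis: "s < \<phi> \<Longrightarrow> \<phi> < s + 2 * pi \<Longrightarrow> ang s (cis \<phi>) = \<phi>"
proof -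
  assume "s < \<phi>" "\<phi> < s + 2 * pi"
  then have "Arg2pi (cis (\<phi> - s)) = \<phi> - s"
    by (intro Arg2pi_unique[of 1]) (simp_all add: cis_conv_exp)
  then show ?thesis by (simp add: ang_def cis_divide)
qed

lemma cut_iff:
  assumes "y \<noteq> 0"
  shows "sgn y \<noteq> cis s \<longleftrightarrow> Arg2pi (y / cis s) > 0"
proof -
  have "Arg2pi (y / cis s) = 0 \<longleftrightarrow> sgn y = cis s"
  proof
    assume "Arg2pi (y / cis s) = 0"
    then show "sgn y = cis s" using cis_ang[OF assms, of s] by (simp add: ang_def)
  next
    assume "sgn y = cis s"
    then have "ang s y = s + Arg2pi 1" using ang_sgn[of s y] by (simp add: ang_def)
    then show "Arg2pi (y / cis s) = 0" by (simp add: ang_def Arg2pi_of_real[of 1, simplified])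
  qed
  then show ?thesis using Arg2pi_ge_0[of "y / cis s"] by linarith
qed

lemma cut_nonpos_Reals:
  assumes "y \<noteq> 0" "sgn y \<noteq> cis s"
  shows "- (y / cis s) \<notin> \<real>\<^sub>\<le>\<^sub>0"
proof
  assume "- (y / cis s) \<in> \<real>\<^sub>\<le>\<^sub>0"
  then have "y / cis s \<in> \<real>\<^sub>\<ge>\<^sub>0" by (simp add: uminus_nonneg_Reals_iff[symmetric] del: uminus_nonneg_Reals_iff)
  then have "Arg2pi (y / cis s) = 0" by (auto simp: Arg2pi_eq_0 complex_nonneg_Reals_iff complex_is_Real_iff)
  then show False using assms cut_iff by fastforce
qed

lemma ang_range: "y \<noteq> 0 \<Longrightarrow> sgn y \<noteq> cis s \<Longrightarrow> s < ang s y \<and> ang s y < s + 2 * pi"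
  using cut_iff[of y s] Arg2pi_lt_2pi[of "y / cis s"] by (simp add: ang_def)

lemma sgn_cut_of_range:
  assumes "s < \<phi>" "\<phi> < s + 2 * pi"
  shows "cis \<phi> \<noteq> cis s"
proof
  assume "cis \<phi> = cis s"
  then have "ang s (cis \<phi>) = ang s (cis s)" by simp
  then show False
    using ang_cis[OF assms] assms by (simp add: ang_def Arg2pi_of_real[of 1, simplified])
qed

lemma ang_eq_Ln:
  assumes "y \<noteq> 0" "sgn y \<noteq> cis s"
  shows "ang s y = s + (Im (Ln (- (y / cis s))) + pi)"
  using Arg2pi_Ln[of "y / cis s"] cut_iff[OF assms(1), of s] assms(2) by (simp add: ang_def)

lemma open_cut_plane: "open {y. y \<noteq> 0 \<and> sgn y \<noteq> cis s}"
proof -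
  have "open (- {y. y / cis s \<in> \<real>\<^sub>\<ge>\<^sub>0})"
    by (intro open_Compl continuous_closed_vimage[of "\<real>\<^sub>\<ge>\<^sub>0" "\<lambda>y. y / cis s", unfolded vimage_def]) auto
  moreover have "y \<noteq> 0 \<and> sgn y \<noteq> cis s \<longleftrightarrow> y / cis s \<notin> \<real>\<^sub>\<ge>\<^sub>0" for y
  proof (cases "y = 0")
    case False
    have "y / cis s \<in> \<real>\<^sub>\<ge>\<^sub>0 \<longleftrightarrow> Arg2pi (y / cis s) = 0"
      by (auto simp: Arg2pi_eq_0 complex_nonneg_Reals_iff complex_is_Real_iff)
    then show ?thesis using False cut_iff[OF False, of s] Arg2pi_ge_0[of "y / cis s"] by auto
  qed simp
  ultimately show ?thesis by (simp add: Collect_neg_eq)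
qed

lemma smooth_on_ang:
  assumes "open S" "smooth_on f S" "\<And>x. x \<in> S \<Longrightarrow> f x \<noteq> 0 \<and> sgn (f x) \<noteq> cis s"
  shows "smooth_on (\<lambda>x. ang s (f x)) S"
proof -
  have "smooth_on (\<lambda>x. s + (Im (Ln (- (f x / cis s))) + pi)) S"
    using assms cut_nonpos_Reals
    by (intro smooth_on_add smooth_on_Im smooth_on_Ln smooth_on_minus smooth_on_divide smooth_on_const) auto
  then show ?thesis
    by (rule smooth_on_cong[OF _ assms(1)]) (use assms(3) ang_eq_Ln in blast)
qed

lemma has_vector_derivative_ang:
  assumes "(y has_vector_derivative y') (at t)" "y t \<noteq> 0" "sgn (y t) \<noteq> cis s"
  shows "((\<lambda>t. ang s (y t)) has_vector_derivative Im (y' / y t)) (at t)"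
proof -
  have "((\<lambda>z. Ln (- (z / cis s))) has_field_derivative 1 / y t) (at (y t))"
    using cut_nonpos_Reals[OF assms(2,3)] assms(2)
    by (auto intro!: derivative_eq_intros)
  from field_vector_diff_chain_at[OF assms(1) this]
  have "((\<lambda>t. Ln (- (y t / cis s))) has_vector_derivative y' / y t) (at t)"
    by (simp add: comp_def)
  then have "((\<lambda>t. s + (Im (Ln (- (y t / cis s))) + pi)) has_vector_derivative 0 + (Im (y' / y t) + 0)) (at t)"
    by (intro has_vector_derivative_add has_vector_derivative_const
          bounded_linear.has_vector_derivative[OF bounded_linear_Im])
  moreover have "\<forall>\<^sub>F r in nhds t. ang s (y r) = s + (Im (Ln (- (y r / cis s))) + pi)"
  proof -
    have "isCont y t" using assms(1) has_vector_derivative_continuous by blast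
    then have "(y \<longlongrightarrow> y t) (nhds t)"
      unfolding isCont_def by (rule tendsto_at_iff_tendsto_nhds[THEN iffD1])
    from topological_tendstoD[OF this open_cut_plane[of s]]
    have "\<forall>\<^sub>F r in nhds t. y r \<in> {y. y \<noteq> 0 \<and> sgn y \<noteq> cis s}" using assms by simp
    then show ?thesis by eventually_elim (simp add: ang_eq_Ln)
  qed
  ultimately show ?thesis by (subst has_vector_derivative_cong_nhds) simp_all
qed

context hyp_triangle
begin

section \<open>Geodesics of the double\<close>

definition chart_cont :: "3 \<Rightarrow> (real \<Rightarrow> dpoint) \<Rightarrow> real \<Rightarrow> bool" where
  "chart_cont i c t \<longleftrightarrow> (\<forall>\<^sub>F s in nhds t. c s \<in> dom i) \<and> isCont (\<lambda>s. crd i (c s)) t"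

lemma chart_cont_dom: "chart_cont i c t \<Longrightarrow> c t \<in> dom i"
  unfolding chart_cont_def using eventually_nhds_x_imp_x by fast

lemma chart_cont_curve:
  assumes "continuous_map (top_of_set I) (manifold_topology (double_atlas A)) c"
    and "open I" "t \<in> I" "c t \<in> dom i"
  shows "chart_cont i c t"
  using curve_continuousD[OF assms] by (auto simp: chart_cont_def elim: eventually_mono)

lemma chart_cont_trans:
  assumes "chart_cont i c t" "trans_map i j (c t) a b"
  shows "\<forall>\<^sub>F s in nhds t. c s \<in> dom j \<and> crd j (c s) = su a b (crd i (c s))" "chart_cont j c t"
proof -
  have P: "c t \<in> dom i" using assms(1) by (rule chart_cont_dom)
  note T = trans_mapD[OF assms(2) P]
  have c: "isCont (\<lambda>s. crd i (c s)) t" using assms(1) by (simp add: chart_cont_def)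
  then have lim: "((\<lambda>s. crd i (c s)) \<longlongrightarrow> crd i (c t)) (nhds t)"
    unfolding isCont_def by (rule tendsto_at_iff_tendsto_nhds[where g = "\<lambda>s. crd i (c s)", THEN iffD1])
  have "\<forall>\<^sub>F s in nhds t. c s \<in> dom i" using assms(1) by (simp add: chart_cont_def)
  with eventually_compose_filterlim[OF T(4) lim]
  show ev: "\<forall>\<^sub>F s in nhds t. c s \<in> dom j \<and> crd j (c s) = su a b (crd i (c s))"
  proof eventually_elim
    case (elim s)
    then obtain Q where Q: "Q \<in> dom i \<inter> dom j" "crd i Q = crd i (c s)" "crd j Q = su a b (crd i (c s))" by blast
    then have "Q = c s" using inj_onD[OF inj_crd[of i], of Q "c s"] elim by simp
    then show ?case using Q by simp
  qed
  have "isCont (su a b) (crd i (c t))" using su_DERIV[OF T(1) crd_ball[OF P]] by (rule DERIV_isCont)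
  then have "isCont (\<lambda>s. su a b (crd i (c s))) t" using isCont_o2[OF c] by blast
  moreover have "\<forall>\<^sub>F s in nhds t. crd j (c s) = su a b (crd i (c s))" using ev by eventually_elim simp
  ultimately have "isCont (\<lambda>s. crd j (c s)) t" using isCont_cong by fastforce
  then show "chart_cont j c t" using ev by (auto simp: chart_cont_def elim: eventually_mono)
qed

lemma velocity_chart:
  "c t \<in> dom i \<Longrightarrow> velocity (double_atlas A) c t (double_chart A i) = vector_derivative (\<lambda>s. crd i (c s)) (at t)"
  by (simp add: velocity_def comp_def)

lemma velocity_trans:
  assumes "chart_cont i c t" "trans_map i j (c t) a b" "((\<lambda>s. crd i (c s)) has_vector_derivative D) (at t)"
  shows "((\<lambda>s. crd j (c s)) has_vector_derivative su' a b (crd i (c t)) * D) (at t)"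
proof -
  have P: "c t \<in> dom i" using assms(1) by (rule chart_cont_dom)
  have "((\<lambda>s. su a b (crd i (c s))) has_vector_derivative su' a b (crd i (c t)) * D) (at t)"
    by (rule has_vector_derivative_su[OF trans_mapD(1)[OF assms(2) P] crd_ball[OF P] assms(3)])
  moreover have "\<forall>\<^sub>F s in nhds t. crd j (c s) = su a b (crd i (c s))"
    using chart_cont_trans(1)[OF assms(1,2)] by eventually_elim simp
  ultimately show ?thesis by (subst has_vector_derivative_cong_nhds)
qed

lemma velocity_tangent:
  assumes "chart_cont i c t" "(\<lambda>s. crd i (c s)) differentiable (at t)"
  shows "velocity (double_atlas A) c t \<in> tangent_space (double_atlas A) (c t)"
  unfolding tangent_space_iff
proof (intro conjI allI impI)
  fix j k assume jk: "c t \<in> dom j \<and> c t \<in> dom k"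
  have P: "c t \<in> dom i" using assms(1) by (rule chart_cont_dom)
  obtain a b where ab: "trans_map i j (c t) a b" using trans_mapE[of "c t" i j] P jk by auto
  obtain d e where de: "trans_map j k (c t) d e" using trans_mapE[of "c t" j k] jk by auto
  note vj = velocity_trans[OF assms(1) ab assms(2)[unfolded vector_derivative_works]]
  note vk = velocity_trans[OF chart_cont_trans(2)[OF assms(1) ab] de vj]
  show "velocity (double_atlas A) c t (double_chart A k) =
       frechet_derivative (crd k \<circ> inv_into (dom j) (crd j)) (at (crd j (c t)))
         (velocity (double_atlas A) c t (double_chart A j))"
    using jk trans_mapD(6)[OF de] vector_derivative_at[OF vj] vector_derivative_at[OF vk]
    by (simp add: velocity_chart)
qed (auto simp: velocity_def)

lemma disc_geodesic_trans:
  assumes "chart_cont i c t" "disc_geodesic_at (\<lambda>s. crd i (c s)) t" "c t \<in> dom j"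
  shows "chart_cont j c t" "disc_geodesic_at (\<lambda>s. crd j (c s)) t"
proof -
  have P: "c t \<in> dom i" using assms(1) by (rule chart_cont_dom)
  obtain a b where ab: "trans_map i j (c t) a b" using trans_mapE[OF P assms(3)] .
  show "chart_cont j c t" by (rule chart_cont_trans(2)[OF assms(1) ab])
  have "\<forall>\<^sub>F s in nhds t. crd j (c s) = su a b (crd i (c s))"
    using chart_cont_trans(1)[OF assms(1) ab] by eventually_elim simp
  then show "disc_geodesic_at (\<lambda>s. crd j (c s)) t"
    using disc_geodesic_at_su[OF assms(2) trans_mapD(1)[OF ab P]] by (rule disc_geodesic_at_cong)
qed

lemma curve_continuous_chart_cont:
  assumes "\<And>t. t \<in> I \<Longrightarrow> \<exists>i. chart_cont i c t"
  shows "continuous_map (top_of_set I) (manifold_topology (double_atlas A)) c"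
proof (rule curve_continuousI)
  fix t assume "t \<in> I"
  then obtain i where i: "chart_cont i c t" using assms by blast
  then have "\<forall>\<^sub>F s in at t within I. c s \<in> dom i"
    unfolding chart_cont_def eventually_at_filter by (auto elim: eventually_mono)
  moreover have "((\<lambda>s. crd i (c s)) \<longlongrightarrow> crd i (c t)) (at t within I)"
    using i unfolding chart_cont_def by (auto simp: isCont_def intro: tendsto_within_subset)
  ultimately show "\<exists>i. c t \<in> dom i \<and> (\<forall>\<^sub>F s in at t within I. c s \<in> dom i)
             \<and> ((\<lambda>s. crd i (c s)) \<longlongrightarrow> crd i (c t)) (at t within I)"
    using chart_cont_dom[OF i] by blast
qed

text \<open>The definition asks for the equation in every chart around the point. Since the equation
  is invariant under the transitions, one chart at each time is enough.\<close>

lemma geodesic_onI: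
  assumes "\<And>t. t \<in> I \<Longrightarrow> \<exists>i. chart_cont i c t \<and> disc_geodesic_at (\<lambda>s. crd i (c s)) t"
  shows "geodesic_on (double_atlas A) c I"
  unfolding geodesic_on_def
proof (intro conjI ballI)
  show "continuous_map (top_of_set I) (manifold_topology (double_atlas A)) c"
    using assms by (intro curve_continuous_chart_cont) blast
  fix ch assume "ch \<in> double_atlas A"
  then obtain j where j: "ch = double_chart A j" by (auto simp: double_atlas_iff)
  define c' where "c' s = vector_derivative (\<lambda>s. crd j (c s)) (at s)" for s
  define c'' where "c'' t = - 2 * cnj (crd j (c t)) * (c' t)\<^sup>2 / of_real (1 - (cmod (crd j (c t)))\<^sup>2)" for t
  have "(snd ch \<circ> c has_vector_derivative c' t) (at t) \<and>
            (c' has_vector_derivative c'' t) (at t) \<and>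
            (\<forall>w. poincare_metric (snd ch (c t)) (c'' t) w +
                 christoffel poincare_metric (snd ch (c t)) (c' t) (c' t) w = 0)"
    if t: "t \<in> I" "c t \<in> fst ch" for t
  proof -
    have "disc_geodesic_at (\<lambda>s. crd j (c s)) t"
      using assms[OF t(1)] disc_geodesic_trans(2) t(2) j by blast
    note g = disc_geodesic_atD[OF this]
    show ?thesis
      using g(4,5) geodesic_equation_iff[OF g(1), of "c'' t" "c' t"]
      by (simp add: j comp_def c'_def[abs_def] c''_def)
  qed
  then show "\<exists>c' c''. \<forall>t\<in>I. c t \<in> fst ch \<longrightarrow>
            (snd ch \<circ> c has_vector_derivative c' t) (at t) \<and>
            (c' has_vector_derivative c'' t) (at t) \<and>
            (\<forall>w. poincare_metric (snd ch (c t)) (c'' t) w +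
                 christoffel poincare_metric (snd ch (c t)) (c' t) (c' t) w = 0)"
    by blast
qed

lemma geodesic_onD:
  assumes "geodesic_on (double_atlas A) c I" "open I" "t \<in> I" "c t \<in> dom i"
  shows "chart_cont i c t" "disc_geodesic_at (\<lambda>s. crd i (c s)) t"
proof -
  have cont: "continuous_map (top_of_set I) (manifold_topology (double_atlas A)) c"
    using assms(1) by (simp add: geodesic_on_def)
  show cc: "chart_cont i c t" by (rule chart_cont_curve[OF cont assms(2-4)])
  obtain c' c'' where d: "\<And>t. t \<in> I \<Longrightarrow> c t \<in> dom i \<Longrightarrow>
        ((\<lambda>s. crd i (c s)) has_vector_derivative c' t) (at t) \<and>
        (c' has_vector_derivative c'' t) (at t) \<and>
        (\<forall>w. poincare_metric (crd i (c t)) (c'' t) w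
             + christoffel poincare_metric (crd i (c t)) (c' t) (c' t) w = 0)"
    using assms(1) double_chart_atlas[of i] unfolding geodesic_on_def comp_def by blast
  have ev: "\<forall>\<^sub>F s in nhds t. s \<in> I \<and> c s \<in> dom i"
    by (rule curve_continuousD(1)[OF cont assms(2-4)])
  have e1: "\<forall>\<^sub>F s in nhds t. (\<lambda>s. crd i (c s)) differentiable (at s)"
    using ev by eventually_elim (use d differentiableI_vector in blast)
  have e2: "\<forall>\<^sub>F s in nhds t. vector_derivative (\<lambda>s. crd i (c s)) (at s) = c' s"
    using ev by eventually_elim (use d vector_derivative_at in blast)
  have "c'' t = - 2 * cnj (crd i (c t)) * (c' t)\<^sup>2 / of_real (1 - (cmod (crd i (c t)))\<^sup>2)"
    using d[OF assms(3,4)] geodesic_equation_iff[OF crd_ball[OF assms(4)]] by blast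
  moreover have "(c' has_vector_derivative c'' t) (at t)" using d[OF assms(3,4)] by blast
  ultimately show "disc_geodesic_at (\<lambda>s. crd i (c s)) t"
    using e1 crd_ball[OF assms(4)] eventually_nhds_x_imp_x[OF e2] has_vector_derivative_cong_nhds[OF e2]
    by (simp add: disc_geodesic_at_def)
qed

text \<open>The geodesic is explicit: the isometry that takes 0 to \<open>z\<close> is applied to
  the unit speed ray in the direction \<open>e\<close>, and the chart is inverted as long as the
  curve stays in its open image. At 0 the isometry has derivative \<open>1 - |z|^2 = 2 |u|\<close>
  and the ray has velocity \<open>e / 2\<close>, which gives the initial vector
  \<open>u\<close>.\<close>

lemma geodesic_exists:
  assumes "v \<in> tangent_space (double_atlas A) P" "P \<in> dom i" "tangent_norm (double_atlas A) P v = 1"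
  obtains c \<delta> where "\<delta> > 0" "geodesic_on (double_atlas A) c {-\<delta><..<\<delta>}" "c 0 = P"
    "velocity (double_atlas A) c 0 = v"
    "\<And>t. t \<in> {-\<delta><..<\<delta>} \<Longrightarrow> (c t, velocity (double_atlas A) c t) \<in> unit_tangent_bundle (double_atlas A)"
proof -
  define z u where "z = crd i P" and "u = v (double_chart A i)"
  define e where "e = u / of_real (cmod u)"
  have z: "cmod z < 1" using crd_ball[OF assms(2)] by (simp add: z_def)
  then have N: "1 - (cmod z)\<^sup>2 > 0" by (simp add: abs_square_less_1)
  have u: "2 * cmod u = 1 - (cmod z)\<^sup>2"
    using assms(3) N unfolding tangent_norm_eq[OF assms(1,2)] by (simp add: z_def u_def)
  have e: "cmod e = 1" "u = of_real (cmod u) * e" using u N by (auto simp: e_def norm_divide)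
  define \<gamma> where "\<gamma> t = su 1 z (of_real (tanh (t / 2)) * e)" for t
  have ray: "disc_geodesic_at (\<lambda>t. of_real (tanh (t / 2)) * e) t" for t
    by (rule disc_geodesic_at_ray[OF e(1)])
  have g: "disc_geodesic_at \<gamma> t" for t
    unfolding \<gamma>_def by (rule disc_geodesic_at_su[OF ray]) (use z in simp)
  have g0: "\<gamma> 0 = z" by (simp add: \<gamma>_def su_def)
  have x: "cmod (of_real (tanh (t / 2)) * e) < 1" for t :: real
    unfolding norm_mult e(1) norm_of_real using tanh_real_lt_1[of "t / 2"] tanh_real_gt_neg1[of "t / 2"]
    by simp
  have gd: "(\<gamma> has_vector_derivative su' 1 z (of_real (tanh (t / 2)) * e) * (of_real ((1 - (tanh (t / 2))\<^sup>2) / 2) * e)) (at t)" for t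
    unfolding \<gamma>_def by (rule has_vector_derivative_su[OF _ x has_vector_derivative_ray]) (use z in simp)
  have unit: "2 * cmod (vector_derivative \<gamma> (at t)) = 1 - (cmod (\<gamma> t))\<^sup>2" for t
  proof -
    have "(tanh (t / 2))\<^sup>2 < 1" using tanh_real_lt_1[of "t / 2"] tanh_real_gt_neg1[of "t / 2"]
      by (simp add: abs_square_less_1)
    then have "2 * cmod (vector_derivative \<gamma> (at t)) =
        cmod (su' 1 z (of_real (tanh (t / 2)) * e)) * (1 - (tanh (t / 2))\<^sup>2)"
      unfolding vector_derivative_at[OF gd] norm_mult norm_of_real e(1) by simp
    also have "\<dots> = 1 - (cmod (\<gamma> t))\<^sup>2"
      unfolding \<gamma>_def using su'_norm[of z 1, OF _ x[of t]] z by (simp add: norm_mult e(1))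
    finally show ?thesis .
  qed
  note gd[of 0]
  moreover have "su' 1 z (of_real (tanh (0 / 2)) * e) * (of_real ((1 - (tanh (0 / 2))\<^sup>2) / 2) * e) = u"
  proof -
    have s0: "su' 1 z 0 = of_real (2 * cmod u)" unfolding u by (simp add: su'_def)
    have "su' 1 z (of_real (tanh (0 / 2)) * e) * (of_real ((1 - (tanh (0 / 2))\<^sup>2) / 2) * e) =
      su' 1 z 0 * (e / 2)" by simp
    also have "\<dots> = of_real (cmod u) * e" unfolding s0 by simp
    finally show ?thesis using e(2) by simp
  qed
  ultimately have gu: "(\<gamma> has_vector_derivative u) (at 0)" by simp
  have "(\<gamma> \<longlongrightarrow> \<gamma> 0) (nhds 0)"
    using disc_geodesic_atD(3)[OF g] unfolding isCont_def by (rule tendsto_at_iff_tendsto_nhds[THEN iffD1])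
  from topological_tendstoD[OF this open_crd_image[of i]]
  have "\<forall>\<^sub>F t in nhds 0. \<gamma> t \<in> crd i ` dom i"
    using assms(2) by (simp add: g0 z_def)
  then obtain \<delta> where \<delta>: "\<delta> > 0" "\<And>t. dist t 0 < \<delta> \<Longrightarrow> \<gamma> t \<in> crd i ` dom i"
    unfolding eventually_nhds_metric by blast
  define c where "c t = inv_into (dom i) (crd i) (\<gamma> t)" for t
  have c: "c t \<in> dom i" "crd i (c t) = \<gamma> t" if "t \<in> {-\<delta><..<\<delta>}" for t
    using \<delta>(2)[of t] that by (auto simp: c_def inv_into_into f_inv_into_f)
  have near: "\<forall>\<^sub>F s in nhds t. s \<in> {-\<delta><..<\<delta>}" if "t \<in> {-\<delta><..<\<delta>}" for t
    using that by (intro eventually_nhds_in_open) auto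
  have near_eq: "\<forall>\<^sub>F s in nhds t. crd i (c s) = \<gamma> s" if "t \<in> {-\<delta><..<\<delta>}" for t
    using near[OF that] by eventually_elim (rule c)
  have cc: "chart_cont i c t" if "t \<in> {-\<delta><..<\<delta>}" for t
  proof -
    have "isCont (\<lambda>s. crd i (c s)) t"
      using disc_geodesic_atD(3)[OF g] isCont_cong[OF near_eq[OF that]] by blast
    moreover have "\<forall>\<^sub>F s in nhds t. c s \<in> dom i" using near[OF that] by eventually_elim (rule c)
    ultimately show ?thesis by (simp add: chart_cont_def)
  qed
  have "geodesic_on (double_atlas A) c {-\<delta><..<\<delta>}"
    using cc disc_geodesic_at_cong[OF near_eq g] by (intro geodesic_onI) blast
  moreover have 0: "0 \<in> {-\<delta><..<\<delta>}" using \<delta> by simp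
  moreover have c0: "c 0 = P"
    using assms(2) g0 by (simp add: c_def z_def inv_into_f_f[OF inj_crd])
  moreover have "velocity (double_atlas A) c 0 = v"
  proof (rule tangent_eqI[OF _ assms(1,2)])
    have vd: "((\<lambda>s. crd i (c s)) has_vector_derivative u) (at 0)"
      using gu has_vector_derivative_cong_nhds[OF near_eq[OF 0]] by simp
    then show "velocity (double_atlas A) c 0 \<in> tangent_space (double_atlas A) P"
      using velocity_tangent[OF cc[OF 0] differentiableI_vector] c0 by simp
    show "velocity (double_atlas A) c 0 (double_chart A i) = v (double_chart A i)"
      using velocity_chart[of c 0 i] c0 assms(2) vector_derivative_at[OF vd] by (simp add: u_def)
  qed
  moreover have "(c t, velocity (double_atlas A) c t) \<in> unit_tangent_bundle (double_atlas A)"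
    if t: "t \<in> {-\<delta><..<\<delta>}" for t
  proof -
    have gt: "((\<lambda>s. crd i (c s)) has_vector_derivative vector_derivative \<gamma> (at t)) (at t)"
      using disc_geodesic_atD(4)[OF g] has_vector_derivative_cong_nhds[OF near_eq[OF t]] by simp
    have vt: "velocity (double_atlas A) c t \<in> tangent_space (double_atlas A) (c t)"
      by (rule velocity_tangent[OF cc[OF t] differentiableI_vector[OF gt]])
    have N: "1 - (cmod (\<gamma> t))\<^sup>2 > 0" using disc_geodesic_atD(1)[OF g, of t] by (simp add: abs_square_less_1)
    have "velocity (double_atlas A) c t (double_chart A i) = vector_derivative \<gamma> (at t)"
      using velocity_chart[of c t i] c(1)[OF t] vector_derivative_at[OF gt] by simp
    then have "tangent_norm (double_atlas A) (c t) (velocity (double_atlas A) c t) = 1"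
      unfolding tangent_norm_eq[OF vt c(1)[OF t]] c(2)[OF t] using unit[of t] N by simp
    then show ?thesis
      using vt c(1)[OF t] carrier_double unfolding unit_tangent_bundle_def by auto
  qed
  ultimately show ?thesis using that \<delta>(1) by blast
qed

section \<open>The geodesic field\<close>

abbreviation dvel :: "(real \<Rightarrow> dpoint) \<Rightarrow> real \<Rightarrow> (dpoint, complex) tangent" where
  "dvel \<equiv> velocity (double_atlas A)"

definition utb_chart :: "3 \<Rightarrow> real \<Rightarrow> (dpoint \<times> (dpoint, complex) tangent, complex \<times> real) chart" where
  "utb_chart i s = angular_chart {(p, v) \<in> unit_tangent_bundle (double_atlas A). p \<in> dom i}
        (\<lambda>(p, v). (crd i p, sgn (v (double_chart A i)))) s"

lemma utb_atlas_iff: "ch \<in> utb_atlas (double_atlas A) \<longleftrightarrow> (\<exists>i s. ch = utb_chart i s)"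
  unfolding utb_atlas_def utb_chart_def mem_Collect_eq double_atlas_def by blast

lemma snd_utb_chart: "snd (utb_chart i s) (P, v) = (crd i P, ang s (v (double_chart A i)))"
  by (simp add: utb_chart_def snd_angular_chart ang_sgn)

lemma fst_utb_chart: "(P, v) \<in> fst (utb_chart i s) \<longleftrightarrow>
   (P, v) \<in> unit_tangent_bundle (double_atlas A) \<and> P \<in> dom i \<and> sgn (v (double_chart A i)) \<noteq> cis s"
  by (simp add: utb_chart_def fst_angular_chart)

lemma unit_tangent_bundle_iff:
  "(P, v) \<in> unit_tangent_bundle (double_atlas A) \<longleftrightarrow>
     (\<exists>i. P \<in> dom i) \<and> v \<in> tangent_space (double_atlas A) P \<and> tangent_norm (double_atlas A) P v = 1"
  by (auto simp: unit_tangent_bundle_def carrier_double)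

lemma unit_tangent_norm:
  assumes "(P, v) \<in> unit_tangent_bundle (double_atlas A)" "P \<in> dom i"
  shows "2 * cmod (v (double_chart A i)) = 1 - (cmod (crd i P))\<^sup>2" "v (double_chart A i) \<noteq> 0"
proof -
  have N: "1 - (cmod (crd i P))\<^sup>2 > 0" using crd_ball[OF assms(2)] by (simp add: abs_square_less_1)
  have "2 * cmod (v (double_chart A i)) / (1 - (cmod (crd i P))\<^sup>2) = 1"
    using assms(1) by (simp only: tangent_norm_eq[OF _ assms(2), symmetric] unit_tangent_bundle_iff)
  with N show "2 * cmod (v (double_chart A i)) = 1 - (cmod (crd i P))\<^sup>2" by (simp add: divide_eq_1_iff)
  with N have "cmod (v (double_chart A i)) > 0" by linarith
  then show "v (double_chart A i) \<noteq> 0" by simp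
qed

text \<open>The geodesic spray in the coordinates \<open>(z, \<phi>)\<close>: unit speed means
  \<open>|z'| = (1 - |z|^2) / 2\<close>, and \<open>\<phi>' = Im (z'' / z')\<close> with
  \<open>z''\<close> taken from the geodesic equation.\<close>

definition field_coord :: "complex \<times> real \<Rightarrow> complex \<times> real" where
  "field_coord = (\<lambda>(z, \<phi>). (of_real ((1 - (cmod z)\<^sup>2) / 2) * cis \<phi>, - Im (cnj z * cis \<phi>)))"

lemma lift_derivative:
  assumes "disc_geodesic_at (\<lambda>s. crd i (c s)) 0" "chart_cont i c 0"
    and "(c 0, dvel c 0) \<in> fst (utb_chart i s)"
  shows "((\<lambda>t. snd (utb_chart i s) (c t, dvel c t)) has_vector_derivative
     field_coord (snd (utb_chart i s) (c 0, dvel c 0))) (at 0)"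
proof -
  note g = disc_geodesic_atD[OF assms(1)]
  define u where "u = vector_derivative (\<lambda>s. crd i (c s)) (at 0)"
  have P: "c 0 \<in> dom i" using assms(2) by (rule chart_cont_dom)
  have vu: "dvel c 0 (double_chart A i) = u" using velocity_chart[of c 0 i] P by (simp add: u_def)
  have U: "(c 0, dvel c 0) \<in> unit_tangent_bundle (double_atlas A)" "sgn u \<noteq> cis s"
    using assms(3) by (auto simp: fst_utb_chart vu)
  have u: "2 * cmod u = 1 - (cmod (crd i (c 0)))\<^sup>2" "u \<noteq> 0"
    using unit_tangent_norm[OF U(1) P] by (simp_all add: vu)
  define z where "z = crd i (c 0)"
  have uc: "u = of_real ((1 - (cmod z)\<^sup>2) / 2) * cis (ang s u)"
  proof -
    have "(1 - (cmod z)\<^sup>2) / 2 = cmod u" using u(1) by (simp add: z_def)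
    then show ?thesis unfolding cis_ang[OF u(2)] using u(2) by (simp add: sgn_eq)
  qed
  have im: "Im (- 2 * cnj z * u\<^sup>2 / of_real (1 - (cmod z)\<^sup>2) / u) = - Im (cnj z * cis (ang s u))"
  proof -
    have "complex_of_real (1 - (cmod z)\<^sup>2) = of_real (2 * cmod u)" using u(1) by (simp only: z_def)
    moreover have "u / of_real (cmod u) = cis (ang s u)" unfolding cis_ang[OF u(2)] by (simp add: sgn_eq)
    moreover have "- 2 * cnj z * u\<^sup>2 / of_real (2 * cmod u) / u = - (cnj z * (u / of_real (cmod u)))"
      using u(2) by (simp add: field_simps power2_eq_square)
    ultimately show ?thesis by simp
  qed
  have "((\<lambda>t. (crd i (c t), ang s (vector_derivative (\<lambda>s. crd i (c s)) (at t)))) has_vector_derivative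
    (u, Im (- 2 * cnj z * u\<^sup>2 / of_real (1 - (cmod z)\<^sup>2) / u))) (at 0)"
    using has_vector_derivative_Pair[OF g(4) has_vector_derivative_ang[OF g(5)]] u(2) U(2)
    by (simp add: u_def z_def)
  moreover have "\<forall>\<^sub>F t in nhds 0. snd (utb_chart i s) (c t, dvel c t) =
      (crd i (c t), ang s (vector_derivative (\<lambda>s. crd i (c s)) (at t)))"
  proof -
    have "\<forall>\<^sub>F t in nhds 0. c t \<in> dom i" using assms(2) by (simp add: chart_cont_def)
    then show ?thesis by eventually_elim (simp add: snd_utb_chart velocity_chart)
  qed
  moreover have "field_coord (snd (utb_chart i s) (c 0, dvel c 0)) =
     (u, Im (- 2 * cnj z * u\<^sup>2 / of_real (1 - (cmod z)\<^sup>2) / u))"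
    unfolding snd_utb_chart vu im field_coord_def prod.case z_def[symmetric] uc[symmetric] ..
  ultimately show ?thesis by (subst has_vector_derivative_cong_nhds) simp_all
qed

text \<open>The velocity of the lifted curve at time 0 involves the second derivative of the
  geodesic there, which the equation expresses by the initial vector
  (\<open>lift_derivative\<close>). All geodesics with this initial vector thus give the same value,
  which is the uniqueness that \<open>THE\<close> demands.\<close>

lemma geodesic_field_eq:
  assumes "geodesic_on (double_atlas A) c {-\<delta><..<\<delta>}" "\<delta> > 0"
    and U: "(c 0, dvel c 0) \<in> unit_tangent_bundle (double_atlas A)"
  shows "geodesic_field (double_atlas A) (c 0, dvel c 0) =
     velocity (utb_atlas (double_atlas A)) (\<lambda>t. (c t, dvel c t)) 0"
  unfolding geodesic_field_def
proof (rule the_equality)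
  show "\<exists>d \<delta>. 0 < \<delta> \<and> geodesic_on (double_atlas A) d {- \<delta><..<\<delta>} \<and> (d 0, dvel d 0) = (c 0, dvel c 0) \<and>
     velocity (utb_atlas (double_atlas A)) (\<lambda>t. (c t, dvel c t)) 0 =
     velocity (utb_atlas (double_atlas A)) (\<lambda>t. (d t, dvel d t)) 0"
    using assms by blast
  have val: "velocity (utb_atlas (double_atlas A)) (\<lambda>t. (d t, dvel d t)) 0 ch =
     (if ch \<in> utb_atlas (double_atlas A) \<and> (c 0, dvel c 0) \<in> fst ch
      then field_coord (snd ch (c 0, dvel c 0)) else 0)"
    if d: "geodesic_on (double_atlas A) d {- \<eta><..<\<eta>}" "0 < \<eta>" "(d 0, dvel d 0) = (c 0, dvel c 0)" for d \<eta> ch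
  proof (cases "ch \<in> utb_atlas (double_atlas A) \<and> (c 0, dvel c 0) \<in> fst ch")
    case True
    then obtain i s where ch: "ch = utb_chart i s" by (auto simp: utb_atlas_iff)
    have P: "d 0 \<in> dom i" using True d(3) by (simp add: ch fst_utb_chart)
    have g: "disc_geodesic_at (\<lambda>s. crd i (d s)) 0" "chart_cont i d 0"
      using geodesic_onD[OF d(1) _ _ P] d(2) by auto
    have "((\<lambda>t. snd ch (d t, dvel d t)) has_vector_derivative field_coord (snd ch (d 0, dvel d 0))) (at 0)"
      unfolding ch by (rule lift_derivative[OF g]) (use True d(3) ch in simp)
    then show ?thesis
      using True d(3) 
      by (simp add: velocity_def[of "utb_atlas (double_atlas A)"] comp_def vector_derivative_at)
  next
    case False
    then show ?thesis using d(3) by (auto simp: velocity_def[of "utb_atlas (double_atlas A)"])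
  qed
  fix X
  assume "\<exists>d \<delta>. 0 < \<delta> \<and> geodesic_on (double_atlas A) d {- \<delta><..<\<delta>} \<and> (d 0, dvel d 0) = (c 0, dvel c 0) \<and>
     X = velocity (utb_atlas (double_atlas A)) (\<lambda>t. (d t, dvel d t)) 0"
  then obtain d \<eta> where d: "0 < \<eta>" "geodesic_on (double_atlas A) d {- \<eta><..<\<eta>}" "(d 0, dvel d 0) = (c 0, dvel c 0)"
     "X = velocity (utb_atlas (double_atlas A)) (\<lambda>t. (d t, dvel d t)) 0" by blast
  show "X = velocity (utb_atlas (double_atlas A)) (\<lambda>t. (c t, dvel c t)) 0"
    unfolding d(4) by (rule ext) (simp only: val[OF d(2,1,3)] val[OF assms(1,2) refl])
qed

end

section \<open>A monotonicity criterion with a Dini derivative\<close>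

text \<open>Stated with upper right difference quotients because it is applied to a curve folded
  into the triangle, which need not be differentiable when it meets a side.\<close>

lemma dini_nonincreasing:
  fixes h :: "real \<Rightarrow> real"
  assumes ab: "a \<le> b" and cont: "continuous_on {a..b} h" and K: "finite K"
    and D: "\<And>t e. t \<in> {a..<b} - K \<Longrightarrow> e > 0 \<Longrightarrow> \<forall>\<^sub>F s in at_right t. h s - h t \<le> e * (s - t)"
  shows "h b \<le> h a"
proof -
  have "h b \<le> h a + e * (b - a) + e * real (card K)" if e: "e > 0" for e
  proof -
    \<comment> \<open>A barrier with slope \<open>e\<close> and a jump \<open>e\<close> just after
      each point of \<open>K\<close>. At an exceptional time only continuity of \<open>h\<close> is
      known, and the jump leaves room for it.\<close>
    define \<phi> where "\<phi> s = h a + e * (s - a) + e * real (card (K \<inter> {..<s}))" for s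
    have mono: "\<phi> r + e * (s - r) \<le> \<phi> s" if "r \<le> s" for r s
    proof -
      have "card (K \<inter> {..<r}) \<le> card (K \<inter> {..<s})"
        using that K by (intro card_mono) auto
      then show ?thesis using e by (simp add: \<phi>_def algebra_simps)
    qed
    have mono': "\<phi> r \<le> \<phi> s" if "r \<le> s" for r s
    proof -
      have "e * (s - r) \<ge> 0" using e that by simp
      then show ?thesis using mono[OF that] by linarith
    qed
    define T where "T = {s \<in> {a..b}. \<forall>r\<in>{a..s}. h r \<le> \<phi> r}"
    have aT: "a \<in> T" using ab e by (auto simp: T_def \<phi>_def)
    have bdd: "bdd_above T" by (auto simp: T_def)
    define m where "m = Sup T"
    have m: "a \<le> m" "m \<le> b"
    proof -
      show "a \<le> m" unfolding m_def using aT bdd by (rule cSup_upper)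
      show "m \<le> b" unfolding m_def using aT by (intro cSup_least) (auto simp: T_def)
    qed
    have below: "h r \<le> \<phi> r" if "a \<le> r" "r < m" for r
    proof -
      obtain s where "s \<in> T" "r < s"
        using less_cSupE[of r T] \<open>r < m\<close> aT unfolding m_def by blast
      then show ?thesis using that by (auto simp: T_def)
    qed
    have hm: "h m \<le> \<phi> m"
    proof (rule ccontr)
      assume "\<not> h m \<le> \<phi> m"
      then have gt: "h m > \<phi> m" by simp
      then have "a < m" using aT m by (cases "m = a") (auto simp: T_def)
      have "(h \<longlongrightarrow> h m) (at m within {a..b})"
        using cont m by (auto simp: continuous_on_def)
      from order_tendstoD(1)[OF this gt]
      obtain d where d: "d > 0" "\<And>x. x \<in> {a..b} \<Longrightarrow> x \<noteq> m \<Longrightarrow> dist x m < d \<Longrightarrow> \<phi> m < h x"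
        unfolding eventually_at by blast
      define r where "r = max a (m - d / 2)"
      have r: "a \<le> r" "r < m" "dist r m < d" using \<open>a < m\<close> d(1) by (auto simp: r_def dist_real_def)
      then have "\<phi> m < h r" using d(2)[of r] m by auto
      moreover have "h r \<le> \<phi> r" using below r by simp
      moreover have "\<phi> r \<le> \<phi> m" using mono' r by simp
      ultimately show False by simp
    qed
    have "m = b"
    proof (rule ccontr)
      assume "m \<noteq> b"
      then have mb: "m < b" using m by simp
      have "\<forall>\<^sub>F s in at_right m. h s \<le> \<phi> s"
      proof (cases "m \<in> K")
        case False
        then have "\<forall>\<^sub>F s in at_right m. h s - h m \<le> e * (s - m)"
          using D[of m e] m mb e by simp
        moreover have "\<forall>\<^sub>F s in at_right m. m < s" by (rule eventually_at_right_less)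
        ultimately show ?thesis
        proof eventually_elim
          case (elim s)
          then show ?case using hm mono[of m s] by simp
        qed
      next
        case True
        have "(h \<longlongrightarrow> h m) (at m within {a..b})"
          using cont m by (auto simp: continuous_on_def)
        then have "(h \<longlongrightarrow> h m) (at m within {m..b})"
          by (rule tendsto_within_subset) (use m in auto)
        then have "(h \<longlongrightarrow> h m) (at_right m)"
          using at_within_Icc_at_right[OF mb] by simp
        then have "\<forall>\<^sub>F s in at_right m. h s < h m + e"
          by (rule order_tendstoD(2)) (use e in simp)
        moreover have "\<forall>\<^sub>F s in at_right m. m < s" by (rule eventually_at_right_less)
        ultimately show ?thesis
        proof eventually_elim
          case (elim s)
          have "card (insert m (K \<inter> {..<m})) \<le> card (K \<inter> {..<s})"
            using True elim K by (intro card_mono) auto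
          then have "real (card (K \<inter> {..<m})) + 1 \<le> real (card (K \<inter> {..<s}))"
            using K by simp
          then have "e * (real (card (K \<inter> {..<m})) + 1) \<le> e * real (card (K \<inter> {..<s}))"
            using e by (intro mult_left_mono) auto
          moreover have "e * (s - m) \<ge> 0" using elim e by simp
          ultimately have "\<phi> m + e \<le> \<phi> s" by (simp add: \<phi>_def algebra_simps)
          then show ?case using elim hm by simp
        qed
      qed
      then obtain d where d: "d > m" "\<And>s. m < s \<Longrightarrow> s < d \<Longrightarrow> h s \<le> \<phi> s"
        unfolding eventually_at_right_field by blast
      define s where "s = min b ((m + d) / 2)"
      have s: "m < s" "s < d" "s \<le> b" using mb d(1) by (auto simp: s_def min_less_iff_disj)
      have "h r \<le> \<phi> r" if "r \<in> {a..s}" for r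
        using that below[of r] hm d(2)[of r] s by (cases r m rule: linorder_cases) auto
      then have "s \<in> T" using s m by (auto simp: T_def)
      then have "s \<le> m" using bdd unfolding m_def by (rule cSup_upper)
      then show False using s by simp
    qed
    then have "h b \<le> \<phi> b" using hm by simp
    moreover have "real (card (K \<inter> {..<b})) \<le> real (card K)" using K by (simp add: card_mono)
    moreover from calculation(2) have "e * real (card (K \<inter> {..<b})) \<le> e * real (card K)"
      using e by (intro mult_left_mono) auto
    ultimately show ?thesis unfolding \<phi>_def by linarith
  qed
  then have *: "h b - h a \<le> e * ((b - a) + real (card K))" if "e > 0" for e
    using that by (force simp: algebra_simps)
  show ?thesis
  proof (rule ccontr)
    assume "\<not> h b \<le> h a"
    define C where "C = (b - a) + real (card K) + 1"
    have C: "C > 0" using ab by (simp add: C_def)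
    define e where "e = (h b - h a) / (2 * C)"
    have e: "e > 0" using \<open>\<not> h b \<le> h a\<close> C by (simp add: e_def)
    have "h b - h a \<le> e * ((b - a) + real (card K))" using *[OF e] .
    also have "\<dots> \<le> e * C" using e by (intro mult_left_mono) (auto simp: C_def)
    also have "\<dots> = (h b - h a) / 2" using C by (simp add: e_def)
    finally show False using \<open>\<not> h b \<le> h a\<close> by simp
  qed
qed

section \<open>The hyperbolic distance to a point\<close>

text \<open>The distance \<open>2 artanh |y|\<close> from 0 has a gradient of length 1 in the
  Poincare metric, so it changes at most with the speed of the curve. The Euclidean part is
  Cauchy-Schwarz.\<close>

lemma artanh_norm_has_derivative:
  fixes y :: "real \<Rightarrow> complex"
  assumes "(y has_vector_derivative y') (at t)" "cmod (y t) < 1" "y t \<noteq> 0"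
  obtains D where "((\<lambda>s. 2 * artanh (cmod (y s))) has_real_derivative D) (at t)"
    "\<bar>D\<bar> \<le> 2 * cmod y' / (1 - (cmod (y t))\<^sup>2)"
proof -
  define n where "n = y' \<bullet> sgn (y t)"
  have "\<bar>n\<bar> \<le> cmod y' * cmod (sgn (y t))" unfolding n_def by (rule Cauchy_Schwarz_ineq2)
  then have n: "\<bar>n\<bar> \<le> cmod y'" using assms(3) by (simp add: norm_sgn)
  have N: "1 - (cmod (y t))\<^sup>2 > 0" using assms(2) by (simp add: abs_square_less_1)
  have "((\<lambda>s. cmod (y s)) has_derivative (\<lambda>h. (h *\<^sub>R y') \<bullet> sgn (y t))) (at t)"
    using has_derivative_compose[OF assms(1)[unfolded has_vector_derivative_def] has_derivative_norm[OF assms(3)]] .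
  then have "((\<lambda>s. cmod (y s)) has_real_derivative n) (at t)"
    by (simp add: has_field_derivative_def n_def mult.commute[of _ n] inner_scaleR_left mult_commute_abs)
  from DERIV_chain2[OF artanh_real_has_field_derivative this]
  have "((\<lambda>s. artanh (cmod (y s))) has_real_derivative 1 / (1 - (cmod (y t))\<^sup>2) * n) (at t)"
    using assms(2) by simp
  from DERIV_cmult[OF this, of 2]
  have "((\<lambda>s. 2 * artanh (cmod (y s))) has_real_derivative 2 * n / (1 - (cmod (y t))\<^sup>2)) (at t)"
    by simp
  moreover have "\<bar>2 * n / (1 - (cmod (y t))\<^sup>2)\<bar> \<le> 2 * cmod y' / (1 - (cmod (y t))\<^sup>2)"
    using N n by (simp add: abs_mult divide_right_mono)
  ultimately show ?thesis using that by blast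
qed

lemma tendsto_nhds_isCont: "isCont f t \<longleftrightarrow> (f \<longlongrightarrow> f t) (nhds t)"
  unfolding isCont_def by (rule tendsto_at_iff_tendsto_nhds)

lemma eventually_ball_isCont:
  "isCont \<gamma> t \<Longrightarrow> cmod (\<gamma> t) < 1 \<Longrightarrow> \<forall>\<^sub>F s in nhds t. cmod (\<gamma> s) < 1"
  unfolding tendsto_nhds_isCont using topological_tendstoD[of \<gamma> "\<gamma> t" "nhds t" "ball 0 1"] by simp

context hyp_triangle
begin

definition hdist :: "3 \<Rightarrow> complex \<Rightarrow> real" where
  "hdist k z = 2 * artanh (cmod (su 1 (- A k) z))"

lemma rho_form:
  obtains a b where "cmod b < cmod a" "\<And>x. cmod x < 1 \<Longrightarrow> rho i c x = su a b (if c then cnj x else x)"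
proof (cases c)
  case True
  then show ?thesis using refl_su[of i] that by (auto simp: rho_def)
next
  case False
  then show ?thesis by (intro that[of 0 1]) (auto simp: rho_def su_def)
qed

lemma rho_vector_derivative:
  assumes "(\<gamma> has_vector_derivative v) (at t)" "cmod (\<gamma> t) < 1"
  obtains v' where "((\<lambda>s. rho i c (\<gamma> s)) has_vector_derivative v') (at t)"
    "cmod v' * (1 - (cmod (\<gamma> t))\<^sup>2) = cmod v * (1 - (cmod (rho i c (\<gamma> t)))\<^sup>2)"
proof -
  obtain a b where ab: "cmod b < cmod a" "\<And>x. cmod x < 1 \<Longrightarrow> rho i c x = su a b (if c then cnj x else x)"
    using rho_form by blast
  define \<eta> where "\<eta> s = (if c then cnj (\<gamma> s) else \<gamma> s)" for s
  define w where "w = (if c then cnj v else v)"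
  have \<eta>: "(\<eta> has_vector_derivative w) (at t)" "cmod (\<eta> t) < 1"
    using assms has_vector_derivative_cnj[OF assms(1)] by (auto simp: \<eta>_def[abs_def] w_def)
  have "isCont \<gamma> t" using assms(1) has_vector_derivative_continuous by blast
  then have "\<forall>\<^sub>F s in nhds t. cmod (\<gamma> s) < 1" using assms(2) by (rule eventually_ball_isCont)
  then have "\<forall>\<^sub>F s in nhds t. rho i c (\<gamma> s) = su a b (\<eta> s)"
    by eventually_elim (simp add: ab(2) \<eta>_def)
  then have "((\<lambda>s. rho i c (\<gamma> s)) has_vector_derivative su' a b (\<eta> t) * w) (at t)"
    using has_vector_derivative_su[OF ab(1) \<eta>(2,1)] by (subst has_vector_derivative_cong_nhds)
  moreover have "cmod (su' a b (\<eta> t) * w) * (1 - (cmod (\<gamma> t))\<^sup>2) = cmod v * (1 - (cmod (rho i c (\<gamma> t)))\<^sup>2)"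
  proof -
    have "rho i c (\<gamma> t) = su a b (\<eta> t)" using ab(2) assms(2) by (simp add: \<eta>_def)
    then have "1 - (cmod (rho i c (\<gamma> t)))\<^sup>2 = cmod (su' a b (\<eta> t)) * (1 - (cmod (\<eta> t))\<^sup>2)"
      using su'_norm[OF ab(1) \<eta>(2)] by simp
    then show ?thesis by (simp add: \<eta>_def w_def norm_mult)
  qed
  ultimately show ?thesis using that by blast
qed

lemma hdist_has_derivative:
  assumes "(\<gamma> has_vector_derivative v) (at t)" "cmod (\<gamma> t) < 1" "rho i c (\<gamma> t) \<noteq> A k"
  obtains D where "((\<lambda>s. hdist k (rho i c (\<gamma> s))) has_real_derivative D) (at t)"
    "\<bar>D\<bar> \<le> 2 * cmod v / (1 - (cmod (\<gamma> t))\<^sup>2)"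
proof -
  obtain v' where v': "((\<lambda>s. rho i c (\<gamma> s)) has_vector_derivative v') (at t)"
    "cmod v' * (1 - (cmod (\<gamma> t))\<^sup>2) = cmod v * (1 - (cmod (rho i c (\<gamma> t)))\<^sup>2)"
    using rho_vector_derivative[OF assms(1,2)] by blast
  define x where "x = rho i c (\<gamma> t)"
  have x: "cmod x < 1" using rho_ball assms(2) by (simp add: x_def)
  have gap: "cmod (- A k) < cmod 1" using A_ball[of k] by simp
  define y where "y s = su 1 (- A k) (rho i c (\<gamma> s))" for s
  have y: "(y has_vector_derivative su' 1 (- A k) x * v') (at t)"
    unfolding y_def x_def by (rule has_vector_derivative_su[OF gap _ v'(1)]) (use x in \<open>simp add: x_def\<close>)
  have yt: "cmod (y t) < 1" unfolding y_def by (rule su_in_ball[OF gap]) (use x in \<open>simp add: x_def\<close>)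
  have "y t \<noteq> 0"
  proof
    assume "y t = 0"
    then have "su 1 (A k) (y t) = A k" by (simp add: su_def)
    then have "x = A k" using mob_inverse(1)[OF A_ball[of k] x] by (simp add: y_def x_def)
    then show False using assms(3) by (simp add: x_def)
  qed
  from artanh_norm_has_derivative[OF y yt this]
  obtain D where D: "((\<lambda>s. 2 * artanh (cmod (y s))) has_real_derivative D) (at t)"
    "\<bar>D\<bar> \<le> 2 * cmod (su' 1 (- A k) x * v') / (1 - (cmod (y t))\<^sup>2)" by blast
  have N: "1 - (cmod x)\<^sup>2 > 0" "1 - (cmod (\<gamma> t))\<^sup>2 > 0" using x assms(2) by (simp_all add: abs_square_less_1)
  have "1 - (cmod (y t))\<^sup>2 = cmod (su' 1 (- A k) x) * (1 - (cmod x)\<^sup>2)"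
    using su'_norm[OF gap x] by (simp add: y_def x_def)
  then have "2 * cmod (su' 1 (- A k) x * v') / (1 - (cmod (y t))\<^sup>2) = 2 * cmod v' / (1 - (cmod x)\<^sup>2)"
    using su'_nonzero[OF gap x] by (simp add: norm_mult)
  also have "\<dots> = 2 * cmod v / (1 - (cmod (\<gamma> t))\<^sup>2)"
    using v'(2) N by (simp add: x_def[symmetric] field_simps)
  finally show ?thesis using D that unfolding y_def hdist_def by simp
qed

lemma hdist_continuous: "continuous_on (ball 0 1) (hdist k)"
proof -
  have "continuous_on (ball 0 1) (su 1 (- A k))"
    using su_DERIV[of "- A k" 1] A_ball[of k]
    by (intro continuous_at_imp_continuous_on ballI DERIV_isCont) auto
  moreover have "- 1 < cmod w" for w using norm_ge_zero[of w] by linarith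
  ultimately show ?thesis
    unfolding hdist_def
    using su_in_ball[of "- A k" 1] A_ball[of k]
    by (intro continuous_on_mult continuous_on_const continuous_on_norm
          continuous_on_compose2[OF continuous_on_artanh[OF order_refl]])
       auto
qed

lemma hdist_self: "hdist k (A k) = 0"
  by (simp add: hdist_def su_def)

section \<open>The distance to a cone point\<close>

text \<open>The distance \<open>g\<close> of the folded curve from \<open>A k\<close> decreases at
  most at the rate \<open>\<sigma>\<close>, the speed of the curve. Hence \<open>- g - S\<close>,
  where \<open>S\<close> is the length so far, has upper right derivatives at most 0; the error
  \<open>e\<close> is shared between the quotients of \<open>g\<close> and of
  \<open>S\<close>.\<close>

lemma length_lower_bound:
  assumes K: "finite K" and c: "continuous_map (top_of_set {0..1}) (double_topology A) c"
    and C1: "C1_curve_on (double_atlas A) c ({0<..<1} - K)"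
    and L: "((\<lambda>t. tangent_norm (double_atlas A) (c t) (dvel c t)) has_integral L) {0..1}"
  shows "hdist k (fold_point (c 0)) \<le> hdist k (fold_point (c 1)) + L"
proof -
  define \<sigma> where "\<sigma> t = tangent_norm (double_atlas A) (c t) (dvel c t)" for t
  define S where "S t = integral {0..t} \<sigma>" for t
  define g where "g t = hdist k (fold_point (c t))" for t
  define I where "I = {0<..<1} - K"
  have I: "open I" unfolding I_def using K by (intro open_Diff finite_imp_closed) auto
  have \<sigma>: "\<sigma> integrable_on {0..1}" using L by (auto simp: \<sigma>_def[abs_def] integrable_on_def)
  have cont: "continuous_map (top_of_set I) (manifold_topology (double_atlas A)) c"
    using C1 by (simp add: C1_curve_on_def I_def)
  have fold: "cmod (fold_point (c t)) < 1" if "t \<in> {0..1}" for t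
  proof -
    have "c t \<in> double A" using continuous_map_image_subset_topspace[OF c] that by auto
    then show ?thesis by (auto elim!: double_glueE simp: triangle_iff)
  qed
  have gcont: "continuous_on {0..1} g"
    unfolding g_def using fold
    by (intro continuous_on_compose2[OF hdist_continuous continuous_fold[OF c]]) auto
  have Scont: "continuous_on {0..1} S" unfolding S_def by (rule indefinite_integral_continuous_1[OF \<sigma>])
  have "- g 1 - S 1 \<le> - g 0 - S 0"
  proof (rule dini_nonincreasing[of 0 1 "\<lambda>t. - g t - S t" "insert 0 K"])
    show "continuous_on {0..1} (\<lambda>t. - g t - S t)" by (intro continuous_intros gcont Scont)
    fix t e :: real assume t: "t \<in> {0..<1} - insert 0 K" and e: "e > 0"
    then have tI: "t \<in> I" by (auto simp: I_def)
    obtain i where P: "c t \<in> dom i" using curve_in_carrier[OF cont tI] by blast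
    define z where "z s = crd i (c s)" for s
    have ev: "\<forall>\<^sub>F s in nhds t. s \<in> I \<and> c s \<in> dom i" by (rule curve_continuousD(1)[OF cont I tI P])
    have cc: "chart_cont i c s" if "s \<in> I" "c s \<in> dom i" for s
      by (rule chart_cont_curve[OF cont I that])
    have "(snd (double_chart A i) \<circ> c) C1_differentiable_on {t \<in> I. c t \<in> dom i}"
      using C1 double_chart_atlas[of i] unfolding C1_curve_on_def I_def by blast
    then obtain D where D: "\<And>s. s \<in> I \<Longrightarrow> c s \<in> dom i \<Longrightarrow> (z has_vector_derivative D s) (at s)"
      "continuous_on {t \<in> I. c t \<in> dom i} D"
      by (auto simp: C1_differentiable_on_def z_def[abs_def] comp_def)
    have z: "cmod (z s) < 1" if "c s \<in> dom i" for s using crd_ball[OF that] by (simp add: z_def)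
    have \<sigma>eq: "\<sigma> s = 2 * cmod (D s) / (1 - (cmod (z s))\<^sup>2)" if "s \<in> I" "c s \<in> dom i" for s
    proof -
      have "dvel c s \<in> tangent_space (double_atlas A) (c s)"
        using velocity_tangent[OF cc[OF that] differentiableI_vector] D(1)[OF that] by (simp add: z_def[abs_def])
      moreover have "dvel c s (double_chart A i) = D s"
        using velocity_chart[of c s i] that vector_derivative_at[OF D(1)[OF that]] by (simp add: z_def[abs_def])
      ultimately show ?thesis using tangent_norm_eq[of "dvel c s" "c s" i] that by (simp add: \<sigma>_def z_def)
    qed
    have open_dom: "open {t \<in> I. c t \<in> dom i}"
    proof (subst open_subopen, intro ballI)
      fix s assume "s \<in> {t \<in> I. c t \<in> dom i}"
      then have "\<forall>\<^sub>F r in nhds s. r \<in> {t \<in> I. c t \<in> dom i}"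
        using curve_continuousD(1)[OF cont I, of s i] by simp
      then show "\<exists>T. open T \<and> s \<in> T \<and> T \<subseteq> {t \<in> I. c t \<in> dom i}"
        unfolding eventually_nhds by blast
    qed
    have "isCont D t" using D(2) open_dom tI P by (simp add: continuous_on_eq_continuous_at)
    moreover have zt: "isCont z t" using D(1)[OF tI P] has_vector_derivative_continuous by blast
    moreover have "1 - (cmod (z t))\<^sup>2 \<noteq> 0" using z[OF P] by (simp add: abs_square_eq_1)
    ultimately have "isCont (\<lambda>s. 2 * cmod (D s) / (1 - (cmod (z s))\<^sup>2)) t"
      by (intro continuous_intros)
    moreover have "\<forall>\<^sub>F s in nhds t. \<sigma> s = 2 * cmod (D s) / (1 - (cmod (z s))\<^sup>2)"
      using ev by eventually_elim (simp add: \<sigma>eq)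
    ultimately have \<sigma>c: "isCont \<sigma> t" by (subst isCont_cong)
    have tin: "t \<in> {0<..<1}" using tI by (auto simp: I_def)
    have "(S has_vector_derivative \<sigma> t) (at t within {0..1} - {})"
      unfolding S_def
      by (rule integral_has_vector_derivative_continuous_at[OF \<sigma>])
         (use tin \<sigma>c in \<open>auto intro: continuous_at_imp_continuous_at_within\<close>)
    then have "(S has_vector_derivative \<sigma> t) (at t)"
      using tin by (simp add: at_within_Icc_at)
    then have S': "(S has_real_derivative \<sigma> t) (at t)"
      by (simp add: has_real_derivative_iff_has_vector_derivative)
    \<comment> \<open>The folded curve follows one of two smooth branches, \<open>z\<close> or its
      mirror image. A branch is good if it has the right value at time \<open>t\<close>; on a side
      both branches are.\<close>
    define good where "good b \<longleftrightarrow> rho i b (z t) = fold_point (c t)" for b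
    have foldrho: "\<exists>b. fold_point (c s) = rho i b (z s)" "fold_point (c s) \<in> region i"
      if "c s \<in> dom i" for s
    proof -
      obtain w b where w: "w \<in> region i" "c s = glue A (w, b)" 
        using \<open>c s \<in> dom i\<close> by (rule domE)
      then have "z s = rho i b w" using crd_glue by (simp add: z_def)
      then have "rho i b (z s) = w" using rho_rho[OF regionD[OF w(1)]] by simp
      then show "\<exists>b. fold_point (c s) = rho i b (z s)" "fold_point (c s) \<in> region i"
        using w by auto
    qed
    \<comment> \<open>A branch that is not good has \<open>bary i < 0\<close> at time
      \<open>t\<close>, hence also nearby, whereas the folded point stays in the triangle. Near
      \<open>t\<close> only good branches occur.\<close>
    have bad: "\<forall>\<^sub>F s in nhds t. fold_point (c s) \<noteq> rho i b (z s)" if "\<not> good b" for b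
    proof -
      have zb: "cmod (z t) < 1" by (rule z[OF P])
      obtain b' where b': "fold_point (c t) = rho i b' (z t)" using foldrho(1)[OF P] by blast
      have "b' \<noteq> b"
      proof
        assume "b' = b"
        then show False using that b' by (simp add: good_def)
      qed
      have reg: "bary i (rho i b' (z t)) \<ge> 0" using foldrho(2)[OF P] b' by (simp add: region_def)
      have "bary i (rho i b (z t)) < 0"
      proof (rule ccontr)
        assume "\<not> bary i (rho i b (z t)) < 0"
        then have "bary i (z t) \<ge> 0" "bary i (refl i (z t)) \<ge> 0"
          using reg \<open>b' \<noteq> b\<close> by (cases b; cases b'; simp add: rho_def)+
        then have "bary i (z t) = 0" using bary_refl_iff(2)[OF zb, of i] by linarith
        then have "refl i (z t) = z t" by (rule refl_fixed[OF zb])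
        then have "good b" using b' by (simp add: good_def rho_def)
        then show False using that by simp
      qed
      moreover have "isCont (\<lambda>s. bary i (rho i b (z s))) t"
      proof -
        obtain v' where "((\<lambda>s. rho i b (z s)) has_vector_derivative v') (at t)"
          using rho_vector_derivative[OF D(1)[OF tI P] zb] by blast
        then have "isCont (\<lambda>s. rho i b (z s)) t" by (rule has_vector_derivative_continuous)
        then show ?thesis
          using continuous_on_bary[of UNIV i] by (intro isCont_o2[of t "\<lambda>s. rho i b (z s)" "bary i"])
            (auto simp: continuous_on_eq_continuous_at)
      qed
      ultimately have "\<forall>\<^sub>F s in nhds t. bary i (rho i b (z s)) < 0"
        unfolding tendsto_nhds_isCont using order_tendstoD(2) by blast
      with ev show ?thesis
      proof eventually_elim
        case (elim s)
        then have "bary i (fold_point (c s)) \<ge> 0" using foldrho(2)[of s] by (simp add: region_def)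
        then show ?case using elim by auto
      qed
    qed
    have good: "\<forall>\<^sub>F s in at_right t. good b \<longrightarrow> g t - hdist k (rho i b (z s)) \<le> (\<sigma> t + e / 2) * (s - t)" for b
    proof (cases "good b")
      case True
      have ne: "rho i b (z t) \<noteq> A k"
      proof
        assume "rho i b (z t) = A k"
        then have "A k \<in> region i" using True foldrho(2)[OF P] by (simp add: good_def)
        then show False
          using three_cases[of i k] bary_other_vertex[of k] by (auto simp: region_def)
      qed
      obtain D' where D': "((\<lambda>s. hdist k (rho i b (z s))) has_real_derivative D') (at t)"
        "\<bar>D'\<bar> \<le> 2 * cmod (D t) / (1 - (cmod (z t))\<^sup>2)"
        using hdist_has_derivative[OF D(1)[OF tI P] z[OF P] ne] by blast
      have "((\<lambda>s. (hdist k (rho i b (z s)) - hdist k (rho i b (z t))) / (s - t)) \<longlongrightarrow> D') (at t)"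
        using D'(1) by (simp add: has_field_derivative_iff)
      then have "((\<lambda>s. (hdist k (rho i b (z s)) - hdist k (rho i b (z t))) / (s - t)) \<longlongrightarrow> D') (at_right t)"
        by (rule tendsto_within_subset) simp
      then have "\<forall>\<^sub>F s in at_right t. (hdist k (rho i b (z s)) - hdist k (rho i b (z t))) / (s - t) > - (\<sigma> t + e / 2)"
        by (rule order_tendstoD(1)) (use D'(2) \<sigma>eq[OF tI P] e in linarith)
      moreover have "\<forall>\<^sub>F s in at_right t. t < s" by (rule eventually_at_right_less)
      ultimately show ?thesis
      proof eventually_elim
        case (elim s)
        then have "hdist k (rho i b (z s)) - hdist k (rho i b (z t)) > - (\<sigma> t + e / 2) * (s - t)"
          by (simp add: pos_less_divide_eq)
        then show ?case using True by (simp add: good_def g_def algebra_simps)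
      qed
    qed simp
    have "((\<lambda>s. (S s - S t) / (s - t)) \<longlongrightarrow> \<sigma> t) (at t)"
      using S' by (simp add: has_field_derivative_iff)
    then have "((\<lambda>s. (S s - S t) / (s - t)) \<longlongrightarrow> \<sigma> t) (at_right t)"
      by (rule tendsto_within_subset) simp
    then have "\<forall>\<^sub>F s in at_right t. (S s - S t) / (s - t) > \<sigma> t - e / 2"
      by (rule order_tendstoD(1)) (use e in simp)
    moreover have "\<forall>\<^sub>F s in at_right t. t < s" by (rule eventually_at_right_less)
    moreover have "\<forall>\<^sub>F s in at_right t. c s \<in> dom i"
      using ev by (auto simp: eventually_at_filter elim: eventually_mono)
    moreover have "\<forall>\<^sub>F s in at_right t. \<forall>b. fold_point (c s) = rho i b (z s) \<longrightarrow> good b"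
    proof -
      have "\<forall>\<^sub>F s in at_right t. fold_point (c s) = rho i b (z s) \<longrightarrow> good b" for b
        using bad[of b] by (cases "good b") (auto simp: eventually_at_filter elim: eventually_mono)
      from this[of True] this[of False] show ?thesis by eventually_elim (simp add: all_bool_eq)
    qed
    moreover from good[of True] good[of False]
    have "\<forall>\<^sub>F s in at_right t. \<forall>b. good b \<longrightarrow> g t - hdist k (rho i b (z s)) \<le> (\<sigma> t + e / 2) * (s - t)"
      by eventually_elim (simp add: all_bool_eq)
    ultimately show "\<forall>\<^sub>F s in at_right t. (- g s - S s) - (- g t - S t) \<le> e * (s - t)"
    proof eventually_elim
      case (elim s)
      obtain b where b: "fold_point (c s) = rho i b (z s)" using foldrho(1) elim by blast
      then have "good b" using elim by blast
      then have 1: "g t - g s \<le> (\<sigma> t + e / 2) * (s - t)"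
        using elim b by (simp add: g_def)
      have "S s - S t > (\<sigma> t - e / 2) * (s - t)" using elim by (simp add: pos_less_divide_eq)
      moreover have "(\<sigma> t + e / 2) * (s - t) - (\<sigma> t - e / 2) * (s - t) = e * (s - t)"
        by (simp add: field_simps)
      ultimately show ?case using 1 by linarith
    qed
  qed (use K in auto)
  moreover have "S 0 = 0" by (simp add: S_def)
  moreover have "S 1 = L" using L unfolding S_def \<sigma>_def[abs_def] by (rule integral_unique)
  ultimately show ?thesis by (simp add: g_def)
qed

text \<open>Of the segment from \<open>A k\<close> to \<open>w\<close> only the end \<open>w\<close>
  can touch the side \<open>k\<close>: the coefficient \<open>a\<close> of \<open>A k\<close>
  contributes \<open>a\<close> to \<open>bary k z\<close>, and \<open>a = 0\<close> forces
  \<open>z = w\<close>.\<close>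

lemma segment_points:
  assumes w: "w \<in> triangle A" "w \<noteq> A k" and x: "0 \<le> x" "x \<le> 1"
    and z: "z = su 1 (A k) (x *\<^sub>R su 1 (- A k) w)"
  shows "z \<in> triangle A" "0 < x \<Longrightarrow> x < 1 \<Longrightarrow> bary k z > 0 \<and> z \<noteq> A k"
proof -
  have w1: "cmod w < 1" "\<And>i. bary i w \<ge> 0" using w by (auto simp: triangle_iff)
  define m where "m = su 1 (- A k) w"
  have gap: "cmod (- A k) < cmod 1" "cmod (A k) < cmod 1" using A_ball[of k] by simp_all
  have m: "cmod m < 1" unfolding m_def by (rule su_in_ball[OF gap(1) w1(1)])
  have xm: "cmod (x *\<^sub>R m) < 1"
    using mult_right_mono[of x 1 "cmod m"] x m by simp
  have "x *\<^sub>R m \<in> closed_segment 0 m" using x by (auto simp: in_segment)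
  then have "z \<in> hyp_segment (A k) w"
    unfolding z hyp_segment_def Moebius_eq_su minus_minus m_def[symmetric] by blast
  then obtain a b where ab: "cmod z < 1" "a \<ge> 0" "b \<ge> 0" "z = a *\<^sub>R A k + b *\<^sub>R w"
      "1 + (cmod z)\<^sup>2 = a * (1 + (cmod (A k))\<^sup>2) + b * (1 + (cmod w)\<^sup>2)"
    unfolding hyp_segment_iff[OF A_ball w1(1)] by blast
  have bz: "bary j z = a * bary j (A k) + b * bary j w" for j
    by (rule bary_linear[OF ab(4,5)])
  have "bary j (A k) \<ge> 0" for j using vertex_in_triangle[of k] by (simp add: triangle_iff)
  then show "z \<in> triangle A" using ab(1-3) w1(2) by (simp add: triangle_iff bz)
  assume x': "0 < x" "x < 1"
  have mz: "su 1 (- A k) z = x *\<^sub>R m"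
    unfolding z m_def[symmetric] by (rule mob_inverse(2)[OF A_ball xm])
  have m0: "m \<noteq> 0"
  proof
    assume "m = 0"
    then have "w = su 1 (A k) 0" using mob_inverse(1)[OF A_ball[of k] w1(1)] by (simp add: m_def)
    then show False using w(2) by (simp add: su_def)
  qed
  have "a \<noteq> 0"
  proof
    assume "a = 0"
    then have "z = w" using hyperboloid_unique[OF ab(1) w1(1), of b] ab(4,5) by simp
    then have "x *\<^sub>R m = m" using mz by (simp only: m_def)
    then have "(x - 1) *\<^sub>R m = 0" by (simp add: scaleR_diff_left)
    then show False using m0 x' by simp
  qed
  then have "bary k z > 0" using ab(2,3) w1(2)[of k] bz[of k] by (simp add: add_pos_nonneg)
  moreover have "z \<noteq> A k"
  proof
    assume "z = A k"
    then have "x *\<^sub>R m = 0" using mz by (simp add: su_def)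
    then show False using m0 x' by simp
  qed
  ultimately show "bary k z > 0 \<and> z \<noteq> A k" by blast
qed

lemma glue_vertex [simp]: "glue A (A k, b) = cone_point A k"
proof -
  have "A k \<in> (\<Union>i. side A i)"
    unfolding on_sides_iff using vertex_in_triangle bary_other_vertex by blast
  then show ?thesis by (simp add: cone_point_def glue_eq_iff)
qed

lemma glue_eq_cone [simp]: "glue A (z, b) = cone_point A k \<longleftrightarrow> z = A k"
  using glue_vertex fold_point_glue by metis

text \<open>Unfolding sends a ray from \<open>A k\<close> to the image of a Euclidean ray with the
  same speed under some \<open>su a b\<close>. The same computation then covers both copies and all
  charts.\<close>

lemma rho_ray:
  obtains a b m' where "cmod b < cmod a" "cmod m' = cmod m"
    "\<And>x :: real. cmod (x *\<^sub>R m) < 1 \<Longrightarrow> rho j c (su 1 (A k) (x *\<^sub>R m)) = su a b (x *\<^sub>R m')"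
proof -
  obtain a b where ab: "cmod b < cmod a" "\<And>x. cmod x < 1 \<Longrightarrow> rho j c x = su a b (if c then cnj x else x)"
    using rho_form by blast
  define p m' where "p = (if c then cnj (A k) else A k)" and "m' = (if c then cnj m else m)"
  have p: "cmod p < cmod 1" using A_ball[of k] by (simp add: p_def)
  have gap: "cmod (A k) < cmod 1" using A_ball[of k] by simp
  have "rho j c (su 1 (A k) (x *\<^sub>R m)) = su (a * 1 + b * cnj p) (a * p + b * cnj 1) (x *\<^sub>R m')"
    if "cmod (x *\<^sub>R m) < 1" for x
  proof -
    have "rho j c (su 1 (A k) (x *\<^sub>R m)) = su a b (su 1 p (x *\<^sub>R m'))"
      using ab(2)[OF su_in_ball[OF gap that]] by (simp add: p_def m'_def cnj_su)
    also have "\<dots> = su (a * 1 + b * cnj p) (a * p + b * cnj 1) (x *\<^sub>R m')"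
      by (rule su_compose[OF p]) (use that in \<open>simp add: m'_def\<close>)
    finally show ?thesis .
  qed
  moreover have "cmod (a * p + b * cnj 1) < cmod (a * 1 + b * cnj p)"
    by (rule su_compose_gap[OF p ab(1)])
  moreover have "cmod m' = cmod m" by (simp add: m'_def)
  ultimately show ?thesis using that by blast
qed

lemma chart_cont_glue:
  assumes "isCont \<gamma> t" "\<forall>\<^sub>F s in nhds t. \<gamma> s \<in> triangle A" "\<gamma> t \<in> region j"
  shows "chart_cont j (\<lambda>s. glue A (\<gamma> s, b)) t"
    "\<forall>\<^sub>F s in nhds t. crd j (glue A (\<gamma> s, b)) = rho j b (\<gamma> s)"
proof -
  have "isCont (\<lambda>s. bary i (\<gamma> s)) t" for i
    using continuous_on_bary[of UNIV i] assms(1)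
    by (intro isCont_o2[of t \<gamma> "bary i"]) (auto simp: continuous_on_eq_continuous_at)
  then have "\<forall>\<^sub>F s in nhds t. bary i (\<gamma> s) > 0" if "bary i (\<gamma> t) > 0" for i
    unfolding tendsto_nhds_isCont using order_tendstoD(1) that by blast
  then have "\<forall>\<^sub>F s in nhds t. bary (j + 1) (\<gamma> s) > 0" "\<forall>\<^sub>F s in nhds t. bary (j + 2) (\<gamma> s) > 0"
    using assms(3) by (auto simp: region_def)
  with assms(2) have reg: "\<forall>\<^sub>F s in nhds t. \<gamma> s \<in> region j"
    by eventually_elim (auto simp: region_def triangle_iff)
  then show ev: "\<forall>\<^sub>F s in nhds t. crd j (glue A (\<gamma> s, b)) = rho j b (\<gamma> s)"
    by eventually_elim (rule crd_glue)
  have ball: "cmod (\<gamma> t) < 1" using regionD[OF assms(3)] .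
  have "isCont (rho j b) (\<gamma> t)"
    using continuous_on_refl[of j] ball
    by (cases b) (auto simp: rho_def[abs_def] continuous_on_eq_continuous_at)
  then have "isCont (\<lambda>s. rho j b (\<gamma> s)) t" by (rule isCont_o2[OF assms(1)])
  then have "isCont (\<lambda>s. crd j (glue A (\<gamma> s, b))) t" using isCont_cong[OF ev] by blast
  moreover have "\<forall>\<^sub>F s in nhds t. glue A (\<gamma> s, b) \<in> dom j" using reg by eventually_elim simp
  ultimately show "chart_cont j (\<lambda>s. glue A (\<gamma> s, b)) t" by (simp add: chart_cont_def)
qed

text \<open>The infimum is attained by the geodesic from \<open>P\<close> to the vertex inside its
  copy of the triangle. It is parametrized by \<open>(1 - t) m\<close> with \<open>A k\<close> moved
  to 0, so that its speed is the derivative of \<open>- 2 artanh ((1 - t) |m|)\<close>.\<close>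

lemma double_dist_eq:
  assumes P: "P \<in> double A" "P \<noteq> cone_point A k"
  shows "double_dist A P (cone_point A k) = hdist k (fold_point P)"
  unfolding double_dist_def
proof (rule cInf_eq_minimum)
  fix L
  assume "L \<in> {L. \<exists>c K. finite K \<and> c 0 = P \<and> c 1 = cone_point A k \<and>
        continuous_map (top_of_set {0..1}) (double_topology A) c \<and>
        C1_curve_on (double_atlas A) c ({0<..<1} - K) \<and>
        ((\<lambda>t. tangent_norm (double_atlas A) (c t) (dvel c t)) has_integral L) {0..1}}"
  then obtain c K where "finite K" "c 0 = P" "c 1 = cone_point A k"
        "continuous_map (top_of_set {0..1}) (double_topology A) c"
        "C1_curve_on (double_atlas A) c ({0<..<1} - K)"
        "((\<lambda>t. tangent_norm (double_atlas A) (c t) (dvel c t)) has_integral L) {0..1}" by blast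
  then show "hdist k (fold_point P) \<le> L" using length_lower_bound[of K c L k] by (simp add: hdist_self)
next
  obtain w b where w: "w \<in> triangle A" "P = glue A (w, b)" using double_glueE[OF P(1)] .
  have wk: "w \<noteq> A k" using P(2) w(2) by auto
  define m where "m = su 1 (- A k) w"
  have gap: "cmod (- A k) < cmod 1" "cmod (A k) < cmod 1" using A_ball[of k] by simp_all
  have w1: "cmod w < 1" using w by (simp add: triangle_iff)
  have m: "cmod m < 1" unfolding m_def by (rule su_in_ball[OF gap(1) w1])
  have xm: "cmod (x *\<^sub>R m) < 1" if "0 \<le> x" "x \<le> 1" for x
    using mult_right_mono[of x 1 "cmod m"] that m by simp
  define \<gamma> where "\<gamma> t = su 1 (A k) ((1 - t) *\<^sub>R m)" for t :: real
  define c where "c t = glue A (\<gamma> t, b)" for t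
  have tri: "\<gamma> t \<in> triangle A" if "t \<in> {0..1}" for t
    using segment_points(1)[OF w(1) wk, of "1 - t"] that by (simp add: \<gamma>_def m_def)
  have inner: "bary k (\<gamma> t) > 0 \<and> \<gamma> t \<noteq> A k" if "t \<in> {0<..<1}" for t
    using segment_points(2)[OF w(1) wk, of "1 - t"] that by (simp add: \<gamma>_def m_def)
  have \<gamma>d: "(\<gamma> has_vector_derivative su' 1 (A k) ((1 - t) *\<^sub>R m) * - m) (at t)" if "t \<in> {0..1}" for t
    unfolding \<gamma>_def
    by (rule has_vector_derivative_su[OF gap(2) xm]) (use that in \<open>auto intro!: derivative_eq_intros\<close>)
  then have \<gamma>c: "isCont \<gamma> t" if "t \<in> {0..1}" for t
    using that has_vector_derivative_continuous by blast
  have near: "\<forall>\<^sub>F s in nhds t. s \<in> {0<..<1}" if "t \<in> {0<..<1}" for t :: real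
    using that by (intro eventually_nhds_in_open) auto
  have cc: "chart_cont j c t" "\<forall>\<^sub>F s in nhds t. crd j (c s) = rho j b (\<gamma> s)"
    if "t \<in> {0<..<1}" "c t \<in> dom j" for t j
  proof -
    have "\<forall>\<^sub>F s in nhds t. \<gamma> s \<in> triangle A" using near[OF that(1)] by eventually_elim (rule tri, simp)
    moreover have "\<gamma> t \<in> region j" using that(2) by (simp add: c_def)
    ultimately show "chart_cont j c t" "\<forall>\<^sub>F s in nhds t. crd j (c s) = rho j b (\<gamma> s)"
      unfolding c_def[abs_def] using chart_cont_glue[OF \<gamma>c] that(1) by auto
  qed
  have vd: "\<exists>D. (\<forall>t\<in>{0<..<1}. c t \<in> dom j \<longrightarrow> ((\<lambda>s. crd j (c s)) has_vector_derivative D t) (at t) \<and>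
        2 * cmod (D t) / (1 - (cmod (crd j (c t)))\<^sup>2) = 2 * cmod m / (1 - ((1 - t) * cmod m)\<^sup>2)) \<and>
      continuous_on {0<..<1} D" for j
  proof -
    obtain a b' m' where r: "cmod b' < cmod a" "cmod m' = cmod m"
      "\<And>x :: real. cmod (x *\<^sub>R m) < 1 \<Longrightarrow> rho j b (su 1 (A k) (x *\<^sub>R m)) = su a b' (x *\<^sub>R m')"
      by (rule rho_ray[where m = m and j = j and c = b and k = k]) blast
    define D where "D t = su' a b' ((1 - t) *\<^sub>R m') * - m'" for t :: real
    have xm': "cmod (x *\<^sub>R m') < 1" if "0 \<le> x" "x \<le> 1" for x using xm[OF that] r(2) by simp
    have "((\<lambda>s. crd j (c s)) has_vector_derivative D t) (at t) \<and>
        2 * cmod (D t) / (1 - (cmod (crd j (c t)))\<^sup>2) = 2 * cmod m / (1 - ((1 - t) * cmod m)\<^sup>2)"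
      if t: "t \<in> {0<..<1}" "c t \<in> dom j" for t
    proof
      have ev: "\<forall>\<^sub>F s in nhds t. crd j (c s) = su a b' ((1 - s) *\<^sub>R m')"
        using cc(2)[OF t] near[OF t(1)]
      proof eventually_elim
        case (elim s)
        then show ?case using r(3)[OF xm[of "1 - s"]] by (simp add: \<gamma>_def)
      qed
      have "((\<lambda>s. su a b' ((1 - s) *\<^sub>R m')) has_vector_derivative D t) (at t)"
        unfolding D_def
        by (rule has_vector_derivative_su[OF r(1) xm']) (use t in \<open>auto intro!: derivative_eq_intros\<close>)
      then show "((\<lambda>s. crd j (c s)) has_vector_derivative D t) (at t)"
        using ev by (subst has_vector_derivative_cong_nhds)
      have ct: "crd j (c t) = su a b' ((1 - t) *\<^sub>R m')" by (rule eventually_nhds_x_imp_x[OF ev])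
      have "1 - (cmod (crd j (c t)))\<^sup>2 = cmod (su' a b' ((1 - t) *\<^sub>R m')) * (1 - (cmod ((1 - t) *\<^sub>R m'))\<^sup>2)"
        unfolding ct by (rule su'_norm[OF r(1) xm']) (use t in auto)
      moreover have "su' a b' ((1 - t) *\<^sub>R m') \<noteq> 0"
        by (rule su'_nonzero[OF r(1) xm']) (use t in auto)
      ultimately show "2 * cmod (D t) / (1 - (cmod (crd j (c t)))\<^sup>2) = 2 * cmod m / (1 - ((1 - t) * cmod m)\<^sup>2)"
        using t r(2) by (simp add: D_def norm_mult power_mult_distrib)
    qed
    moreover have "continuous_on {0<..<1} D"
    proof -
      have "cnj b' * ((1 - t) *\<^sub>R m') + cnj a \<noteq> 0" if "t \<in> {0<..<1}" for t
        using su_denom[OF r(1), of "(1 - t) *\<^sub>R m'"] xm'[of "1 - t"] that by simp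
      then show ?thesis unfolding D_def su'_def by (intro continuous_intros) auto
    qed
    ultimately show ?thesis by blast
  qed
  have cover: "\<exists>j. c t \<in> dom j" if "t \<in> {0<..<1}" for t
    using dom_cover[of "c t" k] inner[OF that] tri[of t] that by (auto simp: c_def)
  have "finite {}" "c 0 = P" "c 1 = cone_point A k"
    using mob_inverse(1)[OF A_ball[of k] w1] by (simp_all add: c_def \<gamma>_def w m_def su_def[of 1 "A k" 0])
  moreover have "continuous_map (top_of_set {0..1}) (double_topology A) c"
    unfolding c_def using \<gamma>c by (intro continuous_glue tri continuous_at_imp_continuous_on) auto
  moreover have "C1_curve_on (double_atlas A) c ({0<..<1} - {})"
    unfolding C1_curve_on_def
  proof (intro conjI ballI)
    show "continuous_map (top_of_set ({0<..<1} - {})) (manifold_topology (double_atlas A)) c"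
    proof (rule curve_continuous_chart_cont)
      fix t :: real assume "t \<in> {0<..<1} - {}"
      then have t: "t \<in> {0<..<1}" by simp
      then obtain j where "c t \<in> dom j" using cover by blast
      from cc(1)[OF t this] show "\<exists>i. chart_cont i c t" by blast
    qed
    fix ch assume "ch \<in> double_atlas A"
    then obtain j where j: "ch = double_chart A j" by (auto simp: double_atlas_iff)
    obtain D where D: "\<forall>t\<in>{0<..<1}. c t \<in> dom j \<longrightarrow> ((\<lambda>s. crd j (c s)) has_vector_derivative D t) (at t)"
      "continuous_on {0<..<1} D" using vd[of j] by blast
    then show "(snd ch \<circ> c) C1_differentiable_on {t \<in> {0<..<1} - {}. c t \<in> fst ch}"
      unfolding C1_differentiable_on_def j comp_def
      by (intro exI[of _ D]) (auto intro: continuous_on_subset)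
  qed
  moreover have "((\<lambda>t. tangent_norm (double_atlas A) (c t) (dvel c t)) has_integral hdist k (fold_point P)) {0..1}"
  proof -
    have "((\<lambda>t. 2 * cmod m / (1 - ((1 - t) * cmod m)\<^sup>2)) has_integral
        - 2 * artanh ((1 - 1) * cmod m) - - 2 * artanh ((1 - 0) * cmod m)) {0..1::real}"
    proof (rule fundamental_theorem_of_calculus)
      fix t :: real assume t: "t \<in> {0..1}"
      then have b: "\<bar>(1 - t) * cmod m\<bar> < 1" using xm[of "1 - t"] by simp
      have "((\<lambda>t. (1 - t) * cmod m) has_real_derivative - cmod m) (at t within {0..1})"
        by (auto intro!: derivative_eq_intros)
      from DERIV_cmult[OF DERIV_chain2[OF artanh_real_has_field_derivative[OF b] this], of "- 2"]
      show "((\<lambda>t. - 2 * artanh ((1 - t) * cmod m)) has_vector_derivative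
          2 * cmod m / (1 - ((1 - t) * cmod m)\<^sup>2)) (at t within {0..1})"
        by (simp add: has_real_derivative_iff_has_vector_derivative)
    qed simp
    then have "((\<lambda>t. 2 * cmod m / (1 - ((1 - t) * cmod m)\<^sup>2)) has_integral hdist k (fold_point P)) {0..1::real}"
      by (simp add: hdist_def w m_def)
    \<comment> \<open>At time 1 the curve is at a cone point, outside all charts, and so it is at
      time 0 if \<open>P\<close> is another vertex. Two times do not affect the integral.\<close>
    moreover have "tangent_norm (double_atlas A) (c t) (dvel c t) = 2 * cmod m / (1 - ((1 - t) * cmod m)\<^sup>2)"
      if "t \<in> {0..1} - {0, 1}" for t
    proof -
      have t: "t \<in> {0<..<1}" using that by auto
      then obtain j where j: "c t \<in> dom j" using cover by blast
      obtain D where D: "((\<lambda>s. crd j (c s)) has_vector_derivative D t) (at t)"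
        "2 * cmod (D t) / (1 - (cmod (crd j (c t)))\<^sup>2) = 2 * cmod m / (1 - ((1 - t) * cmod m)\<^sup>2)"
        using vd[of j] t j by blast
      have "dvel c t \<in> tangent_space (double_atlas A) (c t)"
        by (rule velocity_tangent[OF cc(1)[OF t j] differentiableI_vector[OF D(1)]])
      from tangent_norm_eq[OF this j] show ?thesis
        using velocity_chart[of c t j] j vector_derivative_at[OF D(1)] D(2) by simp
    qed
    ultimately show ?thesis
      by (intro has_integral_spike_finite[of "{0, 1}" "{0..1}" "\<lambda>t. tangent_norm (double_atlas A) (c t) (dvel c t)"
            "\<lambda>t. 2 * cmod m / (1 - ((1 - t) * cmod m)\<^sup>2)"]) auto
  qed
  ultimately show "hdist k (fold_point P) \<in> {L. \<exists>c K. finite K \<and> c 0 = P \<and> c 1 = cone_point A k \<and>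
        continuous_map (top_of_set {0..1}) (double_topology A) c \<and>
        C1_curve_on (double_atlas A) c ({0<..<1} - K) \<and>
        ((\<lambda>t. tangent_norm (double_atlas A) (c t) (dvel c t)) has_integral L) {0..1}}"
    by blast
qed

end

lemma tanh_artanh_real:
  fixes x :: real
  assumes "\<bar>x\<bar> < 1"
  shows "tanh (artanh x) = x"
proof -
  define y where "y = (1 + x) / (1 - x)"
  have y: "y > 0" using assms by (simp add: y_def)
  have "artanh x = ln (sqrt y)" using y by (simp add: artanh_def y_def ln_sqrt)
  then have "tanh (artanh x) = (y - 1) / (y + 1)" using y by (simp add: tanh_ln_real)
  also have "\<dots> = x" using assms by (simp add: y_def divide_simps)
  finally show ?thesis .
qed

context hyp_triangle
begin

section \<open>Exchanging the two copies\<close>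

definition swap :: "dpoint \<Rightarrow> dpoint" where
  "swap P = (\<lambda>(z, b). (z, \<not> b)) ` P"

lemma swap_glue [simp]: "swap (glue A (z, b)) = glue A (z, \<not> b)"
  by (auto simp: swap_def glue_eq)

lemma swap_dom: "P \<in> dom i \<Longrightarrow> swap P \<in> dom i"
  by (auto elim!: domE)

lemma crd_swap: "P \<in> dom i \<Longrightarrow> crd i (swap P) = refl i (crd i P)"
  by (auto elim!: domE simp: crd_glue rho_def refl_refl regionD)

lemma cone_point_eq [simp]: "cone_point A i = cone_point A j \<longleftrightarrow> i = j"
  using cone_point_fold A_inj by metis

lemma swap_cone_point: "swap (cone_point A k) = cone_point A k"
  using swap_glue[of "A k" False] by simp

lemma swap_geodesic:
  assumes "chart_cont i c t" "disc_geodesic_at (\<lambda>s. crd i (c s)) t"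
  shows "chart_cont i (\<lambda>s. swap (c s)) t" "disc_geodesic_at (\<lambda>s. crd i (swap (c s))) t"
    "tangent_norm (double_atlas A) (swap (c t)) (dvel (\<lambda>s. swap (c s)) t) =
     tangent_norm (double_atlas A) (c t) (dvel c t)"
proof -
  have P: "c t \<in> dom i" using assms(1) by (rule chart_cont_dom)
  note g = disc_geodesic_atD[OF assms(2)]
  obtain a b where ab: "cmod b < cmod a" "\<And>z. cmod z < 1 \<Longrightarrow> refl i z = su a b (cnj z)"
    using refl_su by blast
  have dom: "\<forall>\<^sub>F s in nhds t. c s \<in> dom i" using assms(1) by (simp add: chart_cont_def)
  then have ev: "\<forall>\<^sub>F s in nhds t. crd i (swap (c s)) = su a b (cnj (crd i (c s)))"
    by eventually_elim (simp add: crd_swap ab(2) crd_ball)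
  show d: "disc_geodesic_at (\<lambda>s. crd i (swap (c s))) t"
    by (rule disc_geodesic_at_cong[OF ev disc_geodesic_at_su[OF disc_geodesic_at_cnj[OF assms(2)] ab(1)]])
  have "\<forall>\<^sub>F s in nhds t. swap (c s) \<in> dom i" using dom by eventually_elim (rule swap_dom)
  then show cc: "chart_cont i (\<lambda>s. swap (c s)) t"
    using disc_geodesic_atD(3)[OF d] by (simp add: chart_cont_def)
  obtain v' where v': "((\<lambda>s. rho i True (crd i (c s))) has_vector_derivative v') (at t)"
    "cmod v' * (1 - (cmod (crd i (c t)))\<^sup>2) =
       cmod (vector_derivative (\<lambda>s. crd i (c s)) (at t)) * (1 - (cmod (rho i True (crd i (c t))))\<^sup>2)"
    using rho_vector_derivative[OF g(4,1)] by blast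
  have "\<forall>\<^sub>F s in nhds t. crd i (swap (c s)) = rho i True (crd i (c s))"
    using dom by eventually_elim (simp add: crd_swap rho_def)
  then have vd: "((\<lambda>s. crd i (swap (c s))) has_vector_derivative v') (at t)"
    using v'(1) by (subst has_vector_derivative_cong_nhds)
  have sw: "crd i (swap (c t)) = rho i True (crd i (c t))" using P by (simp add: crd_swap rho_def)
  have N: "1 - (cmod (crd i (c t)))\<^sup>2 > 0" "1 - (cmod (crd i (swap (c t))))\<^sup>2 > 0"
    using crd_ball[OF P] crd_ball[OF swap_dom[OF P]] by (simp_all add: abs_square_less_1)
  have "tangent_norm (double_atlas A) (swap (c t)) (dvel (\<lambda>s. swap (c s)) t) =
     2 * cmod v' / (1 - (cmod (crd i (swap (c t))))\<^sup>2)"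
    using tangent_norm_eq[OF velocity_tangent[OF cc differentiableI_vector[OF vd]] swap_dom[OF P]]
      velocity_chart[of "\<lambda>s. swap (c s)" t i] swap_dom[OF P] vector_derivative_at[OF vd] by simp
  also have "\<dots> = 2 * cmod (vector_derivative (\<lambda>s. crd i (c s)) (at t)) / (1 - (cmod (crd i (c t)))\<^sup>2)"
    using v'(2) N unfolding sw by (simp add: field_simps)
  also have "\<dots> = tangent_norm (double_atlas A) (c t) (dvel c t)"
    using tangent_norm_eq[OF velocity_tangent[OF assms(1) g(2)] P] velocity_chart[of c t i] P by simp
  finally show "tangent_norm (double_atlas A) (swap (c t)) (dvel (\<lambda>s. swap (c s)) t) =
     tangent_norm (double_atlas A) (c t) (dvel c t)" .
qed

lemma continuous_swap:
  assumes "continuous_map T (double_topology A) c"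
  shows "continuous_map T (double_topology A) (\<lambda>s. swap (c s))"
proof -
  have "continuous_map (double_topology A) (double_topology A) swap"
    unfolding continuous_map_def
  proof (intro conjI allI impI)
    show "swap \<in> topspace (double_topology A) \<rightarrow> topspace (double_topology A)"
      by (auto elim!: double_glueE)
    fix U assume "openin (double_topology A) U"
    then have U: "openin (prod_topology (top_of_set (triangle A)) (discrete_topology UNIV))
         {x \<in> triangle A \<times> UNIV. glue A x \<in> U}" by (simp add: openin_double_topology)
    have n: "continuous_map (discrete_topology UNIV) (discrete_topology UNIV) Not"
      by (auto simp: continuous_map_def)
    from continuous_map_compose[OF continuous_map_snd n]
    have "continuous_map (prod_topology (top_of_set (triangle A)) (discrete_topology UNIV))
       (discrete_topology UNIV) (\<lambda>x. \<not> snd x)" by (simp add: comp_def)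
    then have "continuous_map (prod_topology (top_of_set (triangle A)) (discrete_topology UNIV))
       (prod_topology (top_of_set (triangle A)) (discrete_topology (UNIV :: bool set))) (\<lambda>x. (fst x, \<not> snd x))"
      by (intro continuous_map_pairedI continuous_map_fst)
    from openin_continuous_map_preimage[OF this U]
    have "openin (prod_topology (top_of_set (triangle A)) (discrete_topology UNIV))
      {x \<in> topspace (prod_topology (top_of_set (triangle A)) (discrete_topology UNIV)).
         (fst x, \<not> snd x) \<in> {x \<in> triangle A \<times> UNIV. glue A x \<in> U}}" .
    moreover have "{x \<in> topspace (prod_topology (top_of_set (triangle A)) (discrete_topology UNIV)).
         (fst x, \<not> snd x) \<in> {x \<in> triangle A \<times> UNIV. glue A x \<in> U}} =
       {x \<in> triangle A \<times> UNIV. glue A x \<in> {P \<in> topspace (double_topology A). swap P \<in> U}}"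
      by auto
    ultimately show "openin (double_topology A) {P \<in> topspace (double_topology A). swap P \<in> U}"
      unfolding openin_double_topology by auto
  qed
  from continuous_map_compose[OF assms this] show ?thesis by (simp add: comp_def)
qed

lemma hdist_pos: "cmod z < 1 \<Longrightarrow> z \<noteq> A k \<Longrightarrow> hdist k z > 0"
proof -
  assume z: "cmod z < 1" "z \<noteq> A k"
  have "su 1 (- A k) z \<noteq> 0"
  proof
    assume "su 1 (- A k) z = 0"
    then have "z = su 1 (A k) 0" using mob_inverse(1)[OF A_ball[of k] z(1)] by simp
    then show False using z(2) by (simp add: su_def)
  qed
  moreover have "cmod (su 1 (- A k) z) < 1" using su_in_ball[of "- A k" 1 z] A_ball[of k] z(1) by simp
  ultimately have "(1 + cmod (su 1 (- A k) z)) / (1 - cmod (su 1 (- A k) z)) > 1" by simp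
  then have "ln ((1 + cmod (su 1 (- A k) z)) / (1 - cmod (su 1 (- A k) z))) > 0" by (rule ln_gt_zero)
  then show ?thesis unfolding hdist_def artanh_def by simp
qed

text \<open>Exchanging the copies is an isometry which fixes the cone points and every point of the
  sides, hence it takes segments to such a \<open>P\<close> to segments to \<open>P\<close>.\<close>

lemma cone_segment_swap:
  assumes P: "P \<in> double A" "P \<noteq> cone_point A k" "swap P = P" and c: "cone_segment A k P c"
  shows "cone_segment A k P (\<lambda>t. swap (c t))"
proof -
  define r where "r = double_dist A P (cone_point A k)"
  obtain a where a: "a > r" "a > 0" "c 0 = cone_point A k"
    "continuous_map (top_of_set {0..<a}) (double_topology A) c"
    "unit_geodesic_on (double_atlas A) c {0<..<a}" "c r = P"
    using c by (auto simp: cone_segment_def cone_geodesic_def r_def)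
  have geo: "geodesic_on (double_atlas A) c {0<..<a}"
    and unit: "\<And>t. t \<in> {0<..<a} \<Longrightarrow> tangent_norm (double_atlas A) (c t) (dvel c t) = 1"
    using a(5) by (auto simp: unit_geodesic_on_def)
  have loc: "\<exists>i. chart_cont i c t \<and> disc_geodesic_at (\<lambda>s. crd i (c s)) t" if t: "t \<in> {0<..<a}" for t
  proof -
    have "continuous_map (top_of_set {0<..<a}) (manifold_topology (double_atlas A)) c"
      using geo by (simp add: geodesic_on_def)
    then obtain i where "c t \<in> dom i" using curve_in_carrier t by blast
    then show ?thesis using geodesic_onD[OF geo _ t] by auto
  qed
  have "geodesic_on (double_atlas A) (\<lambda>t. swap (c t)) {0<..<a}"
    using loc swap_geodesic by (intro geodesic_onI) blast
  moreover have "tangent_norm (double_atlas A) (swap (c t)) (dvel (\<lambda>t. swap (c t)) t) = 1"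
    if t: "t \<in> {0<..<a}" for t
    using loc[OF t] swap_geodesic(3) unit[OF t] by metis
  ultimately show ?thesis
    unfolding cone_segment_def cone_geodesic_def unit_geodesic_on_def
    using a P(3) continuous_swap[OF a(4)] swap_cone_point unfolding r_def by metis
qed

end

section \<open>The balls around the cone points\<close>

locale cone_setting = hyp_triangle +
  fixes \<omega> \<tau> :: real
  assumes omega: "\<omega> \<in> {1, - 1}" and adm: "admissible_radius A \<tau>"
begin

lemma cone_ball_double: "P \<in> cone_ball A \<tau> k \<Longrightarrow> P \<in> double A"
  by (simp add: cone_ball_def)

lemma cone_ball_vertex: "P \<in> cone_ball A \<tau> k \<Longrightarrow> P = cone_point A j \<Longrightarrow> P = cone_point A k"
  using adm unfolding admissible_radius_def by blast

lemma cone_ball_iff: "P \<noteq> cone_point A k \<Longrightarrow> P \<in> cone_ball A \<tau> k \<longleftrightarrow> P \<in> double A \<and> hdist k (fold_point P) < \<tau>"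
  using double_dist_eq[of P k] by (auto simp: cone_ball_def)

lemma cone_segment_ex: "P \<in> cone_ball A \<tau> k \<Longrightarrow> P \<noteq> cone_point A k \<Longrightarrow> \<exists>c. cone_segment A k P c"
  using adm unfolding admissible_radius_def by blast

lemma cone_segment_unique:
  assumes "P \<in> cone_ball A \<tau> k" "P \<noteq> cone_point A k" "cone_segment A k P c" "cone_segment A k P c'"
    "t \<in> {0..hdist k (fold_point P)}"
  shows "c t = c' t"
proof -
  have "double_dist A P (cone_point A k) = hdist k (fold_point P)"
    using double_dist_eq cone_ball_double assms(1,2) by blast
  then show ?thesis using adm assms unfolding admissible_radius_def by (metis DiffI singletonD)
qed

text \<open>Otherwise the ball would meet the opposite side in its interior, and a geodesic segment to
  such a point and its mirror image would violate the uniqueness in \<^const>\<open>admissible_radius\<close>.\<close>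

lemma cone_ball_opposite_side:
  assumes P: "P \<in> cone_ball A \<tau> k"
  shows "bary k (fold_point P) > 0"
proof (rule ccontr)
  assume n: "\<not> bary k (fold_point P) > 0"
  obtain z b where z: "z \<in> triangle A" "P = glue A (z, b)" using double_glueE[OF cone_ball_double[OF P]] .
  have z1: "cmod z < 1" "\<And>i. bary i z \<ge> 0" using z(1) by (auto simp: triangle_iff)
  have bz: "bary k z = 0" using n z z1(2)[of k] by simp
  have Pk: "P \<noteq> cone_point A k"
  proof
    assume "P = cone_point A k"
    then show False using n by simp
  qed
  have ni: "z \<noteq> A i" for i
  proof
    assume "z = A i"
    then have "P = cone_point A i" using z(2) by simp
    then show False using cone_ball_vertex[OF P, of i] Pk by blast
  qed
  have "z \<in> (\<Union>i. side A i)" unfolding on_sides_iff using z(1) bz by blast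
  then have "swap P = P" by (simp add: z(2) glue_eq_iff)
  obtain c where c: "cone_segment A k P c" using cone_segment_ex[OF P Pk] by blast
  define r where "r = hdist k z"
  have r0: "r > 0" unfolding r_def by (rule hdist_pos[OF z1(1) ni])
  have rd: "double_dist A P (cone_point A k) = r"
    using double_dist_eq[OF cone_ball_double[OF P] Pk] z(2) by (simp add: r_def)
  \<comment> \<open>By uniqueness the segment is fixed by the exchange of the copies, which confines
    it to the sides of the triangle.\<close>
  have same: "c t = swap (c t)" if "t \<in> {0..r}" for t
    by (rule cone_segment_unique[OF P Pk c cone_segment_swap[OF cone_ball_double[OF P] Pk \<open>swap P = P\<close> c]])
       (use that z(2) in \<open>simp add: r_def\<close>)
  obtain a where a: "a > r" "c 0 = cone_point A k"
    "continuous_map (top_of_set {0..<a}) (double_topology A) c"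
    "unit_geodesic_on (double_atlas A) c {0<..<a}" "c r = P"
    using c by (auto simp: cone_segment_def cone_geodesic_def rd)
  have cont: "continuous_map (top_of_set {0<..<a}) (manifold_topology (double_atlas A)) c"
    using a(4) by (simp add: unit_geodesic_on_def geodesic_on_def)
  define f where "f i t = bary i (fold_point (c t))" for i t
  have "continuous_on {0..<a} (\<lambda>t. fold_point (c t))" by (rule continuous_fold[OF a(3)])
  then have fc: "continuous_on {0..r} (f i)" for i
    unfolding f_def using a(1)
    by (intro continuous_on_compose2[OF continuous_on_bary[of UNIV]]) (auto intro: continuous_on_subset)
  have f0: "f k 0 = 1" using a(2) by (simp add: f_def)
  have fr: "f k r = 0" using a(5) z(2) bz by (simp add: f_def)
  have side: "(\<exists>i. f i t = 0) \<and> (f k t = 0 \<longrightarrow> f (k + 1) t > 0 \<and> f (k + 2) t > 0) \<and> (\<forall>i. f i t \<ge> 0)"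
    if t: "0 < t" "t \<le> r" for t
  proof -
    obtain j where j: "c t \<in> dom j" using curve_in_carrier[OF cont, of t] t a(1) by auto
    obtain w b' where w: "w \<in> region j" "c t = glue A (w, b')" using j by (rule domE)
    have "w \<in> (\<Union>i. side A i)" using same[of t] t w by (auto simp: glue_eq_iff)
    then have "\<exists>i. bary i w = 0" unfolding on_sides_iff by blast
    moreover have "\<forall>i. bary i w \<ge> 0" using w(1) region_iff triangle_iff by blast
    moreover have "bary k w = 0 \<longrightarrow> bary (k + 1) w > 0 \<and> bary (k + 2) w > 0"
      using w(1) three_cases[of j k] by (auto simp: region_def)
    ultimately show ?thesis using w by (simp add: f_def)
  qed
  \<comment> \<open>The first time \<open>m\<close> on the side \<open>k\<close> leads to a
    contradiction. The point reached then is not a vertex, so the other two coordinates are positive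
    there and shortly before; being on some side, the segment was on the side \<open>k\<close>
    already earlier.\<close>
  define Z where "Z = {t \<in> {0..r}. f k t = 0}"
  have "closed Z"
    unfolding Z_def using continuous_closed_preimage_constant[OF fc, of k 0] by simp
  moreover have rZ: "r \<in> Z" using r0 fr by (simp add: Z_def)
  moreover have "bdd_below Z" unfolding Z_def by (intro bdd_belowI[of _ 0]) auto
  ultimately have mZ: "Inf Z \<in> Z" using closed_contains_Inf by blast
  define m where "m = Inf Z"
  have m: "0 < m" "m \<le> r" "f k m = 0"
    using mZ f0 unfolding m_def Z_def by (auto simp: less_le)
  have "f (k + 1) m > 0" "f (k + 2) m > 0" using side[OF m(1,2)] m(3) by auto
  moreover have lim: "(f i \<longlongrightarrow> f i m) (at m within {0..r})" for i
    using fc[of i] m by (auto simp: continuous_on_def)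
  ultimately have "\<forall>\<^sub>F t in at m within {0..r}. f (k + 1) t > 0" "\<forall>\<^sub>F t in at m within {0..r}. f (k + 2) t > 0"
    using order_tendstoD(1) by blast+
  then have "\<forall>\<^sub>F t in at m within {0..r}. f (k + 1) t > 0 \<and> f (k + 2) t > 0" by (rule eventually_conj)
  then obtain d where d: "d > 0" "\<And>t. t \<in> {0..r} \<Longrightarrow> t \<noteq> m \<Longrightarrow> dist t m < d \<Longrightarrow> f (k + 1) t > 0 \<and> f (k + 2) t > 0"
    unfolding eventually_at by blast
  define t where "t = max (m / 2) (m - d / 2)"
  have t: "0 < t" "t < m" "dist t m < d" using m d(1) by (auto simp: t_def dist_real_def)
  then have "f (k + 1) t > 0" "f (k + 2) t > 0" using d(2)[of t] m by auto
  moreover have "\<exists>i. f i t = 0" using side[of t] t m by auto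
  ultimately have "f k t = 0" using three_cases[of _ k] by (metis less_irrefl)
  then have "t \<in> Z" using t m by (simp add: Z_def)
  then have "m \<le> t" unfolding m_def using \<open>bdd_below Z\<close> by (rule cInf_lower)
  then show False using t by simp
qed

end

section \<open>Principal arguments of complex numbers\<close>

lemma Arg_bounds': "- pi < Arg z \<and> Arg z \<le> pi"
  using Arg_bounded[of z] mpi_less_Arg[of z] Arg_le_pi[of z] by auto

lemma Arg_of_real_cis:
  assumes "r > 0" "- pi < x" "x \<le> pi"
  shows "Arg (of_real r * cis x) = x"
  using assms by (intro Arg_unique[of r]) (auto simp: cis_conv_exp)

lemma of_real_cmod_cis_Arg: "z \<noteq> 0 \<Longrightarrow> of_real (cmod z) * cis (Arg z) = z"
  using Arg_eq[of z] by (simp add: cis_conv_exp)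

lemma Arg_cnj': "\<bar>Arg z\<bar> < pi \<Longrightarrow> z \<noteq> 0 \<Longrightarrow> Arg (cnj z) = - Arg z"
proof -
  assume z: "\<bar>Arg z\<bar> < pi" "z \<noteq> 0"
  have "cnj z = of_real (cmod z) * cis (- Arg z)"
    using arg_cong[OF of_real_cmod_cis_Arg[OF z(2)], of cnj] by (simp add: cis_cnj)
  moreover have "Arg (of_real (cmod z) * cis (- Arg z)) = - Arg z"
    using z by (intro Arg_of_real_cis) auto
  ultimately show ?thesis by (simp only:)
qed

context hyp_triangle
begin

section \<open>Sectors at a vertex\<close>

text \<open>For \<open>j \<noteq> k\<close>, the side \<open>j\<close> joins \<open>A k\<close> to the vertex with index \<open>oth k j\<close>, and
  \<open>qc k j\<close> is the isometry that sends \<open>A k\<close> to 0 and the side \<open>j\<close> to the positive real axis.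
  The interior of the triangle lies on the side of it given by the sign \<open>sgj k j\<close>.\<close>

definition oth :: "3 \<Rightarrow> 3 \<Rightarrow> 3" where
  "oth k j = (if j = k + 2 then k + 1 else k + 2)"

definition bv :: "3 \<Rightarrow> 3 \<Rightarrow> complex" where
  "bv k j = sgn (su 1 (- A k) (A (oth k j)))"

definition qc :: "3 \<Rightarrow> 3 \<Rightarrow> complex \<Rightarrow> complex" where
  "qc k j z = cnj (bv k j) * su 1 (- A k) z"

definition sgj :: "3 \<Rightarrow> 3 \<Rightarrow> real" where
  "sgj k j = (if j = k + 2 then sgn (geo_det (A 0) (A 1) (A 2)) else - sgn (geo_det (A 0) (A 1) (A 2)))"

abbreviation theta :: "3 \<Rightarrow> real" where "theta k \<equiv> interior_angle A k"

lemma not_k_cases: "j \<noteq> k \<Longrightarrow> j = k + 1 \<or> j = k + (2 :: 3)"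
  using three_cases[of j k] by auto

lemma oth_simps [simp]: "oth k (k + 2) = k + 1" "oth k (k + 1) = k + 2"
  by (simp_all add: oth_def)

lemma oth_neq: "oth k j \<noteq> k" "j \<noteq> k \<Longrightarrow> oth k j \<noteq> j"
  using not_k_cases[of j k] by (auto simp: oth_def)

lemma oth_oth: "j \<noteq> k \<Longrightarrow> oth k (oth k j) = j"
  using not_k_cases[of j k] by auto

lemma bary_oth: "j \<noteq> k \<Longrightarrow> bary j (A k) = 0" "j \<noteq> k \<Longrightarrow> bary j (A (oth k j)) = 0"
  using not_k_cases[of j k] bary_other_vertex[of k] bary_other_vertex[of "k + 1"] bary_other_vertex[of "k + 2"]
  by auto

lemma sgj_cases: "sgj k j = 1 \<or> sgj k j = - 1"
  using det_nonzero by (auto simp: sgj_def sgn_real_def)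

lemma sgj_oth: "j \<noteq> k \<Longrightarrow> sgj k (oth k j) = - sgj k j"
  using not_k_cases[of j k] by (auto simp: sgj_def)

lemma norm_bv [simp]: "cmod (bv k j) = 1"
  using mob_A_nonzero[of k "oth k j"] oth_neq(1)[of k j] by (simp add: bv_def norm_sgn)

lemma bv_cnj [simp]: "bv k j * cnj (bv k j) = 1" "cnj (bv k j) * bv k j = 1"
  using complex_norm_square[of "bv k j"] by (simp_all add: mult.commute)

lemma bv_nonzero [simp]: "bv k j \<noteq> 0"
  using norm_bv[of k j] by (metis norm_zero zero_neq_one)

lemma qc_ball: "cmod z < 1 \<Longrightarrow> cmod (qc k j z) < 1"
  using su_in_ball[of "- A k" 1 z] A_ball[of k] by (simp add: qc_def norm_mult)

lemma qc_inverse: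
  "cmod z < 1 \<Longrightarrow> su 1 (A k) (bv k j * qc k j z) = z"
  "cmod q < 1 \<Longrightarrow> qc k j (su 1 (A k) (bv k j * q)) = q"
  using mob_inverse(1)[OF A_ball[of k], of z] mob_inverse(2)[OF A_ball[of k], of "bv k j * q"]
  by (simp_all add: qc_def norm_mult flip: mult.assoc)

lemma qc_eq_0: "cmod z < 1 \<Longrightarrow> qc k j z = 0 \<longleftrightarrow> z = A k"
  using qc_inverse(1)[of z k j] by (auto simp: su_def qc_def)

lemma hdist_qc: "hdist k z = 2 * artanh (cmod (qc k j z))"
  by (simp add: hdist_def qc_def norm_mult)

text \<open>\<open>refl j\<close> is computed with \<open>A (j + 1)\<close> moved to 0, the
  right-hand side with \<open>A k\<close> moved to 0. The product of these two reflections preserves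
  the orientation and fixes both ends of the side \<open>j\<close>, so it is the identity by
  \<open>su_two_fixed_points\<close>.\<close>

lemma mob_refl_vertex:
  assumes jk: "j \<noteq> k" and z: "cmod z < 1"
  shows "refl j z = su 1 (A k) ((bv k j)\<^sup>2 * cnj (su 1 (- A k) z))"
proof -
  define R where "R z = su 1 (A k) ((bv k j)\<^sup>2 * cnj (su 1 (- A k) z))" for z
  obtain c d where cd: "cmod d < cmod c" "\<And>z. cmod z < 1 \<Longrightarrow> R z = su c d (cnj z)"
    unfolding R_def using reflection_su[OF norm_bv[of k j] A_ball[of k]] by blast
  obtain a b where ab: "cmod b < cmod a" "\<And>z. cmod z < 1 \<Longrightarrow> refl j z = su a b (cnj z)"
    using refl_su by blast
  have Rball: "cmod (R w) < 1" if "cmod w < 1" for w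
    using su_in_ball[OF cd(1), of "cnj w"] that by (simp add: cd(2))
  define e f where "e = a * cnj c + b * cnj (cnj d)" and "f = a * cnj d + b * cnj (cnj c)"
  have ef: "cmod f < cmod e" unfolding e_def f_def by (rule su_compose_gap) (use ab cd in simp_all)
  have comp: "refl j (R w) = su e f w" if "cmod w < 1" for w
  proof -
    have "refl j (R w) = su a b (su (cnj c) (cnj d) w)"
      using ab(2)[OF Rball[OF that]] cd(2)[OF that] by (simp add: cnj_su)
    also have "\<dots> = su e f w" unfolding e_def f_def by (rule su_compose) (use cd that in simp_all)
    finally show ?thesis .
  qed
  have RA: "R (A k) = A k" by (simp add: R_def su_def)
  have RB: "R (A (oth k j)) = A (oth k j)"
    using sgn_power2_mult_cnj[OF mob_A_nonzero[of k "oth k j"]] oth_neq(1)[of k j]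
      mob_inverse(1)[OF A_ball[of k] A_ball[of "oth k j"]] by (simp add: R_def bv_def)
  have "su e f (A k) = A k" "su e f (A (oth k j)) = A (oth k j)"
    using comp[OF A_ball[of k]] comp[OF A_ball[of "oth k j"]] RA RB
      refl_fixed[OF A_ball[of k] bary_oth(1)[OF jk]] refl_fixed[OF A_ball[of "oth k j"] bary_oth(2)[OF jk]]
    by simp_all
  then have "su e f z = z"
    using su_two_fixed_points[OF ef A_ball A_ball] A_inj[of k "oth k j"] oth_neq(1)[of k j] by metis
  then have "refl j (R z) = z" using comp[OF z] by simp
  then show ?thesis using refl_refl[OF Rball[OF z], of j] by (simp add: R_def)
qed

lemma qc_refl:
  assumes "j \<noteq> k" "cmod z < 1"
  shows "qc k j (refl j z) = cnj (qc k j z)"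
proof -
  have "cmod ((bv k j)\<^sup>2 * cnj (su 1 (- A k) z)) < 1"
    using su_in_ball[of "- A k" 1 z] A_ball[of k] assms(2) by (simp add: norm_mult norm_power)
  then have "qc k j (refl j z) = cnj (bv k j) * ((bv k j)\<^sup>2 * cnj (su 1 (- A k) z))"
    unfolding qc_def mob_refl_vertex[OF assms] using mob_inverse(2)[OF A_ball[of k]] by simp
  also have "\<dots> = (cnj (bv k j) * bv k j) * (bv k j * cnj (su 1 (- A k) z))"
    by (simp only: power2_eq_square mult_ac)
  finally show ?thesis by (simp add: qc_def)
qed

lemma qc_rho:
  assumes "j \<noteq> k" "cmod z < 1"
  shows "qc k j (rho j b z) = (if b then cnj (qc k j z) else qc k j z)"
  using qc_refl[OF assms] by (simp add: rho_def)

text \<open>An instance of \<open>mob_cross\<close> at the vertex \<open>A k\<close>. The sign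
  \<open>sgj\<close> accounts for the orientation of the triangle and for the order in which the
  side \<open>j\<close> lists its ends.\<close>

lemma bary_qc:
  assumes jk: "j \<noteq> k" and z: "cmod z < 1"
  obtains c where "c > 0" "sgj k j * Im (qc k j z) = c * bary j z"
proof -
  define D where "D = geo_det (A 0) (A 1) (A 2)"
  have D: "D \<noteq> 0" using det_nonzero by (simp add: D_def)
  define m where "m = su 1 (- A k) (A (oth k j))"
  have m: "m \<noteq> 0" using mob_A_nonzero[of k "oth k j"] oth_neq(1)[of k j] by (simp add: m_def)
  have im: "Im (qc k j z) = cross2 m (su 1 (- A k) z) / cmod m"
  proof -
    have "qc k j z = cnj m * su 1 (- A k) z / of_real (cmod m)"
      by (simp add: qc_def bv_def m_def[symmetric] sgn_eq)
    then show ?thesis by (simp only: Im_divide_of_real cross2_def)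
  qed
  define f where "f = (1 - (cmod (A k))\<^sup>2) / ((cmod (1 - cnj (A k) * A (oth k j)))\<^sup>2 * (cmod (1 - cnj (A k) * z))\<^sup>2)"
  have f: "f > 0" unfolding f_def by (rule mob_cross_factor[OF A_ball A_ball z])
  have "cross2 m (su 1 (- A k) z) = geo_det (A k) (A (oth k j)) z * f"
    unfolding m_def f_def by (rule mob_cross[OF A_ball A_ball z])
  moreover have "sgj k j * geo_det (A k) (A (oth k j)) z = \<bar>D\<bar> * bary j z"
  proof -
    have "geo_det (A k) (A (k + 2)) z = - geo_det (A (k + 2)) (A k) z"
      by (simp add: geo_det_def cross2_def algebra_simps)
    moreover have "\<bar>D\<bar> = sgn D * D" by (simp add: abs_sgn mult.commute)
    ultimately show ?thesis
      using not_k_cases[OF jk] D by (auto simp: sgj_def bary_def simp flip: D_def)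
  qed
  ultimately have "sgj k j * Im (qc k j z) = (f * \<bar>D\<bar> / cmod m) * bary j z"
    unfolding im by (simp add: algebra_simps)
  moreover have "f * \<bar>D\<bar> / cmod m > 0" using f D m by simp
  ultimately show ?thesis using that by blast
qed

text \<open>\<open>interior_angle\<close> takes the absolute value of an argument. The lost sign is
  \<open>sgj k (k + 2)\<close>, because the coordinate \<open>bary (k + 2)\<close> of the vertex
  \<open>A (k + 2)\<close> is positive.\<close>

lemma angle_at_vertex:
  "0 < theta k" "theta k < pi" "bv k (k + 1) = bv k (k + 2) * cis (sgj k (k + 2) * theta k)"
proof -
  define m1 m2 where "m1 = su 1 (- A k) (A (k + 1))" and "m2 = su 1 (- A k) (A (k + 2))"
  have m: "m1 \<noteq> 0" "m2 \<noteq> 0" using mob_A_nonzero[of k] by (simp_all add: m1_def m2_def)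
  have th: "theta k = \<bar>Arg (m2 / m1)\<bar>" by (simp add: interior_angle_def Moebius_eq_su m1_def m2_def)
  have "qc k (k + 2) (A (k + 2)) = cnj (sgn m1) * m2" by (simp add: qc_def bv_def m1_def m2_def)
  also have "\<dots> = of_real (cmod m1) * (m2 / m1)"
  proof -
    have "cnj (sgn m1) * m1 = of_real (cmod m1)"
    proof -
      have "cnj (sgn m1) * m1 = cnj m1 * m1 / of_real (cmod m1)" by (simp add: sgn_eq)
      also have "cnj m1 * m1 = of_real (cmod m1) * of_real (cmod m1)"
        using complex_norm_square[of m1] by (simp add: power2_eq_square mult.commute)
      finally show ?thesis using m(1) by simp
    qed
    then show ?thesis using m(1) by (simp add: eq_divide_eq mult.commute mult.left_commute)
  qed
  finally have q: "qc k (k + 2) (A (k + 2)) = of_real (cmod m1) * (m2 / m1)" .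
  obtain c where c: "c > 0" "sgj k (k + 2) * Im (qc k (k + 2) (A (k + 2))) = c * bary (k + 2) (A (k + 2))"
    by (rule bary_qc[OF three_neq(2) A_ball])
  have "sgj k (k + 2) * Im (m2 / m1) > 0"
  proof -
    have "cmod m1 * (sgj k (k + 2) * Im (m2 / m1)) = c"
    proof -
      have "Im (complex_of_real r * x) = r * Im x" for r x by simp
      from this[of "cmod m1" "m2 / m1"] show ?thesis
        using c(2) unfolding q by (simp only: bary_vertex mult_1_right mult.left_commute)
    qed
    then have "cmod m1 * (sgj k (k + 2) * Im (m2 / m1)) > 0" using c(1) by simp
    then show ?thesis using m by (simp add: zero_less_mult_iff)
  qed
  then have a: "Arg (m2 / m1) = sgj k (k + 2) * theta k \<and> 0 < theta k \<and> theta k < pi"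
  proof (cases "sgj k (k + 2) = 1")
    case True
    with \<open>sgj k (k + 2) * Im (m2 / m1) > 0\<close> show ?thesis
      using Arg_lt_pi[of "m2 / m1"] th by auto
  next
    case False
    then have s: "sgj k (k + 2) = - 1" using sgj_cases by blast
    then have "Im (m2 / m1) < 0" using \<open>sgj k (k + 2) * Im (m2 / m1) > 0\<close> by simp
    then have "Arg (m2 / m1) < 0" using Arg_less_0[of "m2 / m1"] by simp
    then show ?thesis using th s Arg_bounds'[of "m2 / m1"] by auto
  qed
  then show "0 < theta k" "theta k < pi" by auto
  have "sgn m2 = sgn m1 * sgn (m2 / m1)" using m by (simp add: sgn_eq norm_divide)
  also have "sgn (m2 / m1) = cis (sgj k (k + 2) * theta k)"
    using a m cis_Arg[of "m2 / m1"] by auto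
  finally show "bv k (k + 1) = bv k (k + 2) * cis (sgj k (k + 2) * theta k)"
    by (simp add: bv_def m1_def m2_def)
qed

lemma qc_oth:
  assumes "j \<noteq> k"
  shows "qc k (oth k j) z = qc k j z * cis (- sgj k j * theta k)"
proof -
  define c where "c = cis (sgj k (k + 2) * theta k)"
  have c: "c * cnj c = 1" "cnj c = cis (- sgj k (k + 2) * theta k)" by (simp_all add: c_def cis_cnj cis_mult)
  have b: "bv k (k + 1) = bv k (k + 2) * c" using angle_at_vertex(3) by (simp add: c_def)
  have s: "sgj k (k + 1) = - sgj k (k + 2)" using sgj_oth[of "k + 2" k] by simp
  show ?thesis
    using not_k_cases[OF assms]
  proof
    assume j: "j = k + 1"
    have "qc k (k + 1) z * c = cnj (bv k (k + 2)) * su 1 (- A k) z * (c * cnj c)"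
      by (simp add: qc_def b)
    then have "qc k (k + 1) z * c = qc k (k + 2) z" unfolding c(1) by (simp add: qc_def)
    then show ?thesis by (simp add: j s c_def)
  next
    assume j: "j = k + 2"
    show ?thesis using c(2) by (simp add: j qc_def b)
  qed
qed

lemma bary_qc_oth:
  assumes jk: "j \<noteq> k" and z: "cmod z < 1" "qc k j z \<noteq> 0"
  obtains c d where "c > 0" "d > 0"
    "sin (sgj k j * Arg (qc k j z)) = c * bary j z"
    "sin (theta k - sgj k j * Arg (qc k j z)) = d * bary (oth k j) z"
proof -
  define q where "q = qc k j z"
  have q: "q = of_real (cmod q) * cis (Arg q)" "cmod q > 0"
    using of_real_cmod_cis_Arg z by (simp_all add: q_def)
  have sin: "s * sin x = sin (s * x)" if "s = 1 \<or> s = - 1" for s x :: real using that by auto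
  obtain c where c: "c > 0" "sgj k j * Im q = c * bary j z" using bary_qc[OF jk z(1)] by (auto simp: q_def)
  obtain d where d: "d > 0" "sgj k (oth k j) * Im (qc k (oth k j) z) = d * bary (oth k j) z"
    using bary_qc[OF oth_neq(1) z(1)] by blast
  have "Im q = cmod q * sin (Arg q)" by (subst q(1)) simp
  then have "cmod q * sin (sgj k j * Arg q) = c * bary j z"
    using c(2) sin[OF sgj_cases, of k j "Arg q"] by (simp add: mult.left_commute)
  then have 1: "sin (sgj k j * Arg q) = (c / cmod q) * bary j z" using q(2) by (simp add: field_simps)
  have "qc k (oth k j) z = of_real (cmod q) * cis (Arg q - sgj k j * theta k)"
    unfolding qc_oth[OF jk] q_def[symmetric] by (subst q(1)) (simp add: cis_mult mult.assoc)
  then have "Im (qc k (oth k j) z) = cmod q * sin (Arg q - sgj k j * theta k)" by simp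
  moreover have "sgj k (oth k j) * sin (Arg q - sgj k j * theta k) = sin (theta k - sgj k j * Arg q)"
  proof -
    have "sgj k (oth k j) * sin (Arg q - sgj k j * theta k) = sin (sgj k (oth k j) * (Arg q - sgj k j * theta k))"
      by (rule sin[OF sgj_cases])
    also have "sgj k (oth k j) * (Arg q - sgj k j * theta k) = (sgj k j * sgj k j) * theta k - sgj k j * Arg q"
      unfolding sgj_oth[OF jk] by (simp add: algebra_simps)
    also have "sgj k j * sgj k j = 1" using sgj_cases[of k j] by auto
    finally show ?thesis by simp
  qed
  ultimately have "cmod q * sin (theta k - sgj k j * Arg q) = d * bary (oth k j) z"
    using d(2) by (metis mult.left_commute)
  then have 2: "sin (theta k - sgj k j * Arg q) = (d / cmod q) * bary (oth k j) z"
    using q(2) by (simp add: field_simps)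
  show ?thesis
    by (rule that[OF _ _ 1[unfolded q_def] 2[unfolded q_def]]) (use c(1) d(1) q(2) in \<open>simp_all add: q_def\<close>)
qed

text \<open>The two conditions become signs of \<open>sin x\<close> and of
  \<open>sin (theta k - x)\<close>. For \<open>x\<close> between \<open>- pi\<close> and
  \<open>pi\<close> and an angle between 0 and \<open>pi\<close> they cut out the interval from 0 to
  \<open>theta k\<close>.\<close>

lemma sector_of_bary:
  assumes jk: "j \<noteq> k" and z: "cmod z < 1" "qc k j z \<noteq> 0"
  shows "bary j z \<ge> 0 \<and> bary (oth k j) z > 0 \<longleftrightarrow>
     0 \<le> sgj k j * Arg (qc k j z) \<and> sgj k j * Arg (qc k j z) < theta k"
proof -
  define x where "x = sgj k j * Arg (qc k j z)"
  obtain c d where cd: "c > 0" "d > 0" "sin x = c * bary j z" "sin (theta k - x) = d * bary (oth k j) z"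
    using bary_qc_oth[OF assms] unfolding x_def by blast
  have x: "- pi \<le> x" "x \<le> pi"
    using sgj_cases[of k j] Arg_bounds'[of "qc k j z"] by (auto simp: x_def)
  note th = angle_at_vertex(1,2)[of k]
  have "bary j z \<ge> 0 \<longleftrightarrow> sin x \<ge> 0" "bary (oth k j) z > 0 \<longleftrightarrow> sin (theta k - x) > 0"
    using cd by (simp_all add: zero_le_mult_iff zero_less_mult_iff)
  moreover have "sin x \<ge> 0 \<and> sin (theta k - x) > 0 \<longleftrightarrow> 0 \<le> x \<and> x < theta k"
  proof
    assume s: "sin x \<ge> 0 \<and> sin (theta k - x) > 0"
    \<comment> \<open>This value occurs when \<open>sgj k j = - 1\<close> and the argument is
      \<open>pi\<close>. There \<open>sin x = 0\<close>, and it is the second sign that excludes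
      it.\<close>
    have "x \<noteq> - pi"
    proof
      assume "x = - pi"
      then have "sin (theta k - x) = - sin (theta k)" by simp
      then show False using s sin_gt_zero[of "theta k"] th by simp
    qed
    moreover have "\<not> (- pi < x \<and> x < 0)" using s sin_gt_zero[of "- x"] by auto
    ultimately have "0 \<le> x" using x by linarith
    moreover have "x < theta k"
    proof (rule ccontr)
      assume "\<not> x < theta k"
      then have "sin (x - theta k) \<ge> 0" using x th by (intro sin_ge_zero) auto
      moreover have "sin (x - theta k) = - sin (theta k - x)" by (metis minus_diff_eq sin_minus)
      ultimately show False using s by simp
    qed
    ultimately show "0 \<le> x \<and> x < theta k" by simp
  next
    assume "0 \<le> x \<and> x < theta k"
    then show "sin x \<ge> 0 \<and> sin (theta k - x) > 0"
      using th sin_ge_zero[of x] sin_gt_zero[of "theta k - x"] by auto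
  qed
  ultimately show ?thesis unfolding x_def by blast
qed

lemma region_oth: "j \<noteq> k \<Longrightarrow> z \<in> region j \<longleftrightarrow> cmod z < 1 \<and> bary k z > 0 \<and> bary j z \<ge> 0 \<and> bary (oth k j) z > 0"
  using not_k_cases[of j k] by (auto simp: region_def)

lemma region_vertex: "z \<in> region j \<Longrightarrow> z \<noteq> A k"
  using dom_not_cone[of k j] glue_in_dom[of "A k" False j] by auto

text \<open>The two copies appear on both sides of the positive real axis and are conjugate to each
  other, so together they form the symmetric sector \<open>|Arg| < theta k\<close>, whose total
  angle is the cone angle.\<close>

lemma chart_sector:
  assumes jk: "j \<noteq> k" and w: "w \<in> region j"
  shows "qc k j w \<noteq> 0" "0 \<le> sgj k j * Arg (qc k j w)" "sgj k j * Arg (qc k j w) < theta k"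
    "Arg (qc k j (rho j b w)) = (if b then - 1 else 1) * Arg (qc k j w)"
    "\<bar>Arg (qc k j (rho j b w))\<bar> < theta k" "qc k j (rho j b w) \<noteq> 0"
proof -
  have w1: "cmod w < 1" using regionD[OF w] .
  show q: "qc k j w \<noteq> 0" using qc_eq_0[OF w1] region_vertex[OF w] by simp
  show s: "0 \<le> sgj k j * Arg (qc k j w)" "sgj k j * Arg (qc k j w) < theta k"
    using sector_of_bary[OF jk w1 q] w by (simp_all add: region_oth[OF jk])
  have "\<bar>sgj k j * Arg (qc k j w)\<bar> < theta k" using s by simp
  then have a: "\<bar>Arg (qc k j w)\<bar> < theta k" using sgj_cases[of k j] by (auto simp: abs_mult)
  then have "\<bar>Arg (qc k j w)\<bar> < pi" using angle_at_vertex(2)[of k] by linarith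
  then show b: "Arg (qc k j (rho j b w)) = (if b then - 1 else 1) * Arg (qc k j w)"
    using Arg_cnj' q by (simp add: qc_rho[OF jk w1])
  show "\<bar>Arg (qc k j (rho j b w))\<bar> < theta k" unfolding b using a by simp
  show "qc k j (rho j b w) \<noteq> 0" using q by (simp add: qc_rho[OF jk w1])
qed

lemma Arg_qc_first:
  "Arg (su 1 (- A k) w / su 1 (- A k) (A (k + 1))) = Arg (qc k (k + 2) w)"
proof -
  define m where "m = su 1 (- A k) (A (k + 1))"
  have m: "m \<noteq> 0" using mob_A_nonzero[of k "k + 1"] by (simp add: m_def)
  have "cnj (bv k (k + 2)) = inverse (bv k (k + 2))"
    using bv_cnj(2)[of k "k + 2"] by (metis inverse_unique mult.commute)
  moreover have "bv k (k + 2) = m / of_real (cmod m)" by (simp add: bv_def m_def sgn_eq)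
  ultimately have "qc k (k + 2) w = of_real (cmod m) * (su 1 (- A k) w / m)"
    by (simp add: qc_def)
  moreover have "Arg (of_real (cmod m) * (su 1 (- A k) w / m)) = Arg (su 1 (- A k) w / m)"
    using m by (intro Arg_times_of_real) simp
  ultimately show ?thesis by (simp only: m_def)
qed

lemma Arg_qc_second:
  assumes "w \<in> region (k + 1)"
  shows "Arg (qc k (k + 2) w) = sgj k (k + 2) * theta k + Arg (qc k (k + 1) w)"
proof -
  define q where "q = qc k (k + 1) w"
  note S = chart_sector[of "k + 1" k, OF _ assms]
  have q: "q \<noteq> 0" using S(1) by (simp add: q_def)
  have s: "sgj k (k + 1) = - sgj k (k + 2)" using sgj_oth[of "k + 2" k] by simp
  have x: "- theta k < sgj k (k + 2) * Arg q" "sgj k (k + 2) * Arg q \<le> 0"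
    using S(2,3) by (simp_all add: q_def s)
  have "qc k (k + 2) w = q * cis (sgj k (k + 2) * theta k)"
    using qc_oth[of "k + 1" k w] by (simp add: s q_def)
  also have "\<dots> = of_real (cmod q) * cis (sgj k (k + 2) * theta k + Arg q)"
    by (subst of_real_cmod_cis_Arg[OF q, symmetric]) (simp add: cis_mult mult_ac add.commute)
  finally have e: "qc k (k + 2) w = of_real (cmod q) * cis (sgj k (k + 2) * theta k + Arg q)" .
  have "\<bar>sgj k (k + 2) * theta k + Arg q\<bar> < pi"
    using sgj_cases[of k "k + 2"] x angle_at_vertex(1,2)[of k] by auto
  then show ?thesis
    unfolding e q_def[symmetric] using q by (intro Arg_of_real_cis) auto
qed

text \<open>The angle at the cone point is multiplied by \<open>\<pi> / \<theta>\<close>, so that the two charts covering the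
  punctured ball differ by the rotation by \<open>\<pi>\<close>.\<close>

lemma cone_angle_chart:
  assumes jk: "j \<noteq> k" and P: "P \<in> dom j" and om: "\<omega> = 1 \<or> \<omega> = (- 1 :: real)"
  shows "cis (cone_angle A \<omega> k P * pi / theta k) =
    (if j = k + 2 then 1 else - 1) * cis (\<omega> * pi / theta k * Arg (qc k j (crd j P)))"
proof -
  obtain w b where w: "w \<in> region j" "P = glue A (w, b)" using P by (rule domE)
  have w1: "cmod w < 1" using regionD[OF w(1)] .
  have th: "theta k > 0" by (rule angle_at_vertex(1))
  \<comment> \<open>The representative \<open>b\<close> is ambiguous on the sides, where
    \<open>in_first_copy\<close> always holds. Replacing \<open>b\<close> by \<open>c\<close> does
    not change the coordinate, as the reflection fixes the side \<open>j\<close>.\<close>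
  define c where "c \<longleftrightarrow> \<not> in_first_copy P"
  have z: "crd j P = rho j c w"
  proof (cases "bary j w = 0")
    case True
    then have "refl j w = w" by (rule refl_fixed[OF w1])
    then show ?thesis using crd_glue[OF w(1), of b] w(2) by (simp add: rho_def)
  next
    case False
    then have "in_first_copy P \<longleftrightarrow> \<not> b" using region_side[OF w(1)] w(2) by simp
    then show ?thesis using crd_glue[OF w(1), of b] w(2) by (simp add: c_def)
  qed
  note S = chart_sector[OF jk w(1)]
  define e where "e = (if c then - 1 else 1 :: real)"
  have ca: "cone_angle A \<omega> k P = \<omega> * e * Arg (qc k (k + 2) w)"
    using w(2) by (simp add: cone_angle_def Moebius_eq_su Arg_qc_first c_def e_def del: in_first_copy_glue)
  have az: "Arg (qc k j (crd j P)) = e * Arg (qc k j w)" unfolding z S(4) by (simp add: e_def)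
  show ?thesis
    using not_k_cases[OF jk]
  proof
    assume j: "j = k + 2"
    show ?thesis unfolding ca az by (simp add: j mult_ac)
  next
    assume j: "j = k + 1"
    have "cone_angle A \<omega> k P * pi / theta k =
       (\<omega> * e * sgj k (k + 2)) * pi + \<omega> * pi / theta k * Arg (qc k j (crd j P))"
      unfolding ca az using Arg_qc_second[OF w(1)[unfolded j]] th
      by (simp add: j field_simps)
    \<comment> \<open>The extra angle is \<open>pi\<close> or \<open>- pi\<close>; both give the
      factor \<open>- 1\<close> of the chart \<open>k + 1\<close>.\<close>
    moreover have "cis ((\<omega> * e * sgj k (k + 2)) * pi) = - 1"
    proof -
      have "\<omega> * e * sgj k (k + 2) = 1 \<or> \<omega> * e * sgj k (k + 2) = - 1"
        using om sgj_cases[of k "k + 2"] by (auto simp: e_def)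
      then show ?thesis by (auto simp: complex_eq_iff)
    qed
    ultimately show ?thesis by (simp add: j flip: cis_mult)
  qed
qed

end

lemma su'_mob_inverse:
  assumes "cmod p < 1" "cmod z < 1"
  shows "su' 1 p (su 1 (- p) z) * su' 1 (- p) z = 1"
proof -
  define d where "d = 1 - cnj p * z"
  define K where "K = complex_of_real (1 - (cmod p)\<^sup>2)"
  have d: "d \<noteq> 0" using su_denom[of "- p" 1 z] assms by (simp add: d_def)
  have K: "K \<noteq> 0" using assms(1) by (simp add: K_def abs_square_eq_1 del: of_real_diff of_real_power)
  have Kp: "K = 1 - cnj p * p" unfolding K_def
    using complex_norm_square[of p] by (simp add: mult.commute)
  have "cnj p * su 1 (- p) z + 1 = (cnj p * (z - p) + d) / d"
    using d by (simp add: su_def d_def field_simps)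
  also have "cnj p * (z - p) + d = K" by (simp add: Kp d_def algebra_simps)
  finally have "su' 1 p (su 1 (- p) z) = K / (K / d)\<^sup>2"
    by (simp add: su'_def K_def)
  moreover have "su' 1 (- p) z = K / d\<^sup>2" by (simp add: su'_def K_def d_def)
  ultimately show ?thesis using d K by (simp add: power2_eq_square)
qed

lemma sinh_2_artanh:
  fixes x :: real
  assumes "\<bar>x\<bar> < 1"
  shows "sinh (2 * artanh x) = 2 * x / (1 - x\<^sup>2)"
proof -
  define y where "y = artanh x"
  have x: "x = sinh y / cosh y" using tanh_artanh_real[OF assms] by (simp add: y_def tanh_def)
  have c: "cosh y \<noteq> 0" by simp
  have "1 - x\<^sup>2 = ((cosh y)\<^sup>2 - (sinh y)\<^sup>2) / (cosh y)\<^sup>2"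
    using c by (simp add: x power_divide diff_divide_distrib)
  also have "(cosh y)\<^sup>2 - (sinh y)\<^sup>2 = 1" by (simp add: hyperbolic_pythagoras)
  finally have "2 * x / (1 - x\<^sup>2) = 2 * sinh y * cosh y"
    using c by (simp add: x power2_eq_square)
  then show ?thesis by (simp add: sinh_double y_def)
qed

lemma cis_mult_Arg:
  assumes "\<omega> = 1 \<or> \<omega> = (- 1 :: real)" "y \<noteq> 0"
  shows "cis (\<omega> * Arg y) = (if \<omega> = 1 then sgn y else cnj (sgn y))"
  using assms cis_Arg[of y] by (auto simp flip: cis_cnj)

context cone_setting
begin

lemma omega_cases: "\<omega> = 1 \<or> \<omega> = - 1"
  using omega by auto

section \<open>Radial geodesics\<close>

definition radial :: "3 \<Rightarrow> complex \<Rightarrow> real \<Rightarrow> complex" where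
  "radial k u t = su 1 (A k) (of_real (tanh (t / 2)) * u)"

lemma tanh_lt_1: "cmod u = 1 \<Longrightarrow> cmod (of_real (tanh t) * u) < 1"
  using tanh_real_bounds[of t] by (auto simp: norm_mult)

lemma radial_derivative:
  assumes "cmod u = 1"
  shows "(radial k u has_vector_derivative
     su' 1 (A k) (of_real (tanh (t / 2)) * u) * (of_real ((1 - (tanh (t / 2))\<^sup>2) / 2) * u)) (at t)"
  unfolding radial_def using A_ball[of k] tanh_lt_1[OF assms]
  by (intro has_vector_derivative_su has_vector_derivative_ray) auto

lemma radial_geodesic: "cmod u = 1 \<Longrightarrow> disc_geodesic_at (radial k u) t"
  unfolding radial_def using A_ball[of k] by (intro disc_geodesic_at_su disc_geodesic_at_ray) auto

lemma radial_unit: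
  assumes "cmod u = 1"
  shows "2 * cmod (vector_derivative (radial k u) (at t)) = 1 - (cmod (radial k u t))\<^sup>2"
proof -
  define T where "T = tanh (t / 2)"
  have T: "\<bar>T\<bar> < 1" using tanh_real_bounds[of "t / 2"] by (auto simp: T_def)
  then have "1 - T\<^sup>2 > 0" by (simp add: abs_square_less_1)
  then have e1: "cmod (of_real ((1 - T\<^sup>2) / 2) * u) = (1 - T\<^sup>2) / 2"
    unfolding norm_mult norm_of_real assms by simp
  have e2: "1 - (cmod (radial k u t))\<^sup>2 = cmod (su' 1 (A k) (of_real T * u)) * (1 - (cmod (of_real T * u))\<^sup>2)"
    unfolding radial_def T_def using A_ball[of k] tanh_lt_1[OF assms] by (intro su'_norm) auto
  have e3: "(cmod (of_real T * u))\<^sup>2 = T\<^sup>2" using assms by (simp add: norm_mult)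
  have e4: "vector_derivative (radial k u) (at t) = su' 1 (A k) (of_real T * u) * (of_real ((1 - T\<^sup>2) / 2) * u)"
    unfolding T_def by (rule vector_derivative_at[OF radial_derivative[OF assms]])
  show ?thesis unfolding e4 norm_mult[of "su' 1 (A k) (of_real T * u)"] e1 e2 e3 by simp
qed

lemma radial_continuous: "cmod u = 1 \<Longrightarrow> isCont (radial k u) t"
  using disc_geodesic_atD(3)[OF radial_geodesic] .

lemma qc_radial: "cmod u = 1 \<Longrightarrow> qc k j (radial k u t) = of_real (tanh (t / 2)) * (cnj (bv k j) * u)"
  using mob_inverse(2)[OF A_ball[of k] tanh_lt_1[of u "t / 2"]] by (simp add: qc_def radial_def mult.left_commute)

lemma radial_ball: "cmod u = 1 \<Longrightarrow> cmod (radial k u t) < 1"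
  using disc_geodesic_atD(1)[OF radial_geodesic] .

lemma tanh_hdist: "cmod z < 1 \<Longrightarrow> tanh (hdist k z / 2) = cmod (qc k j z)"
  using qc_ball[of z k j] by (simp add: hdist_qc[of k z j] tanh_artanh_real)

text \<open>The geodesic from the cone point to \<open>P\<close> is the image of a Euclidean ray in the chart \<open>j\<close>, and
  it extends beyond \<open>P\<close> within the copy of the triangle containing \<open>P\<close>.\<close>

lemma radial_segment:
  assumes P: "P \<in> cone_ball A \<tau> k" "P \<in> dom j" and jk: "j \<noteq> k"
  defines "u \<equiv> bv k j * sgn (qc k j (crd j P))" and "r \<equiv> hdist k (crd j P)"
  obtains c where "cone_segment A k P c"
    "\<And>t. 0 < t \<Longrightarrow> t \<le> r \<Longrightarrow> c t \<in> dom j \<and> crd j (c t) = radial k u t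
        \<and> cone_angle A \<omega> k (c t) = cone_angle A \<omega> k P"
proof -
  obtain w b where w: "w \<in> region j" "P = glue A (w, b)" using P(2) by (rule domE)
  have w1: "cmod w < 1" by (rule regionD[OF w(1)])
  have Pk: "P \<noteq> cone_point A k" using P(2) dom_not_cone by blast
  note S = chart_sector[OF jk w(1)]
  define m where "m = su 1 (- A k) w"
  \<comment> \<open>The direction of the ray in the folded triangle, while \<open>u\<close> is its
    direction in the chart \<open>j\<close>; for the second copy they are mirror images.\<close>
  define u0 where "u0 = sgn m"
  have m0: "m \<noteq> 0" using S(1) by (simp add: qc_def m_def)
  have u0: "cmod u0 = 1" using m0 by (simp add: u0_def norm_sgn)
  have qm: "cmod (qc k i w) = cmod m" for i by (simp add: qc_def m_def norm_mult)
  have rd: "r = hdist k w"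
    unfolding r_def w(2) crd_glue[OF w(1)] hdist_qc[of k _ j] by (simp add: qc_rho[OF jk w1])
  have r0: "r > 0" unfolding rd by (rule hdist_pos[OF w1 region_vertex[OF w(1)]])
  have Tr: "tanh (r / 2) = cmod m" unfolding rd using tanh_hdist[OF w1, of k j] qm by simp
  have m_u0: "m = of_real (cmod m) * u0" by (simp add: u0_def sgn_eq)
  have ray_r: "radial k u0 r = w"
  proof -
    have "radial k u0 r = su 1 (A k) m" unfolding radial_def Tr using m_u0 by simp
    then show ?thesis unfolding m_def by (simp only: mob_inverse(1)[OF A_ball w1])
  qed
  \<comment> \<open>Moving along a ray from the vertex multiplies \<open>qc k i\<close> by a
    positive number, so the coordinates other than \<open>bary k\<close> keep their signs.\<close>
  have sgn: "\<exists>e>0. bary i (radial k u0 t) = e * bary i w" if t: "t > 0" and ik: "i \<noteq> k" for t i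
  proof -
    obtain e where e: "e > 0" "sgj k i * Im (qc k i (radial k u0 t)) = e * bary i (radial k u0 t)"
      using bary_qc[OF ik radial_ball[OF u0]] by blast
    obtain f where f: "f > 0" "sgj k i * Im (qc k i w) = f * bary i w" using bary_qc[OF ik w1] by blast
    have T: "tanh (t / 2) > 0" using t by simp
    have "qc k i w = of_real (cmod m) * (cnj (bv k i) * u0)"
      unfolding qc_def m_def[symmetric] by (subst m_u0) simp
    then have "cmod m * (sgj k i * Im (qc k i (radial k u0 t))) = tanh (t / 2) * (sgj k i * Im (qc k i w))"
      unfolding qc_radial[OF u0] by simp
    then have "cmod m * (e * bary i (radial k u0 t)) = tanh (t / 2) * (f * bary i w)"
      unfolding e(2) f(2) .
    then have "bary i (radial k u0 t) = (tanh (t / 2) * f / (cmod m * e)) * bary i w"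
      using m0 e(1) by (simp add: field_simps)
    moreover have "tanh (t / 2) * f / (cmod m * e) > 0" using T f(1) m0 e(1) by simp
    ultimately show ?thesis by blast
  qed
  \<comment> \<open>By \<open>cone_ball_opposite_side\<close> the ray has not reached the side
    \<open>k\<close> at time \<open>r\<close>, hence it stays in the triangle a little longer. This
    is the extension beyond \<open>P\<close> that \<open>cone_segment\<close> requires.\<close>
  have "isCont (\<lambda>t. bary k (radial k u0 t)) r"
    using continuous_on_bary[of UNIV k] radial_continuous[OF u0]
    by (intro isCont_o2[of r "radial k u0" "bary k"]) (auto simp: continuous_on_eq_continuous_at)
  moreover have "bary k (radial k u0 r) > 0"
    using cone_ball_opposite_side[OF P(1)] w(2) by (simp add: ray_r)
  ultimately have "\<forall>\<^sub>F t in nhds r. bary k (radial k u0 t) > 0"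
    unfolding tendsto_nhds_isCont using order_tendstoD(1) by blast
  then obtain d where d: "d > 0" "\<And>t. dist t r < d \<Longrightarrow> bary k (radial k u0 t) > 0"
    unfolding eventually_nhds_metric by blast
  define a where "a = r + d"
  have a: "a > r" "a > 0" using d r0 by (simp_all add: a_def)
  have bk: "bary k (radial k u0 t) > 0" if t: "0 < t" "t < a" for t
  proof (cases "t < r")
    case True
    define x where "x = tanh (t / 2) / cmod m"
    have "tanh (t / 2) < cmod m" unfolding Tr[symmetric] using True by simp
    then have x: "0 < x" "x < 1" using t(1) m0 by (simp_all add: x_def)
    have "radial k u0 t = su 1 (A k) (x *\<^sub>R m)"
      unfolding radial_def by (subst m_u0) (use m0 in \<open>simp add: x_def scaleR_conv_of_real\<close>)
    then show ?thesis
      using segment_points(2)[of w k x "radial k u0 t"] x w(1) region_iff region_vertex[OF w(1)]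
      by (simp add: m_def)
  next
    case False
    then show ?thesis using d(2)[of t] t by (simp add: a_def dist_real_def)
  qed
  have reg: "radial k u0 t \<in> region j" if t: "0 < t" "t < a" for t
  proof -
    have "bary j w \<ge> 0" "bary (oth k j) w > 0" using w(1) by (simp_all add: region_oth[OF jk])
    then have "bary j (radial k u0 t) \<ge> 0" "bary (oth k j) (radial k u0 t) > 0"
      using sgn[OF t(1) jk] sgn[OF t(1) oth_neq(1)[of k j]] by auto
    then show ?thesis using bk[OF t] radial_ball[OF u0] by (simp add: region_oth[OF jk])
  qed
  have rad0: "radial k u0 0 = A k" by (simp add: radial_def su_def)
  define c where "c t = glue A (radial k u0 t, b)" for t
  have uu: "cmod u = 1"
    using S(6)[of b] by (simp add: u_def w(2) crd_glue[OF w(1)] norm_mult norm_sgn)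
  have crd_c: "c t \<in> dom j \<and> crd j (c t) = radial k u t" if t: "0 < t" "t < a" for t
  proof
    show "c t \<in> dom j" using reg[OF t] by (simp add: c_def)
    have "qc k j (rho j b (radial k u0 t)) = of_real (tanh (t / 2)) * (cnj (bv k j) * u)"
    proof -
      have qw: "cnj (bv k j) * u0 = qc k j w / of_real (cmod m)"
        using m0 by (simp add: qc_def m_def[symmetric] u0_def sgn_eq)
      have "cnj (bv k j) * u = (cnj (bv k j) * bv k j) * sgn (qc k j (rho j b w))"
        by (simp add: u_def w(2) crd_glue[OF w(1)])
      also have "\<dots> = qc k j (rho j b w) / of_real (cmod m)"
        using qm[of j] by (simp add: sgn_eq qc_rho[OF jk w1])
      finally show ?thesis
        unfolding qc_rho[OF jk radial_ball[OF u0]] qc_rho[OF jk w1] qc_radial[OF u0] qw by simp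
    qed
    then have "qc k j (rho j b (radial k u0 t)) = qc k j (radial k u t)"
      unfolding qc_radial[OF uu] .
    then have "rho j b (radial k u0 t) = radial k u t"
      using qc_inverse(1)[of _ k j] rho_ball[OF radial_ball[OF u0]] radial_ball[OF uu] by metis
    then show "crd j (c t) = radial k u t" unfolding c_def crd_glue[OF reg[OF t]] .
  qed
  have near: "\<forall>\<^sub>F s in nhds t. s \<in> {0<..<a}" if "t \<in> {0<..<a}" for t
    using that by (intro eventually_nhds_in_open) auto
  have cc: "chart_cont j c t" if t: "t \<in> {0<..<a}" for t
  proof -
    have "\<forall>\<^sub>F s in nhds t. radial k u0 s \<in> triangle A"
      using near[OF t]
    proof eventually_elim
      case (elim s)
      then show ?case using reg[of s] region_iff by auto
    qed
    then show ?thesis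
      unfolding c_def[abs_def] using chart_cont_glue(1)[OF radial_continuous[OF u0]] reg[of t] t by simp
  qed
  have evr: "\<forall>\<^sub>F s in nhds t. crd j (c s) = radial k u s" if t: "t \<in> {0<..<a}" for t
    using near[OF t] by eventually_elim (use crd_c in simp)
  have dg: "disc_geodesic_at (\<lambda>s. crd j (c s)) t" if t: "t \<in> {0<..<a}" for t
    by (rule disc_geodesic_at_cong[OF evr[OF t] radial_geodesic[OF uu]])
  have "geodesic_on (double_atlas A) c {0<..<a}"
    using cc dg by (intro geodesic_onI) blast
  moreover have "tangent_norm (double_atlas A) (c t) (dvel c t) = 1" if t: "t \<in> {0<..<a}" for t
  proof -
    have ct: "c t \<in> dom j" "crd j (c t) = radial k u t" using crd_c t by auto
    have "dvel c t (double_chart A j) = vector_derivative (radial k u) (at t)"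
      using velocity_chart[of c t j] ct(1) vector_derivative_cong_nhds[OF evr[OF t]] by simp
    moreover have "1 - (cmod (radial k u t))\<^sup>2 > 0" using radial_ball[OF uu] by (simp add: abs_square_less_1)
    ultimately show ?thesis
      using tangent_norm_eq[OF velocity_tangent[OF cc[OF t] disc_geodesic_atD(2)[OF dg[OF t]]] ct(1)]
        radial_unit[OF uu, of k t] ct(2) by simp
  qed
  moreover have "continuous_map (top_of_set {0..<a}) (double_topology A) c"
    unfolding c_def
  proof (rule continuous_glue)
    show "continuous_on {0..<a} (radial k u0)"
      using radial_continuous[OF u0] by (intro continuous_at_imp_continuous_on) auto
    fix t assume "t \<in> {0..<a}"
    then show "radial k u0 t \<in> triangle A"
      using reg[of t] region_iff rad0 vertex_in_triangle by (cases "t = 0") auto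
  qed
  moreover have "double_dist A P (cone_point A k) = r"
    using double_dist_eq[OF cone_ball_double[OF P(1)] Pk] w(2) by (simp add: rd)
  moreover have "c 0 = cone_point A k" "c r = P" by (simp_all add: c_def rad0 ray_r w(2))
  ultimately have "cone_segment A k P c"
    unfolding cone_segment_def cone_geodesic_def unit_geodesic_on_def using a by auto
  moreover have "c t \<in> dom j \<and> crd j (c t) = radial k u t
        \<and> cone_angle A \<omega> k (c t) = cone_angle A \<omega> k P" if t: "0 < t" "t \<le> r" for t
  proof -
    have ta: "0 < t" "t < a" using t a by auto
    have "bary j (radial k u0 t) = 0 \<longleftrightarrow> bary j w = 0" using sgn[OF t(1) jk] by auto
    then have "in_first_copy (c t) \<longleftrightarrow> in_first_copy P"
      using region_side[OF w(1)] region_side[OF reg[OF ta]] by (simp add: c_def w(2))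
    moreover have "Arg (Moebius_function 0 (A k) (fold_point (c t)) / Moebius_function 0 (A k) (A (k + 1))) =
      Arg (Moebius_function 0 (A k) (fold_point P) / Moebius_function 0 (A k) (A (k + 1)))"
    proof -
      have "su 1 (- A k) (radial k u0 t) = of_real (tanh (t / 2)) * u0"
        unfolding radial_def by (rule mob_inverse(2)[OF A_ball tanh_lt_1[OF u0]])
      then have "su 1 (- A k) (radial k u0 t) / x = of_real (tanh (t / 2) / cmod m) * (m / x)" for x
        by (subst (2) m_u0) (use m0 in simp)
      moreover have "tanh (t / 2) / cmod m > 0" using t m0 by simp
      ultimately show ?thesis
        unfolding Moebius_eq_su by (simp only: c_def w(2) fold_point_glue m_def[symmetric] Arg_times_of_real)
    qed
    ultimately show ?thesis using crd_c[OF ta] by (simp add: cone_angle_def)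
  qed
  ultimately show ?thesis using that by blast
qed

text \<open>The polar angle and the outward velocity are defined through a segment picked by
  \<open>SOME\<close>. Uniqueness in the ball identifies it with the radial one, along which the
  cone angle is constant.\<close>

lemma chosen_segment:
  assumes P: "P \<in> cone_ball A \<tau> k" "P \<in> dom j" and jk: "j \<noteq> k"
  defines "c \<equiv> SOME c. cone_segment A k P c"
    and "u \<equiv> bv k j * sgn (qc k j (crd j P))" and "r \<equiv> hdist k (crd j P)"
  shows "r > 0" "double_dist A P (cone_point A k) = r"
    "initial_direction A \<omega> k c = cone_angle A \<omega> k P"
    "outward_velocity A k P (double_chart A j) = vector_derivative (radial k u) (at r)"
    "outward_velocity A k P \<in> tangent_space (double_atlas A) P"
proof -
  have Pk: "P \<noteq> cone_point A k" using P(2) dom_not_cone by blast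
  obtain c0 where c0: "cone_segment A k P c0"
    "\<And>t. 0 < t \<Longrightarrow> t \<le> r \<Longrightarrow> c0 t \<in> dom j \<and> crd j (c0 t) = radial k u t
        \<and> cone_angle A \<omega> k (c0 t) = cone_angle A \<omega> k P"
    using radial_segment[OF P jk] unfolding u_def r_def by blast
  have c: "cone_segment A k P c" unfolding c_def using someI_ex[of "cone_segment A k P"] c0(1) by blast
  obtain w b where w: "w \<in> region j" "P = glue A (w, b)" using P(2) by (rule domE)
  have w1: "cmod w < 1" by (rule regionD[OF w(1)])
  have rd: "r = hdist k (fold_point P)"
    unfolding r_def w(2) crd_glue[OF w(1)] hdist_qc[of k _ j] by (simp add: qc_rho[OF jk w1])
  show r0: "r > 0"
    unfolding rd w(2) fold_point_glue by (rule hdist_pos[OF w1 region_vertex[OF w(1)]])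
  show dist: "double_dist A P (cone_point A k) = r"
    unfolding rd by (rule double_dist_eq[OF cone_ball_double[OF P(1)] Pk])
  have eq: "c t = c0 t" if "0 \<le> t" "t \<le> r" for t
    by (rule cone_segment_unique[OF P(1) Pk c c0(1)]) (use that rd in simp)
  have "\<forall>\<^sub>F t in at_right 0. cone_angle A \<omega> k (c t) = cone_angle A \<omega> k P"
    unfolding eventually_at_right_field
    by (intro exI[of _ r]) (use r0 eq c0(2) in auto)
  then have "((\<lambda>t. cone_angle A \<omega> k (c t)) \<longlongrightarrow> cone_angle A \<omega> k P) (at_right 0)"
    by (rule tendsto_eventually)
  then show "initial_direction A \<omega> k c = cone_angle A \<omega> k P"
    unfolding initial_direction_def by (intro tendsto_Lim) auto
  obtain a where a: "a > r" "unit_geodesic_on (double_atlas A) c {0<..<a}" "c r = P"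
    using c by (auto simp: cone_segment_def cone_geodesic_def dist)
  have geo: "geodesic_on (double_atlas A) c {0<..<a}" using a(2) by (simp add: unit_geodesic_on_def)
  have rin: "r \<in> {0<..<a}" using a r0 by simp
  have cr: "c r \<in> dom j" using P(2) a(3) by simp
  note G = geodesic_onD[OF geo open_greaterThanLessThan rin cr]
  note g = disc_geodesic_atD[OF G(2)]
  have u: "cmod u = 1"
    using chart_sector(6)[OF jk w(1), of b] by (simp add: u_def w(2) crd_glue[OF w(1)] norm_mult norm_sgn)
  \<comment> \<open>The two segments are known to agree only up to time \<open>r\<close>, so their
    velocities at \<open>r\<close> are compared as derivatives within
    \<open>{r/2..r}\<close>.\<close>
  have "((\<lambda>s. crd j (c s)) has_vector_derivative vector_derivative (\<lambda>s. crd j (c s)) (at r)) (at r within {r/2..r})"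
    by (rule has_vector_derivative_at_within[OF g(4)])
  moreover have "((\<lambda>s. crd j (c s)) has_vector_derivative vector_derivative (radial k u) (at r)) (at r within {r/2..r})"
  proof (rule has_vector_derivative_transform)
    show "(radial k u has_vector_derivative vector_derivative (radial k u) (at r)) (at r within {r/2..r})"
      by (rule has_vector_derivative_at_within[OF disc_geodesic_atD(4)[OF radial_geodesic[OF u]]])
    show "crd j (c s) = radial k u s" if "s \<in> {r/2..r}" for s
      using that eq[of s] c0(2)[of s] r0 by auto
  qed (use r0 in auto)
  ultimately have "vector_derivative (\<lambda>s. crd j (c s)) (at r) = vector_derivative (radial k u) (at r)"
    using vector_derivative_unique_within_closed_interval[of "r/2" r r] r0 by auto
  then show "outward_velocity A k P (double_chart A j) = vector_derivative (radial k u) (at r)"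
    unfolding outward_velocity_def c_def[symmetric] dist using velocity_chart[of c r j] cr by simp
  show "outward_velocity A k P \<in> tangent_space (double_atlas A) P"
    unfolding outward_velocity_def c_def[symmetric] dist using velocity_tangent[OF G(1) g(2)] a(3) by simp
qed

section \<open>The polar charts in the charts of the double\<close>

definition kappa :: "3 \<Rightarrow> real" where
  "kappa k = \<omega> * pi / theta k"

definition polar_map :: "3 \<Rightarrow> complex \<Rightarrow> complex" where
  "polar_map k q = of_real (2 * cmod q / (1 - (cmod q)\<^sup>2)) * cis (kappa k * Arg q)"

text \<open>The part of the polar angle that does not depend on the point: the direction of
  \<open>l\<close>, and for \<open>j = k + 1\<close> the half turn from
  \<open>cone_angle_chart\<close>.\<close>

definition phase :: "(real \<Rightarrow> dpoint) \<Rightarrow> 3 \<Rightarrow> 3 \<Rightarrow> complex" where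
  "phase l k j = (if j = k + 2 then 1 else - 1) * cis (- initial_direction A \<omega> k l * pi / theta k)"

text \<open>The effect on a complex number of multiplying its argument by the orientation
  \<open>\<omega>\<close>.\<close>

definition flip :: "complex \<Rightarrow> complex" where
  "flip y = (if \<omega> = 1 then y else cnj y)"

lemma norm_phase [simp]: "cmod (phase l k j) = 1"
  by (simp add: phase_def norm_mult)

lemma cone_chart_eq:
  assumes P: "P \<in> cone_ball A \<tau> k" "P \<in> dom j" and jk: "j \<noteq> k"
  shows "cone_chart A \<omega> l k P = phase l k j * polar_map k (qc k j (crd j P))"
proof -
  define L where "L = initial_direction A \<omega> k l"
  have Pk: "P \<noteq> cone_point A k" using P(2) dom_not_cone by blast
  note C = chosen_segment[OF assms]
  have q: "cmod (qc k j (crd j P)) < 1" by (rule qc_ball[OF crd_ball[OF P(2)]])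
  have "cone_chart A \<omega> l k P = of_real (sinh (hdist k (crd j P))) *
      cis ((cone_angle A \<omega> k P - L) * pi / theta k)"
    using Pk C(2,3) by (simp add: cone_chart_def polar_angle_def L_def scaleR_conv_of_real)
  also have "sinh (hdist k (crd j P)) = 2 * cmod (qc k j (crd j P)) / (1 - (cmod (qc k j (crd j P)))\<^sup>2)"
    unfolding hdist_qc[of k _ j] by (rule sinh_2_artanh) (use q in simp)
  also have "cis ((cone_angle A \<omega> k P - L) * pi / theta k) =
      cis (cone_angle A \<omega> k P * pi / theta k) * cis (- L * pi / theta k)"
    by (simp add: cis_mult left_diff_distrib diff_divide_distrib)
  also have "cis (cone_angle A \<omega> k P * pi / theta k) =
      (if j = k + 2 then 1 else - 1) * cis (kappa k * Arg (qc k j (crd j P)))"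
    using cone_angle_chart[OF jk P(2) omega_cases] by (simp add: kappa_def)
  finally show ?thesis by (simp add: polar_map_def phase_def L_def mult_ac)
qed

text \<open>In the coordinate \<open>m\<close> centred at the vertex the outward velocity is a
  positive multiple of \<open>m\<close>. Dividing by it is, up to the positive factor
  \<open>e\<close>, dividing the transported vector by \<open>m\<close>, and in the quotient the
  derivative of the transition to the chart picked by \<open>SOME\<close> cancels.\<close>

lemma fiber_angle_eq:
  assumes P: "P \<in> cone_ball A \<tau> k" "P \<in> dom j" and jk: "j \<noteq> k"
    and v: "(P, v) \<in> unit_tangent_bundle (double_atlas A)"
  shows "cis (fiber_angle A \<omega> k (P, v)) =
    sgn (flip (su' 1 (- A k) (crd j P) * v (double_chart A j) / su 1 (- A k) (crd j P)))"
proof -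
  define z where "z = crd j P"
  define q where "q = qc k j z"
  define u where "u = bv k j * sgn q"
  define m where "m = su 1 (- A k) z"
  note C = chosen_segment[OF P jk]
  have z: "cmod z < 1" unfolding z_def by (rule crd_ball[OF P(2)])
  obtain w b where w: "w \<in> region j" "P = glue A (w, b)" using P(2) by (rule domE)
  have q0: "q \<noteq> 0" using chart_sector(6)[OF jk w(1), of b] by (simp add: q_def z_def w(2) crd_glue[OF w(1)])
  have u: "cmod u = 1" using q0 by (simp add: u_def norm_mult norm_sgn)
  have mq: "m = bv k j * q" by (simp add: m_def q_def qc_def flip: mult.assoc)
  then have m: "m \<noteq> 0" "cmod m = cmod q" "cmod m < 1"
    using q0 qc_ball[OF z, of k j] by (simp_all add: norm_mult flip: q_def)
  have mu: "of_real (cmod m) * u = m" unfolding u_def mq using q0 by (simp add: norm_mult sgn_eq)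
  define o' where "o' = outward_velocity A k P (double_chart A j)"
  have tanh: "tanh (hdist k z / 2) = cmod m" using tanh_hdist[OF z, of k j] m(2) by (simp add: q_def)
  have "o' = su' 1 (A k) (of_real (cmod m) * u) * (of_real ((1 - (cmod m)\<^sup>2) / 2) * u)"
    unfolding o'_def C(4) tanh[symmetric]
    using vector_derivative_at[OF radial_derivative[OF u, of k "hdist k z"]]
    by (simp add: u_def q_def z_def)
  then have o: "o' = su' 1 (A k) m * of_real ((1 - (cmod m)\<^sup>2) / (2 * cmod m)) * m"
    unfolding mu using m(1) by (subst (3) mu[symmetric]) simp
  have inv: "su' 1 (A k) m * su' 1 (- A k) z = 1"
    unfolding m_def by (rule su'_mob_inverse[OF A_ball z])
  define y where "y = v (double_chart A j) / o'"
  define e where "e = 2 * cmod m / (1 - (cmod m)\<^sup>2)"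
  have e: "e > 0" using m q0 by (auto simp: e_def abs_square_less_1 intro!: divide_pos_pos)
  have vj: "v (double_chart A j) \<noteq> 0" by (rule unit_tangent_norm(2)[OF v P(2)])
  have y: "y = of_real e * (su' 1 (- A k) z * v (double_chart A j) / m)"
  proof -
    have n: "su' 1 (A k) m \<noteq> 0" "su' 1 (- A k) z = inverse (su' 1 (A k) m)"
      using inv by (auto simp: inverse_unique)
    have i: "complex_of_real ((1 - (cmod m)\<^sup>2) / (2 * cmod m)) = inverse (of_real e)"
      by (simp add: e_def)
    have "x / (s * inverse f * m) = f * (inverse s * x / m)" for x s f
      by (simp add: divide_inverse mult.assoc mult.left_commute)
    then show ?thesis unfolding y_def o n(2) i by blast
  qed
  have y0: "y \<noteq> 0" using y e vj m(1) inv by auto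
  have flip_sgn: "flip (sgn x) = sgn (flip x)" for x by (simp add: flip_def sgn_eq)
  obtain i where i: "(SOME ch. ch \<in> double_atlas A \<and> P \<in> fst ch) = double_chart A i" "P \<in> dom i"
    using chosen_chart[OF P(2)] .
  obtain a' b' where ab: "trans_map j i P a' b'" using trans_mapE[OF P(2) i(2)] .
  have vt: "v \<in> tangent_space (double_atlas A) P" using v by (simp add: unit_tangent_bundle_iff)
  have "v (double_chart A i) / outward_velocity A k P (double_chart A i) = y"
    unfolding y_def o'_def tangent_trans[OF vt ab P(2)] tangent_trans[OF C(5) ab P(2)]
    using su'_nonzero[OF trans_mapD(1)[OF ab P(2)] crd_ball[OF P(2)]] by simp
  then have "cis (fiber_angle A \<omega> k (P, v)) = cis (\<omega> * Arg y)"
    by (simp add: fiber_angle_def Let_def i(1))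
  also have "\<dots> = flip (sgn y)" unfolding flip_def by (rule cis_mult_Arg[OF omega_cases y0])
  also have "sgn y = sgn (su' 1 (- A k) z * v (double_chart A j) / m)"
    unfolding y sgn_mult[of "of_real e"] using e by (simp add: sgn_eq[of "of_real e"])
  also have "flip (sgn (su' 1 (- A k) z * v (double_chart A j) / m)) = sgn (flip (su' 1 (- A k) z * v (double_chart A j) / m))"
    by (rule flip_sgn)
  finally show ?thesis unfolding z_def m_def .
qed

section \<open>The inverse of the polar map\<close>

text \<open>\<open>r = t / (1 + sqrt (1 + t^2))\<close> is the solution in the interval from 0 to 1
  of \<open>2 r / (1 - r^2) = t\<close>.\<close>

definition polar_inv :: "3 \<Rightarrow> complex \<Rightarrow> complex" where
  "polar_inv k w = of_real (cmod w / (1 + sqrt (1 + (cmod w)\<^sup>2))) * cis (Arg w / kappa k)"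

lemma kappa_facts: "kappa k \<noteq> 0" "\<bar>kappa k\<bar> = pi / theta k" "\<omega> * kappa k = pi / theta k"
  using angle_at_vertex(1)[of k] omega_cases by (auto simp: kappa_def abs_mult)

lemma nonpos_Reals_Arg: "w \<noteq> 0 \<Longrightarrow> w \<notin> \<real>\<^sub>\<le>\<^sub>0 \<longleftrightarrow> \<bar>Arg w\<bar> < pi"
proof -
  assume w: "w \<noteq> 0"
  have "w \<in> \<real>\<^sub>\<le>\<^sub>0 \<longleftrightarrow> Arg w = pi"
  proof
    assume "w \<in> \<real>\<^sub>\<le>\<^sub>0"
    then have "w = of_real (- cmod w)" "cmod w > 0"
      using w by (auto simp: complex_nonpos_Reals_iff complex_eq_iff cmod_def)
    then have "w = of_real (cmod w) * cis pi" by simp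
    then show "Arg w = pi" using Arg_of_real_cis[of "cmod w" pi] \<open>cmod w > 0\<close> by (metis le_less minus_less_iff neg_0_less_iff_less order_refl pi_gt_zero less_trans minus_zero)
  next
    assume "Arg w = pi"
    then have "w = of_real (- cmod w)" using of_real_cmod_cis_Arg[OF w] by simp
    then show "w \<in> \<real>\<^sub>\<le>\<^sub>0" by (metis neg_le_0_iff_le nonpos_Reals_of_real_iff norm_ge_zero)
  qed
  then show ?thesis using Arg_bounds'[of w] by auto
qed

lemma sqrt_polar:
  fixes r :: real
  assumes "0 \<le> r" "r < 1"
  shows "sqrt (1 + (2 * r / (1 - r\<^sup>2))\<^sup>2) = (1 + r\<^sup>2) / (1 - r\<^sup>2)"
proof (rule real_sqrt_unique)
  have n: "1 - r\<^sup>2 > 0" using assms by (simp add: abs_square_less_1)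
  then show "(1 + r\<^sup>2) / (1 - r\<^sup>2) \<ge> 0" by simp
  have "1 + (2 * r / (1 - r\<^sup>2))\<^sup>2 = ((1 - r\<^sup>2)\<^sup>2 + (2 * r)\<^sup>2) / (1 - r\<^sup>2)\<^sup>2"
    using n by (simp add: power_divide add_divide_distrib)
  also have "(1 - r\<^sup>2)\<^sup>2 + (2 * r)\<^sup>2 = (1 + r\<^sup>2)\<^sup>2" by (simp add: power2_eq_square algebra_simps)
  finally show "((1 + r\<^sup>2) / (1 - r\<^sup>2))\<^sup>2 = 1 + (2 * r / (1 - r\<^sup>2))\<^sup>2" by (simp add: power_divide)
qed

lemma norm_polar_map: "cmod q < 1 \<Longrightarrow> cmod (polar_map k q) = 2 * cmod q / (1 - (cmod q)\<^sup>2)"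
proof -
  assume "cmod q < 1"
  then have "\<bar>2 * cmod q / (1 - (cmod q)\<^sup>2)\<bar> = 2 * cmod q / (1 - (cmod q)\<^sup>2)"
    by (intro abs_of_nonneg divide_nonneg_nonneg) (auto simp: abs_square_le_1)
  then show ?thesis unfolding polar_map_def norm_mult norm_of_real norm_cis by simp
qed

lemma norm_polar_map_sinh: "cmod z < 1 \<Longrightarrow> cmod (polar_map k (qc k j z)) = sinh (hdist k z)"
  using norm_polar_map[OF qc_ball] sinh_2_artanh[of "cmod (qc k j z)"] qc_ball[of z k j]
  by (simp add: hdist_qc[of k z j])

lemma polar_map_Arg:
  assumes q: "q \<noteq> 0" "cmod q < 1" "\<bar>Arg q\<bar> < theta k"
  shows "polar_map k q \<noteq> 0" "Arg (polar_map k q) = kappa k * Arg q" "polar_map k q \<notin> \<real>\<^sub>\<le>\<^sub>0"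
    "polar_inv k (polar_map k q) = q"
proof -
  define t where "t = 2 * cmod q / (1 - (cmod q)\<^sup>2)"
  have n: "1 - (cmod q)\<^sup>2 > 0" using q(2) by (simp add: abs_square_less_1)
  have t: "t > 0" using q n by (simp add: t_def)
  have b: "\<bar>kappa k * Arg q\<bar> < pi"
    using q(3) angle_at_vertex(1)[of k] by (simp add: abs_mult kappa_facts(2) field_simps)
  show A: "Arg (polar_map k q) = kappa k * Arg q"
    unfolding polar_map_def t_def[symmetric] using t b by (intro Arg_of_real_cis) auto
  have w: "cmod (polar_map k q) = t" unfolding t_def by (rule norm_polar_map[OF q(2)])
  then show w0: "polar_map k q \<noteq> 0" using t by auto
  then show "polar_map k q \<notin> \<real>\<^sub>\<le>\<^sub>0" using A b by (simp add: nonpos_Reals_Arg)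
  have "1 + sqrt (1 + t\<^sup>2) = 2 / (1 - (cmod q)\<^sup>2)"
    unfolding t_def sqrt_polar[OF norm_ge_zero q(2)] using n by (simp add: field_simps)
  then have "t / (1 + sqrt (1 + t\<^sup>2)) = cmod q" using n by (simp add: t_def)
  then show "polar_inv k (polar_map k q) = q"
    unfolding polar_inv_def A w using kappa_facts(1)[of k] of_real_cmod_cis_Arg[OF q(1)] by simp
qed

lemma polar_inv_facts:
  assumes w: "w \<notin> \<real>\<^sub>\<le>\<^sub>0"
  shows "cmod (polar_inv k w) < 1" "polar_inv k w \<noteq> 0" "\<bar>Arg (polar_inv k w)\<bar> < theta k"
    "polar_map k (polar_inv k w) = w"
proof -
  have w0: "w \<noteq> 0" using w by auto
  define t where "t = cmod w"
  define r where "r = t / (1 + sqrt (1 + t\<^sup>2))"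
  have t: "t > 0" using w0 by (simp add: t_def)
  have s: "sqrt (1 + t\<^sup>2) > t" "sqrt (1 + t\<^sup>2) \<ge> 1" by (simp_all add: real_less_rsqrt)
  have r: "0 < r" "r < 1" using t s by (simp_all add: r_def)
  have q: "polar_inv k w = of_real r * cis (Arg w / kappa k)" by (simp add: polar_inv_def r_def t_def)
  show n: "cmod (polar_inv k w) < 1" using r by (simp add: q norm_mult)
  show q0: "polar_inv k w \<noteq> 0" using r by (simp add: q)
  have th: "0 < theta k" "theta k < pi" by (rule angle_at_vertex)+
  have "\<bar>Arg w\<bar> < pi" using w nonpos_Reals_Arg[OF w0] by simp
  then have b: "\<bar>Arg w / kappa k\<bar> < theta k"
    using th by (simp add: kappa_facts(2) field_simps)
  have A: "Arg (polar_inv k w) = Arg w / kappa k"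
    unfolding q
  proof (rule Arg_of_real_cis[OF r(1)])
    show "- pi < Arg w / kappa k" "Arg w / kappa k \<le> pi" using b th by linarith+
  qed
  then show "\<bar>Arg (polar_inv k w)\<bar> < theta k" using b by simp
  have "2 * r / (1 - r\<^sup>2) = t"
  proof -
    define S where "S = sqrt (1 + t\<^sup>2)"
    have S: "S\<^sup>2 = 1 + t\<^sup>2" "1 + S > 0" "S > 0" using s t by (simp_all add: S_def add_pos_pos)
    have "1 - r\<^sup>2 = ((1 + S)\<^sup>2 - t\<^sup>2) / (1 + S)\<^sup>2"
      using S(2) by (simp add: r_def S_def[symmetric] power_divide diff_divide_distrib)
    also have "(1 + S)\<^sup>2 - t\<^sup>2 = 2 * (1 + S)" using S(1) by (simp add: power2_eq_square algebra_simps)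
    also have "2 * (1 + S) / (1 + S)\<^sup>2 = 2 / (1 + S)" using S(2) by (simp add: power2_eq_square del: distrib_left_numeral)
    finally have "1 - r\<^sup>2 = 2 / (1 + S)" .
    then show ?thesis using S(2) by (simp add: r_def S_def[symmetric])
  qed
  moreover have "cmod (polar_inv k w) = r" using r by (simp add: q norm_mult)
  ultimately show "polar_map k (polar_inv k w) = w"
    unfolding polar_map_def A using kappa_facts(1)[of k] of_real_cmod_cis_Arg[OF w0] by (simp add: t_def)
qed

lemma smooth_on_Arg:
  assumes "open S" "smooth_on f S" "\<And>x. x \<in> S \<Longrightarrow> f x \<notin> \<real>\<^sub>\<le>\<^sub>0"
  shows "smooth_on (\<lambda>x. Arg (f x)) S"
proof -
  have "smooth_on (\<lambda>x. Im (Ln (f x))) S" by (intro smooth_on_Im smooth_on_Ln assms)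
  then show ?thesis
  proof (rule smooth_on_cong[OF _ assms(1)])
    fix x assume "x \<in> S"
    then have "f x \<noteq> 0" using assms(3) by force
    then show "Arg (f x) = Im (Ln (f x))" by (rule Arg_eq_Im_Ln)
  qed
qed

lemma smooth_on_polar_map:
  assumes "open S" "smooth_on f S" "\<And>x. x \<in> S \<Longrightarrow> f x \<notin> \<real>\<^sub>\<le>\<^sub>0 \<and> cmod (f x) < 1"
  shows "smooth_on (\<lambda>x. polar_map k (f x)) S"
  unfolding polar_map_def
proof (intro smooth_on_mult smooth_on_of_real smooth_on_divide_real smooth_on_diff smooth_on_cis
    smooth_on_cmod smooth_on_cmod_power2 smooth_on_Arg smooth_on_const assms(1,2))
  fix x assume "x \<in> S"
  then have "f x \<notin> \<real>\<^sub>\<le>\<^sub>0" "cmod (f x) < 1" using assms(3) by auto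
  then show "f x \<noteq> 0" "1 - (cmod (f x))\<^sup>2 \<noteq> 0" "f x \<notin> \<real>\<^sub>\<le>\<^sub>0" by (auto simp: abs_square_eq_1)
qed

lemma smooth_on_polar_inv:
  assumes "open S" "smooth_on f S" "\<And>x. x \<in> S \<Longrightarrow> f x \<notin> \<real>\<^sub>\<le>\<^sub>0"
  shows "smooth_on (\<lambda>x. polar_inv k (f x)) S"
  unfolding polar_inv_def
proof (intro smooth_on_mult smooth_on_of_real smooth_on_divide_real smooth_on_add smooth_on_cis smooth_on_sqrt
    smooth_on_cmod smooth_on_cmod_power2 smooth_on_Arg smooth_on_const assms(1,2))
  fix x assume "x \<in> S"
  then have "f x \<notin> \<real>\<^sub>\<le>\<^sub>0" using assms(3) by auto
  then show "f x \<noteq> 0" "f x \<notin> \<real>\<^sub>\<le>\<^sub>0" by auto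
  show "1 + (cmod (f x))\<^sup>2 > 0" "1 + sqrt (1 + (cmod (f x))\<^sup>2) \<noteq> 0" "kappa k \<noteq> 0"
    using kappa_facts(1)[of k] by (simp_all add: add_pos_nonneg add_nonneg_eq_0_iff)
qed

section \<open>The image of the charts around the singular fibers\<close>

text \<open>The point is folded to \<open>w\<close> in the angle of the triangle at
  \<open>A k\<close>. It remains to see that \<open>w\<close> is not on or beyond the side
  \<open>k\<close>: otherwise the ray from \<open>A k\<close> to \<open>w\<close> would meet this
  side at a point \<open>w0\<close> which is at most as far away, hence in the ball, against
  \<open>cone_ball_opposite_side\<close>.\<close>

lemma chart_of_sector:
  assumes jk: "j \<noteq> k" and z: "cmod z < 1" "qc k j z \<noteq> 0" "\<bar>Arg (qc k j z)\<bar> < theta k" "hdist k z < \<tau>"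
  obtains P where "P \<in> dom j" "crd j P = z" "P \<in> cone_ball A \<tau> k"
proof -
  define c where "c \<longleftrightarrow> sgj k j * Arg (qc k j z) < 0"
  define w where "w = rho j c z"
  have w1: "cmod w < 1" unfolding w_def by (rule rho_ball[OF z(1)])
  have qw: "qc k j w = (if c then cnj (qc k j z) else qc k j z)" unfolding w_def by (rule qc_rho[OF jk z(1)])
  then have qw0: "qc k j w \<noteq> 0" using z(2) by simp
  have "\<bar>Arg (qc k j z)\<bar> < pi" using z(3) angle_at_vertex(2)[of k] by linarith
  then have "Arg (qc k j w) = (if c then - Arg (qc k j z) else Arg (qc k j z))"
    using Arg_cnj'[OF _ z(2)] by (simp add: qw)
  then have "0 \<le> sgj k j * Arg (qc k j w)" "sgj k j * Arg (qc k j w) < theta k"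
    using z(3) sgj_cases[of k j] by (auto simp: c_def)
  then have bw: "bary j w \<ge> 0" "bary (oth k j) w > 0"
    using sector_of_bary[OF jk w1 qw0] by auto
  then have bw': "bary i w \<ge> 0" if "i \<noteq> k" for i
    using not_k_cases[OF that] not_k_cases[OF jk] by auto
  have hd: "hdist k w = hdist k z" by (simp add: hdist_qc[of k _ j] qw)
  define m where "m = su 1 (- A k) w"
  have gap: "cmod (A k) < cmod 1" "cmod (- A k) < cmod 1" using A_ball[of k] by simp_all
  have m1: "cmod m < 1" unfolding m_def by (rule su_in_ball[OF gap(2) w1])
  have m0: "m \<noteq> 0" using qw0 by (simp add: qc_def m_def)
  have xm: "cmod (x *\<^sub>R m) < 1" if "0 \<le> x" "x \<le> 1" for x
    using mult_right_mono[of x 1 "cmod m"] that m1 by simp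
  have "bary k w > 0"
  proof (rule ccontr)
    assume "\<not> bary k w > 0"
    define g where "g x = bary k (su 1 (A k) (x *\<^sub>R m))" for x :: real
    have "g 0 = 1" by (simp add: g_def su_def)
    moreover have "g 1 \<le> 0"
      using \<open>\<not> bary k w > 0\<close> mob_inverse(1)[OF A_ball[of k] w1] by (simp add: g_def m_def)
    moreover have "continuous_on {0..1} g"
    proof -
      have "continuous_on {0..1} (\<lambda>x. su 1 (A k) (x *\<^sub>R m))"
      proof (rule continuous_at_imp_continuous_on, rule ballI)
        fix x :: real assume "x \<in> {0..1}"
        then have "isCont (su 1 (A k)) (x *\<^sub>R m)" using su_DERIV[OF gap(1) xm] DERIV_isCont by auto
        then show "isCont (\<lambda>x. su 1 (A k) (x *\<^sub>R m)) x"
          by (intro isCont_o2[of x "\<lambda>x. x *\<^sub>R m" "su 1 (A k)"]) auto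
      qed
      then show ?thesis
        unfolding g_def by (intro continuous_on_compose2[OF continuous_on_bary[of UNIV k]]) auto
    qed
    ultimately obtain x where x: "0 \<le> x" "x \<le> 1" "g x = 0"
      using IVT2'[of g 1 0 0] by auto
    define w0 where "w0 = su 1 (A k) (x *\<^sub>R m)"
    have x0: "x > 0" using x \<open>g 0 = 1\<close> by (cases "x = 0") auto
    have w01: "cmod w0 < 1" unfolding w0_def by (rule su_in_ball[OF gap(1) xm[OF x(1,2)]])
    have mw0: "su 1 (- A k) w0 = x *\<^sub>R m" unfolding w0_def by (rule mob_inverse(2)[OF A_ball xm[OF x(1,2)]])
    have "bary i w0 \<ge> 0" for i
    proof (cases "i = k")
      case True
      then show ?thesis using x(3) by (simp add: g_def w0_def)
    next
      case False
      obtain e where e: "e > 0" "sgj k i * Im (qc k i w0) = e * bary i w0" using bary_qc[OF False w01] by blast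
      obtain f where f: "f > 0" "sgj k i * Im (qc k i w) = f * bary i w" using bary_qc[OF False w1] by blast
      have "qc k i w0 = of_real x * qc k i w" by (simp add: qc_def mw0 m_def scaleR_conv_of_real)
      then have "sgj k i * Im (qc k i w0) = x * (sgj k i * Im (qc k i w))" by simp
      then have "e * bary i w0 = x * (f * bary i w)" unfolding e(2) f(2) .
      then have "e * bary i w0 \<ge> 0" using x0 f(1) bw'[OF False] by simp
      then show ?thesis using e(1) by (simp add: zero_le_mult_iff)
    qed
    then have tri: "w0 \<in> triangle A" using w01 by (simp add: triangle_iff)
    have w0k: "w0 \<noteq> A k" using x(3) by (auto simp: g_def simp flip: w0_def)
    have "tanh (hdist k w0 / 2) \<le> tanh (hdist k w / 2)"
      unfolding tanh_hdist[OF w01, of k j] tanh_hdist[OF w1, of k j]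
      using x x0 mult_right_mono[of x 1 "cmod m"] by (simp add: qc_def mw0 norm_mult flip: m_def)
    then have "hdist k w0 < \<tau>" using hd z(4) by simp
    then have "glue A (w0, False) \<in> cone_ball A \<tau> k"
      using tri w0k by (simp add: cone_ball_iff)
    from cone_ball_opposite_side[OF this] show False using x(3) by (simp add: g_def w0_def)
  qed
  then have reg: "w \<in> region j" using bw w1 by (simp add: region_oth[OF jk])
  define P where "P = glue A (w, c)"
  have "P \<in> dom j" using reg by (simp add: P_def)
  moreover have "crd j P = z" unfolding P_def crd_glue[OF reg] unfolding w_def by (rule rho_rho[OF z(1)])
  moreover have "P \<in> cone_ball A \<tau> k"
  proof -
    have "P \<noteq> cone_point A k" "P \<in> double A" using \<open>P \<in> dom j\<close> dom_not_cone dom_subset_double by blast+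
    then show ?thesis using cone_ball_iff[of P k] hd z(4) by (auto simp: P_def)
  qed
  ultimately show ?thesis using that by blast
qed

lemma cone_ball_chart:
  assumes "P \<in> cone_ball A \<tau> k" "P \<noteq> cone_point A k"
  obtains j where "j \<noteq> k" "P \<in> dom j"
  using dom_cover[OF cone_ball_double[OF assms(1)] assms(2) cone_ball_opposite_side[OF assms(1)]] that
    three_neq by blast

lemma chart_qc_facts:
  assumes "j \<noteq> k" "P \<in> dom j"
  shows "qc k j (crd j P) \<noteq> 0" "cmod (qc k j (crd j P)) < 1" "\<bar>Arg (qc k j (crd j P))\<bar> < theta k"
    "su 1 (- A k) (crd j P) \<noteq> 0"
proof -
  obtain w b where w: "w \<in> region j" "P = glue A (w, b)" using assms(2) by (rule domE)
  note S = chart_sector[OF assms(1) w(1)]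
  show "qc k j (crd j P) \<noteq> 0" "\<bar>Arg (qc k j (crd j P))\<bar> < theta k"
    using S(5)[of b] S(6)[of b] by (simp_all add: w(2) crd_glue[OF w(1)])
  then show "su 1 (- A k) (crd j P) \<noteq> 0" by (auto simp: qc_def)
  show "cmod (qc k j (crd j P)) < 1" by (rule qc_ball[OF crd_ball[OF assms(2)]])
qed

lemma phase_nonzero [simp]: "phase l k j \<noteq> 0"
  using norm_phase[of l k j] by (metis norm_zero zero_neq_one)

lemma phase_oth: "j \<noteq> k \<Longrightarrow> phase l k (oth k j) = - phase l k j"
  using not_k_cases[of j k] by (auto simp: phase_def)

text \<open>The points of the punctured ball outside \<open>dom j\<close> are those on the side
  \<open>oth k j\<close>. In the other chart they have argument 0, and the phases of the two charts
  are opposite, so that they fill the slit.\<close>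

lemma polar_chart_iff:
  assumes jk: "j \<noteq> k" and P: "P \<in> cone_ball A \<tau> k" "P \<noteq> cone_point A k"
  shows "P \<in> dom j \<longleftrightarrow> cone_chart A \<omega> l k P / phase l k j \<notin> \<real>\<^sub>\<le>\<^sub>0"
proof
  assume Pj: "P \<in> dom j"
  have "cone_chart A \<omega> l k P / phase l k j = polar_map k (qc k j (crd j P))"
    using cone_chart_eq[OF P(1) Pj jk, of l] by simp
  then show "cone_chart A \<omega> l k P / phase l k j \<notin> \<real>\<^sub>\<le>\<^sub>0"
    using polar_map_Arg(3)[OF chart_qc_facts(1,2,3)[OF jk Pj]] by simp
next
  assume *: "cone_chart A \<omega> l k P / phase l k j \<notin> \<real>\<^sub>\<le>\<^sub>0"
  show "P \<in> dom j"
  proof (rule ccontr)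
    assume n: "P \<notin> dom j"
    define i where "i = oth k j"
    obtain i' where "i' \<noteq> k" "P \<in> dom i'" using cone_ball_chart[OF P] .
    then have Pi: "P \<in> dom i" using n not_k_cases[of i' k] not_k_cases[OF jk] by (auto simp: i_def)
    have ik: "i \<noteq> k" and oi: "oth k i = j" using oth_neq(1) oth_oth[OF jk] by (simp_all add: i_def)
    obtain w b where w: "w \<in> region i" "P = glue A (w, b)" using Pi by (rule domE)
    have w1: "cmod w < 1" by (rule regionD[OF w(1)])
    have "w \<notin> region j" using n w(2) by simp
    then have b0: "bary i w = 0" using w(1) by (auto simp: region_oth[OF ik] region_oth[OF jk] oi i_def[symmetric])
    then have "refl i w = w" by (rule refl_fixed[OF w1])
    then have z: "crd i P = w" using crd_glue[OF w(1), of b] w(2) by (simp add: rho_def)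
    obtain e where "e > 0" "sgj k i * Im (qc k i w) = e * bary i w" using bary_qc[OF ik w1] by blast
    then have im: "Im (qc k i w) = 0" using b0 sgj_cases[of k i] by auto
    note S = chart_sector[OF ik w(1)]
    have "\<bar>Arg (qc k i w)\<bar> < theta k" using S(5)[of False] by (simp add: rho_def)
    then have "Arg (qc k i w) \<noteq> pi" using angle_at_vertex(2)[of k] by auto
    then have A0: "Arg (qc k i w) = 0" using im by (metis Arg_eq_0_pi complex_is_Real_iff)
    have "cone_chart A \<omega> l k P / phase l k j = - polar_map k (qc k i w)"
      using cone_chart_eq[OF P(1) Pi ik, of l] phase_oth[OF jk, of l] by (simp add: z i_def[symmetric])
    also have "\<dots> = of_real (- (2 * cmod (qc k i w) / (1 - (cmod (qc k i w))\<^sup>2)))"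
      by (simp add: polar_map_def A0)
    finally have "cone_chart A \<omega> l k P / phase l k j \<in> \<real>\<^sub>\<le>\<^sub>0"
      using qc_ball[OF w1, of k i] by (simp only: nonpos_Reals_of_real_iff) (simp add: abs_square_le_1)
    then show False using * by simp
  qed
qed

lemma norm_cone_chart:
  assumes "P \<in> cone_ball A \<tau> k" "P \<noteq> cone_point A k"
  shows "cmod (cone_chart A \<omega> l k P) = sinh (hdist k (fold_point P))" "cone_chart A \<omega> l k P \<noteq> 0"
proof -
  obtain z b where z: "z \<in> triangle A" "P = glue A (z, b)"
    using cone_ball_double[OF assms(1)] by (rule double_glueE)
  then have h: "hdist k z > 0" using assms(2) by (intro hdist_pos) (auto simp: triangle_iff)
  have "double_dist A P (cone_point A k) = hdist k z"
    using double_dist_eq[OF cone_ball_double[OF assms(1)] assms(2)] z(2) by simp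
  then show n: "cmod (cone_chart A \<omega> l k P) = sinh (hdist k (fold_point P))"
    using assms(2) h z(2) by (simp add: cone_chart_def)
  then show "cone_chart A \<omega> l k P \<noteq> 0" using n h z(2) by auto
qed

end

section \<open>Smooth transitions between charts\<close>

text \<open>Besides smoothness this contains that the overlap covers a whole neighbourhood of
  \<open>snd ch p\<close>. For \<open>ch' = ch\<close> it says in particular that the image of the
  chart is a neighbourhood of each of its points.\<close>

definition smooth_transition ::
    "('p, 'e::euclidean_space) chart \<Rightarrow> ('p, 'e) chart \<Rightarrow> 'p \<Rightarrow> bool" where
  "smooth_transition ch ch' p \<longleftrightarrow> p \<in> fst ch \<and>
     (\<exists>\<psi> U. open U \<and> snd ch p \<in> U \<and> smooth_on \<psi> U \<and>
        (\<forall>x\<in>U. \<exists>q\<in>fst ch \<inter> fst ch'. snd ch q = x \<and> snd ch' q = \<psi> x))"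

lemma smooth_transitionI:
  assumes "p \<in> fst ch" "open U" "snd ch p \<in> U" "smooth_on \<psi> U"
    "\<And>x. x \<in> U \<Longrightarrow> \<exists>q\<in>fst ch \<inter> fst ch'. snd ch q = x \<and> snd ch' q = \<psi> x"
  shows "smooth_transition ch ch' p"
  unfolding smooth_transition_def using assms by blast

lemma smooth_transitionE:
  assumes "smooth_transition ch ch' p" "inj_on (snd ch) (fst ch)"
  obtains \<psi> U where "open U" "snd ch p \<in> U" "smooth_on \<psi> U"
    "\<And>x. x \<in> U \<Longrightarrow> \<exists>q\<in>fst ch \<inter> fst ch'. snd ch q = x \<and> snd ch' q = \<psi> x"
    "\<And>q. q \<in> fst ch \<Longrightarrow> snd ch q \<in> U \<Longrightarrow> q \<in> fst ch' \<and> snd ch' q = \<psi> (snd ch q)"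
proof -
  obtain \<psi> U where U: "open U" "snd ch p \<in> U" "smooth_on \<psi> U"
    "\<And>x. x \<in> U \<Longrightarrow> \<exists>q\<in>fst ch \<inter> fst ch'. snd ch q = x \<and> snd ch' q = \<psi> x"
    using assms(1) unfolding smooth_transition_def by blast
  have "q \<in> fst ch' \<and> snd ch' q = \<psi> (snd ch q)" if q: "q \<in> fst ch" "snd ch q \<in> U" for q
  proof -
    obtain q' where q': "q' \<in> fst ch \<inter> fst ch'" "snd ch q' = snd ch q" "snd ch' q' = \<psi> (snd ch q)"
      using U(4)[OF q(2)] by blast
    then have "q' = q" using inj_onD[OF assms(2) q'(2)] q(1) by blast
    then show ?thesis using q' by blast
  qed
  with U show thesis by (rule that)
qed

lemma smooth_transition_trans:
  assumes "smooth_transition a b p" "smooth_transition b c p"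
    "inj_on (snd a) (fst a)" "inj_on (snd b) (fst b)"
  shows "smooth_transition a c p"
proof -
  obtain \<psi> U where U: "open U" "snd a p \<in> U" "smooth_on \<psi> U"
    "\<And>x. x \<in> U \<Longrightarrow> \<exists>q\<in>fst a \<inter> fst b. snd a q = x \<and> snd b q = \<psi> x"
    "\<And>q. q \<in> fst a \<Longrightarrow> snd a q \<in> U \<Longrightarrow> q \<in> fst b \<and> snd b q = \<psi> (snd a q)"
    using assms(1,3) by (rule smooth_transitionE) blast
  obtain \<eta> V where V: "open V" "snd b p \<in> V" "smooth_on \<eta> V"
    "\<And>x. x \<in> V \<Longrightarrow> \<exists>q\<in>fst b \<inter> fst c. snd b q = x \<and> snd c q = \<eta> x"
    "\<And>q. q \<in> fst b \<Longrightarrow> snd b q \<in> V \<Longrightarrow> q \<in> fst c \<and> snd c q = \<eta> (snd b q)"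
    using assms(2,4) by (rule smooth_transitionE) blast
  have p: "p \<in> fst a" using assms(1) by (simp add: smooth_transition_def)
  define W where "W = {x \<in> U. \<psi> x \<in> V}"
  have oW: "open W"
    unfolding W_def using continuous_open_preimage[OF smooth_on_continuous[OF U(3)] U(1) V(1)]
    by (simp add: vimage_def Collect_conj_eq)
  show ?thesis
  proof (rule smooth_transitionI[OF p oW])
    show "snd a p \<in> W" using U(2) U(5)[OF p U(2)] V(2) by (simp add: W_def)
    have "smooth_on \<psi> W" by (rule smooth_on_subset[OF U(3)]) (auto simp: W_def)
    then show "smooth_on (\<lambda>x. \<eta> (\<psi> x)) W"
      by (intro smooth_on_compose[OF V(3) oW]) (auto simp: W_def)
    fix x assume x: "x \<in> W"
    then obtain q where q: "q \<in> fst a \<inter> fst b" "snd a q = x" "snd b q = \<psi> x"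
      using U(4)[of x] by (auto simp: W_def)
    then have "q \<in> fst c \<and> snd c q = \<eta> (\<psi> x)" using V(5)[of q] x by (auto simp: W_def)
    then show "\<exists>q\<in>fst a \<inter> fst c. snd a q = x \<and> snd c q = \<eta> (\<psi> x)" using q by blast
  qed
qed

text \<open>The chain rule in the form in which \<open>tangent_space\<close> compares two charts. It
  also keeps the curve in the second chart for small times.\<close>

lemma smooth_transition_velocity:
  assumes T: "smooth_transition ch ch' (\<gamma> 0)" and inj: "inj_on (snd ch) (fst ch)"
    and ev: "\<forall>\<^sub>F t in nhds 0. \<gamma> t \<in> fst ch"
    and D: "((\<lambda>t. snd ch (\<gamma> t)) has_vector_derivative D) (at (0::real))"
  shows "\<forall>\<^sub>F t in nhds 0. \<gamma> t \<in> fst ch'"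
    "((\<lambda>t. snd ch' (\<gamma> t)) has_vector_derivative
       frechet_derivative (snd ch' \<circ> inv_into (fst ch) (snd ch)) (at (snd ch (\<gamma> 0))) D) (at 0)"
    "bounded_linear (frechet_derivative (snd ch' \<circ> inv_into (fst ch) (snd ch)) (at (snd ch (\<gamma> 0))))"
proof -
  obtain \<psi> U where U: "open U" "snd ch (\<gamma> 0) \<in> U" "smooth_on \<psi> U"
    "\<And>x. x \<in> U \<Longrightarrow> \<exists>q\<in>fst ch \<inter> fst ch'. snd ch q = x \<and> snd ch' q = \<psi> x"
    "\<And>q. q \<in> fst ch \<Longrightarrow> snd ch q \<in> U \<Longrightarrow> q \<in> fst ch' \<and> snd ch' q = \<psi> (snd ch q)"
    using T inj by (rule smooth_transitionE) blast
  define g where "g = snd ch' \<circ> inv_into (fst ch) (snd ch)"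
  have g: "g x = \<psi> x" if x: "x \<in> U" for x
  proof -
    obtain q where "q \<in> fst ch \<inter> fst ch'" "snd ch q = x" "snd ch' q = \<psi> x" using U(4)[OF x] by blast
    then show ?thesis using inv_into_f_f[OF inj, of q] by (auto simp: g_def)
  qed
  have "smooth_on g U" by (rule smooth_on_cong[OF U(3,1) g])
  then have "g differentiable (at (snd ch (\<gamma> 0)))" by (rule smooth_on_differentiable[OF _ U(2)])
  then have "(g has_derivative frechet_derivative g (at (snd ch (\<gamma> 0)))) (at (snd ch (\<gamma> 0)))"
    by (simp add: frechet_derivative_works)
  then show "bounded_linear (frechet_derivative (snd ch' \<circ> inv_into (fst ch) (snd ch)) (at (snd ch (\<gamma> 0))))"
    unfolding g_def by (rule has_derivative_bounded_linear)
  from \<open>(g has_derivative _) _\<close> have "(g has_derivative frechet_derivative g (at (snd ch (\<gamma> 0)))) (at (snd ch (\<gamma> 0)) within range (\<lambda>t. snd ch (\<gamma> t)))"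
    by (rule has_derivative_at_withinI)
  from vector_derivative_diff_chain_within[OF D this]
  have G: "((\<lambda>t. g (snd ch (\<gamma> t))) has_vector_derivative frechet_derivative g (at (snd ch (\<gamma> 0))) D) (at 0)"
    by (simp add: o_def)
  have "isCont (\<lambda>t. snd ch (\<gamma> t)) 0" using has_vector_derivative_continuous[OF D] .
  then have "\<forall>\<^sub>F t in nhds 0. snd ch (\<gamma> t) \<in> U"
    unfolding tendsto_nhds_isCont by (rule topological_tendstoD) (use U in auto)
  with ev have E: "\<forall>\<^sub>F t in nhds 0. \<gamma> t \<in> fst ch' \<and> snd ch' (\<gamma> t) = g (snd ch (\<gamma> t))"
    by eventually_elim (use U(5) g in auto)
  then show "\<forall>\<^sub>F t in nhds 0. \<gamma> t \<in> fst ch'" by eventually_elim simp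
  have "\<forall>\<^sub>F t in nhds 0. snd ch' (\<gamma> t) = g (snd ch (\<gamma> t))" using E by eventually_elim simp
  from has_vector_derivative_cong_nhds[OF this] G
  show "((\<lambda>t. snd ch' (\<gamma> t)) has_vector_derivative
       frechet_derivative (snd ch' \<circ> inv_into (fst ch) (snd ch)) (at (snd ch (\<gamma> 0))) D) (at 0)"
    by (simp add: g_def)
qed

lemma open_Collect_smooth:
  assumes "smooth_on f U" "open U" "open V"
  shows "open {x \<in> U. f x \<in> V}"
  using continuous_open_preimage[OF smooth_on_continuous[OF assms(1)] assms(2,3)]
  by (simp add: vimage_def Collect_conj_eq)

lemma smooth_on_su:
  assumes "cmod b < cmod a" "open S" "smooth_on f S" "\<And>x. x \<in> S \<Longrightarrow> cmod (f x) < 1"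
  shows "smooth_on (\<lambda>x. su a b (f x)) S" "smooth_on (\<lambda>x. su' a b (f x)) S"
proof -
  have n: "cnj b * f x + cnj a \<noteq> 0" if "x \<in> S" for x
    using su_denom[OF assms(1), of "f x"] assms(4)[OF that] by simp
  show "smooth_on (\<lambda>x. su a b (f x)) S"
    unfolding su_def using n
    by (intro smooth_on_divide smooth_on_add smooth_on_mult smooth_on_const assms(2,3)) auto
  show "smooth_on (\<lambda>x. su' a b (f x)) S"
    unfolding su'_def power2_eq_square using n
    by (intro smooth_on_divide smooth_on_add smooth_on_mult smooth_on_const assms(2,3)) auto
qed

section \<open>The charts of the unit tangent bundle\<close>

context hyp_triangle
begin

definition lchart :: "3 \<Rightarrow> real \<Rightarrow> (mpoint, complex \<times> real) chart" where
  "lchart i s = lift_chart (utb_chart i s)"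

abbreviation utb where "utb \<equiv> unit_tangent_bundle (double_atlas A)"

lemma fst_lchart: "p \<in> fst (lchart i s) \<longleftrightarrow>
    (\<exists>P v. p = Inl (P, v) \<and> (P, v) \<in> utb \<and> P \<in> dom i \<and> sgn (v (double_chart A i)) \<noteq> cis s)"
proof -
  have "p \<in> fst (lchart i s) \<longleftrightarrow> (\<exists>P v. p = Inl (P, v) \<and> (P, v) \<in> fst (utb_chart i s))"
    by (auto simp: lchart_def lift_chart_def)
  then show ?thesis by (simp only: fst_utb_chart)
qed

lemma Inl_lchart: "Inl (P, v) \<in> fst (lchart i s) \<longleftrightarrow>
    (P, v) \<in> utb \<and> P \<in> dom i \<and> sgn (v (double_chart A i)) \<noteq> cis s"
  by (simp add: fst_lchart)

lemma snd_lchart: "snd (lchart i s) (Inl (P, v)) = (crd i P, ang s (v (double_chart A i)))"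
  by (simp add: lchart_def lift_chart_def snd_utb_chart)

lemma unit_vector_eq:
  assumes "(P, v) \<in> utb" "P \<in> dom i"
  shows "v (double_chart A i) = of_real ((1 - (cmod (crd i P))\<^sup>2) / 2) * sgn (v (double_chart A i))"
proof -
  have "of_real ((1 - (cmod (crd i P))\<^sup>2) / 2) = complex_of_real (cmod (v (double_chart A i)))"
    using unit_tangent_norm(1)[OF assms] by (metis nonzero_mult_div_cancel_left zero_neq_numeral)
  then show ?thesis using unit_tangent_norm(2)[OF assms] by (simp add: sgn_eq)
qed

lemma unit_vector_exists:
  assumes "P \<in> dom i"
  obtains v where "(P, v) \<in> utb" "v (double_chart A i) = of_real ((1 - (cmod (crd i P))\<^sup>2) / 2) * cis \<phi>"
proof -
  obtain v where v: "v \<in> tangent_space (double_atlas A) P"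
    "v (double_chart A i) = of_real ((1 - (cmod (crd i P))\<^sup>2) / 2) * cis \<phi>"
    using tangent_exists[OF assms] .
  have n: "1 - (cmod (crd i P))\<^sup>2 > 0" using crd_ball[OF assms] by (simp add: abs_square_less_1)
  then have "cmod (v (double_chart A i)) = (1 - (cmod (crd i P))\<^sup>2) / 2"
    unfolding v(2) norm_mult norm_of_real by simp
  then have "tangent_norm (double_atlas A) P v = 1"
    using n by (simp add: tangent_norm_eq[OF v(1) assms])
  then show thesis using that v assms by (auto simp: unit_tangent_bundle_iff)
qed

lemma sgn_pos_mult: "0 < r \<Longrightarrow> sgn (complex_of_real r * y) = sgn y"
  by (simp add: sgn_mult) (simp add: sgn_eq)

lemma sgn_cis [simp]: "sgn (cis x) = cis x"
  by (simp add: sgn_eq)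

lemma half_gap_pos: "P \<in> dom i \<Longrightarrow> 0 < (1 - (cmod (crd i P))\<^sup>2) / 2"
  using crd_ball[of P i] by (simp add: abs_square_less_1)

lemma lchart_point:
  assumes "P \<in> dom i" "s < \<phi>" "\<phi> < s + 2 * pi"
  obtains v where "Inl (P, v) \<in> fst (lchart i s)" "snd (lchart i s) (Inl (P, v)) = (crd i P, \<phi>)"
    "(P, v) \<in> utb" "v (double_chart A i) = of_real ((1 - (cmod (crd i P))\<^sup>2) / 2) * cis \<phi>"
proof -
  obtain v where v: "(P, v) \<in> utb" "v (double_chart A i) = of_real ((1 - (cmod (crd i P))\<^sup>2) / 2) * cis \<phi>"
    using unit_vector_exists[OF assms(1)] .
  note n = half_gap_pos[OF assms(1)]
  have "Inl (P, v) \<in> fst (lchart i s)"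
    using v(1) assms(1) sgn_cut_of_range[OF assms(2,3)] by (simp only: Inl_lchart v(2) sgn_pos_mult[OF n] sgn_cis simp_thms)
  moreover have "snd (lchart i s) (Inl (P, v)) = (crd i P, \<phi>)"
    by (simp only: snd_lchart v(2) ang_of_real_mult[OF n] ang_cis[OF assms(2,3)])
  ultimately show thesis using that v by blast
qed

lemma inj_lchart: "inj_on (snd (lchart i s)) (fst (lchart i s))"
proof (rule inj_onI)
  fix p q assume pq: "p \<in> fst (lchart i s)" "q \<in> fst (lchart i s)" "snd (lchart i s) p = snd (lchart i s) q"
  obtain P v where p: "p = Inl (P, v)" "(P, v) \<in> utb" "P \<in> dom i" using pq(1) unfolding fst_lchart by blast
  obtain Q w where q: "q = Inl (Q, w)" "(Q, w) \<in> utb" "Q \<in> dom i" using pq(2) unfolding fst_lchart by blast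
  have e: "crd i P = crd i Q" "ang s (v (double_chart A i)) = ang s (w (double_chart A i))"
    using pq(3) unfolding p(1) q(1) snd_lchart by simp_all
  have PQ: "P = Q" using inj_onD[OF inj_crd e(1) p(3) q(3)] .
  have "sgn (v (double_chart A i)) = sgn (w (double_chart A i))"
    using e(2) cis_ang[OF unit_tangent_norm(2)[OF p(2,3)], of s] cis_ang[OF unit_tangent_norm(2)[OF q(2,3)], of s] by simp
  then have "v (double_chart A i) = w (double_chart A i)"
    by (metis e(1) unit_vector_eq[OF p(2,3)] unit_vector_eq[OF q(2,3)])
  then have "v = w"
    using tangent_eqI[of v P w i] p(2,3) q(2) by (simp add: PQ unit_tangent_bundle_iff)
  then show "p = q" by (simp add: p(1) q(1) PQ)
qed

lemma lchart_transition:
  assumes p: "p \<in> fst (lchart i s)" "p \<in> fst (lchart j s')"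
  shows "smooth_transition (lchart i s) (lchart j s') p"
proof -
  obtain P v where P: "p = Inl (P, v)" "(P, v) \<in> utb" "P \<in> dom i" "sgn (v (double_chart A i)) \<noteq> cis s"
    using p(1) unfolding fst_lchart by blast
  have Pj: "P \<in> dom j" "sgn (v (double_chart A j)) \<noteq> cis s'" using p(2) unfolding P(1) Inl_lchart by auto
  obtain a b where T: "trans_map i j P a b" using trans_mapE[OF P(3) Pj(1)] .
  note gap = trans_mapD(1)[OF T P(3)]
  obtain V where V: "open V" "crd i P \<in> V"
    "\<And>x. x \<in> V \<Longrightarrow> \<exists>Q\<in>dom i \<inter> dom j. crd i Q = x \<and> crd j Q = su a b x"
    using trans_mapD(4)[OF T P(3)] unfolding eventually_nhds by blast
  have Vb: "cmod x < 1" if "x \<in> V" for x using V(3)[OF that] crd_ball by auto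
  define X where "X = V \<times> {s<..<s + 2 * pi}"
  have oX: "open X" unfolding X_def by (intro open_Times V(1)) auto
  \<comment> \<open>Up to a positive factor, which \<open>ang\<close> ignores, the coordinate in the
    chart \<open>j\<close> of the unit vector with coordinates \<open>x\<close> in the chart
    \<open>i\<close>.\<close>
  define f where "f x = su' a b (fst x) * cis (snd x)" for x :: "complex \<times> real"
  have fstX: "smooth_on fst X" and sndX: "smooth_on snd X"
    using oX by (auto intro!: smooth_on_bounded_linear bounded_linear_fst bounded_linear_snd)
  have fb: "cmod (fst x) < 1" if "x \<in> X" for x using that Vb by (auto simp: X_def)
  have sf: "smooth_on f X"
    unfolding f_def by (intro smooth_on_mult smooth_on_su[OF gap oX fstX fb] smooth_on_cis oX sndX) auto
  define U where "U = {x \<in> X. f x \<in> {y. y \<noteq> 0 \<and> sgn y \<noteq> cis s'}}"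
  have oU: "open U" unfolding U_def by (rule open_Collect_smooth[OF sf oX open_cut_plane])
  have UX: "U \<subseteq> X" by (auto simp: U_def)
  define \<psi> where "\<psi> x = (su a b (fst x), ang s' (f x))" for x
  show ?thesis
  proof (rule smooth_transitionI[OF p(1) oU])
    have v0: "v (double_chart A i) \<noteq> 0" by (rule unit_tangent_norm(2)[OF P(2,3)])
    have vt: "v \<in> tangent_space (double_atlas A) P" using P(2) by (simp add: unit_tangent_bundle_iff)
    have fp: "f (crd i P, ang s (v (double_chart A i))) = su' a b (crd i P) * sgn (v (double_chart A i))"
      by (simp add: f_def cis_ang[OF v0])
    have "of_real ((1 - (cmod (crd i P))\<^sup>2) / 2) * f (crd i P, ang s (v (double_chart A i))) = v (double_chart A j)"
      unfolding fp tangent_trans[OF vt T P(3)]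
      using arg_cong[OF unit_vector_eq[OF P(2,3)], of "(*) (su' a b (crd i P))"] by (metis mult.left_commute)
    then have "sgn (f (crd i P, ang s (v (double_chart A i)))) = sgn (v (double_chart A j))"
      using sgn_pos_mult[OF half_gap_pos[OF P(3)]] by metis
    moreover have "f (crd i P, ang s (v (double_chart A i))) \<noteq> 0"
      using v0 su'_nonzero[OF gap crd_ball[OF P(3)]] by (simp add: fp sgn_zero_iff)
    ultimately show "snd (lchart i s) p \<in> U"
      using V(2) ang_range[OF v0 P(4)] Pj(2) by (simp add: P(1) snd_lchart U_def X_def)
    show "smooth_on \<psi> U"
      unfolding \<psi>_def
    proof (intro smooth_on_Pair smooth_on_ang oU)
      show "smooth_on (\<lambda>x. su a b (fst x)) U"
        using smooth_on_su(1)[OF gap oX fstX fb] UX by (rule smooth_on_subset) 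
      show "smooth_on f U" using sf UX by (rule smooth_on_subset)
    qed (auto simp: U_def)
    fix x assume x: "x \<in> U"
    obtain z \<phi> where z: "x = (z, \<phi>)" by (cases x)
    have zV: "z \<in> V" and r: "s < \<phi>" "\<phi> < s + 2 * pi" and cut: "f x \<noteq> 0" "sgn (f x) \<noteq> cis s'"
      using x by (auto simp: U_def X_def z)
    obtain Q where Q: "Q \<in> dom i" "Q \<in> dom j" "crd i Q = z" using V(3)[OF zV] by blast
    have TQ: "trans_map i j Q a b"
      unfolding trans_map_def eventually_nhds using gap V(1,3) zV Q(3) by blast
    obtain w where w: "Inl (Q, w) \<in> fst (lchart i s)" "snd (lchart i s) (Inl (Q, w)) = (crd i Q, \<phi>)"
      "(Q, w) \<in> utb" "w (double_chart A i) = of_real ((1 - (cmod (crd i Q))\<^sup>2) / 2) * cis \<phi>"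
      using lchart_point[OF Q(1) r] .
    have wt: "w \<in> tangent_space (double_atlas A) Q" using w(3) by (simp add: unit_tangent_bundle_iff)
    have wj: "w (double_chart A j) = of_real ((1 - (cmod (crd i Q))\<^sup>2) / 2) * f x"
      unfolding tangent_trans[OF wt TQ Q(1)] w(4) by (simp add: f_def z Q(3))
    note n = half_gap_pos[OF Q(1)]
    have "Inl (Q, w) \<in> fst (lchart j s')"
      unfolding Inl_lchart wj sgn_pos_mult[OF n] using w(3) Q(2) cut by blast
    moreover have "snd (lchart j s') (Inl (Q, w)) = \<psi> x"
      unfolding snd_lchart wj ang_of_real_mult[OF n]
      by (simp add: \<psi>_def z trans_mapD(3)[OF TQ Q(1)] Q(3))
    ultimately show "\<exists>q\<in>fst (lchart i s) \<inter> fst (lchart j s'). snd (lchart i s) q = x \<and> snd (lchart j s') q = \<psi> x"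
      using w(1,2) Q(3) z by blast
  qed
qed

end

section \<open>The charts around the singular fibers\<close>

context cone_setting
begin

definition schart :: "(real \<Rightarrow> dpoint) \<Rightarrow> 3 \<Rightarrow> real \<Rightarrow> (mpoint, complex \<times> real) chart" where
  "schart l k s = angular_chart (fiber_nbhd A \<tau> k) (fiber_map A \<omega> l k) s"

text \<open>For a velocity \<open>y\<close> at the coordinate \<open>z\<close> this is the
  logarithmic derivative of the centred coordinate, conjugated if \<open>\<omega> = - 1\<close>. Its
  argument is the fiber angle.\<close>

definition fib :: "3 \<Rightarrow> complex \<Rightarrow> complex \<Rightarrow> complex" where
  "fib k z y = flip (su' 1 (- A k) z * y / su 1 (- A k) z)"

lemma gapA: "cmod (A k) < cmod 1" "cmod (- A k) < cmod 1"
  using A_ball[of k] by simp_all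

lemma flip_simps [simp]:
  "flip (flip y) = y" "flip (of_real r * y) = of_real r * flip y" "flip y = 0 \<longleftrightarrow> y = 0"
  "flip y = flip y' \<longleftrightarrow> y = y'"
  by (simp_all add: flip_def)

lemma sgn_flip: "sgn (flip y) = flip (sgn y)"
  by (simp add: flip_def sgn_eq)

lemma smooth_on_flip: "open S \<Longrightarrow> smooth_on f S \<Longrightarrow> smooth_on (\<lambda>x. flip (f x)) S"
  unfolding flip_def by (cases "\<omega> = 1") (simp_all add: smooth_on_cnj)

lemma fib_scale: "fib k z (of_real r * y) = of_real r * fib k z y"
proof -
  have "su' 1 (- A k) z * (of_real r * y) / su 1 (- A k) z = of_real r * (su' 1 (- A k) z * y / su 1 (- A k) z)"
    by simp
  then show ?thesis by (simp only: fib_def flip_simps)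
qed

lemma fib_eq_0: "cmod z < 1 \<Longrightarrow> su 1 (- A k) z \<noteq> 0 \<Longrightarrow> fib k z y = 0 \<longleftrightarrow> y = 0"
  using su'_nonzero[OF gapA(2)[of k]] by (simp add: fib_def)

lemma Inl_schart: "Inl (P, v) \<in> fst (schart l k s) \<longleftrightarrow>
    (P, v) \<in> utb \<and> P \<in> cone_ball A \<tau> k \<and> P \<noteq> cone_point A k \<and> cis (fiber_angle A \<omega> k (P, v)) \<noteq> cis s"
  by (auto simp: schart_def fst_angular_chart fiber_nbhd_def fiber_map_def M_star_def)

lemma Inr_schart: "Inr (Q, u) \<in> fst (schart l k s) \<longleftrightarrow> Q = cone_point A k \<and> cmod u = 1 \<and> u \<noteq> cis s"
  by (auto simp: schart_def fst_angular_chart fiber_nbhd_def fiber_map_def)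

lemma snd_schart:
  "snd (schart l k s) (Inl (P, v)) = (cone_chart A \<omega> l k P, ang s (cis (fiber_angle A \<omega> k (P, v))))"
  "snd (schart l k s) (Inr (Q, u)) = (0, ang s u)"
  by (simp_all add: schart_def snd_angular_chart fiber_map_def)

lemma schart_coord:
  assumes "(P, v) \<in> utb" "P \<in> cone_ball A \<tau> k" "P \<in> dom j" "j \<noteq> k"
  shows "Inl (P, v) \<in> fst (schart l k s) \<longleftrightarrow> sgn (fib k (crd j P) (v (double_chart A j))) \<noteq> cis s"
    "snd (schart l k s) (Inl (P, v)) = (phase l k j * polar_map k (qc k j (crd j P)),
       ang s (fib k (crd j P) (v (double_chart A j))))"
    "fib k (crd j P) (v (double_chart A j)) \<noteq> 0"
proof -
  have f: "cis (fiber_angle A \<omega> k (P, v)) = sgn (fib k (crd j P) (v (double_chart A j)))"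
    using fiber_angle_eq[OF assms(2,3,4,1)] by (simp add: fib_def)
  have "P \<noteq> cone_point A k" using assms(3) dom_not_cone by blast
  then show "Inl (P, v) \<in> fst (schart l k s) \<longleftrightarrow> sgn (fib k (crd j P) (v (double_chart A j))) \<noteq> cis s"
    using assms by (simp add: Inl_schart f)
  show "snd (schart l k s) (Inl (P, v)) = (phase l k j * polar_map k (qc k j (crd j P)),
       ang s (fib k (crd j P) (v (double_chart A j))))"
    unfolding snd_schart f ang_sgn cone_chart_eq[OF assms(2,3,4)] ..
  show "fib k (crd j P) (v (double_chart A j)) \<noteq> 0"
    using fib_eq_0[OF crd_ball[OF assms(3)] chart_qc_facts(4)[OF assms(4,3)]] unit_tangent_norm(2)[OF assms(1,3)] by simp
qed

lemma inj_schart: "inj_on (snd (schart l k s)) (fst (schart l k s))"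
proof (rule inj_onI)
  fix p q assume pq: "p \<in> fst (schart l k s)" "q \<in> fst (schart l k s)" "snd (schart l k s) p = snd (schart l k s) q"
  have n0: "cone_chart A \<omega> l k P \<noteq> 0" if "Inl (P, v) \<in> fst (schart l k s)" for P v
    using that norm_cone_chart(2) by (simp add: Inl_schart)
  show "p = q"
  proof (cases p)
    case p: (Inr P')
    obtain P u where P: "P' = (P, u)" by (cases P')
    show ?thesis
    proof (cases q)
      case q: (Inr Q')
      obtain Q u' where Q: "Q' = (Q, u')" by (cases Q')
      have c: "P = cone_point A k" "Q = cone_point A k" "cmod u = 1" "cmod u' = 1" "ang s u = ang s u'"
        using pq by (simp_all add: p q P Q Inr_schart snd_schart)
      have "u \<noteq> 0" "u' \<noteq> 0" using c by auto
      then have "sgn u = sgn u'" using cis_ang c(5) by metis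
      then show ?thesis using c by (simp add: p q P Q sgn_eq)
    next
      case q: (Inl Q')
      then show ?thesis using pq n0[of "fst Q'" "snd Q'"] by (cases Q') (auto simp: p P snd_schart)
    qed
  next
    case p: (Inl P')
    obtain P v where P: "P' = (P, v)" by (cases P')
    note Pn = n0[OF pq(1)[unfolded p P]]
    show ?thesis
    proof (cases q)
      case q: (Inr Q')
      then show ?thesis using pq Pn by (cases Q') (auto simp: p P snd_schart)
    next
      case q: (Inl Q')
      obtain Q w where Q: "Q' = (Q, w)" by (cases Q')
      have Pu: "(P, v) \<in> utb" "P \<in> cone_ball A \<tau> k" "P \<noteq> cone_point A k"
        and Qu: "(Q, w) \<in> utb" "Q \<in> cone_ball A \<tau> k" "Q \<noteq> cone_point A k"
        using pq by (auto simp: p q P Q Inl_schart)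
      obtain j where j: "j \<noteq> k" "P \<in> dom j" using cone_ball_chart[OF Pu(2,3)] .
      have cc: "cone_chart A \<omega> l k P = cone_chart A \<omega> l k Q"
        using pq(3) by (simp add: p q P Q snd_schart)
      \<comment> \<open>Membership in \<open>dom j\<close> can be read off from the polar
        coordinate, so both points are seen in a common chart.\<close>
      then have Qj: "Q \<in> dom j"
        using polar_chart_iff[OF j(1) Pu(2,3), of l] polar_chart_iff[OF j(1) Qu(2,3), of l] j(2) by simp
      note e = pq(3)[unfolded p q P Q schart_coord(2)[OF Pu(1,2) j(2,1)] schart_coord(2)[OF Qu(1,2) Qj j(1)]]
      have "polar_map k (qc k j (crd j P)) = polar_map k (qc k j (crd j Q))" using e by simp
      then have "qc k j (crd j P) = qc k j (crd j Q)"
        by (metis polar_map_Arg(4)[OF chart_qc_facts(1-3)[OF j(1) j(2)]] polar_map_Arg(4)[OF chart_qc_facts(1-3)[OF j(1) Qj]])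
      then have z: "crd j P = crd j Q"
        by (metis qc_inverse(1)[OF crd_ball[OF j(2)], of k j] qc_inverse(1)[OF crd_ball[OF Qj], of k j])
      have PQ: "P = Q" using inj_onD[OF inj_crd z j(2) Qj] .
      have "sgn (fib k (crd j P) (v (double_chart A j))) = sgn (fib k (crd j P) (w (double_chart A j)))"
        using e cis_ang[OF schart_coord(3)[OF Pu(1,2) j(2,1)], of s] cis_ang[OF schart_coord(3)[OF Qu(1,2) Qj j(1)], of s]
        by (simp add: z)
      then have "sgn (v (double_chart A j)) = sgn (w (double_chart A j))"
        using su'_nonzero[OF gapA(2) crd_ball[OF j(2)], of k] chart_qc_facts(4)[OF j]
        by (simp add: fib_def sgn_flip sgn_mult sgn_divide sgn_zero_iff)
      then have "v (double_chart A j) = w (double_chart A j)"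
        by (metis z unit_vector_eq[OF Pu(1) j(2)] unit_vector_eq[OF Qu(1) Qj])
      then have "v = w"
        using tangent_eqI[of v P w j] Pu(1) Qu(1) j(2) by (simp add: PQ unit_tangent_bundle_iff)
      then show ?thesis by (simp add: p q P Q PQ)
    qed
  qed
qed

lemma hdist_crd:
  assumes "P \<in> dom j" "j \<noteq> k"
  shows "hdist k (crd j P) = hdist k (fold_point P)"
proof -
  obtain w b where w: "w \<in> region j" "P = glue A (w, b)" using assms(1) by (rule domE)
  show ?thesis
    unfolding hdist_qc[of k _ j] using qc_rho[OF assms(2) regionD[OF w(1)], of b] by (simp add: w crd_glue)
qed

lemma cone_ball_crd: "P \<in> dom j \<Longrightarrow> j \<noteq> k \<Longrightarrow> P \<in> cone_ball A \<tau> k \<longleftrightarrow> hdist k (crd j P) < \<tau>"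
  using cone_ball_iff[of P k] dom_not_cone dom_subset_double by (auto simp: hdist_crd)

lemma smooth_on_fst_snd:
  fixes X :: "('a::euclidean_space \<times> 'b::euclidean_space) set"
  assumes "open X"
  shows "smooth_on fst X" "smooth_on snd X"
  using assms by (auto intro!: smooth_on_bounded_linear bounded_linear_fst bounded_linear_snd)

lemma sector_slit:
  assumes "q \<noteq> 0" "\<bar>Arg q\<bar> < theta k"
  shows "q \<notin> \<real>\<^sub>\<le>\<^sub>0"
  using assms angle_at_vertex(2)[of k] nonpos_Reals_Arg by auto

text \<open>The charts with \<open>j \<noteq> k\<close> cover the punctured ball, and in them the
  polar coordinates are explicit. The chart \<open>k\<close> is reached from these by composition in
  \<open>all_transitions\<close>.\<close>

lemma lchart_schart_transition:
  assumes p: "p \<in> fst (lchart j s)" "p \<in> fst (schart l k s')" and jk: "j \<noteq> k"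
  shows "smooth_transition (lchart j s) (schart l k s') p"
proof -
  obtain P v where P: "p = Inl (P, v)" "(P, v) \<in> utb" "P \<in> dom j" "sgn (v (double_chart A j)) \<noteq> cis s"
    using p(1) unfolding fst_lchart by blast
  have Pk: "P \<in> cone_ball A \<tau> k" using p(2) by (simp add: P(1) Inl_schart)
  note C = schart_coord(1,2)[OF P(2) Pk P(3) jk, of l s'] schart_coord(3)[OF P(2) Pk P(3) jk]
  have cut: "sgn (fib k (crd j P) (v (double_chart A j))) \<noteq> cis s'" using p(2) C(1) by (simp add: P(1))
  define V where "V = crd j ` dom j \<inter> {z \<in> ball 0 1. hdist k z < \<tau>}"
  have "{z \<in> ball 0 1. hdist k z < \<tau>} = ball 0 1 \<inter> hdist k -` {..<\<tau>}" by auto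
  then have "open {z \<in> ball 0 1. hdist k z < \<tau>}"
    using continuous_open_preimage[OF hdist_continuous open_ball, of "{..<\<tau>}" k] by (simp only: open_lessThan)
  then have oV: "open V" unfolding V_def by (intro open_Int open_crd_image)
  define X where "X = V \<times> {s<..<s + 2 * pi}"
  have oX: "open X" unfolding X_def by (intro open_Times oV) auto
  note fs = smooth_on_fst_snd[OF oX]
  define f where "f x = fib k (fst x) (cis (snd x))" for x
  have zb: "cmod (fst x) < 1" and m0: "su 1 (- A k) (fst x) \<noteq> 0" and q0: "qc k j (fst x) \<notin> \<real>\<^sub>\<le>\<^sub>0"
    if "x \<in> X" for x
    using that chart_qc_facts(4)[OF jk] crd_ball sector_slit[OF chart_qc_facts(1,3)[OF jk]]
    by (auto simp: X_def V_def)
  have sf: "smooth_on f X"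
    unfolding f_def fib_def
    by (intro smooth_on_flip smooth_on_divide smooth_on_mult smooth_on_su[OF gapA(2) oX fs(1) zb] smooth_on_cis oX fs m0)
  have sq: "smooth_on (\<lambda>x. qc k j (fst x)) X"
    unfolding qc_def by (intro smooth_on_mult smooth_on_const smooth_on_su[OF gapA(2) oX fs(1) zb] oX)
  have sp: "smooth_on (\<lambda>x. phase l k j * polar_map k (qc k j (fst x))) X"
    by (intro smooth_on_mult smooth_on_const smooth_on_polar_map[OF oX sq] oX) (simp add: q0 qc_ball zb)
  define U where "U = {x \<in> X. f x \<in> {y. y \<noteq> 0 \<and> sgn y \<noteq> cis s'}}"
  have oU: "open U" unfolding U_def by (rule open_Collect_smooth[OF sf oX open_cut_plane])
  have UX: "U \<subseteq> X" by (auto simp: U_def)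
  show ?thesis
  proof (rule smooth_transitionI[OF p(1) oU])
    have v0: "v (double_chart A j) \<noteq> 0" by (rule unit_tangent_norm(2)[OF P(2,3)])
    have "fib k (crd j P) (v (double_chart A j)) =
      of_real ((1 - (cmod (crd j P))\<^sup>2) / 2) * fib k (crd j P) (sgn (v (double_chart A j)))"
      unfolding fib_scale[symmetric] using unit_vector_eq[OF P(2,3)] by metis
    then have "fib k (crd j P) (v (double_chart A j)) =
      of_real ((1 - (cmod (crd j P))\<^sup>2) / 2) * f (snd (lchart j s) p)"
      unfolding f_def P(1) snd_lchart by (simp add: cis_ang[OF v0])
    then have "sgn (f (snd (lchart j s) p)) = sgn (fib k (crd j P) (v (double_chart A j)))"
      "f (snd (lchart j s) p) \<noteq> 0"
      using sgn_pos_mult[OF half_gap_pos[OF P(3)]] C(3) by (metis, metis mult_zero_right)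
    moreover have "snd (lchart j s) p \<in> X"
      using ang_range[OF v0 P(4)] P(3) Pk crd_ball[OF P(3)] cone_ball_crd[OF P(3) jk]
      by (simp add: P(1) snd_lchart X_def V_def)
    ultimately show "snd (lchart j s) p \<in> U" using cut by (simp add: U_def)
    show "smooth_on (\<lambda>x. (phase l k j * polar_map k (qc k j (fst x)), ang s' (f x))) U"
    proof (intro smooth_on_Pair smooth_on_ang oU)
      show "smooth_on (\<lambda>x. phase l k j * polar_map k (qc k j (fst x))) U" "smooth_on f U"
        by (rule smooth_on_subset[OF sp UX], rule smooth_on_subset[OF sf UX])
    qed (auto simp: U_def)
    fix x assume x: "x \<in> U"
    obtain z \<phi> where z: "x = (z, \<phi>)" by (cases x)
    have zV: "z \<in> V" and r: "s < \<phi>" "\<phi> < s + 2 * pi" and cut: "f x \<noteq> 0" "sgn (f x) \<noteq> cis s'"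
      using x by (auto simp: U_def X_def z)
    obtain Q where Q: "Q \<in> dom j" "crd j Q = z" "hdist k z < \<tau>" using zV by (auto simp: V_def)
    have Qk: "Q \<in> cone_ball A \<tau> k" using Q cone_ball_crd[OF Q(1) jk] by simp
    obtain w where w: "Inl (Q, w) \<in> fst (lchart j s)" "snd (lchart j s) (Inl (Q, w)) = (crd j Q, \<phi>)"
      "(Q, w) \<in> utb" "w (double_chart A j) = of_real ((1 - (cmod (crd j Q))\<^sup>2) / 2) * cis \<phi>"
      using lchart_point[OF Q(1) r] .
    note n = half_gap_pos[OF Q(1)]
    note D = schart_coord(1,2)[OF w(3) Qk Q(1) jk, of l s']
    have fx: "fib k (crd j Q) (w (double_chart A j)) = of_real ((1 - (cmod (crd j Q))\<^sup>2) / 2) * f x"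
      unfolding w(4) fib_scale by (simp add: f_def z Q(2))
    have "Inl (Q, w) \<in> fst (schart l k s')"
      unfolding D(1) fx sgn_pos_mult[OF n] by (rule cut)
    moreover have "snd (schart l k s') (Inl (Q, w)) = (phase l k j * polar_map k (qc k j (fst x)), ang s' (f x))"
      unfolding D(2) fx ang_of_real_mult[OF n] by (simp add: z Q(2))
    ultimately show "\<exists>q\<in>fst (lchart j s) \<inter> fst (schart l k s').
        snd (lchart j s) q = x \<and> snd (schart l k s') q = (phase l k j * polar_map k (qc k j (fst x)), ang s' (f x))"
      using w(1,2) Q(2) z by blast
  qed
qed

definition zinv :: "(real \<Rightarrow> dpoint) \<Rightarrow> 3 \<Rightarrow> 3 \<Rightarrow> complex \<Rightarrow> complex" where
  "zinv l k j w = su 1 (A k) (bv k j * polar_inv k (w / phase l k j))"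

definition finv :: "3 \<Rightarrow> complex \<Rightarrow> complex \<Rightarrow> complex" where
  "finv k z y = flip y * su 1 (- A k) z / su' 1 (- A k) z"

lemma fib_finv: "cmod z < 1 \<Longrightarrow> su 1 (- A k) z \<noteq> 0 \<Longrightarrow> fib k z (finv k z y) = y"
  using su'_nonzero[OF gapA(2)[of k]] by (simp add: fib_def finv_def)

lemma finv_eq_0: "cmod z < 1 \<Longrightarrow> su 1 (- A k) z \<noteq> 0 \<Longrightarrow> finv k z y = 0 \<longleftrightarrow> y = 0"
  using su'_nonzero[OF gapA(2)[of k]] by (simp add: finv_def)

lemma zinv_facts:
  assumes "w / phase l k j \<notin> \<real>\<^sub>\<le>\<^sub>0"
  shows "cmod (zinv l k j w) < 1" "qc k j (zinv l k j w) = polar_inv k (w / phase l k j)"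
    "su 1 (- A k) (zinv l k j w) \<noteq> 0" "phase l k j * polar_map k (qc k j (zinv l k j w)) = w"
    "sinh (hdist k (zinv l k j w)) = cmod w"
proof -
  note q = polar_inv_facts[OF assms, of k]
  have b: "cmod (bv k j * polar_inv k (w / phase l k j)) < 1" using q(1) by (simp add: norm_mult)
  show z: "cmod (zinv l k j w) < 1" unfolding zinv_def by (rule su_in_ball[OF gapA(1) b])
  show Q: "qc k j (zinv l k j w) = polar_inv k (w / phase l k j)" unfolding zinv_def by (rule qc_inverse(2)[OF q(1)])
  then show "su 1 (- A k) (zinv l k j w) \<noteq> 0" using q(2) by (auto simp: qc_def)
  show "phase l k j * polar_map k (qc k j (zinv l k j w)) = w" unfolding Q q(4) by simp
  show "sinh (hdist k (zinv l k j w)) = cmod w"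
    unfolding norm_polar_map_sinh[OF z, of k j, symmetric] Q q(4) by (simp add: norm_divide)
qed

lemma schart_point:
  assumes jk: "j \<noteq> k" and w: "w / phase l k j \<notin> \<real>\<^sub>\<le>\<^sub>0" "cmod w < sinh \<tau>" and b: "s < \<beta>" "\<beta> < s + 2 * pi"
  obtains Q u where "Inl (Q, u) \<in> fst (schart l k s)" "snd (schart l k s) (Inl (Q, u)) = (w, \<beta>)"
    "Q \<in> dom j" "crd j Q = zinv l k j w" "(Q, u) \<in> utb" "Q \<in> cone_ball A \<tau> k"
    "u (double_chart A j) = of_real ((1 - (cmod (crd j Q))\<^sup>2) / 2) * sgn (finv k (zinv l k j w) (cis \<beta>))"
proof -
  define z where "z = zinv l k j w"
  note Z = zinv_facts[OF w(1), folded z_def]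
  note q = polar_inv_facts[OF w(1), of k, folded Z(2)]
  have "sinh (hdist k z) < sinh \<tau>" using Z(5) w(2) by simp
  then have h: "hdist k z < \<tau>" by simp
  obtain Q where Q: "Q \<in> dom j" "crd j Q = z" "Q \<in> cone_ball A \<tau> k"
    using chart_of_sector[OF jk Z(1) q(2,3) h] .
  define y where "y = finv k z (cis \<beta>)"
  have y0: "y \<noteq> 0" by (simp add: y_def finv_eq_0[OF Z(1,3)])
  obtain u where u: "(Q, u) \<in> utb" "u (double_chart A j) = of_real ((1 - (cmod (crd j Q))\<^sup>2) / 2) * cis (Arg y)"
    using unit_vector_exists[OF Q(1)] .
  have uy: "u (double_chart A j) = of_real ((1 - (cmod (crd j Q))\<^sup>2) / 2) * sgn y"
    using u(2) cis_Arg[OF y0] by simp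
  have "sgn y = of_real (1 / cmod y) * y" by (simp add: sgn_eq)
  then have f: "fib k (crd j Q) (u (double_chart A j)) =
      of_real ((1 - (cmod (crd j Q))\<^sup>2) / 2) * (of_real (1 / cmod y) * cis \<beta>)"
    unfolding uy fib_scale by (simp only: fib_scale) (simp only: y_def Q(2) fib_finv[OF Z(1,3)])
  note n = half_gap_pos[OF Q(1)]
  have n': "1 / cmod y > 0" using y0 by simp
  note D = schart_coord(1,2)[OF u(1) Q(3,1) jk, of l s]
  have "Inl (Q, u) \<in> fst (schart l k s)"
    unfolding D(1) f sgn_pos_mult[OF n] sgn_pos_mult[OF n'] sgn_cis by (rule sgn_cut_of_range[OF b])
  moreover have "snd (schart l k s) (Inl (Q, u)) = (w, \<beta>)"
    unfolding D(2) f ang_of_real_mult[OF n] ang_of_real_mult[OF n'] ang_cis[OF b] unfolding Q(2) Z(4) ..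
  ultimately show thesis using that Q u(1) uy by (simp add: z_def y_def)
qed

text \<open>Smoothness of this direction comes from the explicit inverses: \<open>zinv\<close> for
  the base point on the slit plane, and \<open>finv\<close> for the tangent vector up to a positive
  factor.\<close>

lemma schart_lchart_transition:
  assumes p: "p \<in> fst (schart l k s)" "p \<in> fst (lchart j s')" and jk: "j \<noteq> k"
  shows "smooth_transition (schart l k s) (lchart j s') p"
proof -
  obtain P v where P: "p = Inl (P, v)" "(P, v) \<in> utb" "P \<in> dom j" "sgn (v (double_chart A j)) \<noteq> cis s'"
    using p(2) unfolding fst_lchart by blast
  have Pk: "P \<in> cone_ball A \<tau> k" "P \<noteq> cone_point A k" using p(1) by (simp_all add: P(1) Inl_schart)
  note C = schart_coord(1,2)[OF P(2) Pk(1) P(3) jk, of l s] schart_coord(3)[OF P(2) Pk(1) P(3) jk]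
  have cut: "sgn (fib k (crd j P) (v (double_chart A j))) \<noteq> cis s" using p(1) C(1) by (simp add: P(1))
  have "open {w. w / phase l k j \<in> - \<real>\<^sub>\<le>\<^sub>0}"
    by (rule open_Collect_smooth[where U = UNIV, simplified])
      (auto intro!: smooth_on_divide smooth_on_ident smooth_on_const simp: closed_nonpos_Reals_complex open_Compl)
  define X where "X = ({w. w / phase l k j \<in> - \<real>\<^sub>\<le>\<^sub>0} \<inter> ball 0 (sinh \<tau>)) \<times> {s<..<s + 2 * pi}"
  have oX: "open X" unfolding X_def by (intro open_Times open_Int \<open>open {w. _ w}\<close>) auto
  note fs = smooth_on_fst_snd[OF oX]
  define f where "f x = finv k (zinv l k j (fst x)) (cis (snd x))" for x
  have w0: "fst x / phase l k j \<notin> \<real>\<^sub>\<le>\<^sub>0" if "x \<in> X" for x using that by (auto simp: X_def)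
  have sb: "smooth_on (\<lambda>x. bv k j * polar_inv k (fst x / phase l k j)) X"
    by (intro smooth_on_mult smooth_on_const smooth_on_polar_inv smooth_on_divide oX fs w0) auto
  have sz: "smooth_on (\<lambda>x. zinv l k j (fst x)) X"
    unfolding zinv_def using polar_inv_facts(1)[OF w0]
    by (intro smooth_on_su(1)[OF gapA(1) oX sb]) (simp add: norm_mult)
  have zb: "cmod (zinv l k j (fst x)) < 1" and m0: "su 1 (- A k) (zinv l k j (fst x)) \<noteq> 0" if "x \<in> X" for x
    using zinv_facts(1,3)[OF w0[OF that]] .
  have sf: "smooth_on f X"
    unfolding f_def finv_def
    by (intro smooth_on_flip smooth_on_divide smooth_on_mult smooth_on_su[OF gapA(2) oX sz zb] smooth_on_cis oX fs
        su'_nonzero[OF gapA(2) zb])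
  define U where "U = {x \<in> X. f x \<in> {y. y \<noteq> 0 \<and> sgn y \<noteq> cis s'}}"
  have oU: "open U" unfolding U_def by (rule open_Collect_smooth[OF sf oX open_cut_plane])
  have UX: "U \<subseteq> X" by (auto simp: U_def)
  show ?thesis
  proof (rule smooth_transitionI[OF p(1) oU])
    define z where "z = crd j P"
    define W where "W = phase l k j * polar_map k (qc k j z)"
    define F where "F = fib k z (v (double_chart A j))"
    have sp: "snd (schart l k s) p = (W, ang s F)" unfolding P(1) C(2) W_def F_def z_def ..
    have zb': "cmod z < 1" and m0': "su 1 (- A k) z \<noteq> 0"
      unfolding z_def by (rule crd_ball[OF P(3)], rule chart_qc_facts(4)[OF jk P(3)])
    note q = chart_qc_facts(1-3)[OF jk P(3), folded z_def]
    have Wp: "W / phase l k j = polar_map k (qc k j z)" by (simp add: W_def)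
    have Wn: "W / phase l k j \<notin> \<real>\<^sub>\<le>\<^sub>0" unfolding Wp by (rule polar_map_Arg(3)[OF q])
    have zW: "zinv l k j W = z" unfolding zinv_def Wp polar_map_Arg(4)[OF q] by (rule qc_inverse(1)[OF zb'])
    have "cmod W = sinh (hdist k z)" using zinv_facts(5)[OF Wn] by (simp add: zW)
    then have "cmod W < sinh \<tau>" using Pk(1) cone_ball_crd[OF P(3) jk] by (simp add: z_def)
    then have X: "(W, ang s F) \<in> X" using Wn ang_range[OF C(3) cut] by (simp add: X_def F_def z_def)
    have F0: "F \<noteq> 0" using C(3) by (simp add: F_def z_def)
    have "finv k z F = v (double_chart A j)"
      using su'_nonzero[OF gapA(2) zb', of k] m0' by (simp add: F_def fib_def finv_def)
    moreover have "f (W, ang s F) = of_real (1 / cmod F) * finv k z F"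
      unfolding f_def fst_conv snd_conv zW cis_ang[OF F0] finv_def by (simp add: sgn_eq flip_def)
    ultimately have fW: "f (W, ang s F) = of_real (1 / cmod F) * v (double_chart A j)" by simp
    have "1 / cmod F > 0" using F0 by simp
    then have "sgn (f (W, ang s F)) = sgn (v (double_chart A j))" unfolding fW by (rule sgn_pos_mult)
    moreover have "f (W, ang s F) \<noteq> 0" unfolding fW using F0 unit_tangent_norm(2)[OF P(2,3)] by simp
    ultimately show "snd (schart l k s) p \<in> U" using X P(4) by (simp add: sp U_def)
    show "smooth_on (\<lambda>x. (zinv l k j (fst x), ang s' (f x))) U"
    proof (intro smooth_on_Pair smooth_on_ang oU)
      show "smooth_on (\<lambda>x. zinv l k j (fst x)) U" "smooth_on f U"
        by (rule smooth_on_subset[OF sz UX], rule smooth_on_subset[OF sf UX])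
    qed (auto simp: U_def)
    fix x assume x: "x \<in> U"
    obtain w \<beta> where wb: "x = (w, \<beta>)" by (cases x)
    have w: "w / phase l k j \<notin> \<real>\<^sub>\<le>\<^sub>0" "cmod w < sinh \<tau>" and r: "s < \<beta>" "\<beta> < s + 2 * pi"
      and cut: "f x \<noteq> 0" "sgn (f x) \<noteq> cis s'"
      using x by (auto simp: U_def X_def wb)
    obtain Q u where Q: "Inl (Q, u) \<in> fst (schart l k s)" "snd (schart l k s) (Inl (Q, u)) = (w, \<beta>)"
      "Q \<in> dom j" "crd j Q = zinv l k j w" "(Q, u) \<in> utb"
      "u (double_chart A j) = of_real ((1 - (cmod (crd j Q))\<^sup>2) / 2) * sgn (finv k (zinv l k j w) (cis \<beta>))"
      using schart_point[OF jk w r] by blast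
    have u: "u (double_chart A j) = of_real ((1 - (cmod (crd j Q))\<^sup>2) / 2) * sgn (f x)"
      using Q(6) by (simp add: f_def wb)
    note n = half_gap_pos[OF Q(3)]
    have "Inl (Q, u) \<in> fst (lchart j s')"
      unfolding Inl_lchart u sgn_pos_mult[OF n] using Q(3,5) cut by (simp add: sgn_sgn)
    moreover have "snd (lchart j s') (Inl (Q, u)) = (zinv l k j (fst x), ang s' (f x))"
      unfolding snd_lchart u ang_of_real_mult[OF n] ang_sgn by (simp add: Q(4) wb)
    ultimately show "\<exists>q\<in>fst (schart l k s) \<inter> fst (lchart j s').
        snd (schart l k s) q = x \<and> snd (lchart j s') q = (zinv l k j (fst x), ang s' (f x))"
      using Q(1,2) wb by blast
  qed
qed

text \<open>The slits of the two charts are opposite rays.\<close>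

lemma phase_slit:
  assumes "w \<noteq> 0"
  obtains j where "j \<noteq> k" "w / phase l k j \<notin> \<real>\<^sub>\<le>\<^sub>0"
proof (cases "w / phase l k (k + 1) \<in> \<real>\<^sub>\<le>\<^sub>0")
  case True
  have "w / phase l k (k + 2) = - (w / phase l k (k + 1))"
    using phase_oth[of "k + 1" k l] by (simp add: three_neq)
  moreover have "- y \<notin> \<real>\<^sub>\<le>\<^sub>0" if "y \<in> \<real>\<^sub>\<le>\<^sub>0" "y \<noteq> 0" for y :: complex
    using that by (auto simp: complex_nonpos_Reals_iff complex_eq_iff)
  ultimately have "w / phase l k (k + 2) \<notin> \<real>\<^sub>\<le>\<^sub>0" using True assms by simp
  then show thesis using that[of "k + 2"] three_neq by auto
next
  case False
  then show thesis using that[of "k + 1"] three_neq by auto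
qed

lemma schart_surj:
  assumes "cmod w < sinh \<tau>" "s < \<beta>" "\<beta> < s + 2 * pi"
  obtains q where "q \<in> fst (schart l k s)" "snd (schart l k s) q = (w, \<beta>)"
proof (cases "w = 0")
  case True
  have "Inr (cone_point A k, cis \<beta>) \<in> fst (schart l k s)"
    using sgn_cut_of_range[OF assms(2,3)] by (simp add: Inr_schart)
  moreover have "snd (schart l k s) (Inr (cone_point A k, cis \<beta>)) = (w, \<beta>)"
    using ang_cis[OF assms(2,3)] True by (simp add: snd_schart)
  ultimately show thesis by (rule that)
next
  case False
  then obtain j where j: "j \<noteq> k" "w / phase l k j \<notin> \<real>\<^sub>\<le>\<^sub>0" by (rule phase_slit)
  show thesis by (rule schart_point[OF j assms]) (rule that)
qed

lemma schart_rotate: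
  assumes "q \<in> fst (schart l k s)" "snd (schart l k s) q = (w, \<beta>)" "cis \<beta> \<noteq> cis s'"
  shows "q \<in> fst (schart l k s')" "snd (schart l k s') q = (w, ang s' (cis \<beta>))"
proof -
  have "q \<in> fst (schart l k s') \<and> snd (schart l k s') q = (w, ang s' (cis \<beta>))"
  proof (cases q)
    case (Inl R)
    obtain P v where R: "R = (P, v)" by (cases R)
    have "cis \<beta> = cis (fiber_angle A \<omega> k (P, v))"
      using assms(2) cis_ang[of "cis (fiber_angle A \<omega> k (P, v))" s] by (auto simp: Inl R snd_schart)
    then show ?thesis using assms by (simp add: Inl R snd_schart Inl_schart)
  next
    case (Inr R)
    obtain Q u where R: "R = (Q, u)" by (cases R)
    have "cmod u = 1" using assms(1) by (simp add: Inr R Inr_schart)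
    moreover from this have "u \<noteq> 0" by auto
    ultimately have "cis \<beta> = u" using assms(2) cis_ang[of u s] by (auto simp: Inr R snd_schart sgn_eq)
    then show ?thesis using assms by (simp add: Inr R snd_schart Inr_schart)
  qed
  then show "q \<in> fst (schart l k s')" "snd (schart l k s') q = (w, ang s' (cis \<beta>))" by auto
qed

lemma tau_pos: "\<tau> > 0"
  using adm by (simp add: admissible_radius_def)

text \<open>Two charts around the same fiber differ only in the place where the circle is cut, so
  the transition changes the branch of the angle and keeps the polar coordinate.\<close>

lemma singular_transition:
  assumes p: "p = Inr (Q, u)" "p \<in> fst (schart l k s)" "p \<in> fst (schart l k s')"
  shows "smooth_transition (schart l k s) (schart l k s') p"
proof -
  define X where "X = ball (0 :: complex) (sinh \<tau>) \<times> {s<..<s + 2 * pi}"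
  have oX: "open X" unfolding X_def by (intro open_Times) auto
  have sf: "smooth_on (\<lambda>x. cis (snd x)) X" by (intro smooth_on_cis oX smooth_on_fst_snd)
  define U where "U = {x \<in> X. cis (snd x) \<in> {y. y \<noteq> 0 \<and> sgn y \<noteq> cis s'}}"
  have oU: "open U" unfolding U_def by (rule open_Collect_smooth[OF sf oX open_cut_plane])
  have UX: "U \<subseteq> X" by (auto simp: U_def)
  show ?thesis
  proof (rule smooth_transitionI[OF p(2) oU])
    have u: "cmod u = 1" "u \<noteq> cis s" "u \<noteq> cis s'" using p by (simp_all add: Inr_schart)
    then have u0: "u \<noteq> 0" "sgn u = u" by (auto simp: sgn_eq)
    show "snd (schart l k s) p \<in> U"
      using ang_range[OF u0(1), of s] cis_ang[OF u0(1), of s] u u0 tau_pos by (simp add: p(1) snd_schart U_def X_def)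
    show "smooth_on (\<lambda>x. (fst x, ang s' (cis (snd x)))) U"
    proof (intro smooth_on_Pair smooth_on_ang oU smooth_on_fst_snd)
      show "smooth_on (\<lambda>x. cis (snd x)) U" by (rule smooth_on_subset[OF sf UX])
    qed (auto simp: U_def)
    fix x assume x: "x \<in> U"
    obtain w \<beta> where wb: "x = (w, \<beta>)" by (cases x)
    have w: "cmod w < sinh \<tau>" "s < \<beta>" "\<beta> < s + 2 * pi" and cut: "cis \<beta> \<noteq> cis s'"
      using x by (auto simp: U_def X_def wb)
    obtain q where q: "q \<in> fst (schart l k s)" "snd (schart l k s) q = (w, \<beta>)" using schart_surj[OF w] .
    show "\<exists>q\<in>fst (schart l k s) \<inter> fst (schart l k s').
        snd (schart l k s) q = x \<and> snd (schart l k s') q = (fst x, ang s' (cis (snd x)))"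
      using q schart_rotate[OF q cut] by (auto simp: wb)
  qed
qed

end

section \<open>The velocity of lifted geodesics in the singular charts\<close>

context cone_setting
begin

text \<open>Through the logarithm \<open>L\<close> of \<open>m\<close>, whose derivative is
  \<open>y\<close>: the real part of \<open>y\<close> moves \<open>log |m|\<close>, and
  \<open>K\<close> is the derivative of \<open>log (2 r / (1 - r^2))\<close> with respect to
  \<open>log r\<close>; the imaginary part moves the argument, which the map multiplies by
  \<open>kappa k\<close>.\<close>

lemma polar_map_derivative:
  assumes m: "(m has_vector_derivative m') (at t)" "cmod (m t) < 1" "m t \<notin> \<real>\<^sub>\<le>\<^sub>0"
  defines "K \<equiv> (1 + (cmod (m t))\<^sup>2) / (1 - (cmod (m t))\<^sup>2)" and "y \<equiv> m' / m t"
  shows "((\<lambda>t. polar_map k (m t)) has_vector_derivative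
     polar_map k (m t) * (of_real (K * Re y) + \<i> * of_real (kappa k * Im y))) (at t)"
proof -
  define L where "L = (\<lambda>s. Ln (m s))"
  have m0: "m t \<noteq> 0" using m(3) by auto
  have L: "(L has_vector_derivative y) (at t)"
    using field_vector_diff_chain_at[OF m(1) has_field_derivative_Ln[OF m(3)]]
    unfolding L_def y_def by (simp add: o_def divide_inverse mult.commute)
  define h where "h = (\<lambda>s. Re (L s))"
  have Re: "(h has_real_derivative Re y) (at t)"
    using bounded_linear.has_vector_derivative[OF bounded_linear_Re L]
    by (simp add: has_real_derivative_iff_has_vector_derivative h_def)
  have Im: "((\<lambda>s. Im (L s)) has_vector_derivative Im y) (at t)"
    by (rule bounded_linear.has_vector_derivative[OF bounded_linear_Im L])
  define r where "r = exp (h t)"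
  have r: "cmod (m t) = r" using m0 by (simp add: r_def L_def h_def)
  have r1: "1 - r\<^sup>2 > 0" "r > 0" using m(2) by (simp_all add: r abs_square_less_1 r_def)
  define G where "G = (\<lambda>s. 2 * exp (h s) / (1 - (exp (h s))\<^sup>2))"
  have "(G has_real_derivative G t * (K * Re y)) (at t)"
  proof -
    have "(G has_real_derivative
        (2 * (r * Re y) * (1 - r\<^sup>2) - 2 * r * (- (2 * r * (r * Re y)))) / (1 - r\<^sup>2)\<^sup>2) (at t)"
      unfolding G_def r_def using r1
      by (auto intro!: derivative_eq_intros Re simp: r_def power2_eq_square)
    moreover have "(2 * (r * Re y) * (1 - r\<^sup>2) - 2 * r * (- (2 * r * (r * Re y)))) / (1 - r\<^sup>2)\<^sup>2 = G t * (K * Re y)"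
      using r1 unfolding K_def r G_def r_def[symmetric]
      by (simp add: divide_simps) (simp add: power2_eq_square algebra_simps)
    ultimately show ?thesis by simp
  qed
  then have G: "((\<lambda>s. complex_of_real (G s)) has_vector_derivative of_real (G t * (K * Re y))) (at t)"
    by (intro bounded_linear.has_vector_derivative[OF bounded_linear_of_real])
      (simp add: has_real_derivative_iff_has_vector_derivative)
  have "((\<lambda>s. \<i> * of_real (kappa k * Im (L s))) has_vector_derivative \<i> * of_real (kappa k * Im y)) (at t)"
    using bounded_linear.has_vector_derivative[OF bounded_linear_compose[OF bounded_linear_mult_right[of \<i>]
        bounded_linear_compose[OF bounded_linear_of_real bounded_linear_mult_right[of "kappa k"]]] Im] .
  from field_vector_diff_chain_at[OF this DERIV_exp]
  have C: "((\<lambda>s. cis (kappa k * Im (L s))) has_vector_derivative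
      cis (kappa k * Im (L t)) * (\<i> * of_real (kappa k * Im y))) (at t)"
    by (simp add: o_def cis_conv_exp mult_ac)
  have "((\<lambda>s. of_real (G s) * cis (kappa k * Im (L s))) has_vector_derivative
      of_real (G t) * cis (kappa k * Im (L t)) * (of_real (K * Re y) + \<i> * of_real (kappa k * Im y))) (at t)"
    using has_vector_derivative_mult[OF G C] by (simp add: algebra_simps)
  moreover have pm: "polar_map k (m s) = of_real (G s) * cis (kappa k * Im (L s))" if "m s \<noteq> 0" for s
    using that by (simp add: polar_map_def G_def L_def h_def Arg_eq_Im_Ln)
  moreover have "\<forall>\<^sub>F s in nhds t. m s \<noteq> 0"
  proof -
    have "isCont m t" by (rule has_vector_derivative_continuous[OF m(1)])
    then show ?thesis
      unfolding tendsto_nhds_isCont by (rule topological_tendstoD[of m _ _ "- {0}", simplified]) (use m0 in auto)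
  qed
  then have "\<forall>\<^sub>F s in nhds t. polar_map k (m s) = of_real (G s) * cis (kappa k * Im (L s))"
    by eventually_elim (rule pm)
  from has_vector_derivative_cong_nhds[OF this] show ?thesis
    using calculation(1) pm[OF m0] by simp
qed

text \<open>The geodesic flow moves the point with coordinates \<open>(w, \<beta>)\<close>, \<open>w \<noteq> 0\<close>, with the velocity
  \<open>singular_field k (w, \<beta>) / \<bar>w\<bar>\<close>; the factor \<open>\<rho> = \<bar>w\<bar>\<close> cancels the pole.\<close>

definition singular_field :: "3 \<Rightarrow> complex \<times> real \<Rightarrow> complex \<times> real" where
  "singular_field k = (\<lambda>(w, \<beta>).
     (w * (of_real (sqrt (1 + (cmod w)\<^sup>2) * cos \<beta>) + \<i> * of_real (pi / theta k * sin \<beta>)),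
      - (sqrt (1 + (cmod w)\<^sup>2) * sin \<beta>)))"

lemma flip_has_vector_derivative:
  "(y has_vector_derivative y') (at t) \<Longrightarrow> ((\<lambda>s. flip (y s)) has_vector_derivative flip y') (at t)"
  unfolding flip_def by (cases "\<omega> = 1") (simp_all add: bounded_linear.has_vector_derivative[OF bounded_linear_cnj])

lemma flip_parts: "Re (flip y) = Re y" "\<omega> * Im (flip y) = Im y" "cmod (flip y) = cmod y"
  using omega_cases by (auto simp: flip_def)

lemma singular_velocity:
  assumes g: "disc_geodesic_at (\<lambda>s. crd j (c s)) 0" "chart_cont j c 0" and jk: "j \<noteq> k"
    and U: "\<forall>\<^sub>F t in nhds 0. (c t, dvel c t) \<in> utb"
    and S: "Inl (c 0, dvel c 0) \<in> fst (schart l k s)"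
  shows "((\<lambda>t. snd (schart l k s) (Inl (c t, dvel c t))) has_vector_derivative
     (1 / cmod (fst (snd (schart l k s) (Inl (c 0, dvel c 0))))) *\<^sub>R
       singular_field k (snd (schart l k s) (Inl (c 0, dvel c 0)))) (at 0)"
proof -
  define z where "z = (\<lambda>t. crd j (c t))"
  define z' where "z' = (\<lambda>t. vector_derivative z (at t))"
  define m where "m = (\<lambda>t. su 1 (- A k) (z t))"
  define m' where "m' = (\<lambda>t. vector_derivative m (at t))"
  define y where "y = (\<lambda>t. m' t / m t)"
  have P: "c 0 \<in> dom j" by (rule chart_cont_dom[OF g(2)])
  have P0: "(c 0, dvel c 0) \<in> utb" "c 0 \<in> cone_ball A \<tau> k" using S by (simp_all add: Inl_schart)
  have gz: "disc_geodesic_at z 0" unfolding z_def by (rule g(1))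
  have gm: "disc_geodesic_at m 0" unfolding m_def by (rule disc_geodesic_at_su[OF gz gapA(2)])
  have zb: "\<forall>\<^sub>F t in nhds 0. cmod (z t) < 1"
    by (rule eventually_ball_isCont[OF disc_geodesic_atD(3,1)[OF gz]])
  have zd: "\<forall>\<^sub>F t in nhds 0. z differentiable (at t)" using gz by (simp add: disc_geodesic_at_def)
  have dv: "dvel c t (double_chart A j) = z' t" if "c t \<in> dom j" for t
    using velocity_chart[of c t j] that by (simp add: z'_def z_def)
  have m': "m' t = su' 1 (- A k) (z t) * z' t" if "cmod (z t) < 1" "z differentiable (at t)" for t
  proof -
    have "(z has_vector_derivative z' t) (at t)" using that(2) by (simp add: z'_def vector_derivative_works)
    from has_vector_derivative_su[OF gapA(2)[of k] that(1) this] show ?thesis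
      unfolding m'_def m_def by (rule vector_derivative_at)
  qed
  have fib: "fib k (crd j (c t)) (dvel c t (double_chart A j)) = flip (y t)"
    if "c t \<in> dom j" "cmod (z t) < 1" "z differentiable (at t)" for t
    using m'[OF that(2,3)] by (simp add: fib_def dv[OF that(1)] y_def m_def z_def)
  note D0 = disc_geodesic_atD[OF gm]
  have q: "qc k j (z 0) \<noteq> 0" "\<bar>Arg (qc k j (z 0))\<bar> < theta k" "m 0 \<noteq> 0"
    using chart_qc_facts[OF jk P] by (simp_all add: z_def m_def)
  define R where "R = cmod (m 0)"
  define K where "K = (1 + R\<^sup>2) / (1 - R\<^sup>2)"
  define W where "W = (\<lambda>t. phase l k j * polar_map k (cnj (bv k j) * m t))"
  have qm: "qc k j (z t) = cnj (bv k j) * m t" for t by (simp add: qc_def m_def)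
  have R: "0 < R" "R < 1" "1 - R\<^sup>2 > 0" using q(3) D0(1) by (simp_all add: R_def abs_square_less_1)
  have nq: "cmod (cnj (bv k j) * m 0) = R" by (simp add: norm_mult R_def)
  have W0: "cmod (W 0) = 2 * R / (1 - R\<^sup>2)"
    unfolding W_def norm_mult norm_phase using norm_polar_map[of "cnj (bv k j) * m 0" k] R(2) by (simp add: nq)
  have W0': "cmod (W 0) > 0" using R by (simp add: W0)
  have KW: "sqrt (1 + (cmod (W 0))\<^sup>2) = K" unfolding W0 K_def by (rule sqrt_polar) (use R in auto)
  have cn: "\<forall>\<^sub>F t in nhds 0. c t \<in> dom j \<and> c t \<in> cone_ball A \<tau> k"
  proof -
    have "{z \<in> ball 0 1. hdist k z < \<tau>} = ball 0 1 \<inter> hdist k -` {..<\<tau>}" by auto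
    then have o: "open {z \<in> ball 0 1. hdist k z < \<tau>}"
      using continuous_open_preimage[OF hdist_continuous open_ball, of "{..<\<tau>}" k] by (simp only: open_lessThan)
    have "z 0 \<in> {z \<in> ball 0 1. hdist k z < \<tau>}"
      using cone_ball_crd[OF P jk] P0(2) disc_geodesic_atD(1)[OF gz] by (simp add: z_def)
    from topological_tendstoD[OF _ o this] have "\<forall>\<^sub>F t in nhds 0. z t \<in> {z \<in> ball 0 1. hdist k z < \<tau>}"
      using disc_geodesic_atD(3)[OF gz] by (simp add: tendsto_nhds_isCont)
    moreover have "\<forall>\<^sub>F t in nhds 0. c t \<in> dom j" using g(2) by (simp add: chart_cont_def)
    ultimately show ?thesis by eventually_elim (auto simp: cone_ball_crd[OF _ jk] z_def)
  qed
  have ev: "\<forall>\<^sub>F t in nhds 0. snd (schart l k s) (Inl (c t, dvel c t)) = (W t, ang s (flip (y t)))"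
    using cn U zb zd
  proof eventually_elim
    case (elim t)
    then have "snd (schart l k s) (Inl (c t, dvel c t)) = (phase l k j * polar_map k (qc k j (crd j (c t))),
       ang s (fib k (crd j (c t)) (dvel c t (double_chart A j))))"
      using jk by (intro schart_coord(2)) auto
    then show ?case using fib[of t] elim by (simp add: W_def qm[symmetric] z_def)
  qed
  have at0: "snd (schart l k s) (Inl (c 0, dvel c 0)) = (W 0, ang s (flip (y 0)))"
    using eventually_nhds_x_imp_x[OF ev] .
  define \<beta> where "\<beta> = ang s (flip (y 0))"
  have z0: "cmod (z 0) < 1" "z differentiable (at 0)" using disc_geodesic_atD(1,2)[OF gz] by auto
  \<comment> \<open>Unit speed is preserved by the isometry, so
    \<open>2 |m'| = 1 - |m|^2\<close>.\<close>
  have "cmod (y 0) = (1 - R\<^sup>2) / (2 * R)"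
  proof -
    have "2 * cmod (m' 0) = cmod (su' 1 (- A k) (z 0)) * (2 * cmod (z' 0))"
      unfolding m'[OF z0] by (simp add: norm_mult)
    also have "2 * cmod (z' 0) = 1 - (cmod (z 0))\<^sup>2"
      using unit_tangent_norm(1)[OF P0(1) P] by (simp add: dv[OF P] z_def)
    also have "cmod (su' 1 (- A k) (z 0)) * (1 - (cmod (z 0))\<^sup>2) = 1 - R\<^sup>2"
      using su'_norm[OF gapA(2)[of k] z0(1)] by (simp add: R_def m_def)
    finally show ?thesis using R by (simp add: y_def norm_divide R_def[symmetric] field_simps)
  qed
  then have yW: "cmod (y 0) = 1 / cmod (W 0)" by (simp add: W0)
  then have y0: "flip (y 0) \<noteq> 0" using W0' by auto
  have cut: "sgn (flip (y 0)) \<noteq> cis s"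
    using S unfolding schart_coord(1)[OF P0 P jk] fib[OF P z0] .
  have "sgn (flip (y 0)) = cis \<beta>" unfolding \<beta>_def by (rule cis_ang[OF y0, symmetric])
  then have fy: "flip (y 0) = of_real (1 / cmod (W 0)) * cis \<beta>"
    using yW W0' by (auto simp: sgn_eq flip_parts(3) field_simps)
  have Rey: "Re (y 0) = cos \<beta> / cmod (W 0)" and Imy: "Im (y 0) = \<omega> * (sin \<beta> / cmod (W 0))"
    and Imf: "Im (flip (y 0)) = sin \<beta> / cmod (W 0)"
    unfolding flip_parts(1)[of "y 0", symmetric] flip_parts(2)[of "y 0", symmetric] fy by simp_all
  have md: "(m has_vector_derivative m' 0) (at 0)" unfolding m'_def by (rule D0(4))
  \<comment> \<open>Here \<open>y' = m'' / m - y^2\<close>, and the geodesic equation gives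
    \<open>m'' / m = - 2 |m|^2 / (1 - |m|^2) * y^2\<close>.\<close>
  have yd: "(y has_vector_derivative - (of_real K * (y 0)\<^sup>2)) (at 0)"
  proof -
    define N where "N = complex_of_real (1 - R\<^sup>2)"
    have N0: "N \<noteq> 0" using R(3) unfolding N_def of_real_eq_0_iff by linarith
    have NR: "m 0 * cnj (m 0) = 1 - N" unfolding N_def R_def by (simp flip: complex_norm_square)
    have KN: "of_real K = (2 - N) / N" unfolding K_def N_def by simp
    have inv: "((\<lambda>t. inverse (m t)) has_vector_derivative m' 0 * - (inverse (m 0))\<^sup>2) (at 0)"
      using field_vector_diff_chain_at[OF md DERIV_inverse[OF q(3)]] by (simp add: o_def power2_eq_square)
    have "((\<lambda>t. m' t * inverse (m t)) has_vector_derivative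
        m' 0 * (m' 0 * - (inverse (m 0))\<^sup>2) + (- 2 * cnj (m 0) * (m' 0)\<^sup>2 / N) * inverse (m 0)) (at 0)"
      using has_vector_derivative_mult[OF D0(5) inv] by (simp add: m'_def N_def R_def)
    moreover have "m' 0 * (m' 0 * - (inverse (m 0))\<^sup>2) + (- 2 * cnj (m 0) * (m' 0)\<^sup>2 / N) * inverse (m 0)
       = - (of_real K * (y 0)\<^sup>2)"
    proof -
      have "(- 2 * cnj (m 0) * (m' 0)\<^sup>2 / N) * inverse (m 0) = - 2 * (m 0 * cnj (m 0)) * (y 0)\<^sup>2 / N"
        using q(3) N0 by (simp add: y_def power2_eq_square field_simps)
      moreover have "m' 0 * (m' 0 * - (inverse (m 0))\<^sup>2) = - (y 0)\<^sup>2"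
        by (simp add: y_def power2_eq_square divide_inverse)
      ultimately show ?thesis unfolding NR KN using N0 by (simp add: field_simps)
    qed
    ultimately show ?thesis by (simp add: y_def divide_inverse)
  qed
  \<comment> \<open>The angle moves with the rate \<open>Im (y' / y)\<close>, which is
    \<open>- K Im y\<close>; the orientation acts on \<open>y\<close> and \<open>y'\<close> alike
    through \<open>flip\<close>.\<close>
  have B: "((\<lambda>t. ang s (flip (y t))) has_vector_derivative - (K * sin \<beta>) / cmod (W 0)) (at 0)"
  proof -
    have "flip (- (of_real K * (y 0)\<^sup>2)) / flip (y 0) = - (of_real K * flip (y 0))"
      using y0 by (simp add: flip_def power2_eq_square)
    then have "Im (flip (- (of_real K * (y 0)\<^sup>2)) / flip (y 0)) = - (K * sin \<beta>) / cmod (W 0)"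
      using Imf by simp
    then show ?thesis using has_vector_derivative_ang[OF flip_has_vector_derivative[OF yd] y0 cut] by simp
  qed
  have "((\<lambda>t. polar_map k (cnj (bv k j) * m t)) has_vector_derivative
     polar_map k (cnj (bv k j) * m 0) * (of_real (K * Re (y 0)) + \<i> * of_real (kappa k * Im (y 0)))) (at 0)"
  proof -
    have "((\<lambda>t. cnj (bv k j) * m t) has_vector_derivative cnj (bv k j) * m' 0) (at 0)"
      by (rule bounded_linear.has_vector_derivative[OF bounded_linear_mult_right md])
    from polar_map_derivative[OF this] show ?thesis
      using sector_slit[OF q(1,2)] R(2) unfolding nq qm by (simp add: K_def y_def)
  qed
  from bounded_linear.has_vector_derivative[OF bounded_linear_mult_right[of "phase l k j"] this]
  have "(W has_vector_derivative W 0 * (of_real (K * Re (y 0)) + \<i> * of_real (kappa k * Im (y 0)))) (at 0)"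
    unfolding W_def by (simp only: mult.assoc)
  moreover have "W 0 * (of_real (K * Re (y 0)) + \<i> * of_real (kappa k * Im (y 0))) =
    of_real (1 / cmod (W 0)) * (W 0 * (of_real (K * cos \<beta>) + \<i> * of_real (pi / theta k * sin \<beta>)))"
    unfolding Rey Imy kappa_facts(3)[symmetric] by (simp add: algebra_simps divide_inverse)
  ultimately have WD: "(W has_vector_derivative
      (1 / cmod (W 0)) *\<^sub>R (W 0 * (of_real (K * cos \<beta>) + \<i> * of_real (pi / theta k * sin \<beta>)))) (at 0)"
    by (simp only: scaleR_conv_of_real)
  have "((\<lambda>t. (W t, ang s (flip (y t)))) has_vector_derivative
     ((1 / cmod (W 0)) *\<^sub>R (W 0 * (of_real (K * cos \<beta>) + \<i> * of_real (pi / theta k * sin \<beta>))),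
      - (K * sin \<beta>) / cmod (W 0))) (at 0)"
    by (rule has_vector_derivative_Pair[OF WD B])
  also have "((1 / cmod (W 0)) *\<^sub>R (W 0 * (of_real (K * cos \<beta>) + \<i> * of_real (pi / theta k * sin \<beta>))),
      - (K * sin \<beta>) / cmod (W 0)) = (1 / cmod (W 0)) *\<^sub>R singular_field k (W 0, \<beta>)"
    by (simp add: singular_field_def KW)
  finally show ?thesis
    unfolding at0 \<beta>_def[symmetric] fst_conv using has_vector_derivative_cong_nhds[OF ev] by simp
qed

end

section \<open>The extension of the geodesic field\<close>

locale extension_setting = cone_setting +
  fixes l :: "3 \<Rightarrow> real \<Rightarrow> dpoint" and \<epsilon> :: real
    and \<rho> :: "dpoint \<times> (dpoint, complex) tangent \<Rightarrow> real"
  assumes eps: "\<epsilon> > 0"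
    and rho_smooth: "smooth_function (M_star_atlas A) \<rho>"
    and rho_near: "\<And>v k. v \<in> M_star A \<Longrightarrow> double_dist A (fst v) (cone_point A k) < \<epsilon> \<Longrightarrow>
           \<rho> v = sinh (double_dist A (fst v) (cone_point A k))"
begin

abbreviation "M \<equiv> M_atlas A \<omega> \<tau> l"

lemma M_iff: "ch \<in> M \<longleftrightarrow> (\<exists>i s. ch = lchart i s) \<or> (\<exists>k s. ch = schart (l k) k s)"
proof -
  have *: "M_star_atlas A = {c. \<exists>i s. c = utb_chart i s}"
    by (rule set_eqI) (simp only: mem_Collect_eq M_star_atlas_def utb_atlas_iff)
  show ?thesis unfolding M_atlas_def lchart_def schart_def * by blast
qed

lemma M_charts [simp]: "lchart i s \<in> M" "schart (l k) k s \<in> M"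
  by (auto simp: M_iff)

lemma inj_M: "ch \<in> M \<Longrightarrow> inj_on (snd ch) (fst ch)"
  using inj_lchart inj_schart by (auto simp: M_iff)

lemma direction_cut: "y \<noteq> 0 \<Longrightarrow> \<exists>s. sgn y \<noteq> cis s"
  using cis_Arg[of y] cis_pi by (intro exI[of _ "Arg y + pi"]) (auto simp flip: cis_mult)

lemma chart_via_lchart:
  assumes "ch \<in> M" "Inl (P, v) \<in> fst ch"
  obtains j s where "Inl (P, v) \<in> fst (lchart j s)" "smooth_transition ch (lchart j s) (Inl (P, v))"
    "smooth_transition (lchart j s) ch (Inl (P, v))"
proof -
  consider i s where "ch = lchart i s" | k s where "ch = schart (l k) k s" using assms(1) M_iff by auto
  then show thesis
  proof cases
    case 1
    then show thesis using that lchart_transition assms(2) by blast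
  next
    case 2
    have P: "(P, v) \<in> utb" "P \<in> cone_ball A \<tau> k" "P \<noteq> cone_point A k"
      using assms(2) by (auto simp: 2 Inl_schart)
    obtain j where j: "j \<noteq> k" "P \<in> dom j" using cone_ball_chart[OF P(2,3)] .
    obtain s' where "sgn (v (double_chart A j)) \<noteq> cis s'"
      using direction_cut[OF unit_tangent_norm(2)[OF P(1) j(2)]] by blast
    then have "Inl (P, v) \<in> fst (lchart j s')" using P(1) j(2) by (simp add: Inl_lchart)
    then show thesis
      using that lchart_schart_transition[OF _ _ j(1)] schart_lchart_transition[OF _ _ j(1)] assms(2)
      unfolding 2 by blast
  qed
qed

text \<open>At a regular point the transition is composed of three, through charts of the unit
  tangent bundle. At a singular point both charts belong to the same fiber.\<close>

lemma all_transitions: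
  assumes "ch \<in> M" "ch' \<in> M" "p \<in> fst ch" "p \<in> fst ch'"
  shows "smooth_transition ch ch' p"
proof (cases p)
  case (Inl R)
  obtain P v where R: "R = (P, v)" by (cases R)
  have p: "Inl (P, v) \<in> fst ch" "Inl (P, v) \<in> fst ch'" using assms by (simp_all add: Inl R)
  obtain j s where a: "Inl (P, v) \<in> fst (lchart j s)" "smooth_transition ch (lchart j s) (Inl (P, v))"
    by (rule chart_via_lchart[OF assms(1) p(1)])
  obtain j' s' where b: "Inl (P, v) \<in> fst (lchart j' s')" "smooth_transition (lchart j' s') ch' (Inl (P, v))"
    by (rule chart_via_lchart[OF assms(2) p(2)])
  note ab = smooth_transition_trans[OF a(2) lchart_transition[OF a(1) b(1)] inj_M[OF assms(1)] inj_lchart]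
  show ?thesis unfolding Inl R by (rule smooth_transition_trans[OF ab b(2) inj_M[OF assms(1)] inj_lchart])
next
  case (Inr R)
  obtain Q u where R: "R = (Q, u)" by (cases R)
  have "p \<notin> fst (lchart i s)" for i s by (simp add: Inr fst_lchart)
  then obtain k s k' s' where "ch = schart (l k) k s" "ch' = schart (l k') k' s'"
    using assms M_iff by metis
  moreover from this have "k' = k" using assms(3,4) by (simp add: Inr R Inr_schart)
  ultimately show ?thesis using singular_transition[of p Q u] assms(3,4) by (simp add: Inr R)
qed

definition lift_curve where
  "lift_curve x = (SOME c. \<exists>\<delta>>0. geodesic_on (double_atlas A) c {-\<delta><..<\<delta>} \<and> (c 0, dvel c 0) = x \<and>
     (\<forall>t\<in>{-\<delta><..<\<delta>}. (c t, dvel c t) \<in> utb))"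

lemma lift_curveE:
  assumes "(P, v) \<in> utb"
  obtains \<delta> where "\<delta> > 0" "geodesic_on (double_atlas A) (lift_curve (P, v)) {-\<delta><..<\<delta>}"
    "lift_curve (P, v) 0 = P" "dvel (lift_curve (P, v)) 0 = v"
    "\<And>t. t \<in> {-\<delta><..<\<delta>} \<Longrightarrow> (lift_curve (P, v) t, dvel (lift_curve (P, v)) t) \<in> utb"
proof -
  obtain i where v: "P \<in> dom i" "v \<in> tangent_space (double_atlas A) P" "tangent_norm (double_atlas A) P v = 1"
    using assms by (auto simp: unit_tangent_bundle_iff)
  obtain c \<delta> where "\<delta> > 0" "geodesic_on (double_atlas A) c {-\<delta><..<\<delta>}" "c 0 = P" "dvel c 0 = v"
    "\<And>t. t \<in> {-\<delta><..<\<delta>} \<Longrightarrow> (c t, dvel c t) \<in> utb"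
    by (rule geodesic_exists[OF v(2,1,3)]) blast
  then have "\<exists>c. \<exists>\<delta>>0. geodesic_on (double_atlas A) c {-\<delta><..<\<delta>} \<and> (c 0, dvel c 0) = (P, v) \<and>
     (\<forall>t\<in>{-\<delta><..<\<delta>}. (c t, dvel c t) \<in> utb)" by blast
  from someI_ex[OF this, folded lift_curve_def] that show thesis by auto
qed

text \<open>Only the velocity at time 0 is used. On a fiber the rate \<open>- Im u\<close> is
  \<open>- sin \<beta>\<close>, the angular component of \<open>singular_field\<close> at
  \<open>w = 0\<close>.\<close>

definition flow_curve :: "mpoint \<Rightarrow> real \<Rightarrow> mpoint" where
  "flow_curve p t = (case p of
     Inl x \<Rightarrow> Inl (lift_curve x t, dvel (lift_curve x) t)
   | Inr (Q, u) \<Rightarrow> Inr (Q, u * cis (- Im u * t)))"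

text \<open>The value 1 on the fibers is that of \<open>\<rho> / |w|\<close> near them, since the
  curve there already has the velocity of the rescaled field.\<close>

definition speed :: "mpoint \<Rightarrow> real" where
  "speed p = (case p of Inl x \<Rightarrow> \<rho> x | Inr _ \<Rightarrow> 1)"

definition ext_field :: "mpoint \<Rightarrow> (mpoint, complex \<times> real) tangent" where
  "ext_field p ch = speed p *\<^sub>R velocity M (flow_curve p) 0 ch"

lemma flow_lchart:
  assumes "Inl (P, v) \<in> fst (lchart i s)"
  shows "flow_curve (Inl (P, v)) 0 = Inl (P, v)"
    "\<forall>\<^sub>F t in nhds 0. flow_curve (Inl (P, v)) t \<in> fst (lchart i s)"
    "((\<lambda>t. snd (lchart i s) (flow_curve (Inl (P, v)) t)) has_vector_derivative
       field_coord (snd (lchart i s) (Inl (P, v)))) (at 0)"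
proof -
  have P: "(P, v) \<in> utb" "P \<in> dom i" "sgn (v (double_chart A i)) \<noteq> cis s"
    using assms by (simp_all add: Inl_lchart)
  obtain \<delta> where d: "\<delta> > 0" "geodesic_on (double_atlas A) (lift_curve (P, v)) {-\<delta><..<\<delta>}"
    "lift_curve (P, v) 0 = P" "dvel (lift_curve (P, v)) 0 = v"
    "\<And>t. t \<in> {-\<delta><..<\<delta>} \<Longrightarrow> (lift_curve (P, v) t, dvel (lift_curve (P, v)) t) \<in> utb"
    by (rule lift_curveE[OF P(1)]) blast
  define c where "c = lift_curve (P, v)"
  have fl: "flow_curve (Inl (P, v)) t = Inl (c t, dvel c t)" for t by (simp add: flow_curve_def c_def)
  note d = d[folded c_def]
  show "flow_curve (Inl (P, v)) 0 = Inl (P, v)" by (simp add: fl d)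
  have 0: "0 \<in> {-\<delta><..<\<delta>}" using d(1) by simp
  have c0: "c 0 \<in> dom i" using P(2) by (simp add: d(3))
  note cc = geodesic_onD(1)[OF d(2) open_greaterThanLessThan 0 c0]
  note cg = geodesic_onD(2)[OF d(2) open_greaterThanLessThan 0 c0]
  have "(c 0, dvel c 0) \<in> fst (utb_chart i s)" using P by (simp add: d(3,4) fst_utb_chart)
  from lift_derivative[OF cg cc this]
  show "((\<lambda>t. snd (lchart i s) (flow_curve (Inl (P, v)) t)) has_vector_derivative
       field_coord (snd (lchart i s) (Inl (P, v)))) (at 0)"
    by (simp add: fl lchart_def lift_chart_def d(3,4))
  have z': "isCont (\<lambda>t. vector_derivative (\<lambda>s. crd i (c s)) (at t)) 0"
    by (rule has_vector_derivative_continuous[OF disc_geodesic_atD(5)[OF cg]])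
  have v0: "vector_derivative (\<lambda>s. crd i (c s)) (at 0) = v (double_chart A i)"
    using velocity_chart[of c 0 i] c0 d(4) by simp
  have "\<forall>\<^sub>F t in nhds 0. vector_derivative (\<lambda>s. crd i (c s)) (at t) \<in> {y. y \<noteq> 0 \<and> sgn y \<noteq> cis s}"
    using z' unfolding tendsto_nhds_isCont
    by (rule topological_tendstoD[OF _ open_cut_plane]) (use P unit_tangent_norm(2)[OF P(1,2)] in \<open>simp add: v0\<close>)
  moreover have "\<forall>\<^sub>F t in nhds 0. t \<in> {-\<delta><..<\<delta>}" by (intro eventually_nhds_in_open 0) auto
  moreover have "\<forall>\<^sub>F t in nhds 0. c t \<in> dom i" using cc by (simp add: chart_cont_def)
  ultimately show "\<forall>\<^sub>F t in nhds 0. flow_curve (Inl (P, v)) t \<in> fst (lchart i s)"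
  proof eventually_elim
    case (elim t)
    then show ?case using d(5)[of t] velocity_chart[of c t i] by (simp add: fl Inl_lchart)
  qed
qed

lemma flow_singular:
  assumes "Inr (Q, u) \<in> fst (schart (l k) k s)"
  shows "flow_curve (Inr (Q, u)) 0 = Inr (Q, u)"
    "\<forall>\<^sub>F t in nhds 0. flow_curve (Inr (Q, u)) t \<in> fst (schart (l k) k s)"
    "((\<lambda>t. snd (schart (l k) k s) (flow_curve (Inr (Q, u)) t)) has_vector_derivative
       singular_field k (snd (schart (l k) k s) (Inr (Q, u)))) (at 0)"
proof -
  have Q: "Q = cone_point A k" "cmod u = 1" "u \<noteq> cis s" using assms by (simp_all add: Inr_schart)
  have u: "u \<noteq> 0" "sgn u = u" using Q(2) by (auto simp: sgn_eq)
  define y where "y = (\<lambda>t. u * cis (- Im u * t))"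
  have fl: "flow_curve (Inr (Q, u)) t = Inr (Q, y t)" for t by (simp add: flow_curve_def y_def)
  show "flow_curve (Inr (Q, u)) 0 = Inr (Q, u)" by (simp add: fl y_def)
  have "((\<lambda>t::real. of_real t * (- \<i> * of_real (Im u))) has_vector_derivative - \<i> * of_real (Im u)) (at 0)"
    by (rule bounded_linear.has_vector_derivative[OF bounded_linear_compose[OF bounded_linear_mult_left
        bounded_linear_of_real] has_vector_derivative_id, simplified])
  from has_vector_derivative_mult[OF has_vector_derivative_const[of u] field_vector_diff_chain_at[OF this DERIV_exp]]
  have yd: "(y has_vector_derivative u * (- \<i> * of_real (Im u))) (at 0)"
    by (simp add: y_def o_def cis_conv_exp mult_ac)
  have y0: "y 0 = u" by (simp add: y_def)
  from has_vector_derivative_ang[OF yd, of s]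
  have "((\<lambda>t. ang s (y t)) has_vector_derivative - Im u) (at 0)" using u Q(3) by (simp add: y0)
  from has_vector_derivative_Pair[OF has_vector_derivative_const this, of 0]
  have "((\<lambda>t. (0, ang s (y t))) has_vector_derivative (0, - Im u)) (at 0)" .
  moreover have "Im u = sin (ang s u)"
    using cis_ang[OF u(1), of s] u(2) by (metis cis.sel(2))
  ultimately show "((\<lambda>t. snd (schart (l k) k s) (flow_curve (Inr (Q, u)) t)) has_vector_derivative
       singular_field k (snd (schart (l k) k s) (Inr (Q, u)))) (at 0)"
    by (simp add: fl snd_schart singular_field_def)
  have "isCont y 0" by (rule has_vector_derivative_continuous[OF yd])
  then have "\<forall>\<^sub>F t in nhds 0. y t \<in> - {cis s}"
    unfolding tendsto_nhds_isCont by (rule topological_tendstoD) (use Q(3) in \<open>auto simp: y0\<close>)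
  then show "\<forall>\<^sub>F t in nhds 0. flow_curve (Inr (Q, u)) t \<in> fst (schart (l k) k s)"
    unfolding fl Inr_schart by eventually_elim (simp add: Q y_def norm_mult)
qed

lemma flow_chart:
  assumes "ch \<in> M" "p \<in> fst ch"
  obtains D where "flow_curve p 0 = p" "\<forall>\<^sub>F t in nhds 0. flow_curve p t \<in> fst ch"
    "((\<lambda>t. snd ch (flow_curve p t)) has_vector_derivative D) (at 0)"
proof (cases p)
  case (Inl R)
  obtain P v where R: "R = (P, v)" by (cases R)
  obtain j s where j: "Inl (P, v) \<in> fst (lchart j s)" "smooth_transition (lchart j s) ch (Inl (P, v))"
    by (rule chart_via_lchart[OF assms(1) assms(2)[unfolded Inl R]])
  note f = flow_lchart[OF j(1)]
  have "smooth_transition (lchart j s) ch (flow_curve (Inl (P, v)) 0)" using j(2) f(1) by simp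
  note V = smooth_transition_velocity(1,2)[OF this inj_lchart f(2,3)]
  show thesis by (rule that[unfolded Inl R, OF f(1) V])
next
  case (Inr R)
  obtain Q u where R: "R = (Q, u)" by (cases R)
  have "p \<notin> fst (lchart i s)" for i s by (simp add: Inr fst_lchart)
  then obtain k s where ch: "ch = schart (l k) k s" using assms M_iff by metis
  have "Inr (Q, u) \<in> fst (schart (l k) k s)" using assms(2) by (simp add: Inr R ch)
  from flow_singular[OF this] that show thesis by (auto simp: Inr R ch)
qed

lemma ext_field_chart:
  assumes "ch \<in> M" "p \<in> fst ch" "((\<lambda>t. snd ch (flow_curve p t)) has_vector_derivative D) (at 0)"
  shows "ext_field p ch = speed p *\<^sub>R D"
proof -
  have "flow_curve p 0 = p" using flow_chart[OF assms(1,2)] by blast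
  then show ?thesis
    using assms vector_derivative_at[OF assms(3)] by (simp add: ext_field_def velocity_def o_def)
qed

lemma ext_field_tangent:
  assumes "p \<in> carrier M"
  shows "ext_field p \<in> tangent_space M p"
proof -
  obtain ch0 where "ch0 \<in> M" "p \<in> fst ch0" using assms by (auto simp: carrier_def)
  then have p0: "flow_curve p 0 = p" using flow_chart by blast
  have "ext_field p ch = 0" if "ch \<notin> M \<or> p \<notin> fst ch" for ch
    using that by (auto simp: ext_field_def velocity_def p0)
  moreover have "ext_field p ch' =
      frechet_derivative (snd ch' \<circ> inv_into (fst ch) (snd ch)) (at (snd ch p)) (ext_field p ch)"
    if c: "ch \<in> M" "ch' \<in> M" "p \<in> fst ch" "p \<in> fst ch'" for ch ch'
  proof -
    obtain D where D: "\<forall>\<^sub>F t in nhds 0. flow_curve p t \<in> fst ch"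
      "((\<lambda>t. snd ch (flow_curve p t)) has_vector_derivative D) (at 0)"
      using flow_chart[OF c(1,3)] .
    have T: "smooth_transition ch ch' (flow_curve p 0)" unfolding p0 by (rule all_transitions[OF c])
    note V = smooth_transition_velocity[OF T inj_M[OF c(1)] D, unfolded p0]
    show ?thesis
      unfolding ext_field_chart[OF c(1,3) D(2)] ext_field_chart[OF c(2,4) V(2)]
        linear_scale[OF bounded_linear.linear[OF V(3)]] ..
  qed
  ultimately show ?thesis unfolding tangent_space_def by blast
qed

lemma ext_field_lchart:
  assumes "Inl (P, v) \<in> fst (lchart i s)"
  shows "ext_field (Inl (P, v)) (lchart i s) = \<rho> (P, v) *\<^sub>R field_coord (snd (lchart i s) (Inl (P, v)))"
  using ext_field_chart[OF _ assms flow_lchart(3)[OF assms]] by (simp add: speed_def)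

lemma ext_field_schart:
  assumes "Inl (P, v) \<in> fst (schart (l k) k s)"
  shows "ext_field (Inl (P, v)) (schart (l k) k s) =
    (\<rho> (P, v) / cmod (fst (snd (schart (l k) k s) (Inl (P, v))))) *\<^sub>R
       singular_field k (snd (schart (l k) k s) (Inl (P, v)))"
proof -
  have P: "(P, v) \<in> utb" "P \<in> cone_ball A \<tau> k" "P \<noteq> cone_point A k"
    using assms by (auto simp: Inl_schart)
  obtain j where j: "j \<noteq> k" "P \<in> dom j" using cone_ball_chart[OF P(2,3)] .
  obtain \<delta> where d: "\<delta> > 0" "geodesic_on (double_atlas A) (lift_curve (P, v)) {-\<delta><..<\<delta>}"
    "lift_curve (P, v) 0 = P" "dvel (lift_curve (P, v)) 0 = v"
    "\<And>t. t \<in> {-\<delta><..<\<delta>} \<Longrightarrow> (lift_curve (P, v) t, dvel (lift_curve (P, v)) t) \<in> utb"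
    by (rule lift_curveE[OF P(1)]) blast
  define c where "c = lift_curve (P, v)"
  note d = d[folded c_def]
  have 0: "0 \<in> {-\<delta><..<\<delta>}" using d(1) by simp
  have c0: "c 0 \<in> dom j" using j(2) by (simp add: d(3))
  note cc = geodesic_onD(1)[OF d(2) open_greaterThanLessThan 0 c0]
  note cg = geodesic_onD(2)[OF d(2) open_greaterThanLessThan 0 c0]
  have "\<forall>\<^sub>F t in nhds 0. t \<in> {-\<delta><..<\<delta>}" by (intro eventually_nhds_in_open 0) auto
  then have U: "\<forall>\<^sub>F t in nhds 0. (c t, dvel c t) \<in> utb" by eventually_elim (rule d(5))
  have "Inl (c 0, dvel c 0) \<in> fst (schart (l k) k s)" using assms by (simp add: d(3,4))
  note V = singular_velocity[OF cg cc j(1) U this, unfolded d(3,4)]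
  have "((\<lambda>t. snd (schart (l k) k s) (flow_curve (Inl (P, v)) t)) has_vector_derivative
     (1 / cmod (fst (snd (schart (l k) k s) (Inl (P, v))))) *\<^sub>R
       singular_field k (snd (schart (l k) k s) (Inl (P, v)))) (at 0)"
    using V by (simp add: flow_curve_def c_def)
  from ext_field_chart[OF _ assms this] show ?thesis by (simp add: speed_def)
qed

lemma ext_field_singular:
  assumes "Inr (Q, u) \<in> fst (schart (l k) k s)"
  shows "ext_field (Inr (Q, u)) (schart (l k) k s) = singular_field k (snd (schart (l k) k s) (Inr (Q, u)))"
  using ext_field_chart[OF _ assms flow_singular(3)[OF assms]] by (simp add: speed_def)

definition rho_coord :: "3 \<Rightarrow> real \<Rightarrow> complex \<times> real \<Rightarrow> real" where
  "rho_coord i s = \<rho> \<circ> inv_into (fst (utb_chart i s)) (snd (utb_chart i s))"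

lemma rho_coord_eq:
  assumes "Inl (P, v) \<in> fst (lchart i s)"
  shows "rho_coord i s (snd (lchart i s) (Inl (P, v))) = \<rho> (P, v)"
    "snd (lchart i s) (Inl (P, v)) \<in> snd (utb_chart i s) ` fst (utb_chart i s)"
proof -
  have "inj_on (snd (utb_chart i s)) (fst (utb_chart i s))"
    using inj_lchart[of i s] by (auto simp: inj_on_def lchart_def lift_chart_def)
  moreover have "(P, v) \<in> fst (utb_chart i s)" using assms by (auto simp: lchart_def lift_chart_def)
  ultimately show "rho_coord i s (snd (lchart i s) (Inl (P, v))) = \<rho> (P, v)"
    "snd (lchart i s) (Inl (P, v)) \<in> snd (utb_chart i s) ` fst (utb_chart i s)"
    by (auto simp: rho_coord_def lchart_def lift_chart_def)
qed

lemma smooth_rho_coord: "smooth_on (rho_coord i s) (snd (utb_chart i s) ` fst (utb_chart i s))"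
proof -
  have "utb_chart i s \<in> utb_atlas (double_atlas A)" using utb_atlas_iff by blast
  then show ?thesis
    using rho_smooth unfolding smooth_function_def M_star_atlas_def rho_coord_def by blast
qed

lemma smooth_field_coord: "open S \<Longrightarrow> smooth_on field_coord S"
proof -
  assume o: "open S"
  have "field_coord = (\<lambda>x. (of_real ((1 - (cmod (fst x))\<^sup>2) / 2) * cis (snd x), - Im (cnj (fst x) * cis (snd x))))"
    by (auto simp: field_coord_def)
  moreover have "smooth_on \<dots> S"
    by (intro smooth_on_Pair smooth_on_mult smooth_on_of_real smooth_on_divide_real smooth_on_diff
        smooth_on_cmod_power2 smooth_on_const smooth_on_cis smooth_on_minus smooth_on_Im smooth_on_cnj
        smooth_on_fst_snd o) simp
  ultimately show ?thesis by simp
qed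

lemma smooth_singular_field: "open S \<Longrightarrow> smooth_on (singular_field k) S"
proof -
  assume o: "open S"
  have pos: "1 + (cmod (fst x))\<^sup>2 > 0" for x :: "complex \<times> real"
    by (simp add: add_pos_nonneg)
  have "singular_field k = (\<lambda>x.
     (fst x * (of_real (sqrt (1 + (cmod (fst x))\<^sup>2) * cos (snd x)) + \<i> * of_real (pi / theta k * sin (snd x))),
      - (sqrt (1 + (cmod (fst x))\<^sup>2) * sin (snd x))))"
    by (auto simp: singular_field_def)
  moreover have "smooth_on \<dots> S"
    by (intro smooth_on_Pair smooth_on_mult smooth_on_of_real smooth_on_add
        smooth_on_cmod_power2 smooth_on_const smooth_on_cos smooth_on_sin smooth_on_minus smooth_on_sqrt
        smooth_on_fst_snd o) (rule pos)+
  ultimately show ?thesis by simp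
qed

lemma smooth_ext_lchart:
  "smooth_on (\<lambda>x. ext_field (inv_into (fst (lchart i s)) (snd (lchart i s)) x) (lchart i s))
     (snd (lchart i s) ` fst (lchart i s))"
proof (rule smooth_on_local)
  let ?ch = "lchart i s"
  fix x assume "x \<in> snd ?ch ` fst ?ch"
  then obtain p where p: "p \<in> fst ?ch" "x = snd ?ch p" by auto
  \<comment> \<open>The transition of the chart to itself is used only for the neighbourhood
    \<open>U\<close> of the point inside the image.\<close>
  obtain \<psi> U where U: "open U" "snd ?ch p \<in> U" "\<And>x. x \<in> U \<Longrightarrow> \<exists>q\<in>fst ?ch \<inter> fst ?ch. snd ?ch q = x \<and> snd ?ch q = \<psi> x"
    using lchart_transition[OF p(1) p(1)] inj_lchart by (rule smooth_transitionE) blast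
  have val: "x \<in> snd (utb_chart i s) ` fst (utb_chart i s) \<and>
      ext_field (inv_into (fst ?ch) (snd ?ch) x) ?ch = rho_coord i s x *\<^sub>R field_coord x" if x: "x \<in> U" for x
  proof -
    obtain q where q: "q \<in> fst ?ch" "snd ?ch q = x" using U(3)[OF x] by blast
    obtain P v where Pv: "q = Inl (P, v)" using q(1) by (auto simp: fst_lchart)
    note qq = q[unfolded Pv]
    have "inv_into (fst ?ch) (snd ?ch) x = Inl (P, v)"
      using inv_into_f_f[OF inj_lchart qq(1)] qq(2) by simp
    then show ?thesis using ext_field_lchart[OF qq(1)] rho_coord_eq[OF qq(1)] qq(2) by simp
  qed
  have "smooth_on (rho_coord i s) U" by (rule smooth_on_subset[OF smooth_rho_coord]) (use val in blast)
  then have "smooth_on (\<lambda>x. rho_coord i s x *\<^sub>R field_coord x) U"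
    by (intro smooth_on_scaleR U(1) smooth_field_coord)
  then have "smooth_on (\<lambda>x. ext_field (inv_into (fst ?ch) (snd ?ch) x) ?ch) U"
    by (rule smooth_on_cong[OF _ U(1)]) (use val in blast)
  then show "\<exists>U. open U \<and> x \<in> U \<and> smooth_on (\<lambda>x. ext_field (inv_into (fst ?ch) (snd ?ch) x) ?ch) U"
    using U(1,2) p(2) by blast
qed

text \<open>Away from the fiber \<open>\<rho>\<close> is smooth only with respect to the charts of
  \<open>M*\<close>, so it is expressed through the transition \<open>\<psi>\<close> to one of
  these; \<open>|w|\<close> is nonzero and smooth there, and the quotient multiplies
  \<open>singular_field\<close>.\<close>

lemma smooth_ext_regular:
  assumes p: "Inl (P, v) \<in> fst (schart (l k) k s)"
  shows "\<exists>U. open U \<and> snd (schart (l k) k s) (Inl (P, v)) \<in> U \<and>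
    smooth_on (\<lambda>x. ext_field (inv_into (fst (schart (l k) k s)) (snd (schart (l k) k s)) x) (schart (l k) k s)) U"
proof -
  let ?ch = "schart (l k) k s"
  obtain j s' where "smooth_transition ?ch (lchart j s') (Inl (P, v))"
    by (rule chart_via_lchart[OF _ p]) auto
  from this inj_schart obtain \<psi> U where U: "open U" "snd ?ch (Inl (P, v)) \<in> U" "smooth_on \<psi> U"
    "\<And>x. x \<in> U \<Longrightarrow> \<exists>q\<in>fst ?ch \<inter> fst (lchart j s'). snd ?ch q = x \<and> snd (lchart j s') q = \<psi> x"
    by (rule smooth_transitionE) blast
  have val: "fst x \<noteq> 0 \<and> \<psi> x \<in> snd (utb_chart j s') ` fst (utb_chart j s') \<and>
      ext_field (inv_into (fst ?ch) (snd ?ch) x) ?ch =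
        (rho_coord j s' (\<psi> x) / cmod (fst x)) *\<^sub>R singular_field k x" if x: "x \<in> U" for x
  proof -
    obtain q where q: "q \<in> fst ?ch" "q \<in> fst (lchart j s')" "snd ?ch q = x" "snd (lchart j s') q = \<psi> x"
      using U(4)[OF x] by blast
    obtain Q u where Qu: "q = Inl (Q, u)" using q(2) by (auto simp: fst_lchart)
    note qq = q[unfolded Qu]
    have "inv_into (fst ?ch) (snd ?ch) x = Inl (Q, u)"
      using inv_into_f_f[OF inj_schart qq(1)] qq(3) by simp
    moreover have "fst x \<noteq> 0"
      using qq(1) norm_cone_chart(2)[of Q k "l k"] unfolding qq(3)[symmetric] by (simp add: snd_schart Inl_schart)
    ultimately show ?thesis using ext_field_schart[OF qq(1)] rho_coord_eq[OF qq(2)] qq(3,4) by simp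
  qed
  have "smooth_on (\<lambda>x. rho_coord j s' (\<psi> x)) U"
    by (rule smooth_on_compose[OF smooth_rho_coord U(1,3)]) (use val in blast)
  then have "smooth_on (\<lambda>x. (rho_coord j s' (\<psi> x) / cmod (fst x)) *\<^sub>R singular_field k x) U"
    by (intro smooth_on_scaleR smooth_on_divide_real smooth_on_cmod smooth_on_fst_snd U(1) smooth_singular_field)
      (use val in auto)
  then have "smooth_on (\<lambda>x. ext_field (inv_into (fst ?ch) (snd ?ch) x) ?ch) U"
    by (rule smooth_on_cong[OF _ U(1)]) (use val in blast)
  then show ?thesis using U(1,2) by blast
qed

lemma smooth_ext_singular:
  assumes p: "Inr (Q, u) \<in> fst (schart (l k) k s)"
  shows "\<exists>U. open U \<and> snd (schart (l k) k s) (Inr (Q, u)) \<in> U \<and>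
    smooth_on (\<lambda>x. ext_field (inv_into (fst (schart (l k) k s)) (snd (schart (l k) k s)) x) (schart (l k) k s)) U"
proof -
  let ?ch = "schart (l k) k s"
  \<comment> \<open>Below \<open>sinh \<tau>\<close> all coordinates are attained by the chart
    (\<open>schart_surj\<close>), and below \<open>sinh \<epsilon>\<close> the function
    \<open>\<rho>\<close> equals \<open>|w|\<close>, so that on \<open>U\<close> the field is
    exactly \<open>singular_field\<close>.\<close>
  define U where "U = ball (0 :: complex) (sinh (min \<epsilon> \<tau>)) \<times> {s<..<s + 2 * pi}"
  have oU: "open U" unfolding U_def by (intro open_Times) auto
  have u: "cmod u = 1" "u \<noteq> cis s" using p by (simp_all add: Inr_schart)
  then have u0: "u \<noteq> 0" "sgn u = u" by (auto simp: sgn_eq)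
  have pU: "snd ?ch (Inr (Q, u)) \<in> U"
    using ang_range[OF u0(1), of s] u u0 tau_pos eps by (simp add: snd_schart U_def)
  have val: "ext_field (inv_into (fst ?ch) (snd ?ch) x) ?ch = singular_field k x" if x: "x \<in> U" for x
  proof -
    obtain w \<beta> where wb: "x = (w, \<beta>)" by (cases x)
    have w: "cmod w < sinh (min \<epsilon> \<tau>)" "s < \<beta>" "\<beta> < s + 2 * pi" using x by (auto simp: U_def wb)
    have "sinh (min \<epsilon> \<tau>) \<le> sinh \<tau>" "sinh (min \<epsilon> \<tau>) \<le> sinh \<epsilon>" by simp_all
    then have w': "cmod w < sinh \<tau>" "cmod w < sinh \<epsilon>" using w(1) by linarith+
    obtain q where q: "q \<in> fst ?ch" "snd ?ch q = (w, \<beta>)" using schart_surj[OF w'(1) w(2,3)] .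
    have inv: "inv_into (fst ?ch) (snd ?ch) x = q"
      using inv_into_f_f[OF inj_schart q(1)] q(2) by (simp add: wb)
    show ?thesis
    proof (cases q)
      case (Inr R)
      then show ?thesis using ext_field_singular[of "fst R" "snd R" k s] q inv by (simp add: wb)
    next
      case (Inl R)
      obtain P v where R: "R = (P, v)" by (cases R)
      have P: "(P, v) \<in> utb" "P \<in> cone_ball A \<tau> k" "P \<noteq> cone_point A k"
        using q(1) by (auto simp: Inl R Inl_schart)
      have wc: "w = cone_chart A \<omega> (l k) k P" using q(2) by (simp add: Inl R snd_schart)
      have dd: "double_dist A P (cone_point A k) = hdist k (fold_point P)"
        by (rule double_dist_eq[OF cone_ball_double[OF P(2)] P(3)])
      have n: "cmod w = sinh (hdist k (fold_point P))" "w \<noteq> 0" unfolding wc using norm_cone_chart[OF P(2,3)] by auto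
      have "hdist k (fold_point P) < \<epsilon>" using w'(2) unfolding n(1) by simp
      then have "\<rho> (P, v) = cmod w" using rho_near[of "(P, v)" k] P(1) by (simp add: M_star_def dd n(1))
      then show ?thesis using ext_field_schart[of P v k s] q inv n(2) by (simp add: Inl R wb)
    qed
  qed
  have "smooth_on (\<lambda>x. ext_field (inv_into (fst ?ch) (snd ?ch) x) ?ch) U"
    by (rule smooth_on_cong[OF smooth_singular_field[OF oU] oU val])
  then show ?thesis using oU pU by blast
qed

lemma smooth_ext_field: "smooth_vector_field M ext_field"
  unfolding smooth_vector_field_def
proof (intro conjI ballI)
  show "ext_field p \<in> tangent_space M p" if "p \<in> carrier M" for p using that by (rule ext_field_tangent)
  fix ch assume "ch \<in> M"
  then consider i s where "ch = lchart i s" | k s where "ch = schart (l k) k s" using M_iff by auto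
  then show "smooth_on (\<lambda>x. ext_field (inv_into (fst ch) (snd ch) x) ch) (snd ch ` fst ch)"
  proof cases
    case 1
    then show ?thesis using smooth_ext_lchart by simp
  next
    case 2
    show ?thesis
    proof (rule smooth_on_local)
      fix x assume "x \<in> snd ch ` fst ch"
      then obtain p where p: "p \<in> fst ch" "x = snd ch p" by auto
      show "\<exists>U. open U \<and> x \<in> U \<and> smooth_on (\<lambda>x. ext_field (inv_into (fst ch) (snd ch) x) ch) U"
      proof (cases p)
        case (Inl R)
        then show ?thesis using p smooth_ext_regular[of "fst R" "snd R" k s] by (simp add: 2)
      next
        case (Inr R)
        then show ?thesis using p smooth_ext_singular[of "fst R" "snd R" k s] by (simp add: 2)
      qed
    qed
  qed
qed

lemma ext_field_extends:
  "extends_field (M_star_atlas A) (\<lambda>v ch. \<rho> v *\<^sub>R geodesic_field (double_atlas A) v ch) ext_field"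
  unfolding extends_field_def
proof (intro ballI impI)
  fix x ch assume ch: "ch \<in> M_star_atlas A" "x \<in> fst ch"
  obtain i s where ch_eq: "ch = utb_chart i s" using ch(1) by (auto simp: M_star_atlas_def utb_atlas_iff)
  obtain P v where x: "x = (P, v)" by (cases x)
  have L: "Inl (P, v) \<in> fst (lchart i s)" using ch(2) by (auto simp: ch_eq x lchart_def lift_chart_def)
  then have P: "(P, v) \<in> utb" by (simp add: Inl_lchart)
  obtain \<delta> where d: "\<delta> > 0" "geodesic_on (double_atlas A) (lift_curve (P, v)) {-\<delta><..<\<delta>}"
    "lift_curve (P, v) 0 = P" "dvel (lift_curve (P, v)) 0 = v"
    by (rule lift_curveE[OF P]) blast
  define c where "c = lift_curve (P, v)"
  note d = d[folded c_def]
  have "geodesic_field (double_atlas A) (P, v) = velocity (utb_atlas (double_atlas A)) (\<lambda>t. (c t, dvel c t)) 0"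
    using geodesic_field_eq[OF d(2,1)] P by (simp add: d(3,4))
  moreover have "((\<lambda>t. snd (utb_chart i s) (c t, dvel c t)) has_vector_derivative
       field_coord (snd (lchart i s) (Inl (P, v)))) (at 0)"
    using flow_lchart(3)[OF L] by (simp add: flow_curve_def c_def lchart_def lift_chart_def)
  ultimately have "geodesic_field (double_atlas A) (P, v) (utb_chart i s) = field_coord (snd (lchart i s) (Inl (P, v)))"
    using ch(2) utb_atlas_iff by (auto simp: velocity_def[of "utb_atlas (double_atlas A)"] d(3,4) ch_eq x o_def vector_derivative_at)
  then show "ext_field (Inl x) (lift_chart ch) = \<rho> x *\<^sub>R geodesic_field (double_atlas A) x ch"
    using ext_field_lchart[OF L] by (simp add: x ch_eq lchart_def)
qed

end

theorem theorem3p1: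
  fixes A :: "3 \<Rightarrow> complex" and \<omega> \<tau> \<epsilon> :: real
    and l :: "3 \<Rightarrow> real \<Rightarrow> dpoint"
    and \<rho> :: "dpoint \<times> (dpoint, complex) tangent \<Rightarrow> real"
  assumes "nondegenerate_triangle A"
    and "\<omega> \<in> {1, - 1}"
    and "admissible_radius A \<tau>"
    and "\<And>k. \<exists>a. cone_geodesic A k (l k) a"
    and "\<epsilon> > 0"
    and "smooth_function (M_star_atlas A) \<rho>"
    and "\<And>v. v \<in> M_star A \<Longrightarrow> \<rho> v > 0"
    and "\<And>v k. v \<in> M_star A \<Longrightarrow> double_dist A (fst v) (cone_point A k) < \<epsilon> \<Longrightarrow>
           \<rho> v = sinh (double_dist A (fst v) (cone_point A k))"
  shows "\<exists>Z. smooth_vector_field (M_atlas A \<omega> \<tau> l) Z \<and>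
           extends_field (M_star_atlas A)
             (\<lambda>v ch. \<rho> v *\<^sub>R geodesic_field (double_atlas A) v ch) Z"
proof -
  interpret extension_setting A \<omega> \<tau> l \<epsilon> \<rho>
    by unfold_locales (use assms in auto)
  show ?thesis using smooth_ext_field ext_field_extends by blast
qed

end
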